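(* Let the standing setting and the assumptions (A1)–(A4), (H2) be as in the context ($d\in\{2,3\}$), and assume (A1)–(A4) and (H2). Let $u\in L^2_{loc}([0,\infty);V_{div}\cap L^\infty(\Omega)^d)$ be given and let $\varphi_0\in L^\infty(\Omega)$ be such that $F(\varphi_0)\in L^1(\Omega)$ and $M(\varphi_0)\in L^1(\Omega)$. Assume moreover that there exist $\alpha_0>0$ and $\rho\in[0,1)$ such that $$\rho F_1''(s)+F_2''(s)+a(x)\ge0\quad\forall s\in(-1,1),\ \text{a.e. }x\in\Omega,\qquad m(s)F_1''(s)\ge\alpha_0\quad\forall s\in[-1,1].$$ Then, for every $T>0$, the weak solution $\varphi$ on $[0,T]$, corresponding to $\varphi_0$, of the convective nonlocal Cahn–Hilliard equation with velocity $u$ (in the sense of the context) is unique.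
   Context: Setting. $\Omega\subset\mathbb{R}^d$, $d\in\{2,3\}$, is a bounded domain with sufficiently smooth boundary (say of class $C^{1,1}$), $H=L^2(\Omega)$, $V=H^1(\Omega)$, $V_{div}=\{u\in H^1_0(\Omega)^d:\mathrm{div}\,u=0\}$. $\|\cdot\|$ and $(\cdot,\cdot)$ denote the $L^2$ norm and scalar product, primes on spaces denote duals, $\langle\cdot,\cdot\rangle$ a duality pairing, $Q_T=\Omega\times(0,T)$. $J:\mathbb{R}^d\to\mathbb{R}$, $(J\ast\varphi)(x)=\int_\Omega J(x-y)\varphi(y)\,dy$, $(\nabla J\ast\varphi)(x)=\int_\Omega\nabla J(x-y)\varphi(y)\,dy$, $a(x)=\int_\Omega J(x-y)\,dy$. Assumptions. (H2) $J(\cdot-x)\in W^{1,1}(\Omega)$ for a.e. $x\in\Omega$; $J(x)=J(-x)$; $a(x)\ge0$ for a.e. $x\in\Omega$; $a^\ast:=\sup_{x\in\Omega}\int_\Omega|J(x-y)|dy<\infty$; $\sup_{x\in\Omega}\int_\Omega|\nabla J(x-y)|dy<\infty$. Put $a_\ast:=\inf_{x\in\Omega}\int_\Omega J(x-y)dy$. $m\in C^1([-1,1])$, $m\ge0$, and $m(s)=0$ iff $s=\pm1$. $F:(-1,1)\to\mathbb{R}$ has the form $F=F_1+F_2$ with $F_2\in C^2([-1,1])$. (A1) $F\in C^2(-1,1)$ and $mF''\in C([-1,1])$ (i.e. $mF''$, hence also $mF_1''$, extends continuously to $[-1,1]$; values at $\pm1$ are understood through this extension). (A2) There are $a_2>4(a^\ast-a_\ast-b_2)$,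 where $b_2:=\min_{[-1,1]}F_2''$, and $\epsilon_0>0$ such that $F_1''(s)\ge a_2$ for all $s\in(-1,-1+\epsilon_0]\cup[1-\epsilon_0,1)$. (A3) There is $\epsilon_0>0$ such that $F_1''$ is non-decreasing in $[1-\epsilon_0,1)$ and non-increasing in $(-1,-1+\epsilon_0]$. (A4) There is $c_0>0$ such that $F''(s)+a(x)\ge c_0$ for all $s\in(-1,1)$ and a.a. $x\in\Omega$. $M\in C^2(-1,1)$ is defined by $m(s)M''(s)=1$, $M(0)=M'(0)=0$; $F$ and $M$ are extended to $\pm1$ by their limits (possibly $+\infty$), and $F(\varphi_0),M(\varphi_0)\in L^1(\Omega)$ includes that $|\varphi_0|\le1$ a.e. in $\Omega$. Weak solution. The equation is $\varphi_t+u\cdot\nabla\varphi=\mathrm{div}(m(\varphi)\nabla\mu)$, $\mu=a\varphi-J\ast\varphi+F'(\varphi)$ in $\Omega\times(0,T)$, with $\partial\mu/\partial n=0$ on $\partial\Omega\times(0,T)$ and $\varphi(0)=\varphi_0$. A weak solution on $[0,T]$ corresponding to $\varphi_0$ is a function $\varphi$ with $\varphi\in L^\infty(0,T;H)\cap L^2(0,T;V)$, $\varphi_t\in L^2(0,T;V')$, $\varphi\in L^\infty(Q_T)$ with $|\varphi|\le1$ a.e. in $Q_T$, $\varphi(0)=\varphi_0$, and, for every $\psi\in V$ and a.e. $t\in(0,T)$, $$\langle\varphi_t,\psi\rangle+\int_\Omega m(\varphi)F''(\varphi)\nabla\varphi\cdot\nabla\psi+\int_\Omega m(\varphi)a\nabla\varphi\cdot\nabla\psi+\int_\Omega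 m(\varphi)(\varphi\nabla a-\nabla J\ast\varphi)\cdot\nabla\psi=(u\varphi,\nabla\psi).$$ *)

theory Defs
  imports "HOL-Analysis.Analysis" "HOL-Probability.Essential_Supremum"
begin

section \<open>Lebesgue spaces\<close>

text \<open>
  Elements of function spaces are represented by functions; two functions represent the same
  element iff they agree almost everywhere. All norms below are therefore seminorms on functions.
\<close>

definition L2_space :: "'a measure \<Rightarrow> ('a \<Rightarrow> 'b::euclidean_space) set" where
  "L2_space M = {f \<in> borel_measurable M. integrable M (\<lambda>x. (norm (f x))\<^sup>2)}"

definition L2_norm_on :: "'a measure \<Rightarrow> ('a \<Rightarrow> 'b::euclidean_space) \<Rightarrow> real" where
  "L2_norm_on M f = sqrt (\<integral>x. (norm (f x))\<^sup>2 \<partial>M)"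

definition Linf_space :: "'a measure \<Rightarrow> ('a \<Rightarrow> 'b::euclidean_space) set" where
  "Linf_space M = {f \<in> borel_measurable M. \<exists>C. AE x in M. norm (f x) \<le> C}"

definition Linf_norm_on :: "'a measure \<Rightarrow> ('a \<Rightarrow> 'b::euclidean_space) \<Rightarrow> real" where
  "Linf_norm_on M f = real_of_ereal (esssup M (\<lambda>x. ereal (norm (f x))))"


section \<open>Weak gradients and Sobolev spaces\<close>

primrec Ck :: "nat \<Rightarrow> ('a::euclidean_space \<Rightarrow> real) \<Rightarrow> bool" where
  "Ck 0 f \<longleftrightarrow> continuous_on UNIV f"
| "Ck (Suc k) f \<longleftrightarrow> (\<exists>g. (\<forall>x. GDERIV f x :> g x) \<and> (\<forall>b\<in>Basis. Ck k (\<lambda>x. g x \<bullet> b)))"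

definition test_functions :: "'a::euclidean_space set \<Rightarrow> ('a \<Rightarrow> real) set" where
  "test_functions S = {\<eta>. (\<forall>k. Ck k \<eta>) \<and> compact (closure {x. \<eta> x \<noteq> 0}) \<and> closure {x. \<eta> x \<noteq> 0} \<subseteq> S}"

definition locally_integrable :: "'a::euclidean_space set \<Rightarrow> ('a \<Rightarrow> 'b::euclidean_space) \<Rightarrow> bool" where
  "locally_integrable S f \<longleftrightarrow> (\<forall>K. compact K \<and> K \<subseteq> S \<longrightarrow> set_integrable lebesgue K f)"

definition has_weak_gradient ::
    "'a::euclidean_space set \<Rightarrow> ('a \<Rightarrow> real) \<Rightarrow> ('a \<Rightarrow> 'a) \<Rightarrow> bool" where
  "has_weak_gradient S f g \<longleftrightarrow>
     locally_integrable S f \<and> locally_integrable S g \<and>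
     (\<forall>\<eta>\<in>test_functions S. \<forall>\<eta>'. (\<forall>x. GDERIV \<eta> x :> \<eta>' x) \<longrightarrow>
        (\<integral>x. f x *\<^sub>R \<eta>' x \<partial>lebesgue_on S) = - (\<integral>x. \<eta> x *\<^sub>R g x \<partial>lebesgue_on S))"

text \<open>On an open set the weak gradient is unique up to a null set, if it exists.\<close>

definition weak_gradient :: "'a::euclidean_space set \<Rightarrow> ('a \<Rightarrow> real) \<Rightarrow> 'a \<Rightarrow> 'a" where
  "weak_gradient S f = (SOME g. has_weak_gradient S f g)"

definition W11 :: "'a::euclidean_space set \<Rightarrow> ('a \<Rightarrow> real) set" where
  "W11 S = {f. integrable (lebesgue_on S) f \<and>
              (\<exists>g. has_weak_gradient S f g \<and> integrable (lebesgue_on S) g)}"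

definition H1 :: "'a::euclidean_space set \<Rightarrow> ('a \<Rightarrow> real) set" where
  "H1 S = {f \<in> L2_space (lebesgue_on S). \<exists>g \<in> L2_space (lebesgue_on S). has_weak_gradient S f g}"

definition H1_norm :: "'a::euclidean_space set \<Rightarrow> ('a \<Rightarrow> real) \<Rightarrow> real" where
  "H1_norm S f = sqrt ((L2_norm_on (lebesgue_on S) f)\<^sup>2 +
                       (L2_norm_on (lebesgue_on S) (weak_gradient S f))\<^sup>2)"

definition H1_0 :: "'a::euclidean_space set \<Rightarrow> ('a \<Rightarrow> real) set" where
  "H1_0 S = {f \<in> H1 S. \<exists>\<eta>. (\<forall>n. \<eta> n \<in> test_functions S) \<and> (\<lambda>n. H1_norm S (\<eta> n - f)) \<longlonglongrightarrow> 0}"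

definition V_div :: "'a::euclidean_space set \<Rightarrow> ('a \<Rightarrow> 'a) set" where
  "V_div S = {v. (\<forall>b\<in>Basis. (\<lambda>x. v x \<bullet> b) \<in> H1_0 S) \<and>
                 (AE x in lebesgue_on S. (\<Sum>b\<in>Basis. weak_gradient S (\<lambda>y. v y \<bullet> b) x \<bullet> b) = 0)}"

definition V_div_norm :: "'a::euclidean_space set \<Rightarrow> ('a \<Rightarrow> 'a) \<Rightarrow> real" where
  "V_div_norm S v = sqrt (\<Sum>b\<in>Basis. (H1_norm S (\<lambda>x. v x \<bullet> b))\<^sup>2)"

text \<open>
  The topological dual of \<open>H\<^sup>1\<close>. A functional is only relevant on \<open>H1 S\<close>; boundedness with
  respect to the seminorm makes it independent of the chosen representatives.
\<close>

definition H1_dual :: "'a::euclidean_space set \<Rightarrow> (('a \<Rightarrow> real) \<Rightarrow> real) set" where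
  "H1_dual S = {l. (\<forall>v\<in>H1 S. \<forall>w\<in>H1 S. \<forall>c d. l (\<lambda>x. c * v x + d * w x) = c * l v + d * l w) \<and>
                   (\<exists>C. \<forall>v\<in>H1 S. \<bar>l v\<bar> \<le> C * H1_norm S v)}"

definition H1_dual_norm :: "'a::euclidean_space set \<Rightarrow> (('a \<Rightarrow> real) \<Rightarrow> real) \<Rightarrow> real" where
  "H1_dual_norm S l = (SUP v\<in>{v \<in> H1 S. H1_norm S v \<le> 1}. \<bar>l v\<bar>)"


section \<open>Bochner spaces\<close>

text \<open>
  \<open>X\<close> is a space of functions with seminorm \<open>N\<close>. Strong measurability is almost-everywhere
  approximability by \<open>X\<close>-valued simple functions; the library's notion needs a type of class
  \<open>banach\<close>, which function spaces over a variable set \<open>S\<close> do not form.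
\<close>

definition strongly_measurable ::
    "'t measure \<Rightarrow> 'v::minus set \<Rightarrow> ('v \<Rightarrow> real) \<Rightarrow> ('t \<Rightarrow> 'v) \<Rightarrow> bool" where
  "strongly_measurable M X N f \<longleftrightarrow>
     (AE t in M. f t \<in> X) \<and>
     (\<exists>s. (\<forall>n. simple_function M (s n) \<and> (\<forall>t\<in>space M. s n t \<in> X)) \<and>
          (AE t in M. (\<lambda>n. N (s n t - f t)) \<longlonglongrightarrow> 0))"

definition bochner_L2 :: "'t measure \<Rightarrow> 'v::minus set \<Rightarrow> ('v \<Rightarrow> real) \<Rightarrow> ('t \<Rightarrow> 'v) set" where
  "bochner_L2 M X N = {f. strongly_measurable M X N f \<and> (\<lambda>t. N (f t)) \<in> L2_space M}"

definition bochner_Linf :: "'t measure \<Rightarrow> 'v::minus set \<Rightarrow> ('v \<Rightarrow> real) \<Rightarrow> ('t \<Rightarrow> 'v) set" where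
  "bochner_Linf M X N = {f. strongly_measurable M X N f \<and> (\<lambda>t. N (f t)) \<in> Linf_space M}"

text \<open>
  The derivative of \<open>\<phi>\<close> as a distribution on \<open>(0,T)\<close> with values in the dual of \<open>H\<^sup>1\<close>, where
  \<open>\<phi>(t)\<close> is identified with the functional \<open>\<psi> \<mapsto> (\<phi>(t),\<psi>)\<close>.
\<close>

definition has_weak_time_derivative ::
    "'a::euclidean_space set \<Rightarrow> real \<Rightarrow> (real \<Rightarrow> 'a \<Rightarrow> real) \<Rightarrow> (real \<Rightarrow> ('a \<Rightarrow> real) \<Rightarrow> real) \<Rightarrow> bool" where
  "has_weak_time_derivative S T \<phi> \<phi>t \<longleftrightarrow>
     (\<forall>\<eta>\<in>test_functions {0<..<T}. \<forall>\<psi>\<in>H1 S.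
        (\<integral>t. (\<integral>x. \<phi> t x * \<psi> x \<partial>lebesgue_on S) * deriv \<eta> t \<partial>lebesgue_on {0<..<T}) =
        - (\<integral>t. \<phi>t t \<psi> * \<eta> t \<partial>lebesgue_on {0<..<T}))"

text \<open>
  The value at time 0 is that of the representative in \<open>C([0,T];L\<^sup>2)\<close>, which exists for every
  \<open>\<phi>\<close> in \<open>L\<^sup>2(0,T;H\<^sup>1)\<close> with time derivative in \<open>L\<^sup>2(0,T;(H\<^sup>1)')\<close>.
\<close>

definition has_initial_value ::
    "'a::euclidean_space set \<Rightarrow> real \<Rightarrow> (real \<Rightarrow> 'a \<Rightarrow> real) \<Rightarrow> ('a \<Rightarrow> real) \<Rightarrow> bool" where
  "has_initial_value S T \<phi> \<phi>0 \<longleftrightarrow>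
     (\<exists>c. (\<forall>t\<in>{0..T}. c t \<in> L2_space (lebesgue_on S)) \<and>
          (\<forall>t\<in>{0..T}. ((\<lambda>s. L2_norm_on (lebesgue_on S) (c s - c t)) \<longlongrightarrow> 0) (at t within {0..T})) \<and>
          (AE t in lebesgue_on {0<..<T}. AE x in lebesgue_on S. \<phi> t x = c t x) \<and>
          (AE x in lebesgue_on S. c 0 x = \<phi>0 x))"


section \<open>Domains with regular boundary\<close>

text \<open>
  Near each boundary point the domain is, with respect to some direction \<open>e\<close>, the strict epigraph
  of a function \<open>\<gamma>\<close> of the variables orthogonal to \<open>e\<close> with Lipschitz gradient.
\<close>

definition C11_boundary :: "'a::euclidean_space set \<Rightarrow> bool" where
  "C11_boundary S \<longleftrightarrow>
     (\<forall>p\<in>frontier S. \<exists>r>0. \<exists>e \<gamma> g L. norm e = 1 \<and>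
        (\<forall>x. GDERIV \<gamma> x :> g x) \<and> L-lipschitz_on UNIV g \<and>
        (\<forall>x s. \<gamma> (x + s *\<^sub>R e) = \<gamma> x) \<and>
        S \<inter> ball p r = {x \<in> ball p r. \<gamma> x < x \<bullet> e})"


section \<open>Functions on an interval\<close>

definition deriv_on :: "real set \<Rightarrow> (real \<Rightarrow> real) \<Rightarrow> real \<Rightarrow> real" where
  "deriv_on I f s = vector_derivative f (at s within I)"

definition deriv2_on :: "real set \<Rightarrow> (real \<Rightarrow> real) \<Rightarrow> real \<Rightarrow> real" where
  "deriv2_on I f = deriv_on I (deriv_on I f)"

definition C1_on :: "real set \<Rightarrow> (real \<Rightarrow> real) \<Rightarrow> bool" where
  "C1_on I f \<longleftrightarrow> f differentiable_on I \<and> continuous_on I (deriv_on I f)"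

definition C2_on :: "real set \<Rightarrow> (real \<Rightarrow> real) \<Rightarrow> bool" where
  "C2_on I f \<longleftrightarrow> C1_on I f \<and> C1_on I (deriv_on I f)"

text \<open>
  Extension of a function on \<open>(-1,1)\<close> to \<open>[-1,1]\<close> by its limits. If a limit fails to exist, the
  value there is unspecified and the extension is not continuous.
\<close>

definition limit_ext :: "(real \<Rightarrow> 'b::t2_space) \<Rightarrow> real \<Rightarrow> 'b" where
  "limit_ext g s = (if s \<in> {-1<..<1} then g s else Lim (at s within {-1<..<1}) g)"

text \<open>\<open>G(\<phi>0) \<in> L\<^sup>1\<close>, with \<open>G\<close> extended to \<open>\<plusminus>1\<close> by its possibly infinite limits.\<close>

definition composition_in_L1 :: "'a measure \<Rightarrow> (real \<Rightarrow> real) \<Rightarrow> ('a \<Rightarrow> real) \<Rightarrow> bool" where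
  "composition_in_L1 M G \<phi>0 \<longleftrightarrow>
     (AE x in M. \<bar>\<phi>0 x\<bar> \<le> 1) \<and>
     (\<exists>h. integrable M h \<and> (AE x in M. limit_ext (\<lambda>s. ereal (G s)) (\<phi>0 x) = ereal (h x)))"


section \<open>The convolution kernel\<close>

text \<open>
  Only the values of \<open>J\<close> on the difference set of the domain matter; its gradient is the weak
  gradient there.
\<close>

definition kernel_gradient :: "'a::euclidean_space set \<Rightarrow> ('a \<Rightarrow> real) \<Rightarrow> 'a \<Rightarrow> 'a" where
  "kernel_gradient S J = weak_gradient {x - y |x y. x \<in> S \<and> y \<in> S} J"

definition kernel_mass :: "'a::euclidean_space set \<Rightarrow> ('a \<Rightarrow> real) \<Rightarrow> 'a \<Rightarrow> real" where
  "kernel_mass S J x = (\<integral>y. J (x - y) \<partial>lebesgue_on S)"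

definition kernel_sup :: "'a::euclidean_space set \<Rightarrow> ('a \<Rightarrow> 'b::euclidean_space) \<Rightarrow> ennreal" where
  "kernel_sup S K = (SUP x\<in>S. \<integral>\<^sup>+y. ennreal (norm (K (x - y))) \<partial>lebesgue_on S)"

definition a_upper :: "'a::euclidean_space set \<Rightarrow> ('a \<Rightarrow> real) \<Rightarrow> real" where
  "a_upper S J = enn2real (kernel_sup S J)"

definition a_lower :: "'a::euclidean_space set \<Rightarrow> ('a \<Rightarrow> real) \<Rightarrow> real" where
  "a_lower S J = (INF x\<in>S. kernel_mass S J x)"

definition gradient_conv ::
    "'a::euclidean_space set \<Rightarrow> ('a \<Rightarrow> real) \<Rightarrow> ('a \<Rightarrow> real) \<Rightarrow> 'a \<Rightarrow> 'a" where
  "gradient_conv S J f x = (\<integral>y. f y *\<^sub>R kernel_gradient S J (x - y) \<partial>lebesgue_on S)"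

definition admissible_kernel :: "'a::euclidean_space set \<Rightarrow> ('a \<Rightarrow> real) \<Rightarrow> bool" where
  "admissible_kernel S J \<longleftrightarrow>
     (AE x in lebesgue_on S. (\<lambda>y. J (y - x)) \<in> W11 S) \<and>
     (\<forall>x. J x = J (- x)) \<and>
     (AE x in lebesgue_on S. 0 \<le> kernel_mass S J x) \<and>
     kernel_sup S J < \<infinity> \<and>
     kernel_sup S (kernel_gradient S J) < \<infinity>"


section \<open>Weak solutions of the convective nonlocal Cahn--Hilliard equation\<close>

definition weak_solution ::
    "'a::euclidean_space set \<Rightarrow> ('a \<Rightarrow> real) \<Rightarrow> (real \<Rightarrow> real) \<Rightarrow> (real \<Rightarrow> real) \<Rightarrow>
     (real \<Rightarrow> 'a \<Rightarrow> 'a) \<Rightarrow> ('a \<Rightarrow> real) \<Rightarrow> real \<Rightarrow> (real \<Rightarrow> 'a \<Rightarrow> real) \<Rightarrow> bool" where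
  "weak_solution S J m F u \<phi>0 T \<phi> \<longleftrightarrow>
     \<phi> \<in> bochner_Linf (lebesgue_on {0<..<T}) (L2_space (lebesgue_on S)) (L2_norm_on (lebesgue_on S)) \<and>
     \<phi> \<in> bochner_L2 (lebesgue_on {0<..<T}) (H1 S) (H1_norm S) \<and>
     (\<lambda>(t, x). \<phi> t x) \<in> Linf_space (lebesgue_on ({0<..<T} \<times> S)) \<and>
     (AE (t, x) in lebesgue_on ({0<..<T} \<times> S). \<bar>\<phi> t x\<bar> \<le> 1) \<and>
     has_initial_value S T \<phi> \<phi>0 \<and>
     (\<exists>\<phi>t \<in> bochner_L2 (lebesgue_on {0<..<T}) (H1_dual S) (H1_dual_norm S).
        has_weak_time_derivative S T \<phi> \<phi>t \<and>
        (\<forall>\<psi>\<in>H1 S. AE t in lebesgue_on {0<..<T}.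
           \<phi>t t \<psi>
           + (\<integral>x. limit_ext (\<lambda>s. m s * deriv2_on {-1<..<1} F s) (\<phi> t x) *
                    (weak_gradient S (\<phi> t) x \<bullet> weak_gradient S \<psi> x) \<partial>lebesgue_on S)
           + (\<integral>x. m (\<phi> t x) * kernel_mass S J x *
                    (weak_gradient S (\<phi> t) x \<bullet> weak_gradient S \<psi> x) \<partial>lebesgue_on S)
           + (\<integral>x. m (\<phi> t x) *
                    ((\<phi> t x *\<^sub>R weak_gradient S (kernel_mass S J) x - gradient_conv S J (\<phi> t) x)
                      \<bullet> weak_gradient S \<psi> x) \<partial>lebesgue_on S)
           = (\<integral>x. (\<phi> t x *\<^sub>R u t x) \<bullet> weak_gradient S \<psi> x \<partial>lebesgue_on S)))"

end

theory Submission
  imports Defs "HOL-Computational_Algebra.Polynomial"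
begin

text \<open>
  Let \<open>\<phi>\<close> be the difference of two weak solutions \<open>\<phi>1\<close>, \<open>\<phi>2\<close>, and let \<open>\<psi> = R \<phi>\<close> be the Riesz
  representative of \<open>w \<mapsto> (\<phi>,w)\<close> in \<open>H\<^sup>1\<close> with its full scalar product, so \<open>\<psi>\<close> solves
  \<open>-\<Delta>\<psi> + \<psi> = \<phi>\<close> with a Neumann condition. The proof is a Gronwall argument for the dual energy
  \<open>E = \<parallel>\<psi>\<parallel>\<^sup>2 = (\<phi>, R \<phi>)\<close> in the norm of \<open>H\<^sup>1\<close>. Using the full product instead of the Dirichlet form
  avoids mean values and Poincare's inequality and costs only a lower order term.

  Let \<open>\<Lambda>\<close> and \<open>\<Gamma>\<close> be primitives of \<open>m F''\<close> and \<open>m\<close>. The difference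
  \<open>v = \<Lambda>(\<phi>1) - \<Lambda>(\<phi>2) + a (\<Gamma>(\<phi>1) - \<Gamma>(\<phi>2))\<close> lies in \<open>H\<^sup>1\<close>, and its gradient is the difference of the
  diffusive fluxes up to the term \<open>(\<Gamma>(\<phi>1) - \<Gamma>(\<phi>2)) \<nabla>a\<close>. By the definition of \<open>\<psi>\<close>,
  \<open>(\<nabla>v,\<nabla>\<psi>) = (v,\<phi>) - (v,\<psi>)\<close>. The structural hypothesis makes \<open>s \<mapsto> \<Lambda>(s) + a \<Gamma>(s)\<close> strongly
  monotone with constant \<open>\<kappa> = (1 - \<rho>) \<alpha>0\<close>, although \<open>m\<close> degenerates, so \<open>(v,\<phi>) \<ge> \<kappa> \<parallel>\<phi>\<parallel>\<^sup>2\<close>. Every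
  other term is bounded by a constant times \<open>(1 + \<parallel>u\<parallel>) \<parallel>\<phi>\<parallel> \<parallel>\<psi>\<parallel>\<close>; for the convolution this is Schur's
  test. Young's inequality gives \<open>E' \<le> K (1 + \<parallel>u\<parallel>\<^sup>2) E\<close> with \<open>E(0) = 0\<close>. The static part is
  \<open>energy_estimate\<close>, the time evolution is \<open>dual_evolution\<close>, and both meet in
  \<open>weak_solution_unique\<close>.

  Three points need care. The gradients of \<open>\<Lambda>(\<phi>)\<close> and \<open>a \<Gamma>(\<phi>)\<close> require a product rule
  (\<open>has_weak_gradient_mult\<close>, by mollification) and a chain rule (\<open>has_weak_gradient_compose\<close>, by
  polynomial approximation). The gradient of the kernel on the difference set of the domain is
  assembled from those of its translates (\<open>kernel_gradient_has_weak_gradient\<close>). Finally, \<open>E\<close> is not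
  differentiated in time: since \<open>(\<phi>, R \<phi>)\<close> is a symmetric quadratic form, its increments are pairings
  of increments of \<open>\<phi>\<close> with \<open>R \<phi>(s) + R \<phi>(t)\<close>, and these are summed over fine partitions. This uses
  the weak equation only for the countably many test functions \<open>R \<phi>(q)\<close> with \<open>q\<close> rational, and so one
  null set of exceptional times suffices (\<open>dual_equation_extends\<close>).
\<close>

section \<open>Smooth functions of compact support\<close>

lemma gderiv_unique:
 assumes "GDERIV f x :> D" "GDERIV f x :> E"
 shows "D = E"
proof -
 have "(%h. h \<bullet> D) = (%h. h \<bullet> E)"
  using assms has_derivative_unique unfolding gderiv_def by blast
 then have "(D - E) \<bullet> D = (D - E) \<bullet> E"
  by meson
 then show ?thesis
  by (metis inner_diff_right right_minus_eq inner_eq_zero_iff)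
qed

lemma Ck_0_if_gderiv: "(!!x. GDERIV f x :> g x) ==> Ck 0 f"
 unfolding gderiv_def Ck.simps
 by (intro continuous_at_imp_continuous_on ballI) (rule has_derivative_continuous)

lemma Ck_Suc_D: "Ck (Suc k) f ==> Ck k f"
proof (induction k arbitrary: f)
 case 0
 then obtain g where "\<forall>x. GDERIV f x :> g x" by auto
 then show ?case
  using Ck_0_if_gderiv by blast
next
 case (Suc k)
 then obtain g where g: "\<forall>x. GDERIV f x :> g x" "\<forall>b\<in>Basis. Ck (Suc k) (%x. g x \<bullet> b)"
  unfolding Ck.simps(2)[of "Suc k"] by blast
 with Suc.IH have "\<forall>b\<in>Basis. Ck k (%x. g x \<bullet> b)"
  by blast
 with g(1) show ?case
  unfolding Ck.simps(2) by blast
qed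

lemma Ck_imp_continuous: "Ck k f ==> continuous_on UNIV f"
proof (induction k)
 case (Suc k)
 from Suc.IH[OF Ck_Suc_D[OF Suc.prems]] show ?case .
qed simp

lemma Ck_SucI:
 assumes "!!x. GDERIV f x :> g x" "!!b. b \<in> Basis ==> Ck k (%x. g x \<bullet> b)"
 shows "Ck (Suc k) f"
 using assms by auto

lemma Ck_const: "Ck k (%x::'a::euclidean_space. c)"
proof (induction k arbitrary: c)
 case (Suc k)
 have "\<forall>x::'a. GDERIV (%x. c) x :> (%x. 0) x"
  by (simp add: GDERIV_const)
 moreover have "\<forall>b\<in>Basis. Ck k (%x::'a. (%x::'a. 0::'a) x \<bullet> b)"
  using Suc by simp
 ultimately show ?case
  by (intro Ck_SucI) blast+
qed simp

lemma Ck_add: "Ck k f ==> Ck k g ==> Ck k (%x. f x + g x)"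
proof (induction k arbitrary: f g)
 case (Suc k)
 obtain f' where f': "\<forall>x. GDERIV f x :> f' x" "\<forall>b\<in>Basis. Ck k (%x. f' x \<bullet> b)"
  using Suc.prems by auto
 obtain g' where g': "\<forall>x. GDERIV g x :> g' x" "\<forall>b\<in>Basis. Ck k (%x. g' x \<bullet> b)"
  using Suc.prems by auto
 have "\<forall>b\<in>Basis. Ck k (%x. (f' x + g' x) \<bullet> b)"
  using Suc.IH f' g' by (simp add: inner_add_left)
 moreover have "\<forall>x. GDERIV (%x. f x + g x) x :> (%x. f' x + g' x) x"
  using f' g' GDERIV_add by blast
 ultimately show ?case
  by (intro Ck_SucI) blast+
qed (simp add: continuous_on_add)

lemma Ck_mult: "Ck k f ==> Ck k g ==> Ck k (%x. f x * g x)"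
proof (induction k arbitrary: f g)
 case (Suc k)
 obtain f' where f': "\<forall>x. GDERIV f x :> f' x" "\<forall>b\<in>Basis. Ck k (%x. f' x \<bullet> b)"
  using Suc.prems by auto
 obtain g' where g': "\<forall>x. GDERIV g x :> g' x" "\<forall>b\<in>Basis. Ck k (%x. g' x \<bullet> b)"
  using Suc.prems by auto
 have "Ck k f" "Ck k g"
  using Suc.prems Ck_Suc_D by auto
 then have "\<forall>b\<in>Basis. Ck k (%x. (f x *\<^sub>R g' x + g x *\<^sub>R f' x) \<bullet> b)"
  using Suc.IH f' g' by (simp add: inner_add_left Ck_add)
 moreover have "\<forall>x. GDERIV (%x. f x * g x) x :> (%x. f x *\<^sub>R g' x + g x *\<^sub>R f' x) x"
  using f' g' GDERIV_mult by blast
 ultimately show ?case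
  by (intro Ck_SucI) blast+
qed (simp add: continuous_on_mult)

lemma GDERIV_affine:
 assumes "GDERIV f (a + s *\<^sub>R x) :> D"
 shows "GDERIV (%x. f (a + s *\<^sub>R x)) x :> s *\<^sub>R D"
proof -
 have "((%x. a + s *\<^sub>R x) has_derivative (%h. s *\<^sub>R h)) (at x)"
  by (auto intro!: derivative_eq_intros)
 from has_derivative_compose[OF this] assms show ?thesis
  unfolding gderiv_def by fastforce
qed

lemma Ck_affine: "Ck k f ==> Ck k (%x. f (a + s *\<^sub>R x))"
proof (induction k arbitrary: f)
 case 0
 then show ?case
  by (auto intro!: continuous_on_compose2[of UNIV f] continuous_intros)
next
 case (Suc k)
 obtain f' where f': "\<forall>x. GDERIV f x :> f' x" "\<forall>b\<in>Basis. Ck k (%x. f' x \<bullet> b)"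
  using Suc.prems by auto
 have "\<forall>b\<in>Basis. Ck k (%x. (s *\<^sub>R f' (a + s *\<^sub>R x)) \<bullet> b)"
  using Suc.IH f' by (auto intro!: Ck_mult[OF Ck_const] )
 moreover have "\<forall>x. GDERIV (%x. f (a + s *\<^sub>R x)) x :> (%x. s *\<^sub>R f' (a + s *\<^sub>R x)) x"
  using f' GDERIV_affine by blast
 ultimately show ?case
  by (intro Ck_SucI) blast+
qed

lemma Ck_inner_const: "Ck k (%x. x \<bullet> b)"
proof (cases k)
 case (Suc k)
 have "\<forall>x. GDERIV (%x. x \<bullet> b) x :> (%x. b) x"
  unfolding gderiv_def by (auto intro!: derivative_eq_intros)
 moreover have "\<forall>c\<in>Basis. Ck k (%x::'a. (%x::'a. b) x \<bullet> c)"
  by (simp add: Ck_const)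
 ultimately show ?thesis
  unfolding Suc by (intro Ck_SucI) blast+
qed (auto intro!: continuous_intros)

lemma test_functionsI:
 assumes "!!k. Ck k \<eta>" "compact K" "K \<subseteq> S" "!!x. x \<notin> K ==> \<eta> x = 0"
 shows "\<eta> \<in> test_functions S"
proof -
 have "closure {x. \<eta> x \<noteq> 0} \<subseteq> K"
  using assms by (intro closure_minimal) (auto intro: compact_imp_closed)
 moreover have "compact (closure {x. \<eta> x \<noteq> 0})"
  using calculation assms(2) by (meson bounded_subset closed_closure compact_eq_bounded_closed)
 ultimately show ?thesis
  using assms unfolding test_functions_def by auto
qed

lemma test_functions_mono: "\<eta> \<in> test_functions S ==> S \<subseteq> T ==> \<eta> \<in> test_functions T"
 unfolding test_functions_def by auto

lemma Ck_gradient: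
 assumes "Ck (Suc k) f" "!!x. GDERIV f x :> g x" "b \<in> Basis"
 shows "Ck k (%x. g x \<bullet> b)"
proof -
 obtain h where h: "\<forall>x. GDERIV f x :> h x" "\<forall>b\<in>Basis. Ck k (%x. h x \<bullet> b)"
  using assms(1) by auto
 have "h = g"
  using h assms(2) gderiv_unique by blast
 with h assms(3) show ?thesis by auto
qed

lemma test_functionsE:
 assumes "\<eta> \<in> test_functions S"
 obtains \<eta>' K B where "!!x. GDERIV \<eta> x :> \<eta>' x" "continuous_on UNIV \<eta>" "continuous_on UNIV \<eta>'"
  "compact K" "K \<subseteq> S" "!!x. x \<notin> K ==> \<eta> x = 0" "!!x. x \<notin> K ==> \<eta>' x = 0"
  "B > 0" "!!x. \<bar>\<eta> x\<bar> <= B" "!!x. norm (\<eta>' x) <= B"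
proof -
 define K where "K = closure {x. \<eta> x \<noteq> 0}"
 have Ck: "Ck k \<eta>" for k
  using assms by (auto simp: test_functions_def)
 have K: "compact K" "K \<subseteq> S"
  using assms by (auto simp: test_functions_def K_def)
 obtain g where g: "\<forall>x. GDERIV \<eta> x :> g x"
  using Ck[of "Suc 0"] by auto
 have out: "\<eta> x = 0" if "x \<notin> K" for x
  using that closure_subset[of "{x. \<eta> x \<noteq> 0}"] unfolding K_def by auto
 have out': "g x = 0" if "x \<notin> K" for x
 proof -
  have "open (- K)" "x \<in> - K"
   using K that by (auto simp: compact_imp_closed open_Compl)
  moreover have "((%x. 0) has_derivative (%h. h \<bullet> 0)) (at x)"
   by (simp)
  ultimately have "(\<eta> has_derivative (%h. h \<bullet> 0)) (at x)"
   using has_derivative_transform_within_open[of "%x. 0" _ x UNIV "- K" \<eta>] out by simp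
  then show ?thesis
   using g gderiv_unique unfolding gderiv_def by blast
 qed
 have c1: "continuous_on UNIV \<eta>"
  using Ck Ck_imp_continuous by blast
 have c2: "continuous_on UNIV g"
  using Ck[of "Suc 0"] Ck_gradient[of 0 \<eta> g] g by (subst continuous_on_componentwise) auto
 have "bounded (\<eta> ` K)" "bounded (g ` K)"
  using K c1 c2 by (meson compact_continuous_image compact_imp_bounded continuous_on_subset subset_UNIV)+
 then obtain B1 B2 where "\<forall>x\<in>K. norm (\<eta> x) <= B1" "\<forall>x\<in>K. norm (g x) <= B2"
  unfolding bounded_iff by auto
 then have "\<bar>\<eta> x\<bar> <= \<bar>B1\<bar> + \<bar>B2\<bar> + 1" "norm (g x) <= \<bar>B1\<bar> + \<bar>B2\<bar> + 1" for x
  using out[of x] out'[of x] by (cases "x \<in> K"; force)+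
 then show thesis
  by (intro that[of g K "\<bar>B1\<bar> + \<bar>B2\<bar> + 1"]) (use g c1 c2 K out out' in auto)
qed

lemma test_functions_partial:
 assumes "\<eta> \<in> test_functions S" "!!x. GDERIV \<eta> x :> g x" "b \<in> Basis"
 shows "(%x. g x \<bullet> b) \<in> test_functions S"
proof -
 obtain h K B where h: "!!x. GDERIV \<eta> x :> h x" "compact K" "K \<subseteq> S" "!!x. x \<notin> K ==> h x = 0"
  by (rule test_functionsE[OF assms(1)]) blast
 have "h = g" using h(1) assms(2) gderiv_unique by blast
 show ?thesis
  by (rule test_functionsI[OF _ h(2,3)])
   (use assms Ck_gradient[OF _ assms(2,3)] h(4) \<open>h = g\<close> in \<open>auto simp: test_functions_def simp del: Ck.simps\<close>)
qed

lemma test_functions_mult_smooth: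
 assumes "\<eta> \<in> test_functions S" "!!k. Ck k f"
 shows "(%x. f x * \<eta> x) \<in> test_functions S"
proof -
 obtain K where K: "compact K" "K \<subseteq> S" "!!x. x \<notin> K ==> \<eta> x = 0"
  by (rule test_functionsE[OF assms(1)]) blast
 have "Ck k (%x. f x * \<eta> x)" for k
  using assms by (intro Ck_mult) (auto simp: test_functions_def)
 then show ?thesis
  by (rule test_functionsI[OF _ K(1,2)]) (simp add: K(3))
qed

text \<open>
 The functions \<open>p(1/t) exp (-1/t)\<close>, extended by zero to the negative half-line, form a class
 closed under differentiation; the limit at \<open>0\<close> vanishes for every polynomial \<open>p\<close>, and dividing by
 \<open>t\<close> stays in the class.
\<close>

definition flat_exp :: "real poly => real => real" where
 "flat_exp p t = (if t > 0 then poly p (1 / t) * exp (- (1 / t)) else 0)"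

lemma flat_exp_tendsto_0: "(flat_exp p \<longlongrightarrow> 0) (at 0)"
proof (rule filterlim_split_at)
 have "\<forall>\<^sub>F t in at_left (0::real). 0 = flat_exp p t"
  by (auto simp: eventually_at_filter flat_exp_def)
 then show "(flat_exp p \<longlongrightarrow> 0) (at_left 0)"
  by (rule Lim_transform_eventually[OF tendsto_const])
 have "((%s. \<Sum>i\<le>degree p. coeff p i * (s ^ i / exp s)) \<longlongrightarrow> (\<Sum>i\<le>degree p. coeff p i * 0)) at_top"
  by (intro tendsto_intros tendsto_power_div_exp_0)
 then have "((%s. poly p s * exp (- s)) \<longlongrightarrow> 0) at_top"
  by (simp add: poly_altdef exp_minus divide_inverse sum_distrib_right mult.assoc)
 then have "((%t. poly p (1 / t) * exp (- (1 / t))) \<longlongrightarrow> 0) (at_right 0)"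
  using filterlim_compose[OF _ filterlim_inverse_at_top_right] by (fastforce simp: inverse_eq_divide)
 moreover have "\<forall>\<^sub>F t in at_right 0. poly p (1 / t) * exp (- (1 / t)) = flat_exp p t"
  by (auto simp: eventually_at_filter flat_exp_def)
 ultimately show "(flat_exp p \<longlongrightarrow> 0) (at_right 0)"
  by (rule Lim_transform_eventually)
qed

definition flat_deriv :: "real poly => real poly" where
 "flat_deriv p = pCons 0 (pCons 0 (p - pderiv p))"

lemma DERIV_flat_exp: "(flat_exp p has_real_derivative flat_exp (flat_deriv p) t) (at t)"
proof -
 consider "t > 0" | "t < 0" | "t = 0" by linarith
 then show ?thesis
 proof cases
  case 1
  have "((%t. poly p (1 / t) * exp (- (1 / t))) has_real_derivative
    (poly p (1 / t) * (exp (- (1 / t)) * (1 / t\<^sup>2)) + (poly (pderiv p) (1 / t) * (- 1 / t\<^sup>2)) * exp (- (1 / t)))) (at t)"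
  proof -
   have inv: "((%t. 1 / t) has_real_derivative - 1 / t\<^sup>2) (at t)"
    using 1 by (auto intro!: derivative_eq_intros simp: power2_eq_square)
   have e: "((%t. exp (- (1 / t))) has_real_derivative exp (- (1 / t)) * (1 / t\<^sup>2)) (at t)"
    using DERIV_chain2[OF DERIV_exp DERIV_minus[OF inv]] by simp
   show ?thesis
    using DERIV_mult'[OF DERIV_chain2[OF poly_DERIV inv] e] by simp
  qed
  moreover have "poly p (1 / t) * (exp (- (1 / t)) * (1 / t\<^sup>2)) + (poly (pderiv p) (1 / t) * (- 1 / t\<^sup>2)) * exp (- (1 / t))
   = flat_exp (flat_deriv p) t"
   using 1 by (simp add: flat_exp_def flat_deriv_def field_simps power2_eq_square)
  ultimately have "((%t. poly p (1 / t) * exp (- (1 / t))) has_real_derivative flat_exp (flat_deriv p) t) (at t)"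
   by (rule back_subst)
  then show ?thesis
   by (rule has_field_derivative_transform_within_open[where S="{0<..}"])
    (use 1 in \<open>auto simp: flat_exp_def\<close>)
 next
  case 2
  then have "flat_exp (flat_deriv p) t = 0"
   by (simp add: flat_exp_def)
  then have "((%t. 0) has_real_derivative flat_exp (flat_deriv p) t) (at t)"
   by simp
  then show ?thesis
   by (rule has_field_derivative_transform_within_open[where S="{..<0}"])
    (use 2 in \<open>auto simp: flat_exp_def\<close>)
 next
  case 3
  have "(%h. (flat_exp p (0 + h) - flat_exp p 0) / h) = flat_exp (pCons 0 p)"
   by (auto simp: flat_exp_def fun_eq_iff)
  with flat_exp_tendsto_0[of "pCons 0 p"] 3 show ?thesis
   unfolding DERIV_def by (simp add: flat_exp_def)
 qed
qed

lemma Ck_flat_exp_radial: "Ck k (%z::'a::euclidean_space. flat_exp p (r - z \<bullet> z))"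
proof (induction k arbitrary: p)
 case 0
 have "continuous_on UNIV (flat_exp p)"
  by (intro continuous_at_imp_continuous_on ballI) (rule DERIV_continuous[OF DERIV_flat_exp])
 then show ?case
  by (auto intro!: continuous_on_compose2[of UNIV "flat_exp p"] continuous_intros)
next
 case (Suc k)
 have "GDERIV (%z. flat_exp p (r - z \<bullet> z)) z :> flat_exp (flat_deriv p) (r - z \<bullet> z) *\<^sub>R (- 2 *\<^sub>R z)" for z :: 'a
 proof (rule GDERIV_DERIV_compose[OF _ DERIV_flat_exp])
  show "GDERIV (%z. r - z \<bullet> z) z :> - 2 *\<^sub>R z"
   unfolding gderiv_def by (auto intro!: derivative_eq_intros simp: inner_commute)
 qed
 moreover have "Ck k (%z::'a. (flat_exp (flat_deriv p) (r - z \<bullet> z) *\<^sub>R (- 2 *\<^sub>R z)) \<bullet> b)" for b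
 proof -
  have "Ck k (%z::'a. flat_exp (flat_deriv p) (r - z \<bullet> z) * ((- 2) * (z \<bullet> b)))"
   by (intro Ck_mult Ck_inner_const Ck_const Suc)
  then show ?thesis
   by (simp only: inner_scaleR_left)
 qed
 ultimately show ?case
  by (intro Ck_SucI) blast+
qed

definition bump :: "real => 'a::euclidean_space => real" where
 "bump r z = flat_exp 1 (r\<^sup>2 - z \<bullet> z)"

lemma bump_test_function:
 assumes "0 < r"
 shows "bump r \<in> test_functions (UNIV :: 'a::euclidean_space set)"
proof (rule test_functionsI[of _ "cball 0 r"])
 show "Ck k (bump r :: 'a => real)" for k
  unfolding bump_def by (rule Ck_flat_exp_radial)
 show "bump r x = 0" if "x \<notin> cball 0 r" for x :: 'a
  using that assms power_mono[of r "norm x" 2]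
  by (simp add: bump_def flat_exp_def dot_square_norm not_less)
qed auto

lemma bump_nonneg: "0 <= bump r z"
 by (simp add: bump_def flat_exp_def)

lemma bump_pos: "0 < r ==> norm z < r ==> 0 < bump r z"
 using power_strict_mono[of "norm z" r 2] by (simp add: bump_def flat_exp_def dot_square_norm)

lemma bump_outside: "0 < r ==> r <= norm z ==> bump r z = 0"
 using power_mono[of r "norm z" 2] by (simp add: bump_def flat_exp_def dot_square_norm not_less)

lemma integrable_continuous_compact_support:
 fixes f :: "'a::euclidean_space => 'b::euclidean_space"
 assumes "continuous_on UNIV f" "compact K" "!!x. x \<notin> K ==> f x = 0"
 shows "integrable lebesgue f" "f \<in> borel_measurable borel"
proof -
 show m: "f \<in> borel_measurable borel"
  using assms(1) borel_measurable_continuous_onI by blast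
 have "integrable lborel (%x. indicator K x *\<^sub>R f x)"
  using assms by (intro borel_integrable_compact) (auto intro: continuous_on_subset)
 moreover have "(%x. indicator K x *\<^sub>R f x) = f"
  using assms(3) by (auto simp: fun_eq_iff indicator_def)
 ultimately show "integrable lebesgue f"
  using m by (simp add: integrable_completion)
qed

lemma test_functions_integrable:
 assumes "\<eta> \<in> test_functions S"
 shows "integrable lebesgue \<eta>"
proof (rule test_functionsE[OF assms])
 fix K
 assume "continuous_on UNIV \<eta>" "compact K" "!!x. x \<notin> K ==> \<eta> x = 0"
 then show ?thesis
  by (rule integrable_continuous_compact_support(1))
qed

lemma bump_integral_pos:
 assumes "0 < r"
 shows "0 < (\<integral>z. bump r (z::'a::euclidean_space) \<partial>lebesgue)"
proof -
 have i: "integrable lebesgue (bump r :: 'a => real)"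
  using bump_test_function[OF assms] test_functions_integrable by blast
 have "(\<integral>z. bump r (z::'a) \<partial>lebesgue) \<noteq> 0"
 proof
  assume "(\<integral>z. bump r (z::'a) \<partial>lebesgue) = 0"
  then have "AE z in lebesgue. bump r (z::'a) = 0"
   using integral_nonneg_eq_0_iff_AE[OF i] bump_nonneg by auto
  then have "AE z in lebesgue. z \<in> - ball (0::'a) r"
  proof (rule eventually_mono)
   show "z \<in> - ball 0 r" if "bump r z = 0" for z :: 'a
    using that bump_pos[OF assms, of z] by (cases "norm z < r") auto
  qed
  then have "(0::'a) \<in> - ball 0 r"
   by (rule mem_closed_if_AE_lebesgue[rotated]) auto
  then show False using assms by simp
 qed
 moreover have "0 <= (\<integral>z. bump r (z::'a) \<partial>lebesgue)"
  by (simp add: bump_nonneg)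
 ultimately show ?thesis by linarith
qed

definition mollifier :: "real => 'a::euclidean_space => real" where
 "mollifier r z = inverse (\<integral>z. bump r (z::'a) \<partial>lebesgue) * bump r z"

lemma mollifier_test_function:
 "0 < r ==> mollifier r \<in> test_functions (UNIV :: 'a::euclidean_space set)"
 using test_functions_mult_smooth[OF bump_test_function Ck_const]
 unfolding mollifier_def by fastforce

lemma mollifier_nonneg: "0 < r ==> 0 <= mollifier r z"
 unfolding mollifier_def using bump_nonneg bump_integral_pos by (metis inverse_nonnegative_iff_nonnegative less_imp_le mult_nonneg_nonneg)

lemma mollifier_outside: "0 < r ==> r <= norm z ==> mollifier r z = 0"
 by (simp add: mollifier_def bump_outside)

lemma mollifier_minus: "mollifier r (- z) = mollifier r z"
 by (simp add: mollifier_def bump_def)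

lemma mollifier_integrable: "0 < r ==> integrable lebesgue (mollifier r :: 'a::euclidean_space => real)"
 using mollifier_test_function test_functions_integrable by blast

lemma mollifier_continuous: "0 < r ==> continuous_on UNIV (mollifier r)"
 by (rule test_functionsE[OF mollifier_test_function]) blast

lemma mollifier_integral: "0 < r ==> (\<integral>z. mollifier r (z::'a::euclidean_space) \<partial>lebesgue) = 1"
 unfolding mollifier_def using bump_integral_pos[of r, where 'a='a] by simp

lemma test_functions_reflect:
 assumes "\<eta> \<in> test_functions UNIV"
 shows "(%y. \<eta> (x - y)) \<in> test_functions UNIV"
proof -
 obtain K where K: "compact K" "!!x. x \<notin> K ==> \<eta> x = 0"
  by (rule test_functionsE[OF assms]) blast
 have "Ck k (%y. \<eta> (x + (- 1) *\<^sub>R y))" for k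
  using assms Ck_affine unfolding test_functions_def by blast
 moreover have "compact ((%y. x - y) ` K)"
  using K(1) by (intro compact_continuous_image continuous_intros)
 ultimately show ?thesis
 proof (rule_tac test_functionsI[where K="(%y. x - y) ` K"])
  show "\<eta> (x - y) = 0" if "y \<notin> (%y. x - y) ` K" for y
  proof (rule K(2))
   show "x - y \<notin> K"
   proof
    assume "x - y \<in> K"
    then have "x - (x - y) \<in> (%y. x - y) ` K" by (rule imageI)
    with that show False by simp
   qed
  qed
 qed auto
qed

lemma mollifier_shift_test_function:
 assumes "0 < r" "cball x r \<subseteq> S"
 shows "(%y. mollifier r (x - y)) \<in> test_functions S"
proof (rule test_functionsI[where K="cball x r"])
 show "Ck k (%y. mollifier r (x - y))" for k
  using test_functions_reflect[OF mollifier_test_function[OF assms(1)], of x] by (auto simp: test_functions_def)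
 show "mollifier r (x - y) = 0" if "y \<notin> cball x r" for y
  using that assms by (intro mollifier_outside) (auto simp: dist_norm)
qed (use assms in auto)

lemma GDERIV_reflect:
 assumes "GDERIV \<eta> (x - y) :> D"
 shows "GDERIV (%y. \<eta> (x - y)) y :> - D"
 using GDERIV_affine[of \<eta> x "-1" y D] assms by simp

section \<open>Convolution with a smooth kernel\<close>

lemma continuous_reflect_measurable:
 fixes g :: "'a::euclidean_space => 'b::euclidean_space"
 assumes "continuous_on UNIV g"
 shows "(%y. g (x - y)) \<in> borel_measurable lebesgue"
proof -
 have "continuous_on UNIV (%y. g (x - y))"
  by (rule continuous_on_compose2[OF assms]) (auto intro!: continuous_intros)
 then show ?thesis
  by (intro measurable_completion) (simp add: borel_measurable_continuous_onI)
qed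

text \<open>
  The derivative falls on the smooth factor, so mollifications are smooth however rough the
  mollified function is.
\<close>

lemma GDERIV_convolution:
 fixes \<eta> :: "'a::euclidean_space => real"
 assumes \<eta>: "\<eta> \<in> test_functions UNIV" "!!x. GDERIV \<eta> x :> g x" and u: "integrable lebesgue u"
 shows "GDERIV (%x. \<integral>y. \<eta> (x - y) * u y \<partial>lebesgue) x :> (\<integral>y. u y *\<^sub>R g (x - y) \<partial>lebesgue)"
proof -
 obtain g' B where g': "!!x. GDERIV \<eta> x :> g' x" "continuous_on UNIV \<eta>" "continuous_on UNIV g'"
  "B > 0" "!!x. \<bar>\<eta> x\<bar> <= B" "!!x. norm (g' x) <= B"
  by (rule test_functionsE[OF \<eta>(1)]) blast
 have gg: "g' = g" using g'(1) \<eta>(2) gderiv_unique by blast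
 note g = g'[unfolded gg]
 have mu[measurable]: "u \<in> borel_measurable lebesgue" using u by simp
 have me: "(%y. \<eta> (z - y)) \<in> borel_measurable lebesgue" for z
  using continuous_reflect_measurable[OF g(2)] .
 have mg: "(%y. g (z - y)) \<in> borel_measurable lebesgue" for z
  using continuous_reflect_measurable[OF g(3)] .
 have i1: "integrable lebesgue (%y. \<eta> (z - y) * u y)" for z
  by (rule Bochner_Integration.integrable_bound[of _ "%y. B * \<bar>u y\<bar>"])
   (use u g(4,5) me in \<open>auto simp: abs_mult intro!: mult_right_mono AE_I2\<close>)
 have i2: "integrable lebesgue (%y. u y *\<^sub>R g (z - y))" for z
  by (rule Bochner_Integration.integrable_bound[of _ "%y. \<bar>u y\<bar> * B"])
   (use u g(4,6) mg in \<open>auto simp: abs_mult intro!: mult_left_mono AE_I2\<close>)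
 have lip: "\<bar>\<eta> (z + h) - \<eta> z\<bar> <= B * norm h" for z h
 proof -
  have "onorm (%h. h \<bullet> g z) <= B" for z
  proof (rule onorm_le)
   fix h
   have "\<bar>h \<bullet> g z\<bar> <= norm h * norm (g z)" by (rule Cauchy_Schwarz_ineq2)
   also have "\<dots> <= norm h * B" using g(6) by (intro mult_left_mono) auto
   finally show "norm (h \<bullet> g z) <= B * norm h" by (simp add: mult.commute)
  qed
  then have "norm (\<eta> (z + h) - \<eta> z) <= B * norm (z + h - z)"
   using g(1) by (intro differentiable_bound[of UNIV \<eta> "%z h. h \<bullet> g z"]) (auto simp: gderiv_def)
  then show ?thesis by simp
 qed
 let ?D = "\<integral>y. u y *\<^sub>R g (x - y) \<partial>lebesgue"
 let ?q = "%h y. (\<bar>\<eta> (x - y + h) - \<eta> (x - y) - h \<bullet> g (x - y)\<bar> / norm h) * \<bar>u y\<bar>"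
 have q_le: "norm (?q h y) <= 2 * B * \<bar>u y\<bar>" if "h \<noteq> 0" for h y
 proof -
  have "\<bar>h \<bullet> g (x - y)\<bar> <= B * norm h"
   using Cauchy_Schwarz_ineq2[of h "g (x - y)"] mult_left_mono[OF g(6)[of "x - y"] norm_ge_zero[of h]]
   by (simp add: mult.commute)
  then have "\<bar>\<eta> (x - y + h) - \<eta> (x - y) - h \<bullet> g (x - y)\<bar> <= 2 * B * norm h"
   using lip[of "x - y" h] by linarith
  from mult_right_mono[OF this abs_ge_zero[of "u y"]] show ?thesis
   using that by (auto simp: divide_le_eq abs_mult ac_simps)
 qed
 have mq: "?q h \<in> borel_measurable lebesgue" for h
  using me[of x] me[of "x + h"] mg[of x] by (simp add: algebra_simps)
 have "((%h. norm ((\<integral>y. \<eta> (x + h - y) * u y \<partial>lebesgue) - (\<integral>y. \<eta> (x - y) * u y \<partial>lebesgue) - h \<bullet> ?D) / norm h) \<longlongrightarrow> 0) (at 0)"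
  unfolding tendsto_at_iff_sequentially
 proof (intro allI impI)
  fix X :: "nat => 'a" assume X: "\<forall>i. X i \<in> UNIV - {0}" "X \<longlonglongrightarrow> 0"
  have "(%n. \<integral>y. ?q (X n) y \<partial>lebesgue) \<longlonglongrightarrow> (\<integral>y. 0 \<partial>(lebesgue :: 'a measure))"
  proof (rule integral_dominated_convergence[where w="%y. 2 * B * \<bar>u y\<bar>"])
   have "(%n. ?q (X n) y) \<longlonglongrightarrow> 0 * \<bar>u y\<bar>" for y
   proof (rule tendsto_mult[OF _ tendsto_const])
    have "((%h. norm (\<eta> (x - y + h) - \<eta> (x - y) - h \<bullet> g (x - y)) / norm h) \<longlongrightarrow> 0) (at 0)"
     using g(1)[of "x - y"] unfolding gderiv_def has_derivative_at by simp
    then show "(%n. \<bar>\<eta> (x - y + X n) - \<eta> (x - y) - X n \<bullet> g (x - y)\<bar> / norm (X n)) \<longlonglongrightarrow> 0"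
     using X unfolding tendsto_at_iff_sequentially by (auto simp: o_def)
   qed
   then show "AE y in lebesgue. (%n. ?q (X n) y) \<longlonglongrightarrow> 0" by simp
   show "AE y in lebesgue. norm (?q (X n) y) <= 2 * B * \<bar>u y\<bar>" for n
    using q_le X by auto
  qed (use mq u in auto)
  then have lim: "(%n. \<integral>y. ?q (X n) y \<partial>lebesgue) \<longlonglongrightarrow> 0" by simp
  have bound: "norm ((\<integral>y. \<eta> (x + h - y) * u y \<partial>lebesgue) - (\<integral>y. \<eta> (x - y) * u y \<partial>lebesgue) - h \<bullet> ?D) / norm h
    <= (\<integral>y. ?q h y \<partial>lebesgue)" if "h \<noteq> 0" for h
  proof -
   have "h \<bullet> ?D = (\<integral>y. h \<bullet> (u y *\<^sub>R g (x - y)) \<partial>lebesgue)"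
    by (rule integral_inner_right[symmetric]) (rule i2)
   moreover have "integrable lebesgue (%y. h \<bullet> (u y *\<^sub>R g (x - y)))"
    using i2[of x] by (rule integrable_inner_right)
   ultimately have diff: "(\<integral>y. \<eta> (x + h - y) * u y \<partial>lebesgue) - (\<integral>y. \<eta> (x - y) * u y \<partial>lebesgue) - h \<bullet> ?D
    = (\<integral>y. \<eta> (x + h - y) * u y - \<eta> (x - y) * u y - h \<bullet> (u y *\<^sub>R g (x - y)) \<partial>lebesgue)"
    using i1[of x] i1[of "x + h"] i2[of x] by simp
   have "norm ((\<integral>y. \<eta> (x + h - y) * u y \<partial>lebesgue) - (\<integral>y. \<eta> (x - y) * u y \<partial>lebesgue) - h \<bullet> ?D)
     <= (\<integral>y. norm (\<eta> (x + h - y) * u y - \<eta> (x - y) * u y - h \<bullet> (u y *\<^sub>R g (x - y))) \<partial>lebesgue)"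
    unfolding diff by (rule integral_norm_bound)
   also have "\<dots> = (\<integral>y. norm h * ?q h y \<partial>lebesgue)"
   proof (intro Bochner_Integration.integral_cong refl)
    fix y
    have "\<eta> (x + h - y) * u y - \<eta> (x - y) * u y - h \<bullet> (u y *\<^sub>R g (x - y))
     = (\<eta> (x - y + h) - \<eta> (x - y) - h \<bullet> g (x - y)) * u y"
     by (simp add: right_diff_distrib add_diff_eq diff_add_eq mult.commute)
    then show "norm (\<eta> (x + h - y) * u y - \<eta> (x - y) * u y - h \<bullet> (u y *\<^sub>R g (x - y))) = norm h * ?q h y"
     using that by (simp add: abs_mult)
   qed
   finally show ?thesis
    using that by (simp add: divide_le_eq mult.commute)
  qed
  show "((%h. norm ((\<integral>y. \<eta> (x + h - y) * u y \<partial>lebesgue) - (\<integral>y. \<eta> (x - y) * u y \<partial>lebesgue) - h \<bullet> ?D) / norm h) \<circ> X) \<longlonglongrightarrow> 0"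
   by (rule Lim_null_comparison[OF _ lim]) (use bound X in auto)
 qed
 then show ?thesis
  unfolding gderiv_def has_derivative_at by (auto intro: bounded_linear_inner_left)
qed

lemma Ck_convolution:
 fixes \<eta> :: "'a::euclidean_space => real"
 assumes "\<eta> \<in> test_functions UNIV" "integrable lebesgue u"
 shows "Ck k (%x. \<integral>y. \<eta> (x - y) * u y \<partial>lebesgue)"
 using assms(1)
proof (induction k arbitrary: \<eta>)
 case 0
 obtain g where "!!x. GDERIV \<eta> x :> g x" by (rule test_functionsE[OF 0]) blast
 from GDERIV_convolution[OF 0 this assms(2)] show ?case
  by (rule Ck_0_if_gderiv)
next
 case (Suc k)
 obtain g B where g: "!!x. GDERIV \<eta> x :> g x" "continuous_on UNIV g" "!!x. norm (g x) <= B"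
  by (rule test_functionsE[OF Suc.prems]) blast
 have i: "integrable lebesgue (%y. u y *\<^sub>R g (x - y))" for x
 proof (rule Bochner_Integration.integrable_bound[of _ "%y. \<bar>u y\<bar> * B"])
  have "(%y. g (x - y)) \<in> borel_measurable lebesgue"
   using continuous_reflect_measurable[OF g(2)] .
  then show "(%y. u y *\<^sub>R g (x - y)) \<in> borel_measurable lebesgue"
   using assms(2) by simp
  have "norm (g y) <= \<bar>B\<bar>" for y using g(3)[of y] by linarith
  then show "AE y in lebesgue. norm (u y *\<^sub>R g (x - y)) <= norm (\<bar>u y\<bar> * B)"
   by (auto simp: abs_mult intro!: mult_left_mono)
 qed (use assms in auto)
 have "(\<integral>y. u y *\<^sub>R g (x - y) \<partial>lebesgue) \<bullet> b = (\<integral>y. (g (x - y) \<bullet> b) * u y \<partial>lebesgue)" for x b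
 proof -
  have "(\<integral>y. u y *\<^sub>R g (x - y) \<partial>lebesgue) \<bullet> b = (\<integral>y. (u y *\<^sub>R g (x - y)) \<bullet> b \<partial>lebesgue)"
   by (rule integral_inner_left[symmetric]) (rule i)
  then show ?thesis by (simp add: mult.commute)
 qed
 then have "\<forall>b\<in>Basis. Ck k (%x. (%x. \<integral>y. u y *\<^sub>R g (x - y) \<partial>lebesgue) x \<bullet> b)"
  using Suc.IH[OF test_functions_partial[OF Suc.prems g(1)]] by simp
 then show ?case
  using GDERIV_convolution[OF Suc.prems g(1) assms(2)] by (intro Ck_SucI) blast+
qed

section \<open>Mollification in \<open>L\<^sup>1\<close>\<close>

lemma lebesgue_isometry:
 fixes a :: "'a::euclidean_space"
 assumes "s = 1 \<or> s = - 1"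
 shows "(%y. a + s *\<^sub>R y) \<in> lebesgue \<rightarrow>\<^sub>M lebesgue"
  "distr lebesgue lebesgue (%y. a + s *\<^sub>R y) = lebesgue"
proof -
 have T: "(%y::'a. a + (\<Sum>j\<in>Basis. (s * (y \<bullet> j)) *\<^sub>R j)) = (%y. a + s *\<^sub>R y)"
  unfolding scaleR_scaleR[symmetric] scaleR_sum_right[symmetric] euclidean_representation ..
 show "(%y. a + s *\<^sub>R y) \<in> lebesgue \<rightarrow>\<^sub>M lebesgue"
  using lebesgue_affine_measurable[of "%_. s" a] assms T by auto
 have "(\<Prod>j\<in>(Basis::'a set). \<bar>s\<bar>) = 1" using assms by auto
 then show "distr lebesgue lebesgue (%y. a + s *\<^sub>R y) = lebesgue"
  using lebesgue_affine_euclidean[of "%_. s" a] assms unfolding T by (auto simp: density_1)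
qed

lemma measurable_reflect: "(%y. x - y) \<in> lebesgue \<rightarrow>\<^sub>M (lebesgue :: 'a::euclidean_space measure)"
 and distr_reflect: "distr lebesgue lebesgue (%y. x - y) = (lebesgue :: 'a::euclidean_space measure)"
 and measurable_shift: "(%y. y - x) \<in> lebesgue \<rightarrow>\<^sub>M (lebesgue :: 'a::euclidean_space measure)"
 and distr_shift: "distr lebesgue lebesgue (%y. y - x) = (lebesgue :: 'a::euclidean_space measure)"
 using lebesgue_isometry[of "-1" x] lebesgue_isometry[of 1 "- x"] by (simp_all add: algebra_simps)

lemma AE_reflect:
 assumes "AE y in lebesgue. P (y::'a::euclidean_space)"
 shows "AE y in lebesgue. P (x - y)"
proof -
 from assms have "AE y in distr lebesgue lebesgue (%y. x - y). P y"
  by (simp only: distr_reflect)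
 then show ?thesis by (rule AE_distrD[OF measurable_reflect])
qed

lemma AE_shift:
 assumes "AE y in lebesgue. P (y::'a::euclidean_space)"
 shows "AE y in lebesgue. P (y - x)"
proof -
 from assms have "AE y in distr lebesgue lebesgue (%y. y - x). P y"
  by (simp only: distr_shift)
 then show ?thesis by (rule AE_distrD[OF measurable_shift])
qed

lemma integral_reflect:
 fixes f :: "'a::euclidean_space => 'b::euclidean_space"
 assumes "f \<in> borel_measurable lebesgue"
 shows "(\<integral>y. f (x - y) \<partial>lebesgue) = (\<integral>y. f y \<partial>lebesgue)"
 using integral_distr[OF measurable_reflect[of x] assms] by (simp add: distr_reflect)

lemma integrable_reflect:
 fixes f :: "'a::euclidean_space => 'b::euclidean_space"
 assumes "integrable lebesgue f"
 shows "integrable lebesgue (%y. f (x - y))"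
 using integrable_distr[OF measurable_reflect[of x], of f] assms by (simp add: distr_reflect)

lemma integral_shift:
 fixes f :: "'a::euclidean_space => 'b::euclidean_space"
 assumes "f \<in> borel_measurable lebesgue"
 shows "(\<integral>y. f (y - x) \<partial>lebesgue) = (\<integral>y. f y \<partial>lebesgue)"
 using integral_distr[OF measurable_shift[of x] assms] by (simp add: distr_shift)

lemma integrable_shift:
 fixes f :: "'a::euclidean_space => 'b::euclidean_space"
 assumes "integrable lebesgue f"
 shows "integrable lebesgue (%y. f (y - x))"
 using integrable_distr[OF measurable_shift[of x], of f] assms by (simp add: distr_shift)

lemma lebesgue_borel_representative:
 fixes f :: "'a::euclidean_space => 'b::euclidean_space"
 assumes "f \<in> borel_measurable lebesgue"
 obtains g where "g \<in> borel_measurable borel" "AE x in lebesgue. f x = g x"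
proof -
 have "\<exists>g\<in>borel_measurable lborel. AE x in lborel. f x \<bullet> b = g x" for b
  using assms by (intro completion_ex_borel_measurable_real) simp
 then obtain g where g: "!!b. g b \<in> borel_measurable lborel" "!!b. AE x in lborel. f x \<bullet> b = g b x"
  by metis
 show thesis
 proof (rule that)
  show "(%x. \<Sum>b\<in>Basis. g b x *\<^sub>R b) \<in> borel_measurable borel"
   using g(1) by simp
  have "AE x in lborel. \<forall>b\<in>Basis. f x \<bullet> b = g b x"
   using g(2) by (intro AE_finite_allI) auto
  then have "AE x in lborel. f x = (\<Sum>b\<in>Basis. g b x *\<^sub>R b)"
  proof (rule eventually_mono)
   fix x assume "\<forall>b\<in>Basis. f x \<bullet> b = g b x"
   then have "(\<Sum>b\<in>Basis. g b x *\<^sub>R b) = (\<Sum>b\<in>Basis. (f x \<bullet> b) *\<^sub>R b)" by simp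
   then show "f x = (\<Sum>b\<in>Basis. g b x *\<^sub>R b)" by (simp add: euclidean_representation)
  qed
  then show "AE x in lebesgue. f x = (\<Sum>b\<in>Basis. g b x *\<^sub>R b)"
   by (rule AE_completion)
 qed
qed

definition truncate :: "real => 'b::real_normed_vector => 'b" where
 "truncate k v = (1 / max 1 (norm v / k)) *\<^sub>R v"

lemma truncate_props:
 assumes "0 < k"
 shows "norm (truncate k v) <= k" "norm (truncate k v) <= norm v" "norm v <= k ==> truncate k v = v"
  "isCont (truncate k) v"
proof -
 have *: "norm (truncate k v) = norm v / max 1 (norm v / k)"
  unfolding truncate_def by (simp add: max_def)
 show "norm (truncate k v) <= norm v"
  unfolding * using divide_left_mono[of 1 "max 1 (norm v / k)" "norm v"] by simp
 show "norm (truncate k v) <= k"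
  unfolding * using assms by (simp add: divide_le_eq max_def field_simps)
 show "norm v <= k ==> truncate k v = v"
  using assms by (simp add: truncate_def)
 show "isCont (truncate k) v"
  unfolding truncate_def using assms by (intro continuous_intros) (auto simp: max_def)
qed

lemma L1_continuous_approximation:
 fixes f :: "'a::euclidean_space => 'b::euclidean_space"
 assumes f: "integrable lebesgue f" and "0 < e"
 obtains g K where "continuous_on UNIV g" "compact K" "!!x. x \<notin> K ==> g x = 0"
  "(\<integral>x. norm (f x - g x) \<partial>lebesgue) < e"
proof -
 have mf[measurable]: "f \<in> borel_measurable lebesgue" using f by simp
 define cut where "cut k x = max 0 (min 1 (real k + 1 - norm x))" for k and x :: 'a
 have cut: "0 <= cut k x" "cut k x <= 1" "norm x <= real k ==> cut k x = 1" "real k + 1 <= norm x ==> cut k x = 0" for k x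
  by (auto simp: cut_def)
 have ccut: "continuous_on UNIV (cut k)" for k
  unfolding cut_def by (intro continuous_intros)
 have mcut[measurable]: "cut k \<in> borel_measurable lebesgue" for k
  using ccut by (intro measurable_completion) (simp add: borel_measurable_continuous_onI)
 have tr: "norm (truncate (real (Suc k)) v) <= real (Suc k)" "norm (truncate (real (Suc k)) v) <= norm v" for k and v :: 'b
  using truncate_props[of "real (Suc k)" v] by auto
 have c_tr: "continuous_on UNIV (truncate (real (Suc k)) :: 'b => 'b)" for k
  using truncate_props(4)[of "real (Suc k)"] by (intro continuous_at_imp_continuous_on) auto
 have m_tr[measurable]: "(truncate (real (Suc k)) :: 'b => 'b) \<in> borel_measurable borel" for k
  using c_tr borel_measurable_continuous_onI by blast
 define fk where "fk k x = cut k x *\<^sub>R truncate (real (Suc k)) (f x)" for k x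
 have fk_le: "norm (fk k x) <= norm (f x)" for k x
  using mult_mono[OF cut(2)[of k x] tr(2)[of k "f x"]] cut(1) by (simp add: fk_def)
 have mfk[measurable]: "fk k \<in> borel_measurable lebesgue" for k
  unfolding fk_def by measurable
 have "(%k. \<integral>x. norm (f x - fk k x) \<partial>lebesgue) \<longlonglongrightarrow> (\<integral>x. 0 \<partial>(lebesgue :: 'a measure))"
 proof (rule integral_dominated_convergence[where w="%x. 2 * norm (f x)"])
  have "(%k. norm (f x - fk k x)) \<longlonglongrightarrow> 0" for x
  proof -
   obtain N where N: "max (norm x) (norm (f x)) <= real N"
    using real_arch_simple by blast
   have "norm (f x - fk k x) = 0" if "N <= k" for k
   proof -
    have "real N <= real k" using that by simp
    then have "cut k x = 1" "truncate (real (Suc k)) (f x) = f x"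
     using N cut(3)[of x k] truncate_props(3)[of "real (Suc k)" "f x"] by auto
    then show ?thesis by (simp add: fk_def)
   qed
   then show ?thesis
    by (intro tendsto_eventually) (auto simp: eventually_sequentially)
  qed
  then show "AE x in lebesgue. (%k. norm (f x - fk k x)) \<longlonglongrightarrow> 0" by simp
  show "AE x in lebesgue. norm (norm (f x - fk k x)) <= 2 * norm (f x)" for k
  proof (rule AE_I2)
   fix x show "norm (norm (f x - fk k x)) <= 2 * norm (f x)"
    using norm_triangle_ineq4[of "f x" "fk k x"] fk_le[of k x] by simp
  qed
 qed (use f in auto)
 then have "\<forall>\<^sub>F k in sequentially. (\<integral>x. norm (f x - fk k x) \<partial>lebesgue) < e / 2"
  using assms(2) by (intro order_tendstoD(2)) auto
 then have "\<exists>k. (\<integral>x. norm (f x - fk k x) \<partial>lebesgue) < e / 2"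
  by (rule eventually_happens'[OF sequentially_bot])
 then obtain k where k: "(\<integral>x. norm (f x - fk k x) \<partial>lebesgue) < e / 2" ..
 have "f measurable_on UNIV"
  using mf by (simp add: measurable_on_iff_borel_measurable lebesgue_on_UNIV_eq)
 then obtain N g where N: "negligible N" and g: "!!n. continuous_on UNIV (g n)"
  "!!x. x \<notin> N ==> (%n. g n x) \<longlonglongrightarrow> f x"
  unfolding measurable_on_def by auto
 define gk where "gk n x = cut k x *\<^sub>R truncate (real (Suc k)) (g n x)" for n x
 have cgk: "continuous_on UNIV (gk n)" for n
  unfolding gk_def by (intro continuous_intros ccut continuous_on_compose2[OF c_tr] g(1)) auto
 have gk0: "gk n x = 0" if "x \<notin> cball 0 (real k + 1)" for n x
  using that cut(4)[of k x] by (simp add: gk_def)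
 have mgk[measurable]: "gk n \<in> borel_measurable lebesgue" for n
  using cgk by (intro measurable_completion) (simp add: borel_measurable_continuous_onI)
 have B: "norm (cut k x *\<^sub>R truncate (real (Suc k)) v) <= real (Suc k) * indicator (cball 0 (real k + 1)) x" for x and v :: 'b
 proof (cases "x \<in> cball 0 (real k + 1)")
  case True
  then show ?thesis
   using mult_mono[OF cut(2)[of k x] tr(1)[of k v]] cut(1) by simp
 next
  case False
  then show ?thesis using cut(4)[of k x] by simp
 qed
 have icb: "integrable lebesgue (%x. real (Suc k) * indicator (cball (0::'a) (real k + 1)) x)"
  using lmeasurable_cball[of "0::'a" "real k + 1"] by (auto simp: fmeasurable_def)
 have "(%n. \<integral>x. norm (fk k x - gk n x) \<partial>lebesgue) \<longlonglongrightarrow> (\<integral>x. 0 \<partial>(lebesgue :: 'a measure))"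
 proof (rule integral_dominated_convergence[where w="%x. 2 * (real (Suc k) * indicator (cball (0::'a) (real k + 1)) x)"])
  have "AE x in lebesgue. x \<notin> N"
   using N by (simp add: AE_not_in negligible_iff_null_sets)
  then show "AE x in lebesgue. (%n. norm (fk k x - gk n x)) \<longlonglongrightarrow> 0"
  proof (rule eventually_mono)
   fix x assume "x \<notin> N"
   then have "(%n. truncate (real (Suc k)) (g n x)) \<longlonglongrightarrow> truncate (real (Suc k)) (f x)"
    by (intro isCont_tendsto_compose[OF truncate_props(4)] g(2)) auto
   then have "(%n. norm (fk k x - gk n x)) \<longlonglongrightarrow> norm (fk k x - fk k x)"
    unfolding fk_def gk_def by (intro tendsto_intros)
   then show "(%n. norm (fk k x - gk n x)) \<longlonglongrightarrow> 0" by simp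
  qed
  show "AE x in lebesgue. norm (norm (fk k x - gk n x)) <= 2 * (real (Suc k) * indicator (cball (0::'a) (real k + 1)) x)" for n
  proof (rule AE_I2)
   fix x :: 'a
   have "norm (fk k x - gk n x) <= norm (fk k x) + norm (gk n x)" by (rule norm_triangle_ineq4)
   then show "norm (norm (fk k x - gk n x)) <= 2 * (real (Suc k) * indicator (cball (0::'a) (real k + 1)) x)"
    using B[of x "f x"] B[of x "g n x"] unfolding fk_def gk_def by simp
  qed
 qed (use icb in auto)
 then have "\<forall>\<^sub>F n in sequentially. (\<integral>x. norm (fk k x - gk n x) \<partial>lebesgue) < e / 2"
  using assms(2) by (intro order_tendstoD(2)) auto
 then have "\<exists>n. (\<integral>x. norm (fk k x - gk n x) \<partial>lebesgue) < e / 2"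
  by (rule eventually_happens'[OF sequentially_bot])
 then obtain n where n: "(\<integral>x. norm (fk k x - gk n x) \<partial>lebesgue) < e / 2" ..
 have ifk: "integrable lebesgue (fk k)"
  using fk_le by (intro Bochner_Integration.integrable_bound[OF f]) auto
 have igk: "integrable lebesgue (gk n)"
  using integrable_continuous_compact_support(1)[OF cgk compact_cball gk0] .
 have "(\<integral>x. norm (f x - gk n x) \<partial>lebesgue) <= (\<integral>x. norm (f x - fk k x) + norm (fk k x - gk n x) \<partial>lebesgue)"
 proof (rule integral_mono)
  show "norm (f x - gk n x) <= norm (f x - fk k x) + norm (fk k x - gk n x)" for x
   using norm_triangle_ineq[of "f x - fk k x" "fk k x - gk n x"] by simp
 qed (use f ifk igk in auto)
 also have "\<dots> < e"
  using f ifk igk k n by simp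
 finally show thesis
  using that[OF cgk compact_cball gk0] by blast
qed

text \<open>
  Translations are continuous in \<open>L\<^sup>1\<close>, because they are so on the dense subspace of continuous
  functions with compact support.
\<close>

lemma L1_translation_tendsto:
 fixes f :: "'a::euclidean_space => 'b::euclidean_space"
 assumes f: "integrable lebesgue f"
 shows "((%h. \<integral>x. norm (f (x - h) - f x) \<partial>lebesgue) \<longlongrightarrow> 0) (at 0)"
 unfolding tendsto_at_iff_sequentially comp_def
proof (intro allI impI)
 fix X :: "nat => 'a" assume X: "X \<longlonglongrightarrow> 0"
 show "(%n. \<integral>x. norm (f (x - X n) - f x) \<partial>lebesgue) \<longlonglongrightarrow> 0"
 proof (rule LIMSEQ_I)
  fix e :: real assume "0 < e"
  then obtain g K where g: "continuous_on UNIV g" "compact K" "!!x. x \<notin> K ==> g x = 0"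
   "(\<integral>x. norm (f x - g x) \<partial>lebesgue) < e / 3"
   using L1_continuous_approximation[OF f, of "e / 3"] by auto
  have ig: "integrable lebesgue g"
   using integrable_continuous_compact_support(1)[OF g(1-3)] .
  obtain R where R: "!!x. x \<in> K ==> norm x <= R"
   using compact_imp_bounded[OF g(2)] bounded_iff by blast
  obtain B where "!!x. x \<in> K ==> norm (g x) <= B"
   using compact_imp_bounded[OF compact_continuous_image[OF continuous_on_subset[OF g(1) subset_UNIV] g(2)]]
   unfolding bounded_iff by blast
  then have B: "norm (g x) <= \<bar>B\<bar>" for x
   using g(3)[of x] by (cases "x \<in> K") force+
  obtain C where C: "!!n. norm (X n) <= C"
   using convergent_imp_Bseq[OF convergentI[OF X]] unfolding Bseq_def by blast
  let ?I = "indicator (cball (0::'a) (R + C)) :: 'a => real"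
  have g0: "g (x - X n) = 0" "g x = 0" if "x \<notin> cball 0 (R + C)" for x n
  proof -
   have "norm x <= norm (x - X n) + norm (X n)"
    using norm_triangle_sub[of x "X n"] by simp
   with that R[of "x - X n"] C[of n] show "g (x - X n) = 0" by (intro g(3)) auto
   have "0 <= C" using C[of 0] norm_ge_zero order_trans by blast
   with that R[of x] show "g x = 0" by (intro g(3)) auto
  qed
  have "(%n. \<integral>x. norm (g (x - X n) - g x) \<partial>lebesgue) \<longlonglongrightarrow> (\<integral>x. 0 \<partial>(lebesgue :: 'a measure))"
  proof (rule integral_dominated_convergence[where w="%x. (2 * \<bar>B\<bar>) * ?I x"])
   have "(%n. norm (g (x - X n) - g x)) \<longlonglongrightarrow> norm (g (x - 0) - g x)" for x
    using g(1) by (intro tendsto_intros X isCont_tendsto_compose[of _ g]) (auto simp: continuous_on_eq_continuous_at)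
   then show "AE x in lebesgue. (%n. norm (g (x - X n) - g x)) \<longlonglongrightarrow> 0" by simp
   show "AE x in lebesgue. norm (norm (g (x - X n) - g x)) <= 2 * \<bar>B\<bar> * ?I x" for n
   proof (rule AE_I2)
    fix x show "norm (norm (g (x - X n) - g x)) <= 2 * \<bar>B\<bar> * ?I x"
     using g0(1)[of x n] g0(2)[of x] B[of x] B[of "x - X n"] norm_triangle_ineq4[of "g (x - X n)" "g x"]
     by (cases "x \<in> cball 0 (R + C)") auto
   qed
   show "integrable lebesgue (%x. (2 * \<bar>B\<bar>) * ?I x)"
    using lmeasurable_cball[of "0::'a" "R + C"] by (auto simp: fmeasurable_def)
   show "(%x. norm (g (x - X n) - g x)) \<in> borel_measurable lebesgue" for n
    using ig integrable_shift[OF ig, of "X n"] by auto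
  qed simp
  then have "\<forall>\<^sub>F n in sequentially. (\<integral>x. norm (g (x - X n) - g x) \<partial>lebesgue) < e / 3"
   using \<open>0 < e\<close> by (intro order_tendstoD(2)) auto
  then obtain N where N: "!!n. n \<ge> N ==> (\<integral>x. norm (g (x - X n) - g x) \<partial>lebesgue) < e / 3"
   unfolding eventually_sequentially by blast
  show "\<exists>N. \<forall>n\<ge>N. norm ((\<integral>x. norm (f (x - X n) - f x) \<partial>lebesgue) - 0) < e"
  proof (intro exI allI impI)
   fix n assume n: "n \<ge> N"
   have sh: "integrable lebesgue (%x. f (x - X n))" "integrable lebesgue (%x. g (x - X n))"
    using f ig by (auto intro: integrable_shift)
   have "(\<integral>x. norm (f (x - X n) - f x) \<partial>lebesgue) \<le>
    (\<integral>x. norm (f (x - X n) - g (x - X n)) + norm (g (x - X n) - g x) + norm (f x - g x) \<partial>lebesgue)"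
   proof (rule integral_mono)
    fix x
    show "norm (f (x - X n) - f x) <= norm (f (x - X n) - g (x - X n)) + norm (g (x - X n) - g x) + norm (f x - g x)"
     using norm_triangle_ineq[of "f (x - X n) - g (x - X n)" "g (x - X n) - g x"]
      norm_triangle_ineq4[of "(f (x - X n) - g (x - X n)) + (g (x - X n) - g x)" "f x - g x"] by simp
   qed (use f ig sh in auto)
   also have "\<dots> = (\<integral>x. norm (f (x - X n) - g (x - X n)) \<partial>lebesgue) + (\<integral>x. norm (g (x - X n) - g x) \<partial>lebesgue) + (\<integral>x. norm (f x - g x) \<partial>lebesgue)"
    using f ig sh by simp
   also have "(\<integral>x. norm (f (x - X n) - g (x - X n)) \<partial>lebesgue) = (\<integral>x. norm (f x - g x) \<partial>lebesgue)"
    using integral_shift[of "%x. norm (f x - g x)" "X n"] f ig by simp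
   finally have "(\<integral>x. norm (f (x - X n) - f x) \<partial>lebesgue) < e"
    using g(4) N[OF n] by linarith
   then show "norm ((\<integral>x. norm (f (x - X n) - f x) \<partial>lebesgue) - 0) < e" by simp
  qed
 qed
qed

definition mollify :: "real => ('a::euclidean_space => 'b::euclidean_space) => 'a => 'b" where
 "mollify r f x = (\<integral>y. mollifier r (x - y) *\<^sub>R f y \<partial>lebesgue)"

lemma mollify_integrand_integrable:
 fixes f :: "'a::euclidean_space => 'b::euclidean_space"
 assumes "integrable lebesgue f" "0 < r"
 shows "integrable lebesgue (%y. mollifier r (x - y) *\<^sub>R f y)"
proof -
 obtain B where B: "!!z::'a. \<bar>mollifier r z\<bar> <= B" "0 < B"
  by (rule test_functionsE[OF mollifier_test_function[OF assms(2), where 'a='a]]) blast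
 show ?thesis
 proof (rule Bochner_Integration.integrable_bound[of _ "%y. B *\<^sub>R f y"])
  show "AE y in lebesgue. norm (mollifier r (x - y) *\<^sub>R f y) <= norm (B *\<^sub>R f y)"
  proof (rule AE_I2)
   fix y
   have "\<bar>mollifier r (x - y)\<bar> * norm (f y) <= B * norm (f y)"
    using B(1) by (rule mult_right_mono) simp
   then show "norm (mollifier r (x - y) *\<^sub>R f y) <= norm (B *\<^sub>R f y)" using B(2) by simp
  qed
  show "(%y. mollifier r (x - y) *\<^sub>R f y) \<in> borel_measurable lebesgue"
   using continuous_reflect_measurable[OF mollifier_continuous[OF assms(2)], of x] assms(1) by simp
 qed (use assms in simp)
qed

lemma mollify_cong_AE:
 assumes "f \<in> borel_measurable lebesgue" "g \<in> borel_measurable lebesgue" "AE x in lebesgue. f x = g x" "0 < r"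
 shows "mollify r f x = mollify r g x"
 unfolding mollify_def
proof (rule integral_cong_AE)
 have m: "(%y. mollifier r (x - y)) \<in> borel_measurable lebesgue"
  by (rule continuous_reflect_measurable[OF mollifier_continuous[OF assms(4)]])
 show "(%y. mollifier r (x - y) *\<^sub>R f y) \<in> borel_measurable lebesgue"
  "(%y. mollifier r (x - y) *\<^sub>R g y) \<in> borel_measurable lebesgue"
  by (rule borel_measurable_scaleR[OF m assms(1)]) (rule borel_measurable_scaleR[OF m assms(2)])
 show "AE y in lebesgue. mollifier r (x - y) *\<^sub>R f y = mollifier r (x - y) *\<^sub>R g y"
  using assms(3) by (rule eventually_mono) simp
qed

text \<open>
 Since the mollifier has integral one, the error is an average of the translation errors.
\<close>

lemma nn_integral_mollify_error:
 fixes f :: "'a::euclidean_space => 'b::euclidean_space"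
 assumes f: "integrable lebesgue f" and r: "0 < r"
  and \<omega>: "!!h. norm h < r ==> (\<integral>x. norm (f (x - h) - f x) \<partial>lebesgue) <= s"
 shows "mollify r f \<in> borel_measurable borel"
  "(\<integral>\<^sup>+x. norm (mollify r f x - f x) \<partial>lebesgue) <= ennreal s"
proof -
 obtain g where g[measurable]: "g \<in> borel_measurable borel" and fg: "AE x in lebesgue. f x = g x"
  by (rule lebesgue_borel_representative[OF borel_measurable_integrable[OF f]])
 have mg: "g \<in> borel_measurable lebesgue" using g by (intro measurable_completion) simp
 have mf: "f \<in> borel_measurable lebesgue" using f by simp
 have ig: "integrable lebesgue g"
  using integrable_cong_AE[OF mf mg fg] f by simp
 have \<rho>c: "continuous_on UNIV (mollifier r :: 'a => real)" using mollifier_continuous[OF r] .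
 then have \<rho>[measurable]: "(mollifier r :: 'a => real) \<in> borel_measurable borel"
  by (rule borel_measurable_continuous_onI)
 have fg': "mollify r f x = mollify r g x" for x
  by (rule mollify_cong_AE[OF mf mg fg r])
 have mollify_lborel: "mollify r g x = (\<integral>y. mollifier r (x - y) *\<^sub>R g y \<partial>lborel)" for x
  unfolding mollify_def by (intro integral_completion) measurable
 show m: "mollify r f \<in> borel_measurable borel"
 proof -
  have "mollify r f = (%x. \<integral>y. mollifier r (x - y) *\<^sub>R g y \<partial>lborel)"
   using fg' mollify_lborel by (intro ext) (rule trans)
  then show ?thesis by simp
 qed
 have err: "norm (mollify r g x - g x) <= (\<integral>\<^sup>+z. ennreal (mollifier r z * norm (g (x - z) - g x)) \<partial>lborel)" for x
 proof -
  have i1: "integrable lebesgue (%z. mollifier r z *\<^sub>R g (x - z))"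
   using integrable_reflect[OF mollify_integrand_integrable[OF ig r, of x], of x] by simp
  have i2: "integrable lebesgue (%z::'a. mollifier r z *\<^sub>R g x)"
   using mollifier_integrable[OF r] by (rule integrable_scaleR_left)
  have "mollify r g x = (\<integral>z. mollifier r z *\<^sub>R g (x - z) \<partial>lebesgue)"
   unfolding mollify_def
   using integral_reflect[of "%y. mollifier r (x - y) *\<^sub>R g y" x] mollify_integrand_integrable[OF ig r, of x] by simp
  moreover have "g x = (\<integral>z. mollifier r (z::'a) *\<^sub>R g x \<partial>lebesgue)"
  proof -
   have "(\<integral>z. mollifier r (z::'a) *\<^sub>R g x \<partial>lebesgue) = (\<integral>z. mollifier r (z::'a) \<partial>lebesgue) *\<^sub>R g x"
    by (rule integral_scaleR_left) (rule mollifier_integrable[OF r])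
   then show ?thesis using mollifier_integral[OF r, where 'a='a] by simp
  qed
  moreover have "(\<integral>z. mollifier r z *\<^sub>R (g (x - z) - g x) \<partial>lebesgue)
    = (\<integral>z. mollifier r z *\<^sub>R g (x - z) \<partial>lebesgue) - (\<integral>z. mollifier r (z::'a) *\<^sub>R g x \<partial>lebesgue)"
   unfolding scaleR_diff_right by (rule Bochner_Integration.integral_diff[OF i1 i2])
  ultimately have "mollify r g x - g x = (\<integral>z. mollifier r z *\<^sub>R (g (x - z) - g x) \<partial>lebesgue)"
   by (metis (no_types))
  moreover have "integrable lebesgue (%z. mollifier r z *\<^sub>R (g (x - z) - g x))"
   using i1 i2 by (simp add: scaleR_diff_right)
  ultimately have "ennreal (norm (mollify r g x - g x)) <= (\<integral>\<^sup>+z. norm (mollifier r z *\<^sub>R (g (x - z) - g x)) \<partial>lebesgue)"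
   using integral_norm_bound_ennreal by metis
  also have "\<dots> = (\<integral>\<^sup>+z. ennreal (mollifier r z * norm (g (x - z) - g x)) \<partial>lborel)"
   unfolding nn_integral_completion by (intro nn_integral_cong) (simp add: mollifier_nonneg[OF r])
  finally show ?thesis .
 qed
 have "(\<integral>\<^sup>+x. norm (mollify r f x - f x) \<partial>lebesgue) = (\<integral>\<^sup>+x. norm (mollify r g x - g x) \<partial>lebesgue)"
  using fg unfolding fg' by (intro nn_integral_cong_AE) auto
 also have "\<dots> = (\<integral>\<^sup>+x. norm (mollify r g x - g x) \<partial>lborel)"
  by (rule nn_integral_completion)
 also have "\<dots> <= (\<integral>\<^sup>+x. (\<integral>\<^sup>+z. ennreal (mollifier r z * norm (g (x - z) - g x)) \<partial>lborel) \<partial>lborel)"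
  by (intro nn_integral_mono err)
 also have "\<dots> = (\<integral>\<^sup>+z. (\<integral>\<^sup>+x. ennreal (mollifier r z * norm (g (x - z) - g x)) \<partial>lborel) \<partial>lborel)"
  by (intro lborel_pair.Fubini'[symmetric]) measurable
 also have "\<dots> <= (\<integral>\<^sup>+z. ennreal (mollifier r (z::'a)) * ennreal s \<partial>lborel)"
 proof (intro nn_integral_mono)
  fix z :: 'a
  show "(\<integral>\<^sup>+x. ennreal (mollifier r z * norm (g (x - z) - g x)) \<partial>lborel) <= ennreal (mollifier r z) * ennreal s"
  proof (cases "norm z < r")
   case True
   have sh: "integrable lebesgue (%x. norm (g (x - z) - g x))"
    using ig integrable_shift[OF ig] by auto
   have "(\<integral>\<^sup>+x. ennreal (mollifier r z * norm (g (x - z) - g x)) \<partial>lborel)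
    = ennreal (mollifier r z) * (\<integral>\<^sup>+x. ennreal (norm (g (x - z) - g x)) \<partial>lborel)"
    using mollifier_nonneg[OF r, of z] by (simp add: ennreal_mult nn_integral_cmult)
   also have "(\<integral>\<^sup>+x. ennreal (norm (g (x - z) - g x)) \<partial>lborel) = (\<integral>\<^sup>+x. ennreal (norm (g (x - z) - g x)) \<partial>lebesgue)"
    by (rule nn_integral_completion[symmetric])
   also have "\<dots> = ennreal (\<integral>x. norm (g (x - z) - g x) \<partial>lebesgue)"
    using sh by (intro nn_integral_eq_integral) auto
   also have "(\<integral>x. norm (g (x - z) - g x) \<partial>lebesgue) = (\<integral>x. norm (f (x - z) - f x) \<partial>lebesgue)"
    using fg AE_shift[OF fg, of z] sh integrable_shift[OF f, of z] f by (intro integral_cong_AE) auto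
   also have "ennreal (mollifier r z) * ennreal \<dots> <= ennreal (mollifier r z) * ennreal s"
    using \<omega>[OF True] by (intro mult_left_mono ennreal_leI) auto
   finally show ?thesis .
  qed (use mollifier_outside[OF r, of z] in auto)
 qed
 also have "\<dots> = (\<integral>\<^sup>+z. ennreal (mollifier r (z::'a)) \<partial>lebesgue) * ennreal s"
  unfolding nn_integral_completion by (simp add: nn_integral_multc)
 also have "(\<integral>\<^sup>+z. ennreal (mollifier r (z::'a)) \<partial>lebesgue) = 1"
  using nn_integral_eq_integral[OF mollifier_integrable[OF r, where 'a='a]] mollifier_integral[OF r, where 'a='a]
  by (simp add: mollifier_nonneg[OF r])
 finally show "(\<integral>\<^sup>+x. norm (mollify r f x - f x) \<partial>lebesgue) <= ennreal s" by simp
qed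

lemma mollify_integrable:
 fixes f :: "'a::euclidean_space => 'b::euclidean_space"
 assumes f: "integrable lebesgue f" and r: "0 < r"
 shows "integrable lebesgue (mollify r f)"
proof -
 have "(\<integral>x. norm (f (x - h) - f x) \<partial>lebesgue) <= 2 * (\<integral>x. norm (f x) \<partial>lebesgue)" for h
 proof -
  have "(\<integral>x. norm (f (x - h) - f x) \<partial>lebesgue) <= (\<integral>x. norm (f (x - h)) + norm (f x) \<partial>lebesgue)"
   using f integrable_shift[OF f, of h] by (intro integral_mono) (auto intro: norm_triangle_ineq4)
  then show ?thesis
   using f integrable_shift[OF f, of h] integral_shift[of "%x. norm (f x)" h] by simp
 qed
 from nn_integral_mollify_error[OF f r this]
 have m: "mollify r f \<in> borel_measurable borel" and
  b: "(\<integral>\<^sup>+x. norm (mollify r f x - f x) \<partial>lebesgue) <= ennreal (2 * (\<integral>x. norm (f x) \<partial>lebesgue))" .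
 have m': "mollify r f \<in> borel_measurable lebesgue" using m by (intro measurable_completion) simp
 have "integrable lebesgue (%x. mollify r f x - f x)"
  using m' f b by (intro integrableI_bounded) (auto intro: le_less_trans)
 from Bochner_Integration.integrable_add[OF this f] show ?thesis
  by (simp only: diff_add_cancel)
qed

theorem mollify_tendsto_L1:
 fixes f :: "'a::euclidean_space => 'b::euclidean_space"
 assumes f: "integrable lebesgue f"
 shows "((%r. \<integral>x. norm (mollify r f x - f x) \<partial>lebesgue) \<longlongrightarrow> 0) (at_right 0)"
proof (rule tendstoI)
 fix e :: real assume e: "0 < e"
 have "\<forall>\<^sub>F h in at 0. dist (\<integral>x. norm (f (x - h) - f x) \<partial>lebesgue) 0 < e / 2"
  using L1_translation_tendsto[OF f] e by (intro tendstoD) auto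
 then obtain d where d: "0 < d" "!!h. h \<noteq> 0 ==> norm h < d ==> (\<integral>x. norm (f (x - h) - f x) \<partial>lebesgue) < e / 2"
  unfolding eventually_at by (auto simp: dist_norm)
 have "dist (\<integral>x. norm (mollify r f x - f x) \<partial>lebesgue) 0 < e" if r: "0 < r" "r < d" for r
 proof -
  have "(\<integral>x. norm (f (x - h) - f x) \<partial>lebesgue) <= e / 2" if "norm h < r" for h
   using d(2)[of h] that r e by (cases "h = 0") auto
  from nn_integral_mollify_error(2)[OF f r(1) this]
  have "(\<integral>\<^sup>+x. norm (mollify r f x - f x) \<partial>lebesgue) <= ennreal (e / 2)" .
  moreover have "(\<integral>\<^sup>+x. norm (mollify r f x - f x) \<partial>lebesgue) = ennreal (\<integral>x. norm (mollify r f x - f x) \<partial>lebesgue)"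
   using mollify_integrable[OF f r(1)] f by (intro nn_integral_eq_integral) auto
  ultimately have "(\<integral>x. norm (mollify r f x - f x) \<partial>lebesgue) <= e / 2"
   using e by (simp add: ennreal_le_iff)
  then show ?thesis using e by simp
 qed
 then show "\<forall>\<^sub>F r in at_right 0. dist (\<integral>x. norm (mollify r f x - f x) \<partial>lebesgue) 0 < e"
  unfolding eventually_at_right_field using d(1) by auto
qed

lemma integral_gradient_test_function:
 fixes \<eta> :: "'a::euclidean_space => real"
 assumes \<eta>: "\<eta> \<in> test_functions S" and g: "!!x. GDERIV \<eta> x :> g x"
 shows "(\<integral>x. g x \<partial>lebesgue) = 0"
proof -
 obtain g' K where g': "!!x. GDERIV \<eta> x :> g' x" "continuous_on UNIV \<eta>" "continuous_on UNIV g'" "compact K"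
  "!!x. x \<notin> K ==> \<eta> x = 0" "!!x. x \<notin> K ==> g' x = 0"
  by (rule test_functionsE[OF \<eta>]) blast
 have "g' = g" using g g'(1) gderiv_unique by blast
 note g' = g'[unfolded this]
 obtain R where R: "0 < R" "!!x. x \<in> K ==> norm x <= R"
  using compact_imp_bounded[OF g'(4)] unfolding bounded_pos by blast
 define u :: "'a => real" where "u = indicator (cball 0 (R + 1))"
 have u: "integrable lebesgue u"
  unfolding u_def using lmeasurable_cball[of "0::'a" "R + 1"] by (auto simp: fmeasurable_def)
 have eq: "\<eta> (x - y) * u y = \<eta> (x - y)" if "x \<in> ball 0 1" for x y
 proof (cases "x - y \<in> K")
  case True
  have "norm y <= norm x + norm (x - y)" using norm_triangle_ineq4[of x "x - y"] by simp
  then have "norm y <= R + 1" using R(2)[OF True] that by auto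
  then show ?thesis by (simp add: u_def)
 qed (simp add: g')
 have eq2: "u y *\<^sub>R g (0 - y) = g (0 - y)" for y
 proof (cases "0 - y \<in> K")
  case True
  then have "norm y <= R + 1" using R(2)[of "0 - y"] by simp
  then show ?thesis by (simp add: u_def)
 qed (simp add: g')
 have mg: "g \<in> borel_measurable lebesgue" "\<eta> \<in> borel_measurable lebesgue"
  using g'(2,3) by (auto intro!: measurable_completion simp: borel_measurable_continuous_onI)
 have "\<eta> \<in> test_functions UNIV" using \<eta> test_functions_mono by blast
 from GDERIV_convolution[OF this g u, of 0]
 have "GDERIV (%x. \<integral>y. \<eta> (x - y) * u y \<partial>lebesgue) 0 :> (\<integral>y. g (0 - y) \<partial>lebesgue)"
  unfolding eq2 .
 also have "(\<integral>y. g (0 - y) \<partial>lebesgue) = (\<integral>y. g y \<partial>lebesgue)"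
  using mg by (intro integral_reflect)
 finally have "GDERIV (%x. \<integral>y. \<eta> (x - y) * u y \<partial>lebesgue) 0 :> (\<integral>y. g y \<partial>lebesgue)" .
 moreover have "GDERIV (%x. \<integral>y. \<eta> (x - y) * u y \<partial>lebesgue) 0 :> 0"
 proof -
  have "(\<integral>y. \<eta> y \<partial>lebesgue) = (\<integral>y. \<eta> (x - y) * u y \<partial>lebesgue)" if "x \<in> ball 0 1" for x
   using integral_reflect[OF mg(2), of x] by (simp only: eq[OF that])
  then have "((%x. \<integral>y. \<eta> (x - y) * u y \<partial>lebesgue) has_derivative (%h. 0)) (at 0)"
   by (intro has_derivative_transform_within_open[OF has_derivative_const, where s="ball 0 1"]) auto
  then show ?thesis unfolding gderiv_def by simp
 qed
 ultimately show ?thesis by (rule gderiv_unique)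
qed

section \<open>Weak gradients\<close>

lemma open_sets_lebesgue [simp]: "open S ==> S \<in> sets lebesgue"
 by auto

lemma integral_lebesgue_on_support:
 fixes F :: "'a::euclidean_space => 'b::euclidean_space"
 assumes "S \<in> sets lebesgue" "!!x. x \<notin> S ==> F x = 0"
 shows "(\<integral>x. F x \<partial>lebesgue_on S) = (\<integral>x. F x \<partial>lebesgue)"
  "integrable (lebesgue_on S) F \<longleftrightarrow> integrable lebesgue F"
proof -
 have eq: "(%x. indicator S x *\<^sub>R F x) = F"
  using assms(2) by (auto simp: fun_eq_iff indicator_def)
 show "(\<integral>x. F x \<partial>lebesgue_on S) = (\<integral>x. F x \<partial>lebesgue)"
  using integral_restrict_space[of S lebesgue F] assms(1) by (simp add: eq)
 show "integrable (lebesgue_on S) F \<longleftrightarrow> integrable lebesgue F"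
  using integrable_restrict_space[of S lebesgue F] assms(1) by (simp add: eq)
qed

lemma integral_lebesgue_on_indicator:
 fixes F :: "'a::euclidean_space => 'b::euclidean_space"
 assumes "S \<in> sets lebesgue"
 shows "(\<integral>x. F x \<partial>lebesgue_on S) = (\<integral>x. indicator S x *\<^sub>R F x \<partial>lebesgue)"
  "integrable (lebesgue_on S) F \<longleftrightarrow> integrable lebesgue (%x. indicator S x *\<^sub>R F x)"
 using integral_restrict_space[of S lebesgue F] integrable_restrict_space[of S lebesgue F] assms by simp_all

lemma AE_lebesgue_on_iff:
 assumes "S \<in> sets lebesgue"
 shows "(AE x in lebesgue_on S. P x) \<longleftrightarrow> (AE x in lebesgue. x \<in> S --> P x)"
 using assms by (intro AE_restrict_space_iff) simp

lemma integrable_imp_locally_integrable: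
 assumes "S \<in> sets lebesgue" "integrable (lebesgue_on S) f"
 shows "locally_integrable S f"
 unfolding locally_integrable_def set_integrable_def
proof (intro allI impI)
 fix K assume K: "compact K \<and> K \<subseteq> S"
 have "K \<in> sets lebesgue"
  using K lmeasurable_compact by (auto intro: fmeasurableD)
 moreover have "integrable lebesgue (%x. indicator S x *\<^sub>R f x)"
  using assms integral_lebesgue_on_indicator(2)[OF assms(1), of f] by simp
 ultimately have "integrable lebesgue (%x. indicator K x *\<^sub>R (indicator S x *\<^sub>R f x))"
  by (rule integrable_mult_indicator)
 moreover have "(%x. indicator K x *\<^sub>R (indicator S x *\<^sub>R f x)) = (%x. indicator K x *\<^sub>R f x)"
  using K by (auto simp: fun_eq_iff indicator_def)
 ultimately show "integrable lebesgue (%x. indicator K x *\<^sub>R f x)" by simp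
qed

lemma locally_integrable_mono:
 assumes "locally_integrable S f" "T \<subseteq> S"
 shows "locally_integrable T f"
 unfolding locally_integrable_def
proof (intro allI impI)
 fix K assume "compact K \<and> K \<subseteq> T"
 then have "compact K \<and> K \<subseteq> S" using assms(2) by auto
 then show "set_integrable lebesgue K f"
  using assms(1) unfolding locally_integrable_def by simp
qed

lemma locally_integrable_D:
 "locally_integrable S f ==> compact K ==> K \<subseteq> S ==> integrable lebesgue (%x. indicator K x *\<^sub>R f x)"
 unfolding locally_integrable_def set_integrable_def by simp

lemma locally_integrable_combine:
 assumes "locally_integrable S f" "locally_integrable S g"
 shows "locally_integrable S (%x. a *\<^sub>R f x + b *\<^sub>R g x)"
 unfolding locally_integrable_def set_integrable_def
proof (intro allI impI)
 fix K assume K: "compact K \<and> K \<subseteq> S"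
 have "integrable lebesgue (%x. a *\<^sub>R (indicator K x *\<^sub>R f x) + b *\<^sub>R (indicator K x *\<^sub>R g x))"
  using assms K by (intro Bochner_Integration.integrable_add integrable_scaleR_right locally_integrable_D) auto
 then show "integrable lebesgue (%x. indicator K x *\<^sub>R (a *\<^sub>R f x + b *\<^sub>R g x))"
  by (simp add: scaleR_add_right mult.commute)
qed

lemma bounded_mult_integrable:
 fixes f :: "'a => 'b::euclidean_space" and \<phi> :: "'a => real"
 assumes "integrable M f" "\<phi> \<in> borel_measurable M" "AE x in M. \<bar>\<phi> x\<bar> <= B"
 shows "integrable M (%x. \<phi> x *\<^sub>R f x)"
proof (rule Bochner_Integration.integrable_bound[of _ "%x. B *\<^sub>R f x"])
 show "AE x in M. norm (\<phi> x *\<^sub>R f x) <= norm (B *\<^sub>R f x)"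
  using assms(3)
 proof (rule eventually_mono)
  fix x assume "\<bar>\<phi> x\<bar> <= B"
  then have "\<bar>\<phi> x\<bar> * norm (f x) <= \<bar>B\<bar> * norm (f x)"
   by (intro mult_right_mono) auto
  then show "norm (\<phi> x *\<^sub>R f x) <= norm (B *\<^sub>R f x)" by simp
 qed
 have "f \<in> borel_measurable M" using assms(1) by (rule borel_measurable_integrable)
 with assms(2) show "(%x. \<phi> x *\<^sub>R f x) \<in> borel_measurable M" by (rule borel_measurable_scaleR)
 show "integrable M (%x. B *\<^sub>R f x)" using assms(1) by (rule integrable_scaleR_right)
qed

lemma bounded_mult_integrable2:
 fixes f :: "'a => real" and \<phi> :: "'a => 'b::euclidean_space"
 assumes "integrable M f" "\<phi> \<in> borel_measurable M" "AE x in M. norm (\<phi> x) <= B"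
 shows "integrable M (%x. f x *\<^sub>R \<phi> x)"
proof (rule Bochner_Integration.integrable_bound[of _ "%x. B * f x"])
 show "AE x in M. norm (f x *\<^sub>R \<phi> x) <= norm (B * f x)"
  using assms(3)
 proof (rule eventually_mono)
  fix x assume "norm (\<phi> x) <= B"
  then have "\<bar>f x\<bar> * norm (\<phi> x) <= \<bar>f x\<bar> * \<bar>B\<bar>"
   by (intro mult_left_mono) auto
  then show "norm (f x *\<^sub>R \<phi> x) <= norm (B * f x)" by (simp add: abs_mult mult.commute)
 qed
 have "f \<in> borel_measurable M" using assms(1) by (rule borel_measurable_integrable)
 then show "(%x. f x *\<^sub>R \<phi> x) \<in> borel_measurable M" using assms(2) by (rule borel_measurable_scaleR)
 show "integrable M (%x. B * f x)" using assms(1) by (rule integrable_mult_right)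
qed

lemma continuous_borel_lebesgue:
 fixes g :: "'a::euclidean_space => 'b::euclidean_space"
 shows "continuous_on UNIV g ==> g \<in> borel_measurable lebesgue"
 by (intro measurable_completion) (simp add: borel_measurable_continuous_onI)

lemma test_times_locally_integrable:
 fixes f :: "'a::euclidean_space => 'b::euclidean_space"
 assumes f: "locally_integrable S f" and \<eta>: "\<eta> \<in> test_functions S"
 shows "integrable lebesgue (%x. \<eta> x *\<^sub>R f x)"
proof -
 obtain K B where K: "continuous_on UNIV \<eta>" "compact K" "K \<subseteq> S" "!!x. x \<notin> K ==> \<eta> x = 0" "!!x. \<bar>\<eta> x\<bar> <= B"
  by (rule test_functionsE[OF \<eta>]) blast
 have "integrable lebesgue (%x. \<eta> x *\<^sub>R (indicator K x *\<^sub>R f x))"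
  using K by (intro bounded_mult_integrable[where B=B] locally_integrable_D[OF f] continuous_borel_lebesgue) auto
 moreover have "(%x. \<eta> x *\<^sub>R (indicator K x *\<^sub>R f x)) = (%x. \<eta> x *\<^sub>R f x)"
  using K(4) by (auto simp: fun_eq_iff indicator_def)
 ultimately show ?thesis by simp
qed

lemma gradient_times_locally_integrable:
 fixes f :: "'a::euclidean_space => real"
 assumes f: "locally_integrable S f" and \<eta>: "\<eta> \<in> test_functions S" "!!x. GDERIV \<eta> x :> \<eta>' x"
 shows "integrable lebesgue (%x. f x *\<^sub>R \<eta>' x)"
proof -
 obtain h K B where h: "!!x. GDERIV \<eta> x :> h x" and K: "continuous_on UNIV h" "compact K" "K \<subseteq> S"
   "!!x. x \<notin> K ==> h x = 0" "!!x. norm (h x) <= B"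
  by (rule test_functionsE[OF \<eta>(1)]) blast
 have "h = \<eta>'" using h \<eta>(2) gderiv_unique by blast
 note K = K[unfolded this]
 have "integrable lebesgue (%x. (indicator K x *\<^sub>R f x) *\<^sub>R \<eta>' x)"
  using K by (intro bounded_mult_integrable2[where B=B] locally_integrable_D[OF f] continuous_borel_lebesgue) auto
 moreover have "(%x. (indicator K x *\<^sub>R f x) *\<^sub>R \<eta>' x) = (%x. f x *\<^sub>R \<eta>' x)"
  using K(4) by (auto simp: fun_eq_iff indicator_def)
 ultimately show ?thesis by simp
qed

lemma test_functions_zero_outside:
 assumes "\<eta> \<in> test_functions S" "x \<notin> S"
 shows "\<eta> x = 0" "GDERIV \<eta> x :> D ==> D = 0"
proof -
 obtain h K where h: "!!x. GDERIV \<eta> x :> h x" and K: "K \<subseteq> S" "!!x. x \<notin> K ==> \<eta> x = 0" "!!x. x \<notin> K ==> h x = 0"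
  by (rule test_functionsE[OF assms(1)]) blast
 have "x \<notin> K" using assms(2) K(1) by blast
 then show "\<eta> x = 0" by (rule K(2))
 show "D = 0" if "GDERIV \<eta> x :> D"
  using gderiv_unique[OF that h] K(3)[OF \<open>x \<notin> K\<close>] by simp
qed

lemma has_weak_gradient_iff:
 fixes S :: "'a::euclidean_space set"
 assumes S: "open S"
 shows "has_weak_gradient S f g \<longleftrightarrow> locally_integrable S f \<and> locally_integrable S g \<and>
  (\<forall>\<eta>\<in>test_functions S. \<forall>\<eta>'. (\<forall>x. GDERIV \<eta> x :> \<eta>' x) -->
    (\<integral>x. f x *\<^sub>R \<eta>' x \<partial>lebesgue) = - (\<integral>x. \<eta> x *\<^sub>R g x \<partial>lebesgue))"
proof -
 have 1: "(\<integral>x. f x *\<^sub>R \<eta>' x \<partial>lebesgue_on S) = (\<integral>x. f x *\<^sub>R \<eta>' x \<partial>lebesgue)"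
  if "\<eta> \<in> test_functions S" "\<forall>x. GDERIV \<eta> x :> \<eta>' x" for \<eta> \<eta>'
  using test_functions_zero_outside(2)[OF that(1)] that(2) S by (intro integral_lebesgue_on_support) auto
 have 2: "(\<integral>x. \<eta> x *\<^sub>R g x \<partial>lebesgue_on S) = (\<integral>x. \<eta> x *\<^sub>R g x \<partial>lebesgue)"
  if "\<eta> \<in> test_functions S" for \<eta>
  using test_functions_zero_outside(1)[OF that(1)] S by (intro integral_lebesgue_on_support) auto
 show ?thesis
  unfolding has_weak_gradient_def using 1 2 by (simp cong: conj_cong ball_cong)
qed

lemma has_weak_gradientD:
 assumes "open S" "has_weak_gradient S f g" "\<eta> \<in> test_functions S" "!!x. GDERIV \<eta> x :> \<eta>' x"
 shows "(\<integral>x. f x *\<^sub>R \<eta>' x \<partial>lebesgue) = - (\<integral>x. \<eta> x *\<^sub>R g x \<partial>lebesgue)"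
proof -
 have "\<forall>\<eta>\<in>test_functions S. \<forall>\<eta>'. (\<forall>x. GDERIV \<eta> x :> \<eta>' x) -->
    (\<integral>x. f x *\<^sub>R \<eta>' x \<partial>lebesgue) = - (\<integral>x. \<eta> x *\<^sub>R g x \<partial>lebesgue)"
  using assms(2) unfolding has_weak_gradient_iff[OF assms(1)] by (elim conjE)
 from this[rule_format, OF assms(3,4)] show ?thesis .
qed

lemma has_weak_gradientI:
 assumes "open S" "locally_integrable S f" "locally_integrable S g"
  "!!\<eta> \<eta>'. \<eta> \<in> test_functions S ==> (!!x. GDERIV \<eta> x :> \<eta>' x) ==>
   (\<integral>x. f x *\<^sub>R \<eta>' x \<partial>lebesgue) = - (\<integral>x. \<eta> x *\<^sub>R g x \<partial>lebesgue)"
 shows "has_weak_gradient S f g"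
 unfolding has_weak_gradient_iff[OF assms(1)]
proof (intro conjI ballI allI impI assms(2,3))
 fix \<eta> \<eta>' assume "\<eta> \<in> test_functions S" "\<forall>x. GDERIV \<eta> x :> \<eta>' x"
 then show "(\<integral>x. f x *\<^sub>R \<eta>' x \<partial>lebesgue) = - (\<integral>x. \<eta> x *\<^sub>R g x \<partial>lebesgue)"
  by (intro assms(4)) simp_all
qed

lemma has_weak_gradient_locally_integrable:
 "has_weak_gradient S f g ==> locally_integrable S f"
 "has_weak_gradient S f g ==> locally_integrable S g"
 unfolding has_weak_gradient_def by (elim conjE, assumption)+

lemma has_weak_gradient_restrict:
 assumes "has_weak_gradient S f g" "open S" "open T" "T \<subseteq> S"
 shows "has_weak_gradient T f g"
proof (rule has_weak_gradientI[OF assms(3)])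
 show "locally_integrable T f" "locally_integrable T g"
  using has_weak_gradient_locally_integrable[OF assms(1)] locally_integrable_mono[OF _ assms(4)] by auto
 fix \<eta> \<eta>' assume \<eta>: "\<eta> \<in> test_functions T" "!!x. GDERIV \<eta> x :> \<eta>' x"
 show "(\<integral>x. f x *\<^sub>R \<eta>' x \<partial>lebesgue) = - (\<integral>x. \<eta> x *\<^sub>R g x \<partial>lebesgue)"
  by (rule has_weak_gradientD[OF assms(2,1) test_functions_mono[OF \<eta>(1) assms(4)] \<eta>(2)])
qed

lemma has_weak_gradient_combine:
 assumes "open S" "has_weak_gradient S f g" "has_weak_gradient S f' g'"
 shows "has_weak_gradient S (%x. a * f x + b * f' x) (%x. a *\<^sub>R g x + b *\<^sub>R g' x)"
proof (rule has_weak_gradientI[OF assms(1)])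
 note li = has_weak_gradient_locally_integrable[OF assms(2)] has_weak_gradient_locally_integrable[OF assms(3)]
 show "locally_integrable S (%x. a * f x + b * f' x)"
  using locally_integrable_combine[OF li(1,3), of a b] by simp
 show "locally_integrable S (%x. a *\<^sub>R g x + b *\<^sub>R g' x)"
  by (rule locally_integrable_combine[OF li(2,4)])
 fix \<eta> \<eta>' assume \<eta>: "\<eta> \<in> test_functions S" "!!x. GDERIV \<eta> x :> \<eta>' x"
 have i: "integrable lebesgue (%x. f x *\<^sub>R \<eta>' x)" "integrable lebesgue (%x. f' x *\<^sub>R \<eta>' x)"
  by (rule gradient_times_locally_integrable[OF li(1) \<eta>] gradient_times_locally_integrable[OF li(3) \<eta>])+
 have j: "integrable lebesgue (%x. \<eta> x *\<^sub>R g x)" "integrable lebesgue (%x. \<eta> x *\<^sub>R g' x)"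
  by (rule test_times_locally_integrable[OF li(2) \<eta>(1)] test_times_locally_integrable[OF li(4) \<eta>(1)])+
 have "(\<integral>x. (a * f x + b * f' x) *\<^sub>R \<eta>' x \<partial>lebesgue) = (\<integral>x. a *\<^sub>R (f x *\<^sub>R \<eta>' x) + b *\<^sub>R (f' x *\<^sub>R \<eta>' x) \<partial>lebesgue)"
  by (simp add: scaleR_add_left)
 also have "\<dots> = a *\<^sub>R (\<integral>x. f x *\<^sub>R \<eta>' x \<partial>lebesgue) + b *\<^sub>R (\<integral>x. f' x *\<^sub>R \<eta>' x \<partial>lebesgue)"
  by (subst Bochner_Integration.integral_add) (use i in \<open>auto simp del: scaleR_scaleR\<close>)
 also have "\<dots> = - (a *\<^sub>R (\<integral>x. \<eta> x *\<^sub>R g x \<partial>lebesgue) + b *\<^sub>R (\<integral>x. \<eta> x *\<^sub>R g' x \<partial>lebesgue))"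
  using has_weak_gradientD[OF assms(1,2) \<eta>] has_weak_gradientD[OF assms(1,3) \<eta>] by simp
 also have "a *\<^sub>R (\<integral>x. \<eta> x *\<^sub>R g x \<partial>lebesgue) + b *\<^sub>R (\<integral>x. \<eta> x *\<^sub>R g' x \<partial>lebesgue)
   = (\<integral>x. a *\<^sub>R (\<eta> x *\<^sub>R g x) + b *\<^sub>R (\<eta> x *\<^sub>R g' x) \<partial>lebesgue)"
  by (subst Bochner_Integration.integral_add) (use j in \<open>auto simp del: scaleR_scaleR\<close>)
 also have "\<dots> = (\<integral>x. \<eta> x *\<^sub>R (a *\<^sub>R g x + b *\<^sub>R g' x) \<partial>lebesgue)"
  by (simp add: scaleR_add_right mult.commute)
 finally show "(\<integral>x. (a * f x + b * f' x) *\<^sub>R \<eta>' x \<partial>lebesgue) = - (\<integral>x. \<eta> x *\<^sub>R (a *\<^sub>R g x + b *\<^sub>R g' x) \<partial>lebesgue)" .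
qed

lemma integrable_cong_AE_lebesgue:
 fixes f g :: "'a::euclidean_space => 'b::euclidean_space"
 assumes "integrable lebesgue f" "AE x in lebesgue. f x = g x"
 shows "integrable lebesgue g" "(\<integral>x. g x \<partial>lebesgue) = (\<integral>x. f x \<partial>lebesgue)"
proof -
 have m: "f \<in> borel_measurable lebesgue" using assms(1) by (rule borel_measurable_integrable)
 have "f \<in> borel_measurable (lebesgue_on UNIV)" using m by (simp add: lebesgue_on_UNIV_eq)
 from borel_measurable_AE[OF m assms(2)] have m': "g \<in> borel_measurable lebesgue" .
 show "integrable lebesgue g"
  using integrable_cong_AE[OF m m' assms(2)] assms(1) by simp
 show "(\<integral>x. g x \<partial>lebesgue) = (\<integral>x. f x \<partial>lebesgue)"
  using integral_cong_AE[OF m m' assms(2)] by simp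
qed

lemma locally_integrable_cong_AE:
 assumes S: "open S" and f: "locally_integrable S f" and eq: "AE x in lebesgue_on S. f x = f' x"
 shows "locally_integrable S f'"
 unfolding locally_integrable_def set_integrable_def
proof (intro allI impI)
 fix K assume K: "compact K \<and> K \<subseteq> S"
 have "AE x in lebesgue. x \<in> S --> f x = f' x"
  using eq S by (simp add: AE_lebesgue_on_iff)
 then have "AE x in lebesgue. indicator K x *\<^sub>R f x = indicator K x *\<^sub>R f' x"
  by (rule eventually_mono) (use K in \<open>auto simp: indicator_def\<close>)
 moreover have "integrable lebesgue (%x. indicator K x *\<^sub>R f x)"
  using K by (intro locally_integrable_D[OF f]) auto
 ultimately show "integrable lebesgue (%x. indicator K x *\<^sub>R f' x)"
  by (rule integrable_cong_AE_lebesgue(1)[rotated])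
qed

lemma has_weak_gradient_cong_AE:
 assumes S: "open S" and w: "has_weak_gradient S f g"
  and f: "AE x in lebesgue_on S. f x = f' x" and g: "AE x in lebesgue_on S. g x = g' x"
 shows "has_weak_gradient S f' g'"
proof (rule has_weak_gradientI[OF S])
 note li = has_weak_gradient_locally_integrable[OF w]
 show "locally_integrable S f'" "locally_integrable S g'"
  using locally_integrable_cong_AE[OF S li(1) f] locally_integrable_cong_AE[OF S li(2) g] by auto
 fix \<eta> \<eta>' assume \<eta>: "\<eta> \<in> test_functions S" "!!x. GDERIV \<eta> x :> \<eta>' x"
 have "AE x in lebesgue. x \<in> S --> f x = f' x"
  using f S by (simp add: AE_lebesgue_on_iff)
 then have 1: "AE x in lebesgue. f x *\<^sub>R \<eta>' x = f' x *\<^sub>R \<eta>' x"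
 proof (rule eventually_mono)
  show "f x *\<^sub>R \<eta>' x = f' x *\<^sub>R \<eta>' x" if "x \<in> S --> f x = f' x" for x
   using that test_functions_zero_outside(2)[OF \<eta>(1) _ \<eta>(2), of x] by (cases "x \<in> S") auto
 qed
 have "AE x in lebesgue. x \<in> S --> g x = g' x"
  using g S by (simp add: AE_lebesgue_on_iff)
 then have 2: "AE x in lebesgue. \<eta> x *\<^sub>R g x = \<eta> x *\<^sub>R g' x"
 proof (rule eventually_mono)
  show "\<eta> x *\<^sub>R g x = \<eta> x *\<^sub>R g' x" if "x \<in> S --> g x = g' x" for x
   using that test_functions_zero_outside(1)[OF \<eta>(1), of x] by (cases "x \<in> S") auto
 qed
 show "(\<integral>x. f' x *\<^sub>R \<eta>' x \<partial>lebesgue) = - (\<integral>x. \<eta> x *\<^sub>R g' x \<partial>lebesgue)"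
  using integrable_cong_AE_lebesgue(2)[OF gradient_times_locally_integrable[OF li(1) \<eta>] 1]
   integrable_cong_AE_lebesgue(2)[OF test_times_locally_integrable[OF li(2) \<eta>(1)] 2]
   has_weak_gradientD[OF S w \<eta>] by simp
qed

text \<open>
 Fundamental lemma of the calculus of variations: testing against mollifiers shows that the
 mollifications vanish in the interior, and these converge in \<open>L\<^sup>1\<close>.
\<close>

lemma AE_zero_if_orthogonal_to_test_functions:
 fixes h :: "'a::euclidean_space => 'b::euclidean_space"
 assumes S: "open S" and h: "locally_integrable S h"
  and orth: "!!\<eta>. \<eta> \<in> test_functions S ==> (\<integral>x. \<eta> x *\<^sub>R h x \<partial>lebesgue) = 0"
 shows "AE x in lebesgue_on S. h x = 0"
proof -
 have local: "AE x in lebesgue. x \<in> ball x0 r --> h x = 0"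
  if r: "0 < r" "cball x0 (2 * r) \<subseteq> S" for x0 r
 proof -
  define H where "H x = indicator (cball x0 (2 * r)) x *\<^sub>R h x" for x
  have H: "integrable lebesgue H"
   unfolding H_def using locally_integrable_D[OF h compact_cball r(2)] .
  have zero: "mollify \<rho> H x = 0" if \<rho>: "0 < \<rho>" "\<rho> < r" and x: "x \<in> ball x0 r" for \<rho> x
  proof -
   have sub: "cball x \<rho> \<subseteq> cball x0 (2 * r)"
   proof
    fix y assume "y \<in> cball x \<rho>"
    then show "y \<in> cball x0 (2 * r)"
     using x \<rho> dist_triangle[of x0 y x] by auto
   qed
   have "mollifier \<rho> (x - y) *\<^sub>R H y = mollifier \<rho> (x - y) *\<^sub>R h y" for y
   proof (cases "y \<in> cball x \<rho>")
    case True
    then have "y \<in> cball x0 (2 * r)" using sub by (rule subsetD[rotated])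
    then show ?thesis by (simp add: H_def)
   next
    case False
    then have "mollifier \<rho> (x - y) = 0"
     using mollifier_outside[OF \<rho>(1), of "x - y"] by (simp add: dist_norm)
    then show ?thesis by simp
   qed
   then have "(%y. mollifier \<rho> (x - y) *\<^sub>R H y) = (%y. mollifier \<rho> (x - y) *\<^sub>R h y)"
    by (rule ext)
   then have "mollify \<rho> H x = (\<integral>y. mollifier \<rho> (x - y) *\<^sub>R h y \<partial>lebesgue)"
    unfolding mollify_def by (rule arg_cong)
   also have "\<dots> = 0"
    using sub r(2) by (intro orth mollifier_shift_test_function[OF \<rho>(1)]) (rule order_trans)
   finally show ?thesis .
  qed
  define I where "I = (\<integral>x. indicator (ball x0 r) x * norm (H x) \<partial>lebesgue)"
  have iI: "integrable lebesgue (%x. indicator (ball x0 r) x * norm (H x))"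
   using integrable_mult_indicator[of "ball x0 r" lebesgue "%x. norm (H x)"] H by simp
  have le: "I <= (\<integral>x. norm (mollify \<rho> H x - H x) \<partial>lebesgue)" if \<rho>: "0 < \<rho>" "\<rho> < r" for \<rho>
   unfolding I_def
  proof (rule integral_mono)
   show "integrable lebesgue (%x. norm (mollify \<rho> H x - H x))"
    using mollify_integrable[OF H \<rho>(1)] H by simp
   show "indicator (ball x0 r) x * norm (H x) <= norm (mollify \<rho> H x - H x)" for x
    using zero[OF \<rho>, of x] by (simp add: indicator_def)
  qed (rule iI)
  have "I <= 0"
  proof (rule tendsto_lowerbound[OF mollify_tendsto_L1[OF H]])
   show "\<forall>\<^sub>F \<rho> in at_right 0. I <= (\<integral>x. norm (mollify \<rho> H x - H x) \<partial>lebesgue)"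
    unfolding eventually_at_right_field using le r(1) by blast
  qed simp
  moreover have "0 <= I" unfolding I_def by (intro Bochner_Integration.integral_nonneg) simp
  ultimately have "I = 0" by simp
  then have "AE x in lebesgue. indicator (ball x0 r) x * norm (H x) = 0"
   unfolding I_def using integral_nonneg_eq_0_iff_AE[OF iI] by simp
  then show ?thesis
  proof (rule eventually_mono)
   fix x assume "indicator (ball x0 r) x * norm (H x) = 0"
   then show "x \<in> ball x0 r --> h x = 0"
    using r(1) by (auto simp: H_def indicator_def)
  qed
 qed
 have "\<forall>x\<in>S. \<exists>r>0. cball x (2 * r) \<subseteq> S"
 proof
  fix x assume "x \<in> S"
  then obtain e where "0 < e" "cball x e \<subseteq> S" using S open_contains_cball by blast
  then show "\<exists>r>0. cball x (2 * r) \<subseteq> S" by (intro exI[of _ "e / 2"]) simp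
 qed
 then obtain r where r: "!!x. x \<in> S ==> 0 < r x \<and> cball x (2 * r x) \<subseteq> S"
  by metis
 obtain F where F: "F \<subseteq> (%x. ball x (r x)) ` S" "countable F" "\<Union>F = (\<Union>x\<in>S. ball x (r x))"
  by (rule Lindelof[of "(%x. ball x (r x)) ` S"]) auto
 have "AE x in lebesgue. \<forall>A\<in>F. x \<in> A --> h x = 0"
  unfolding AE_ball_countable[OF F(2)]
 proof
  fix A assume "A \<in> F"
  with F(1) obtain x0 where x0: "x0 \<in> S" "A = ball x0 (r x0)" by blast
  show "AE x in lebesgue. x \<in> A --> h x = 0"
   unfolding x0(2) using r[OF x0(1)] by (intro local) auto
 qed
 then have "AE x in lebesgue. x \<in> S --> h x = 0"
 proof (rule eventually_mono, intro impI)
  fix x assume *: "\<forall>A\<in>F. x \<in> A --> h x = 0" and "x \<in> S"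
  have "x \<in> ball x (r x)" using r[OF \<open>x \<in> S\<close>] by simp
  with \<open>x \<in> S\<close> have "x \<in> (\<Union>x\<in>S. ball x (r x))" by (rule UN_I)
  then have "x \<in> \<Union>F" by (simp only: F(3))
  then obtain A where "A \<in> F" "x \<in> A" by (rule UnionE)
  from *[rule_format, OF this] show "h x = 0" .
 qed
 then show ?thesis by (rule AE_lebesgue_on_iff[THEN iffD2, OF open_sets_lebesgue[OF S]])
qed

lemma has_weak_gradient_unique:
 assumes S: "open S" and w: "has_weak_gradient S f g" "has_weak_gradient S f g'"
 shows "AE x in lebesgue_on S. g x = g' x"
proof -
 note li = has_weak_gradient_locally_integrable(2)[OF w(1)] has_weak_gradient_locally_integrable(2)[OF w(2)]
 have "locally_integrable S (%x. g x - g' x)"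
  using locally_integrable_combine[OF li, of 1 "-1"] by simp
 moreover have "(\<integral>x. \<eta> x *\<^sub>R (g x - g' x) \<partial>lebesgue) = 0" if \<eta>: "\<eta> \<in> test_functions S" for \<eta>
 proof -
  obtain \<eta>' where \<eta>': "!!x. GDERIV \<eta> x :> \<eta>' x" by (rule test_functionsE[OF \<eta>]) blast
  have "(\<integral>x. \<eta> x *\<^sub>R g x \<partial>lebesgue) = (\<integral>x. \<eta> x *\<^sub>R g' x \<partial>lebesgue)"
   using has_weak_gradientD[OF S w(1) \<eta> \<eta>'] has_weak_gradientD[OF S w(2) \<eta> \<eta>'] by simp
  then show ?thesis
   unfolding scaleR_diff_right
   using Bochner_Integration.integral_diff[OF test_times_locally_integrable[OF li(1) \<eta>] test_times_locally_integrable[OF li(2) \<eta>]]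
   by simp
 qed
 ultimately have "AE x in lebesgue_on S. g x - g' x = 0"
  by (rule AE_zero_if_orthogonal_to_test_functions[OF S])
 then show ?thesis by simp
qed

lemma has_weak_gradient_test_function:
 assumes S: "open S" and \<eta>: "\<eta> \<in> test_functions S" "!!x. GDERIV \<eta> x :> g x"
 shows "has_weak_gradient S \<eta> g" "integrable lebesgue g"
proof -
 obtain h K where h: "!!x. GDERIV \<eta> x :> h x" and K: "continuous_on UNIV h" "compact K" "!!x. x \<notin> K ==> h x = 0"
  by (rule test_functionsE[OF \<eta>(1)]) blast
 have "h = g" using h \<eta>(2) gderiv_unique by blast
 note K = K[unfolded this]
 show ig: "integrable lebesgue g" by (rule integrable_continuous_compact_support(1)[OF K])
 have on: "integrable (lebesgue_on S) f" if "integrable lebesgue f" for f :: "'a => 'c::euclidean_space"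
  using that S integrable_mult_indicator[of S lebesgue f] by (simp add: integral_lebesgue_on_indicator(2))
 show "has_weak_gradient S \<eta> g"
 proof (rule has_weak_gradientI[OF S])
  show l1: "locally_integrable S \<eta>"
   using S test_functions_integrable[OF \<eta>(1)] by (intro integrable_imp_locally_integrable on) auto
  show l2: "locally_integrable S g"
   using S ig by (intro integrable_imp_locally_integrable on) auto
  fix \<zeta> \<zeta>' assume \<zeta>: "\<zeta> \<in> test_functions S" "!!x. GDERIV \<zeta> x :> \<zeta>' x"
  have "(%x. \<eta> x * \<zeta> x) \<in> test_functions S"
   using \<eta>(1) by (intro test_functions_mult_smooth[OF \<zeta>(1)]) (simp add: test_functions_def)
  moreover have "GDERIV (%x. \<eta> x * \<zeta> x) x :> \<eta> x *\<^sub>R \<zeta>' x + \<zeta> x *\<^sub>R g x" for x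
   by (rule GDERIV_mult[OF \<eta>(2) \<zeta>(2)])
  ultimately have "(\<integral>x. \<eta> x *\<^sub>R \<zeta>' x + \<zeta> x *\<^sub>R g x \<partial>lebesgue) = 0"
   by (rule integral_gradient_test_function)
  then show "(\<integral>x. \<eta> x *\<^sub>R \<zeta>' x \<partial>lebesgue) = - (\<integral>x. \<zeta> x *\<^sub>R g x \<partial>lebesgue)"
   using Bochner_Integration.integral_add[OF gradient_times_locally_integrable[OF l1 \<zeta>] test_times_locally_integrable[OF l2 \<zeta>(1)]]
   by (simp add: eq_neg_iff_add_eq_0)
 qed
qed

lemma integrable_isometry:
 fixes f :: "'a::euclidean_space => 'b::euclidean_space"
 assumes s: "s = 1 \<or> s = - 1" and f: "integrable lebesgue f"
 shows "integrable lebesgue (%x. f (a + s *\<^sub>R x))" "(\<integral>x. f (a + s *\<^sub>R x) \<partial>lebesgue) = (\<integral>x. f x \<partial>lebesgue)"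
proof -
 have d: "distr lebesgue lebesgue (%y. a + s *\<^sub>R y) = lebesgue" by (rule lebesgue_isometry(2)[OF s])
 show "integrable lebesgue (%x. f (a + s *\<^sub>R x))"
  using integrable_distr[OF lebesgue_isometry(1)[OF s, of a], of f] f by (simp add: d)
 show "(\<integral>x. f (a + s *\<^sub>R x) \<partial>lebesgue) = (\<integral>x. f x \<partial>lebesgue)"
  using integral_distr[OF lebesgue_isometry(1)[OF s, of a] borel_measurable_integrable[OF f]] by (simp add: d)
qed

lemma isometry_inverse:
 fixes x :: "'a::real_vector"
 assumes "s = 1 \<or> s = - 1"
 shows "a + s *\<^sub>R (- s *\<^sub>R a + s *\<^sub>R x) = x" "- s *\<^sub>R a + s *\<^sub>R (a + s *\<^sub>R x) = x"
 using assms by (elim disjE; simp)+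

text \<open>
  This carries gradients of translates \<open>J(\<cdot> - x)\<close> on the domain over to gradients of \<open>J\<close> itself, and
  relates the gradient of an even function to its own reflection.
\<close>

lemma has_weak_gradient_isometry:
 fixes S :: "'a::euclidean_space set"
 assumes s: "s = 1 \<or> s = - 1" and S: "open S" and w: "has_weak_gradient S f g"
 shows "has_weak_gradient {x. a + s *\<^sub>R x \<in> S} (%x. f (a + s *\<^sub>R x)) (%x. s *\<^sub>R g (a + s *\<^sub>R x))"
  "open {x. a + s *\<^sub>R x \<in> S}"
proof -
 let ?T = "{x. a + s *\<^sub>R x \<in> S}" let ?\<tau> = "%x. a + s *\<^sub>R x" let ?\<sigma> = "%x. - s *\<^sub>R a + s *\<^sub>R x"
 note inv = isometry_inverse[OF s]
 have "open (?\<tau> -` S)" by (intro open_vimage S continuous_intros)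
 then show T: "open ?T" by (simp add: vimage_def)
 have li: "locally_integrable ?T (%x. F (?\<tau> x))" if F: "locally_integrable S F" for F :: "'a => 'b::euclidean_space"
  unfolding locally_integrable_def set_integrable_def
 proof (intro allI impI)
  fix K assume K: "compact K \<and> K \<subseteq> ?T"
  have "compact (?\<tau> ` K)" "?\<tau> ` K \<subseteq> S"
   using K by (auto intro!: compact_continuous_image continuous_intros)
  from integrable_isometry(1)[OF s locally_integrable_D[OF F this], of a]
  have "integrable lebesgue (%x. indicator (?\<tau> ` K) (?\<tau> x) *\<^sub>R F (?\<tau> x))" .
  moreover have "indicator (?\<tau> ` K) (?\<tau> x) = (indicator K x :: real)" for x
  proof -
   have "inj ?\<tau>" using s by (auto simp: inj_def)
   then have "?\<tau> x \<in> ?\<tau> ` K \<longleftrightarrow> x \<in> K" by (rule inj_image_mem_iff)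
   then show ?thesis by (simp add: indicator_def)
  qed
  ultimately show "integrable lebesgue (%x. indicator K x *\<^sub>R F (?\<tau> x))" by simp
 qed
 note lw = has_weak_gradient_locally_integrable[OF w]
 show "has_weak_gradient ?T (%x. f (?\<tau> x)) (%x. s *\<^sub>R g (?\<tau> x))"
 proof (rule has_weak_gradientI[OF T])
  show "locally_integrable ?T (%x. f (?\<tau> x))" by (rule li[OF lw(1)])
  show "locally_integrable ?T (%x. s *\<^sub>R g (?\<tau> x))"
   using locally_integrable_combine[OF li[OF lw(2)] li[OF lw(2)], of s 0] by simp
  fix \<eta> \<eta>' assume \<eta>: "\<eta> \<in> test_functions ?T" "!!x. GDERIV \<eta> x :> \<eta>' x"
  obtain K where K: "compact K" "K \<subseteq> ?T" "!!x. x \<notin> K ==> \<eta> x = 0"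
   by (rule test_functionsE[OF \<eta>(1)]) blast
  define \<zeta> where "\<zeta> y = \<eta> (?\<sigma> y)" for y
  have \<zeta>: "\<zeta> \<in> test_functions S"
  proof (rule test_functionsI)
   show "Ck k \<zeta>" for k
    unfolding \<zeta>_def using \<eta>(1) by (intro Ck_affine) (simp add: test_functions_def)
   show "compact (?\<tau> ` K)" using K(1) by (auto intro!: compact_continuous_image continuous_intros)
   show "?\<tau> ` K \<subseteq> S" using K(2) by auto
   show "\<zeta> y = 0" if "y \<notin> ?\<tau> ` K" for y
    unfolding \<zeta>_def
   proof (rule K(3), rule notI)
    assume "?\<sigma> y \<in> K"
    then have "?\<tau> (?\<sigma> y) \<in> ?\<tau> ` K" by (rule imageI)
    then show False using that by (simp only: inv)
   qed
  qed
  have \<zeta>': "GDERIV \<zeta> y :> s *\<^sub>R \<eta>' (?\<sigma> y)" for y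
   unfolding \<zeta>_def by (intro GDERIV_affine \<eta>(2))
  have 1: "(\<integral>y. f y *\<^sub>R (s *\<^sub>R \<eta>' (?\<sigma> y)) \<partial>lebesgue) = - (\<integral>y. \<zeta> y *\<^sub>R g y \<partial>lebesgue)"
   by (rule has_weak_gradientD[OF S w \<zeta> \<zeta>'])
  have 2: "(\<integral>x. f (?\<tau> x) *\<^sub>R (s *\<^sub>R \<eta>' (?\<sigma> (?\<tau> x))) \<partial>lebesgue) = (\<integral>y. f y *\<^sub>R (s *\<^sub>R \<eta>' (?\<sigma> y)) \<partial>lebesgue)"
   by (rule integrable_isometry(2)[OF s gradient_times_locally_integrable[OF lw(1) \<zeta> \<zeta>']])
  have 3: "(\<integral>x. \<zeta> (?\<tau> x) *\<^sub>R g (?\<tau> x) \<partial>lebesgue) = (\<integral>y. \<zeta> y *\<^sub>R g y \<partial>lebesgue)"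
   by (rule integrable_isometry(2)[OF s test_times_locally_integrable[OF lw(2) \<zeta>]])
  have 4: "\<zeta> (?\<tau> x) = \<eta> x" for x unfolding \<zeta>_def inv ..
  have "s *\<^sub>R (\<integral>x. f (?\<tau> x) *\<^sub>R \<eta>' x \<partial>lebesgue) = (\<integral>x. f (?\<tau> x) *\<^sub>R (s *\<^sub>R \<eta>' x) \<partial>lebesgue)"
   by (simp add: mult.commute flip: integral_scaleR_right)
  also have "\<dots> = - (\<integral>x. \<eta> x *\<^sub>R g (?\<tau> x) \<partial>lebesgue)"
   using 1 2 3 unfolding inv 4 by simp
  finally have 5: "s *\<^sub>R (\<integral>x. f (?\<tau> x) *\<^sub>R \<eta>' x \<partial>lebesgue) = - (\<integral>x. \<eta> x *\<^sub>R g (?\<tau> x) \<partial>lebesgue)" .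
  have "(\<integral>x. \<eta> x *\<^sub>R (s *\<^sub>R g (?\<tau> x)) \<partial>lebesgue) = s *\<^sub>R (\<integral>x. \<eta> x *\<^sub>R g (?\<tau> x) \<partial>lebesgue)"
   by (simp add: mult.commute flip: integral_scaleR_right)
  also have "\<dots> = - (s *\<^sub>R s *\<^sub>R (\<integral>x. f (?\<tau> x) *\<^sub>R \<eta>' x \<partial>lebesgue))"
   using 5 by simp
  finally show "(\<integral>x. f (?\<tau> x) *\<^sub>R \<eta>' x \<partial>lebesgue) = - (\<integral>x. \<eta> x *\<^sub>R (s *\<^sub>R g (?\<tau> x)) \<partial>lebesgue)"
   using s by auto
 qed
qed

section \<open>Product rule for weak gradients\<close>

lemma integral_norm_diff_tendsto:
 fixes F :: "nat => 'a => 'b::euclidean_space"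
 assumes "!!n. integrable M (F n)" "integrable M G"
  and "(%n. \<integral>x. norm (F n x - G x) \<partial>M) \<longlonglongrightarrow> 0"
 shows "(%n. \<integral>x. F n x \<partial>M) \<longlonglongrightarrow> (\<integral>x. G x \<partial>M)"
proof -
 have "norm ((\<integral>x. F n x \<partial>M) - (\<integral>x. G x \<partial>M)) <= (\<integral>x. norm (F n x - G x) \<partial>M)" for n
  using integral_norm_bound[of M "%x. F n x - G x"] assms(1,2) by simp
 then have "(%n. (\<integral>x. F n x \<partial>M) - (\<integral>x. G x \<partial>M)) \<longlonglongrightarrow> 0"
  by (rule Lim_null_comparison[OF always_eventually[OF allI] assms(3)])
 then show ?thesis by (rule LIM_zero_cancel)
qed

lemma integral_bounded_mult_tendsto:
 fixes F :: "nat => 'a => 'b::euclidean_space" and \<phi> :: "'a => real"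
 assumes F: "!!n. integrable M (F n)" and G: "integrable M G"
  and lim: "(%n. \<integral>x. norm (F n x - G x) \<partial>M) \<longlonglongrightarrow> 0"
  and \<phi>: "\<phi> \<in> borel_measurable M" "AE x in M. \<bar>\<phi> x\<bar> <= B"
 shows "(%n. \<integral>x. \<phi> x *\<^sub>R F n x \<partial>M) \<longlonglongrightarrow> (\<integral>x. \<phi> x *\<^sub>R G x \<partial>M)"
proof (rule integral_norm_diff_tendsto)
 show i: "integrable M (%x. \<phi> x *\<^sub>R F n x)" "integrable M (%x. \<phi> x *\<^sub>R G x)" for n
  by (rule bounded_mult_integrable[OF F \<phi>] bounded_mult_integrable[OF G \<phi>])+
 have "(\<integral>x. norm (\<phi> x *\<^sub>R F n x - \<phi> x *\<^sub>R G x) \<partial>M) <= (\<integral>x. \<bar>B\<bar> * norm (F n x - G x) \<partial>M)" for n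
 proof (rule integral_mono_AE)
  show "integrable M (%x. norm (\<phi> x *\<^sub>R F n x - \<phi> x *\<^sub>R G x))" using i by (intro integrable_norm Bochner_Integration.integrable_diff)
  show "integrable M (%x. \<bar>B\<bar> * norm (F n x - G x))" using F G by auto
  show "AE x in M. norm (\<phi> x *\<^sub>R F n x - \<phi> x *\<^sub>R G x) <= \<bar>B\<bar> * norm (F n x - G x)"
   using \<phi>(2)
  proof (rule eventually_mono)
   fix x assume "\<bar>\<phi> x\<bar> <= B"
   then have "\<bar>\<phi> x\<bar> * norm (F n x - G x) <= \<bar>B\<bar> * norm (F n x - G x)" by (intro mult_right_mono) auto
   then show "norm (\<phi> x *\<^sub>R F n x - \<phi> x *\<^sub>R G x) <= \<bar>B\<bar> * norm (F n x - G x)"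
    by (simp flip: scaleR_diff_right)
  qed
 qed
 then have "norm (\<integral>x. norm (\<phi> x *\<^sub>R F n x - \<phi> x *\<^sub>R G x) \<partial>M) <= \<bar>B\<bar> * (\<integral>x. norm (F n x - G x) \<partial>M)" for n
  by simp
 moreover have "(%n. \<bar>B\<bar> * (\<integral>x. norm (F n x - G x) \<partial>M)) \<longlonglongrightarrow> 0"
  using tendsto_mult_right_zero[OF lim] by simp
 ultimately show "(%n. \<integral>x. norm (\<phi> x *\<^sub>R F n x - \<phi> x *\<^sub>R G x) \<partial>M) \<longlonglongrightarrow> 0"
  by (rule Lim_null_comparison[OF always_eventually[OF allI]])
qed

lemma integral_bounded_vector_mult_tendsto:
 fixes F :: "nat => 'a => real" and \<phi> :: "'a => 'b::euclidean_space"
 assumes F: "!!n. integrable M (F n)" and G: "integrable M G"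
  and lim: "(%n. \<integral>x. norm (F n x - G x) \<partial>M) \<longlonglongrightarrow> 0"
  and \<phi>: "\<phi> \<in> borel_measurable M" "AE x in M. norm (\<phi> x) <= B"
 shows "(%n. \<integral>x. F n x *\<^sub>R \<phi> x \<partial>M) \<longlonglongrightarrow> (\<integral>x. G x *\<^sub>R \<phi> x \<partial>M)"
proof (rule integral_norm_diff_tendsto)
 show i: "integrable M (%x. F n x *\<^sub>R \<phi> x)" "integrable M (%x. G x *\<^sub>R \<phi> x)" for n
  by (rule bounded_mult_integrable2[OF F \<phi>] bounded_mult_integrable2[OF G \<phi>])+
 have "(\<integral>x. norm (F n x *\<^sub>R \<phi> x - G x *\<^sub>R \<phi> x) \<partial>M) <= (\<integral>x. \<bar>B\<bar> * norm (F n x - G x) \<partial>M)" for n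
 proof (rule integral_mono_AE)
  show "integrable M (%x. norm (F n x *\<^sub>R \<phi> x - G x *\<^sub>R \<phi> x))" using i by (intro integrable_norm Bochner_Integration.integrable_diff)
  show "integrable M (%x. \<bar>B\<bar> * norm (F n x - G x))" using F G by auto
  show "AE x in M. norm (F n x *\<^sub>R \<phi> x - G x *\<^sub>R \<phi> x) <= \<bar>B\<bar> * norm (F n x - G x)"
   using \<phi>(2)
  proof (rule eventually_mono)
   fix x assume "norm (\<phi> x) <= B"
   then have "norm (\<phi> x) * norm (F n x - G x) <= \<bar>B\<bar> * norm (F n x - G x)" by (intro mult_right_mono) auto
   then show "norm (F n x *\<^sub>R \<phi> x - G x *\<^sub>R \<phi> x) <= \<bar>B\<bar> * norm (F n x - G x)"
    by (simp add: mult.commute flip: scaleR_diff_left)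
  qed
 qed
 then have "norm (\<integral>x. norm (F n x *\<^sub>R \<phi> x - G x *\<^sub>R \<phi> x) \<partial>M) <= \<bar>B\<bar> * (\<integral>x. norm (F n x - G x) \<partial>M)" for n
  by simp
 moreover have "(%n. \<bar>B\<bar> * (\<integral>x. norm (F n x - G x) \<partial>M)) \<longlonglongrightarrow> 0"
  using tendsto_mult_right_zero[OF lim] by simp
 ultimately show "(%n. \<integral>x. norm (F n x *\<^sub>R \<phi> x - G x *\<^sub>R \<phi> x) \<partial>M) \<longlonglongrightarrow> 0"
  by (rule Lim_null_comparison[OF always_eventually[OF allI]])
qed

lemma test_function_bounds:
 fixes \<eta> :: "'a::euclidean_space => real"
 assumes "\<eta> \<in> test_functions S" "!!x. GDERIV \<eta> x :> g x"
 obtains B where "!!x. \<bar>\<eta> x\<bar> <= B" "!!x. norm (g x) <= B" "\<eta> \<in> borel_measurable lebesgue" "g \<in> borel_measurable lebesgue"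
proof -
 obtain h B where h: "!!x. GDERIV \<eta> x :> h x" "continuous_on UNIV \<eta>" "continuous_on UNIV h"
   "!!x. \<bar>\<eta> x\<bar> <= B" "!!x. norm (h x) <= B"
  by (rule test_functionsE[OF assms(1)]) blast
 have "h = g" using h(1) assms(2) gderiv_unique by blast
 with h show thesis by (intro that[of B]) (auto intro: continuous_borel_lebesgue)
qed

lemma measurable_lebesgue_on:
 "f \<in> borel_measurable lebesgue ==> f \<in> borel_measurable (lebesgue_on S)"
 by (rule measurable_restrict_space1)

text \<open>
  The defining identity passes to the limit, since a test function and its gradient are bounded.
\<close>

lemma has_weak_gradient_L1_limit:
 fixes S :: "'a::euclidean_space set"
 assumes S: "open S" and w: "!!n. has_weak_gradient S (f n) (g n)"
  and i: "!!n. integrable (lebesgue_on S) (f n)" "integrable (lebesgue_on S) f0"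
   "!!n. integrable (lebesgue_on S) (g n)" "integrable (lebesgue_on S) g0"
  and lf: "(%n. \<integral>x. norm (f n x - f0 x) \<partial>lebesgue_on S) \<longlonglongrightarrow> 0"
  and lg: "(%n. \<integral>x. norm (g n x - g0 x) \<partial>lebesgue_on S) \<longlonglongrightarrow> 0"
 shows "has_weak_gradient S f0 g0"
 unfolding has_weak_gradient_def
proof (intro conjI ballI allI impI)
 show "locally_integrable S f0" "locally_integrable S g0"
  using S i by (auto intro: integrable_imp_locally_integrable)
 fix \<eta> \<eta>' assume \<eta>: "\<eta> \<in> test_functions S" and "\<forall>x. GDERIV \<eta> x :> \<eta>' x"
 then have \<eta>': "!!x. GDERIV \<eta> x :> \<eta>' x" by blast
 obtain B where B: "!!x. \<bar>\<eta> x\<bar> <= B" "!!x. norm (\<eta>' x) <= B" "\<eta> \<in> borel_measurable lebesgue" "\<eta>' \<in> borel_measurable lebesgue"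
  by (rule test_function_bounds[OF \<eta> \<eta>']) blast
 have "(%n. \<integral>x. f n x *\<^sub>R \<eta>' x \<partial>lebesgue_on S) \<longlonglongrightarrow> (\<integral>x. f0 x *\<^sub>R \<eta>' x \<partial>lebesgue_on S)"
  using B by (intro integral_bounded_vector_mult_tendsto[OF i(1,2) lf, where B=B] measurable_lebesgue_on) auto
 moreover have "(\<integral>x. f n x *\<^sub>R \<eta>' x \<partial>lebesgue_on S) = - (\<integral>x. \<eta> x *\<^sub>R g n x \<partial>lebesgue_on S)" for n
  using w[of n] \<eta> \<eta>' unfolding has_weak_gradient_def by blast
 moreover have "(%n. - (\<integral>x. \<eta> x *\<^sub>R g n x \<partial>lebesgue_on S)) \<longlonglongrightarrow> - (\<integral>x. \<eta> x *\<^sub>R g0 x \<partial>lebesgue_on S)"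
  using B by (intro tendsto_minus integral_bounded_mult_tendsto[OF i(3,4) lg, where B=B] measurable_lebesgue_on) auto
 ultimately show "(\<integral>x. f0 x *\<^sub>R \<eta>' x \<partial>lebesgue_on S) = - (\<integral>x. \<eta> x *\<^sub>R g0 x \<partial>lebesgue_on S)"
  using LIMSEQ_unique by simp
qed

text \<open>
 Near the support of a test function, mollification commutes with the weak gradient, so the
 mollified factor can be absorbed into the test function for the other factor.
\<close>

text \<open>
  A mollifier centred at a point whose ball lies in \<open>S\<close> is a test function on \<open>S\<close>; the definition of
  the weak gradient moves the derivative from it to \<open>u\<close>.
\<close>

lemma mollify_weak_gradient:
 fixes S :: "'a::euclidean_space set"
 assumes S: "open S" and w: "has_weak_gradient S u g"
  and u: "integrable (lebesgue_on S) u"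
  and r: "0 < r" "cball x r \<subseteq> S"
 shows "GDERIV (mollify r (%x. indicator S x *\<^sub>R u x)) x :> mollify r (%x. indicator S x *\<^sub>R g x) x"
proof -
 let ?U = "%x. indicator S x *\<^sub>R u x"
 have U: "integrable lebesgue ?U" using u S by (simp add: integral_lebesgue_on_indicator(2))
 obtain \<rho>' where \<rho>': "!!z::'a. GDERIV (mollifier r) z :> \<rho>' z"
  by (rule test_functionsE[OF mollifier_test_function[OF r(1), where 'a='a]]) blast
 note t = mollifier_shift_test_function[OF r]
 have d: "GDERIV (%y. mollifier r (x - y)) y :> - \<rho>' (x - y)" for y
  by (rule GDERIV_reflect[OF \<rho>'])
 have out: "mollifier r (x - y) = 0" "- \<rho>' (x - y) = 0" if "y \<notin> S" for y
  using test_functions_zero_outside(1)[OF t that] test_functions_zero_outside(2)[OF t that d] by auto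
 have "mollify r ?U = (%x. \<integral>y. mollifier r (x - y) * ?U y \<partial>lebesgue)"
  by (simp add: mollify_def fun_eq_iff)
 then have "GDERIV (mollify r ?U) x :> (\<integral>y. ?U y *\<^sub>R \<rho>' (x - y) \<partial>lebesgue)"
  using GDERIV_convolution[OF mollifier_test_function[OF r(1)] \<rho>' U, of x] by simp
 also have "(\<integral>y. ?U y *\<^sub>R \<rho>' (x - y) \<partial>lebesgue) = - (\<integral>y. u y *\<^sub>R (- \<rho>' (x - y)) \<partial>lebesgue)"
 proof -
  have "?U y *\<^sub>R \<rho>' (x - y) = - (u y *\<^sub>R (- \<rho>' (x - y)))" for y
   using out(2)[of y] by (cases "y \<in> S") auto
  then have "(\<integral>y. ?U y *\<^sub>R \<rho>' (x - y) \<partial>lebesgue) = (\<integral>y. - (u y *\<^sub>R (- \<rho>' (x - y))) \<partial>lebesgue)"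
   by (simp only:)
  then show ?thesis by (simp only: integral_minus)
 qed
 also have "(\<integral>y. u y *\<^sub>R (- \<rho>' (x - y)) \<partial>lebesgue) = - (\<integral>y. mollifier r (x - y) *\<^sub>R g y \<partial>lebesgue)"
  by (rule has_weak_gradientD[OF S w t d])
 also have "- (- (\<integral>y. mollifier r (x - y) *\<^sub>R g y \<partial>lebesgue)) = mollify r (%x. indicator S x *\<^sub>R g x) x"
 proof -
  have "mollifier r (x - y) *\<^sub>R g y = mollifier r (x - y) *\<^sub>R (indicator S y *\<^sub>R g y)" for y
   using out(1)[of y] by (cases "y \<in> S") auto
  then have "(\<integral>y. mollifier r (x - y) *\<^sub>R g y \<partial>lebesgue) = mollify r (%x. indicator S x *\<^sub>R g x) x"
   unfolding mollify_def by (simp only:)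
  then show ?thesis by simp
 qed
 finally show ?thesis .
qed

lemma mollify_bound:
 fixes u :: "'a::euclidean_space => real"
 assumes r: "0 < r" and u: "integrable lebesgue u" and b: "AE x in lebesgue. \<bar>u x\<bar> <= C"
 shows "\<bar>mollify r u x\<bar> <= C"
proof -
 have i: "integrable lebesgue (%y. mollifier r (x - y) * C)"
  using integrable_reflect[OF mollifier_integrable[OF r, where 'a='a], of x] by simp
 have "norm (mollify r u x) <= (\<integral>y. norm (mollifier r (x - y) *\<^sub>R u y) \<partial>lebesgue)"
  unfolding mollify_def by (rule integral_norm_bound)
 also have "\<dots> <= (\<integral>y. mollifier r (x - y) * C \<partial>lebesgue)"
 proof (rule integral_mono_AE[OF _ i])
  show "integrable lebesgue (%y. norm (mollifier r (x - y) *\<^sub>R u y))"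
   by (rule integrable_norm[OF mollify_integrand_integrable[OF u r]])
  show "AE y in lebesgue. norm (mollifier r (x - y) *\<^sub>R u y) <= mollifier r (x - y) * C"
   using b
  proof (rule eventually_mono)
   fix y assume "\<bar>u y\<bar> <= C"
   then show "norm (mollifier r (x - y) *\<^sub>R u y) <= mollifier r (x - y) * C"
    using mult_left_mono[of "\<bar>u y\<bar>" C "mollifier r (x - y)"] mollifier_nonneg[OF r, of "x - y"] by (simp add: abs_mult)
  qed
 qed
 also have "\<dots> = C"
  using integral_reflect[OF borel_measurable_integrable[OF mollifier_integrable[OF r, where 'a='a]], of x]
   mollifier_integral[OF r, where 'a='a] by simp
 finally show ?thesis by simp
qed

lemma has_weak_gradient_mult:
 fixes S :: "'a::euclidean_space set"
 assumes S: "open S" and wu: "has_weak_gradient S u gu" and wv: "has_weak_gradient S v gv"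
  and i: "integrable (lebesgue_on S) u" "integrable (lebesgue_on S) gu"
   "integrable (lebesgue_on S) v" "integrable (lebesgue_on S) gv"
  and bu: "AE x in lebesgue_on S. \<bar>u x\<bar> <= C" and bv: "AE x in lebesgue_on S. \<bar>v x\<bar> <= C"
 shows "has_weak_gradient S (%x. u x * v x) (%x. u x *\<^sub>R gv x + v x *\<^sub>R gu x)"
proof (rule has_weak_gradientI[OF S])
 have m: "u \<in> borel_measurable (lebesgue_on S)" "v \<in> borel_measurable (lebesgue_on S)" using i by auto
 have "integrable (lebesgue_on S) (%x. u x *\<^sub>R v x)" "integrable (lebesgue_on S) (%x. u x *\<^sub>R gv x)"
  "integrable (lebesgue_on S) (%x. v x *\<^sub>R gu x)"
  by (rule bounded_mult_integrable[OF i(3) m(1) bu] bounded_mult_integrable[OF i(4) m(1) bu]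
    bounded_mult_integrable[OF i(2) m(2) bv])+
 then show "locally_integrable S (%x. u x * v x)" "locally_integrable S (%x. u x *\<^sub>R gv x + v x *\<^sub>R gu x)"
  using S by (auto intro!: integrable_imp_locally_integrable)
 fix \<eta> \<eta>' assume \<eta>: "\<eta> \<in> test_functions S" "!!x. GDERIV \<eta> x :> \<eta>' x"
 obtain B where B: "!!x. \<bar>\<eta> x\<bar> <= B" "!!x. norm (\<eta>' x) <= B" "\<eta> \<in> borel_measurable lebesgue" "\<eta>' \<in> borel_measurable lebesgue"
  by (rule test_function_bounds[OF \<eta>]) blast
 obtain h K where h: "!!x. GDERIV \<eta> x :> h x" and K: "compact K" "K \<subseteq> S" "!!x. x \<notin> K ==> \<eta> x = 0" "!!x. x \<notin> K ==> h x = 0"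
  by (rule test_functionsE[OF \<eta>(1)]) blast
 have "h = \<eta>'" using h \<eta>(2) gderiv_unique by blast
 note K = K[unfolded this]
 obtain \<delta> where \<delta>: "0 < \<delta>" "(\<Union>x\<in>K. cball x \<delta>) \<subseteq> S"
  by (rule compact_subset_open_imp_cball_epsilon_subset[OF K(1) S K(2)])
 define ind where "ind = (indicator S :: 'a => real)"
 have ind: "x \<in> S ==> ind x = 1" "x \<notin> S ==> ind x = 0" for x by (auto simp: ind_def)
 let ?u = "%x. ind x *\<^sub>R u x" let ?v = "%x. ind x *\<^sub>R v x"
 let ?gu = "%x. ind x *\<^sub>R gu x" let ?gv = "%x. ind x *\<^sub>R gv x"
 have I: "integrable lebesgue ?u" "integrable lebesgue ?gu" "integrable lebesgue ?v" "integrable lebesgue ?gv"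
  using i S by (auto simp: integral_lebesgue_on_indicator(2) ind_def)
 have ext: "AE x in lebesgue. \<bar>ind x *\<^sub>R f x\<bar> <= \<bar>C\<bar>" if "AE x in lebesgue_on S. \<bar>f x\<bar> <= C" for f
 proof -
  have "AE x in lebesgue. x \<in> S --> \<bar>f x\<bar> <= C" using that S by (simp add: AE_lebesgue_on_iff)
  then show ?thesis
  proof (rule eventually_mono)
   fix x assume *: "x \<in> S --> \<bar>f x\<bar> <= C"
   show "\<bar>ind x *\<^sub>R f x\<bar> <= \<bar>C\<bar>"
    by (cases "x \<in> S") (use * ind in auto)
  qed
 qed
 note bu' = ext[OF bu] and bv' = ext[OF bv]
 define r where "r n = inverse (real (Suc n))" for n
 have r0: "0 < r n" for n by (simp add: r_def)
 have rlim: "filterlim r (at_right 0) sequentially"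
  unfolding filterlim_at
 proof (rule conjI)
  show "\<forall>\<^sub>F n in sequentially. r n \<in> {0<..} \<and> r n \<noteq> 0"
   using r0 less_irrefl by (intro always_eventually allI) (simp add: less_imp_neq[symmetric])
  show "r \<longlonglongrightarrow> 0"
   unfolding r_def by (rule LIMSEQ_inverse_real_of_nat)
 qed
 define un where "un n = mollify (r n) ?u" for n
 define Gn where "Gn n = mollify (r n) ?gu" for n
 have Iun: "integrable lebesgue (un n)" for n unfolding un_def by (rule mollify_integrable[OF I(1) r0])
 have IGn: "integrable lebesgue (Gn n)" for n unfolding Gn_def by (rule mollify_integrable[OF I(2) r0])
 have lun: "(%n. \<integral>x. norm (un n x - ?u x) \<partial>lebesgue) \<longlonglongrightarrow> 0"
  unfolding un_def by (rule filterlim_compose[OF mollify_tendsto_L1[OF I(1)] rlim])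
 have lGn: "(%n. \<integral>x. norm (Gn n x - ?gu x) \<partial>lebesgue) \<longlonglongrightarrow> 0"
  unfolding Gn_def by (rule filterlim_compose[OF mollify_tendsto_L1[OF I(2)] rlim])
 have bun: "\<bar>un n x\<bar> <= \<bar>C\<bar>" for n x
  unfolding un_def by (rule mollify_bound[OF r0 I(1) bu'])
 have Ckun: "Ck k (un n)" for k n
 proof -
  have "un n = (%x. \<integral>y. mollifier (r n) (x - y) * ?u y \<partial>lebesgue)"
   unfolding un_def by (simp add: mollify_def fun_eq_iff)
  then show ?thesis using Ck_convolution[OF mollifier_test_function[OF r0] I(1), of k n] by simp
 qed
 let ?A = "%f x. (f x *\<^sub>R (?v x *\<^sub>R \<eta>' x))"
 let ?Bt = "%G x. (?v x * \<eta> x) *\<^sub>R G x"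
 let ?Ct = "%f x. (f x * \<eta> x) *\<^sub>R ?gv x"
 have mv: "?v \<in> borel_measurable lebesgue" using I(3) by (rule borel_measurable_integrable)
 have iA: "integrable lebesgue (?A f)" if f: "integrable lebesgue f" for f
 proof -
  have "AE x in lebesgue. norm (?v x *\<^sub>R \<eta>' x) <= \<bar>C\<bar> * \<bar>B\<bar>"
   using bv' by (rule eventually_mono) (use B(2) in \<open>auto simp: abs_mult intro!: mult_mono order_trans[OF B(2)]\<close>)
  then show ?thesis using mv B(4) by (intro bounded_mult_integrable2[OF f]) auto
 qed
 have bB: "AE x in lebesgue. \<bar>?v x * \<eta> x\<bar> <= \<bar>C\<bar> * \<bar>B\<bar>"
  using bv'
 proof (rule eventually_mono)
  fix x assume "\<bar>?v x\<bar> <= \<bar>C\<bar>"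
  then show "\<bar>?v x * \<eta> x\<bar> <= \<bar>C\<bar> * \<bar>B\<bar>"
   unfolding abs_mult using order_trans[OF B(1) abs_ge_self] by (intro mult_mono) auto
 qed
 have mB: "(%x. ?v x * \<eta> x) \<in> borel_measurable lebesgue" using mv B(3) by (rule borel_measurable_times)
 have eqn: "(\<integral>x. ?A (un n) x \<partial>lebesgue) + (\<integral>x. ?Bt (Gn n) x \<partial>lebesgue) + (\<integral>x. ?Ct (un n) x \<partial>lebesgue) = 0"
  if n: "r n < \<delta>" for n
 proof -
  obtain D where D: "!!x. GDERIV (un n) x :> D x"
   using Ckun[of "Suc 0" n] unfolding Ck.simps by blast
  have Dx: "D x = Gn n x" if "x \<in> K" for x
  proof -
   have "cball x (r n) \<subseteq> S" using \<delta>(2) that n by (force simp: )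
   from mollify_weak_gradient[OF S wu i(1) r0 this] show ?thesis
    using D gderiv_unique unfolding un_def Gn_def ind_def by blast
  qed
  have t: "(%x. un n x * \<eta> x) \<in> test_functions S" by (rule test_functions_mult_smooth[OF \<eta>(1) Ckun])
  have g: "GDERIV (%x. un n x * \<eta> x) x :> un n x *\<^sub>R \<eta>' x + \<eta> x *\<^sub>R D x" for x
   by (rule GDERIV_mult[OF D \<eta>(2)])
  have "(\<integral>x. v x *\<^sub>R (un n x *\<^sub>R \<eta>' x + \<eta> x *\<^sub>R D x) \<partial>lebesgue) = - (\<integral>x. (un n x * \<eta> x) *\<^sub>R gv x \<partial>lebesgue)"
   by (rule has_weak_gradientD[OF S wv t g])
  moreover have "v x *\<^sub>R (un n x *\<^sub>R \<eta>' x + \<eta> x *\<^sub>R D x) = ?A (un n) x + ?Bt (Gn n) x" for x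
  proof (cases "x \<in> K")
   case True
   then have "ind x = 1" using K(2) ind by blast
   then show ?thesis using Dx[OF True] by (simp add: scaleR_add_right mult.commute)
  next
   case False
   then show ?thesis using K by simp
  qed
  moreover have "(un n x * \<eta> x) *\<^sub>R gv x = ?Ct (un n) x" for x
  proof (cases "x \<in> K")
   case True
   then have "ind x = 1" using K(2) ind by blast
   then show ?thesis by simp
  next
   case False
   then show ?thesis using K by simp
  qed
  ultimately have "(\<integral>x. ?A (un n) x + ?Bt (Gn n) x \<partial>lebesgue) = - (\<integral>x. ?Ct (un n) x \<partial>lebesgue)"
   by (simp only:)
  then show ?thesis
   using Bochner_Integration.integral_add[OF iA[OF Iun[of n]] bounded_mult_integrable[OF IGn[of n] mB bB]]
   by (simp only: add_eq_0_iff2)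
 qed
 obtain s where s_both: "strict_mono (s :: nat => nat) \<and> (AE x in lebesgue. (%n. un (s n) x - ?u x) \<longlonglongrightarrow> 0)"
  using tendsto_L1_AE_subseq[OF Bochner_Integration.integrable_diff[OF Iun I(1)] lun] ..
 note s = conjunct1[OF s_both]
 have s_lim: "AE x in lebesgue. (%n. un (s n) x) \<longlonglongrightarrow> ?u x"
  using conjunct2[OF s_both] by (rule eventually_mono) (rule LIM_zero_cancel)
 have limA: "(%n. \<integral>x. ?A (un n) x \<partial>lebesgue) \<longlonglongrightarrow> (\<integral>x. ?A ?u x \<partial>lebesgue)"
 proof (rule integral_bounded_vector_mult_tendsto[OF Iun I(1) lun])
  show "(%x. ?v x *\<^sub>R \<eta>' x) \<in> borel_measurable lebesgue" using mv B(4) by (rule borel_measurable_scaleR)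
  show "AE x in lebesgue. norm (?v x *\<^sub>R \<eta>' x) <= \<bar>C\<bar> * \<bar>B\<bar>"
   using bv' by (rule eventually_mono) (use B(2) in \<open>auto simp: abs_mult intro!: mult_mono order_trans[OF B(2)]\<close>)
 qed
 have limB: "(%n. \<integral>x. ?Bt (Gn n) x \<partial>lebesgue) \<longlonglongrightarrow> (\<integral>x. ?Bt ?gu x \<partial>lebesgue)"
  by (rule integral_bounded_mult_tendsto[OF IGn I(2) lGn mB bB])
 have mC: "(%x. ?Ct f x) \<in> borel_measurable lebesgue" if "integrable lebesgue f" for f
  by (rule borel_measurable_scaleR[OF borel_measurable_times[OF borel_measurable_integrable[OF that] B(3)]
     borel_measurable_integrable[OF I(4)]])
 have limC: "(%n. \<integral>x. ?Ct (un (s n)) x \<partial>lebesgue) \<longlonglongrightarrow> (\<integral>x. ?Ct ?u x \<partial>lebesgue)"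
 proof (rule integral_dominated_convergence[where w="%x. (\<bar>C\<bar> * \<bar>B\<bar>) * norm (?gv x)"])
  show "(%x. ?Ct ?u x) \<in> borel_measurable lebesgue" "(%x. ?Ct (un (s n)) x) \<in> borel_measurable lebesgue" for n
   by (rule mC[OF I(1)] mC[OF Iun])+
  show "integrable lebesgue (%x. (\<bar>C\<bar> * \<bar>B\<bar>) * norm (?gv x))"
   by (rule integrable_mult_right[OF integrable_norm[OF I(4)]])
  show "AE x in lebesgue. (%n. ?Ct (un (s n)) x) \<longlonglongrightarrow> ?Ct ?u x"
   using s_lim by (rule eventually_mono) (intro tendsto_intros)
  show "AE x in lebesgue. norm (?Ct (un (s n)) x) <= (\<bar>C\<bar> * \<bar>B\<bar>) * norm (?gv x)" for n
  proof (rule AE_I2)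
   fix x
   have "\<bar>un (s n) x * \<eta> x\<bar> <= \<bar>C\<bar> * \<bar>B\<bar>"
    unfolding abs_mult using order_trans[OF B(1) abs_ge_self] bun by (intro mult_mono) auto
   then show "norm (?Ct (un (s n)) x) <= (\<bar>C\<bar> * \<bar>B\<bar>) * norm (?gv x)"
    unfolding norm_scaleR[of "un (s n) x * \<eta> x"] by (rule mult_right_mono) simp
  qed
 qed
 have "\<forall>\<^sub>F n in sequentially. r n < \<delta>"
  using LIMSEQ_inverse_real_of_nat \<delta>(1) unfolding r_def by (intro order_tendstoD(2)) auto
 then have "\<forall>\<^sub>F n in sequentially. r (s n) < \<delta>"
  by (rule eventually_subseq[OF s])
 then have "\<forall>\<^sub>F n in sequentially. 0 = (\<integral>x. ?A (un (s n)) x \<partial>lebesgue) + (\<integral>x. ?Bt (Gn (s n)) x \<partial>lebesgue) + (\<integral>x. ?Ct (un (s n)) x \<partial>lebesgue)"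
  by (rule eventually_mono) (rule eqn[symmetric])
 then have "(%n. (\<integral>x. ?A (un (s n)) x \<partial>lebesgue) + (\<integral>x. ?Bt (Gn (s n)) x \<partial>lebesgue) + (\<integral>x. ?Ct (un (s n)) x \<partial>lebesgue)) \<longlonglongrightarrow> 0"
  by (rule Lim_transform_eventually[OF tendsto_const])
 moreover have "(%n. (\<integral>x. ?A (un (s n)) x \<partial>lebesgue) + (\<integral>x. ?Bt (Gn (s n)) x \<partial>lebesgue) + (\<integral>x. ?Ct (un (s n)) x \<partial>lebesgue))
  \<longlonglongrightarrow> (\<integral>x. ?A ?u x \<partial>lebesgue) + (\<integral>x. ?Bt ?gu x \<partial>lebesgue) + (\<integral>x. ?Ct ?u x \<partial>lebesgue)"
  using LIMSEQ_subseq_LIMSEQ[OF limA s] LIMSEQ_subseq_LIMSEQ[OF limB s] limC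
  unfolding comp_def by (intro tendsto_add)
 ultimately have lim0: "(\<integral>x. ?A ?u x \<partial>lebesgue) + (\<integral>x. ?Bt ?gu x \<partial>lebesgue) + (\<integral>x. ?Ct ?u x \<partial>lebesgue) = 0"
  by (rule LIMSEQ_unique[symmetric])
 have eA: "(%x. ?A ?u x) = (%x. (u x * v x) *\<^sub>R \<eta>' x)"
 proof
  fix x show "?A ?u x = (u x * v x) *\<^sub>R \<eta>' x"
   using K(2,4) ind by (cases "x \<in> K") auto
 qed
 have eB: "(%x. ?Bt ?gu x) = (%x. \<eta> x *\<^sub>R (v x *\<^sub>R gu x))"
 proof
  fix x show "?Bt ?gu x = \<eta> x *\<^sub>R (v x *\<^sub>R gu x)"
   using K(2,3) ind by (cases "x \<in> K") (auto simp: mult.commute)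
 qed
 have eC: "(%x. ?Ct ?u x) = (%x. \<eta> x *\<^sub>R (u x *\<^sub>R gv x))"
 proof
  fix x show "?Ct ?u x = \<eta> x *\<^sub>R (u x *\<^sub>R gv x)"
   using K(2,3) ind by (cases "x \<in> K") (auto simp: mult.commute)
 qed
 have i_vgu: "integrable lebesgue (%x. \<eta> x *\<^sub>R (v x *\<^sub>R gu x))"
  unfolding eB[symmetric] by (rule bounded_mult_integrable[OF I(2) mB bB])
 have i_ugv: "integrable lebesgue (%x. \<eta> x *\<^sub>R (u x *\<^sub>R gv x))"
 proof -
  have "integrable (lebesgue_on S) (%x. u x *\<^sub>R gv x)" by (rule bounded_mult_integrable[OF i(4) m(1) bu])
  then have "locally_integrable S (%x. u x *\<^sub>R gv x)" using S by (intro integrable_imp_locally_integrable) auto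
  then show ?thesis using \<eta>(1) by (rule test_times_locally_integrable)
 qed
 have "(\<integral>x. \<eta> x *\<^sub>R (u x *\<^sub>R gv x + v x *\<^sub>R gu x) \<partial>lebesgue)
   = (\<integral>x. \<eta> x *\<^sub>R (u x *\<^sub>R gv x) \<partial>lebesgue) + (\<integral>x. \<eta> x *\<^sub>R (v x *\<^sub>R gu x) \<partial>lebesgue)"
  unfolding scaleR_add_right by (rule Bochner_Integration.integral_add[OF i_ugv i_vgu])
 moreover have "(\<integral>x. (u x * v x) *\<^sub>R \<eta>' x \<partial>lebesgue) + (\<integral>x. \<eta> x *\<^sub>R (v x *\<^sub>R gu x) \<partial>lebesgue)
   + (\<integral>x. \<eta> x *\<^sub>R (u x *\<^sub>R gv x) \<partial>lebesgue) = 0"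
  using lim0 unfolding eA eB eC .
 ultimately show "(\<integral>x. (u x * v x) *\<^sub>R \<eta>' x \<partial>lebesgue) = - (\<integral>x. \<eta> x *\<^sub>R (u x *\<^sub>R gv x + v x *\<^sub>R gu x) \<partial>lebesgue)"
  by (simp only: eq_neg_iff_add_eq_0 ac_simps)
qed

section \<open>Chain rule and gluing\<close>

lemma has_weak_gradient_power:
 fixes S :: "'a::euclidean_space set"
 assumes S: "open S" "S \<in> lmeasurable" and w: "has_weak_gradient S u g"
  and i: "u \<in> borel_measurable (lebesgue_on S)" "integrable (lebesgue_on S) g"
  and b: "!!x. \<bar>u x\<bar> <= 1"
 shows "has_weak_gradient S (%x. u x ^ Suc k) (%x. (real (Suc k) * u x ^ k) *\<^sub>R g x)"
proof (induction k)
 case 0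
 then show ?case using w by simp
next
 case (Suc k)
 interpret finite_measure "lebesgue_on S" by (rule finite_measure_lebesgue_on[OF S(2)])
 have bk: "\<bar>u x ^ j\<bar> <= 1" for x j
  using b[of x] by (simp add: power_abs power_le_one)
 have ik: "integrable (lebesgue_on S) (%x. u x ^ j)" for j
  using bk i(1) by (intro integrable_const_bound[where B=1]) auto
 have igk: "integrable (lebesgue_on S) (%x. (real (Suc k) * u x ^ k) *\<^sub>R g x)"
 proof (rule bounded_mult_integrable[OF i(2), where B="real (Suc k)"])
  have "real (Suc k) * \<bar>u x ^ k\<bar> <= real (Suc k) * 1" for x
   using bk[of x k] by (intro mult_left_mono) auto
  then show "AE x in lebesgue_on S. \<bar>real (Suc k) * u x ^ k\<bar> <= real (Suc k)"
   by (simp add: abs_mult)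
 qed (use i(1) in auto)
 have "has_weak_gradient S (%x. u x * u x ^ Suc k) (%x. u x *\<^sub>R ((real (Suc k) * u x ^ k) *\<^sub>R g x) + u x ^ Suc k *\<^sub>R g x)"
  using b bk[of _ "Suc k"] ik[of 1] ik[of "Suc k"] i igk
  by (intro has_weak_gradient_mult[OF S(1) w Suc.IH, where C=1]) auto
 moreover have "u x *\<^sub>R ((real (Suc k) * u x ^ k) *\<^sub>R g x) + u x ^ Suc k *\<^sub>R g x = (real (Suc (Suc k)) * u x ^ Suc k) *\<^sub>R g x" for x
  by (simp add: algebra_simps flip: scaleR_add_left)
 ultimately show ?case by simp
qed

lemma has_weak_gradient_polynomial:
 fixes S :: "'a::euclidean_space set" and a :: "nat => real"
 assumes S: "open S" "S \<in> lmeasurable" and w: "has_weak_gradient S u g"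
  and i: "u \<in> borel_measurable (lebesgue_on S)" "integrable (lebesgue_on S) g"
  and b: "!!x. \<bar>u x\<bar> <= 1"
 shows "has_weak_gradient S (%x. \<Sum>j\<le>n. a j / real (Suc j) * u x ^ Suc j) (%x. (\<Sum>j\<le>n. a j * u x ^ j) *\<^sub>R g x)"
proof -
 have "has_weak_gradient S (%x. \<Sum>j\<le>n. a j / real (Suc j) * u x ^ Suc j)
  (%x. \<Sum>j\<le>n. (a j / real (Suc j)) *\<^sub>R (real (Suc j) * u x ^ j) *\<^sub>R g x)"
 proof (induction n)
  case 0
  show ?case
   using has_weak_gradient_combine[OF S(1) has_weak_gradient_power[OF assms, of 0] has_weak_gradient_power[OF assms, of 0], of "a 0" 0]
   by simp
 next
  case (Suc n)
  show ?case
   using has_weak_gradient_combine[OF S(1) Suc has_weak_gradient_power[OF assms, of "Suc n"], of 1 "a (Suc n) / real (Suc (Suc n))"]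
   by (simp only: sum.atMost_Suc mult_1 scaleR_one)
 qed
 moreover have "(\<Sum>j\<le>n. (a j / real (Suc j)) *\<^sub>R (real (Suc j) * u x ^ j) *\<^sub>R g x) = (\<Sum>j\<le>n. a j * u x ^ j) *\<^sub>R g x" for x
  unfolding scaleR_sum_left by (intro sum.cong refl) (simp del: of_nat_Suc)
 ultimately show ?thesis by simp
qed

text \<open>
 The chain rule follows from the product rule: Weierstrass approximation of the derivative by
 polynomials converges uniformly, hence in \<open>L\<^sup>1\<close> after composition.
\<close>

lemma has_weak_gradient_compose:
 fixes S :: "'a::euclidean_space set"
 assumes S: "open S" "S \<in> lmeasurable" and w: "has_weak_gradient S u g"
  and i: "u \<in> borel_measurable (lebesgue_on S)" "integrable (lebesgue_on S) g"
  and b: "AE x in lebesgue_on S. \<bar>u x\<bar> <= 1"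
  and \<Lambda>: "!!s. s \<in> {-1..1} ==> (\<Lambda> has_real_derivative dL s) (at s within {-1..1})"
   "continuous_on {-1..1} dL" "\<Lambda> 0 = 0"
 shows "has_weak_gradient S (%x. \<Lambda> (u x)) (%x. dL (u x) *\<^sub>R g x)"
proof -
 interpret finite_measure "lebesgue_on S" by (rule finite_measure_lebesgue_on[OF S(2)])
 define v where "v x = max (-1) (min 1 (u x))" for x
 have v1: "\<bar>v x\<bar> <= 1" "v x \<in> {-1..1}" for x by (auto simp: v_def)
 have mv: "v \<in> borel_measurable (lebesgue_on S)" unfolding v_def using i(1) by measurable
 have uv: "AE x in lebesgue_on S. u x = v x"
  using b by (rule eventually_mono) (auto simp: v_def)
 have wv: "has_weak_gradient S v g"
  by (rule has_weak_gradient_cong_AE[OF S(1) w uv]) simp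
 have comp_m: "(%x. f (v x)) \<in> borel_measurable (lebesgue_on S)" if "continuous_on {-1..1} f" for f :: "real => real"
 proof -
  have "continuous_on UNIV (%s. f (max (-1) (min 1 s)))"
   by (rule continuous_on_compose2[OF that]) (auto intro!: continuous_intros)
  then have "(%s. f (max (-1) (min 1 s))) \<in> borel_measurable borel" by (rule borel_measurable_continuous_onI)
  from measurable_compose[OF i(1) this] show ?thesis by (simp add: v_def)
 qed
 have c\<Lambda>: "continuous_on {-1..1} \<Lambda>"
  by (rule DERIV_continuous_on[OF \<Lambda>(1)])
 have "\<exists>a n. \<forall>s\<in>{-1..1}. \<bar>dL s - (\<Sum>j\<le>n. a j * s ^ j)\<bar> < inverse (real (Suc N))" for N
 proof -
  obtain p where p: "real_polynomial_function p" "!!s. s \<in> {-1..1} ==> \<bar>dL s - p s\<bar> < inverse (real (Suc N))"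
   by (rule Stone_Weierstrass_real_polynomial_function[OF compact_Icc \<Lambda>(2), of "inverse (real (Suc N))"]) auto
  obtain a n where "p = (%x. \<Sum>i\<le>n. a i * x ^ i)"
   using p(1) unfolding real_polynomial_function_iff_sum by blast
  with p(2) show ?thesis by blast
 qed
 then obtain a n where an: "!!N s. s \<in> {-1..1} ==> \<bar>dL s - (\<Sum>j\<le>n N. a N j * s ^ j)\<bar> < inverse (real (Suc N))"
  by metis
 define p where "p N s = (\<Sum>j\<le>n N. a N j * s ^ j)" for N s
 define P where "P N s = (\<Sum>j\<le>n N. a N j / real (Suc j) * s ^ Suc j)" for N s
 have cp: "continuous_on A (p N)" "continuous_on A (P N)" for N A
  unfolding p_def P_def by (intro continuous_intros)+
 have dP: "(P N has_real_derivative p N s) (at s within A)" for N s A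
 proof -
  have "((%s. a N j / real (Suc j) * s ^ Suc j) has_real_derivative a N j * s ^ j) (at s within A)" for j
   by (rule derivative_eq_intros refl)+ (simp add: field_simps)
  then show ?thesis unfolding p_def P_def by (rule DERIV_sum)
 qed
 have pb: "\<bar>p N s - dL s\<bar> <= inverse (real (Suc N))" if "s \<in> {-1..1}" for N s
  using an[OF that, of N] unfolding p_def by (simp add: abs_minus_commute)
 have Pb: "\<bar>P N s - \<Lambda> s\<bar> <= inverse (real (Suc N))" if s: "s \<in> {-1..1}" for N s
 proof -
  have "norm ((P N s - \<Lambda> s) - (P N 0 - \<Lambda> 0)) <= inverse (real (Suc N)) * norm (s - 0)"
  proof (rule field_differentiable_bound[where S="{-1..1}" and f'="%s. p N s - dL s"])
   show "((%s. P N s - \<Lambda> s) has_field_derivative p N z - dL z) (at z within {-1..1})" if "z \<in> {-1..1}" for z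
    using dP \<Lambda>(1)[OF that] by (rule DERIV_diff)
  qed (use s pb in auto)
  also have "\<dots> <= inverse (real (Suc N)) * 1"
   using s by (intro mult_left_mono) auto
  also have "P N 0 - \<Lambda> 0 = 0" by (simp add: P_def \<Lambda>(3))
  finally show ?thesis by simp
 qed
 have inv0: "(%N. inverse (real (Suc N)) * c) \<longlonglongrightarrow> 0" for c
  using tendsto_mult_left_zero[OF LIMSEQ_inverse_real_of_nat, of c] .
 have bnd: "\<exists>B. \<forall>x. \<bar>f (v x)\<bar> <= B" if "continuous_on {-1..1} f" for f :: "real => real"
 proof -
  have "bounded (f ` {-1..1})" using that by (intro compact_imp_bounded compact_continuous_image) auto
  then obtain B where "\<forall>s\<in>{-1..1}. norm (f s) <= B" unfolding bounded_iff by auto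
  then have "\<forall>x. \<bar>f (v x)\<bar> <= B" using v1(2) by simp
  then show ?thesis ..
 qed
 have int1: "integrable (lebesgue_on S) (%x. f (v x))" if "continuous_on {-1..1} f" for f :: "real => real"
 proof -
  from bnd[OF that] obtain B where "\<forall>x. \<bar>f (v x)\<bar> <= B" ..
  then show ?thesis using comp_m[OF that] by (intro integrable_const_bound[where B=B]) auto
 qed
 have int2: "integrable (lebesgue_on S) (%x. f (v x) *\<^sub>R g x)" if "continuous_on {-1..1} f" for f :: "real => real"
 proof -
  from bnd[OF that] obtain B where "\<forall>x. \<bar>f (v x)\<bar> <= B" ..
  then show ?thesis using comp_m[OF that] by (intro bounded_mult_integrable[OF i(2), where B=B]) auto
 qed
 have "has_weak_gradient S (%x. \<Lambda> (v x)) (%x. dL (v x) *\<^sub>R g x)"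
 proof (rule has_weak_gradient_L1_limit[OF S(1)])
  show "has_weak_gradient S (%x. P N (v x)) (%x. p N (v x) *\<^sub>R g x)" for N
   unfolding P_def p_def by (rule has_weak_gradient_polynomial[OF S wv mv i(2) v1(1)])
  show i1: "integrable (lebesgue_on S) (%x. P N (v x))" "integrable (lebesgue_on S) (%x. \<Lambda> (v x))"
   and i2: "integrable (lebesgue_on S) (%x. p N (v x) *\<^sub>R g x)" "integrable (lebesgue_on S) (%x. dL (v x) *\<^sub>R g x)" for N
   by (rule int1[OF cp(2)] int1[OF c\<Lambda>] int2[OF cp(1)] int2[OF \<Lambda>(2)])+
  show "(%N. \<integral>x. norm (P N (v x) - \<Lambda> (v x)) \<partial>lebesgue_on S) \<longlonglongrightarrow> 0"
  proof (rule Lim_null_comparison[OF _ inv0[of "measure (lebesgue_on S) S"]], intro always_eventually allI)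
   fix N
   have "(\<integral>x. norm (P N (v x) - \<Lambda> (v x)) \<partial>lebesgue_on S) <= (\<integral>x. inverse (real (Suc N)) \<partial>lebesgue_on S)"
    using i1 Pb[OF v1(2)] by (intro integral_mono) auto
   then show "norm (\<integral>x. norm (P N (v x) - \<Lambda> (v x)) \<partial>lebesgue_on S) <= inverse (real (Suc N)) * measure (lebesgue_on S) S"
    by (simp add: mult.commute)
  qed
  show "(%N. \<integral>x. norm (p N (v x) *\<^sub>R g x - dL (v x) *\<^sub>R g x) \<partial>lebesgue_on S) \<longlonglongrightarrow> 0"
  proof (rule Lim_null_comparison[OF _ inv0[of "\<integral>x. norm (g x) \<partial>lebesgue_on S"]], intro always_eventually allI)
   fix N
   have "(\<integral>x. norm (p N (v x) *\<^sub>R g x - dL (v x) *\<^sub>R g x) \<partial>lebesgue_on S) <= (\<integral>x. inverse (real (Suc N)) * norm (g x) \<partial>lebesgue_on S)"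
   proof (rule integral_mono)
    show "norm (p N (v x) *\<^sub>R g x - dL (v x) *\<^sub>R g x) <= inverse (real (Suc N)) * norm (g x)" for x
     using mult_right_mono[OF pb[OF v1(2)[of x], of N] norm_ge_zero[of "g x"]] by (simp flip: scaleR_diff_left)
    show "integrable (lebesgue_on S) (%x. norm (p N (v x) *\<^sub>R g x - dL (v x) *\<^sub>R g x))"
     by (intro integrable_norm Bochner_Integration.integrable_diff i2)
   qed (use i(2) in simp)
   then show "norm (\<integral>x. norm (p N (v x) *\<^sub>R g x - dL (v x) *\<^sub>R g x) \<partial>lebesgue_on S) <= inverse (real (Suc N)) * (\<integral>x. norm (g x) \<partial>lebesgue_on S)"
    by simp
  qed
 qed
 then show ?thesis
  by (rule has_weak_gradient_cong_AE[OF S(1)]) (use uv in \<open>auto elim!: eventually_mono\<close>)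
qed

text \<open>
  The integral over all shifts of a localised integral recovers the whole one. This replaces the
  finite sum over a partition of unity.
\<close>

lemma integral_shift_swap:
 fixes F :: "'a::euclidean_space => 'b::euclidean_space" and \<phi> :: "'a => real"
 assumes F: "integrable lebesgue F" and \<phi>: "continuous_on UNIV \<phi>" "integrable lebesgue \<phi>"
 shows "integrable lebesgue (%w. \<integral>z. \<phi> (z - w) *\<^sub>R F z \<partial>lebesgue)"
  "(\<integral>w. (\<integral>z. \<phi> (z - w) *\<^sub>R F z \<partial>lebesgue) \<partial>lebesgue) = (\<integral>z. \<phi> z \<partial>lebesgue) *\<^sub>R (\<integral>z. F z \<partial>lebesgue)"
proof -
 obtain G where G[measurable]: "G \<in> borel_measurable borel" and FG: "AE x in lebesgue. F x = G x"
  by (rule lebesgue_borel_representative[OF borel_measurable_integrable[OF F]])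
 have \<phi>m[measurable]: "\<phi> \<in> borel_measurable borel" using \<phi>(1) by (rule borel_measurable_continuous_onI)
 have iG: "integrable lborel G"
  using integrable_cong_AE_lebesgue(1)[OF F FG] by (simp add: integrable_completion)
 have intG: "(\<integral>z. F z \<partial>lebesgue) = (\<integral>z. G z \<partial>lborel)"
  using integrable_cong_AE_lebesgue(2)[OF F FG] by (simp add: integral_completion)
 have i\<phi>: "integrable lborel (%w. \<phi> (z - w))" for z
  using integrable_reflect[OF \<phi>(2), of z] by (simp add: integrable_completion)
 have int\<phi>: "(\<integral>w. \<phi> (z - w) \<partial>lborel) = (\<integral>z. \<phi> z \<partial>lebesgue)" for z
  using integral_reflect[OF borel_measurable_integrable[OF \<phi>(2)], of z] by (simp add: integral_completion)
 have intn\<phi>: "(\<integral>w. \<bar>\<phi> (z - w)\<bar> \<partial>lborel) = (\<integral>z. \<bar>\<phi> z\<bar> \<partial>lebesgue)" for z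
  using integral_reflect[of "%z. \<bar>\<phi> z\<bar>" z] \<phi>(2) by (simp add: integral_completion)
 have inner: "(\<integral>z. \<phi> (z - w) *\<^sub>R F z \<partial>lebesgue) = (\<integral>z. \<phi> (z - w) *\<^sub>R G z \<partial>lborel)" for w
 proof -
  have s: "(%z. \<phi> (z - w)) \<in> borel_measurable lebesgue" by (intro measurable_completion) measurable
  have "(\<integral>z. \<phi> (z - w) *\<^sub>R F z \<partial>lebesgue) = (\<integral>z. \<phi> (z - w) *\<^sub>R G z \<partial>lebesgue)"
  proof (rule integral_cong_AE)
   show "(%z. \<phi> (z - w) *\<^sub>R F z) \<in> borel_measurable lebesgue"
    by (rule borel_measurable_scaleR[OF s borel_measurable_integrable[OF F]])
   show "(%z. \<phi> (z - w) *\<^sub>R G z) \<in> borel_measurable lebesgue" by (intro measurable_completion) measurable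
   show "AE z in lebesgue. \<phi> (z - w) *\<^sub>R F z = \<phi> (z - w) *\<^sub>R G z" using FG by (rule eventually_mono) simp
  qed
  also have "\<dots> = (\<integral>z. \<phi> (z - w) *\<^sub>R G z \<partial>lborel)" by (intro integral_completion) measurable
  finally show ?thesis .
 qed
 have prod: "integrable (lborel \<Otimes>\<^sub>M lborel) (%(z, w). \<phi> (z - w) *\<^sub>R G z)"
 proof (rule lborel_pair.Fubini_integrable)
  show "(%(z, w). \<phi> (z - w) *\<^sub>R G z) \<in> borel_measurable (lborel \<Otimes>\<^sub>M lborel)" by measurable
  have "(\<integral>w. norm (case (z, w) of (z, w) => \<phi> (z - w) *\<^sub>R G z) \<partial>lborel) = (\<integral>z. \<bar>\<phi> z\<bar> \<partial>lebesgue) * norm (G z)" for z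
   using intn\<phi>[of z] by simp
  moreover have "integrable lborel (%z. (\<integral>z. \<bar>\<phi> z\<bar> \<partial>lebesgue) * norm (G z))"
   by (rule integrable_mult_right[OF integrable_norm[OF iG]])
  ultimately show "integrable lborel (%z. \<integral>w. norm (case (z, w) of (z, w) => \<phi> (z - w) *\<^sub>R G z) \<partial>lborel)"
   by (simp only:)
  show "AE z in lborel. integrable lborel (%w. case (z, w) of (z, w) => \<phi> (z - w) *\<^sub>R G z)"
   using i\<phi> by simp
 qed
 have "integrable lborel (%w. \<integral>z. \<phi> (z - w) *\<^sub>R G z \<partial>lborel)"
  using lborel_pair.integrable_snd[OF prod] by simp
 then show "integrable lebesgue (%w. \<integral>z. \<phi> (z - w) *\<^sub>R F z \<partial>lebesgue)"
  unfolding inner by (subst integrable_completion) auto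
 have "(\<integral>w. (\<integral>z. \<phi> (z - w) *\<^sub>R F z \<partial>lebesgue) \<partial>lebesgue) = (\<integral>w. (\<integral>z. \<phi> (z - w) *\<^sub>R G z \<partial>lborel) \<partial>lborel)"
  unfolding inner by (intro integral_completion) measurable
 also have "\<dots> = (\<integral>z. (\<integral>w. \<phi> (z - w) *\<^sub>R G z \<partial>lborel) \<partial>lborel)"
  by (rule lborel_pair.Fubini_integral[OF prod])
 also have "\<dots> = (\<integral>z. (\<integral>z. \<phi> z \<partial>lebesgue) *\<^sub>R G z \<partial>lborel)"
  using int\<phi> i\<phi> by simp
 also have "\<dots> = (\<integral>z. \<phi> z \<partial>lebesgue) *\<^sub>R (\<integral>z. F z \<partial>lebesgue)"
  using intG by simp
 finally show "(\<integral>w. (\<integral>z. \<phi> (z - w) *\<^sub>R F z \<partial>lebesgue) \<partial>lebesgue) = (\<integral>z. \<phi> z \<partial>lebesgue) *\<^sub>R (\<integral>z. F z \<partial>lebesgue)" .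
qed

text \<open>
 Weak gradients are local. Instead of a finite partition of unity, the continuous family
 \<open>z \<mapsto> \<rho>(z - w)\<close> is used, with \<open>\<rho>\<close> supported below the Lebesgue number of the cover.
\<close>

lemma has_weak_gradient_Union:
 fixes \<U> :: "'a::euclidean_space set set"
 assumes op: "!!U. U \<in> \<U> ==> open U" and w: "!!U. U \<in> \<U> ==> has_weak_gradient U f g"
 shows "has_weak_gradient (\<Union>\<U>) f g"
proof -
 have oU: "open (\<Union>\<U>)" using op by blast
 have li: "locally_integrable (\<Union>\<U>) F" if F: "!!U. U \<in> \<U> ==> locally_integrable U F" for F :: "'a => 'c::euclidean_space"
  unfolding locally_integrable_def
 proof (intro allI impI)
  fix K assume K: "compact K \<and> K \<subseteq> \<Union>\<U>"
  then have K': "compact K" "K \<subseteq> \<Union>\<U>" by auto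
  obtain e where e: "0 < e" "!!x. x \<in> K ==> \<exists>G\<in>\<U>. ball x e \<subseteq> G"
   by (rule Heine_Borel_lemma[OF K' op]) (assumption, rule that)
  have "K \<subseteq> (\<Union>x\<in>K. ball x (e / 2))" using e(1) by auto
  then obtain X where X: "X \<subseteq> K" "finite X" "K \<subseteq> (\<Union>x\<in>X. ball x (e / 2))"
   by (rule compactE_image[OF K'(1) open_ball])
  have "set_integrable lebesgue (\<Union>x\<in>X. K \<inter> cball x (e / 2)) F"
  proof (rule set_integrable_UN[OF X(2)])
   fix x assume "x \<in> X"
   then obtain G where G: "G \<in> \<U>" "ball x e \<subseteq> G" using e(2) X(1) by blast
   have "cball x (e / 2) \<subseteq> ball x e" using e(1) by (intro cball_subset_ball_iff[THEN iffD2]) auto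
   then show "set_integrable lebesgue (K \<inter> cball x (e / 2)) F"
    using F[OF G(1)] G(2) K'(1) unfolding locally_integrable_def by (auto simp: compact_Int)
   show "K \<inter> cball x (e / 2) \<in> sets lebesgue"
    using K by (intro fmeasurableD lmeasurable_compact) auto
  qed
  moreover have "(\<Union>x\<in>X. K \<inter> cball x (e / 2)) = K"
  proof
   show "K \<subseteq> (\<Union>x\<in>X. K \<inter> cball x (e / 2))"
   proof
    fix y assume "y \<in> K"
    then obtain x where "x \<in> X" "y \<in> ball x (e / 2)" using X(3) by blast
    then show "y \<in> (\<Union>x\<in>X. K \<inter> cball x (e / 2))" using \<open>y \<in> K\<close> by (intro UN_I[of x]) auto
   qed
  qed auto
  ultimately show "set_integrable lebesgue K F" by simp
 qed
 have lf: "locally_integrable (\<Union>\<U>) f"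
  by (rule li) (rule has_weak_gradient_locally_integrable(1)[OF w])
 have lg: "locally_integrable (\<Union>\<U>) g"
  by (rule li) (rule has_weak_gradient_locally_integrable(2)[OF w])
 show ?thesis
 proof (rule has_weak_gradientI[OF oU lf lg])
  fix \<eta> \<eta>' assume \<eta>: "\<eta> \<in> test_functions (\<Union>\<U>)" "!!x. GDERIV \<eta> x :> \<eta>' x"
  obtain K where K: "compact K" "K \<subseteq> \<Union>\<U>" "!!x. x \<notin> K ==> \<eta> x = 0"
   by (rule test_functionsE[OF \<eta>(1)]) blast
  obtain e where e: "0 < e" "!!x. x \<in> K ==> \<exists>G\<in>\<U>. ball x e \<subseteq> G"
   by (rule Heine_Borel_lemma[OF K(1,2) op]) (assumption, rule that)
  define r where "r = e / 3"
  have r: "0 < r" using e by (simp add: r_def)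
  obtain \<rho>' B where \<rho>': "!!z::'a. GDERIV (mollifier r) z :> \<rho>' z" "continuous_on UNIV \<rho>'"
   and \<rho>B: "!!z::'a. \<bar>mollifier r z\<bar> <= B" "!!z. norm (\<rho>' z) <= B"
   by (rule test_functionsE[OF mollifier_test_function[OF r, where 'a='a]]) blast
  note \<rho>c = mollifier_continuous[OF r, where 'a='a]
  have i\<rho>': "integrable lebesgue \<rho>'" and int\<rho>': "(\<integral>z. \<rho>' z \<partial>lebesgue) = 0"
   using has_weak_gradient_test_function(2)[OF open_UNIV mollifier_test_function[OF r] \<rho>'(1)]
    integral_gradient_test_function[OF mollifier_test_function[OF r] \<rho>'(1)] by auto
  have sh: "GDERIV (%z. mollifier r (z - w)) z :> \<rho>' (z - w)" for z w :: 'a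
   using GDERIV_affine[of "mollifier r" "- w" 1 z] \<rho>'(1) by simp
  have Cksh: "Ck k (%z. mollifier r (z - w))" for k and w :: 'a
  proof -
   have "Ck k (mollifier r :: 'a => real)" using mollifier_test_function[OF r, where 'a='a] by (simp add: test_functions_def)
   from Ck_affine[OF this, of "- w" 1] show ?thesis by simp
  qed
  have loc: "(\<integral>z. f z *\<^sub>R (mollifier r (z - w) *\<^sub>R \<eta>' z + \<eta> z *\<^sub>R \<rho>' (z - w)) \<partial>lebesgue)
    = - (\<integral>z. (mollifier r (z - w) * \<eta> z) *\<^sub>R g z \<partial>lebesgue)" for w
  proof -
   have d: "GDERIV (%z. mollifier r (z - w) * \<eta> z) z :> mollifier r (z - w) *\<^sub>R \<eta>' z + \<eta> z *\<^sub>R \<rho>' (z - w)" for z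
    by (rule GDERIV_mult[OF sh \<eta>(2)])
   have exG: "\<exists>G\<in>\<U>. K \<inter> cball w r \<subseteq> G" if "K \<noteq> {}"
   proof (cases "K \<inter> cball w r = {}")
    case True
    from that obtain x where "x \<in> K" by blast
    then obtain G where "G \<in> \<U>" using K(2) by blast
    then show ?thesis using True by auto
   next
    case False
    then obtain x where x: "x \<in> K" "dist w x <= r" by auto
    obtain G where G: "G \<in> \<U>" "ball x e \<subseteq> G" using e(2) x(1) by blast
    have "cball w r \<subseteq> ball x e"
    proof
     fix y assume "y \<in> cball w r"
     then have "dist x y <= r + r" using x(2) dist_triangle3[of x y w] by simp
     then show "y \<in> ball x e" using e(1) by (simp add: r_def)
    qed
    then show ?thesis using G by auto
   qed
   show ?thesis
   proof (cases "K = {}")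
    case True
    then have "\<eta> = (%x. 0)" using K(3) by auto
    then have "\<eta>' z = 0" for z using \<eta>(2)[of z] GDERIV_const[of 0 z] gderiv_unique by simp
    then show ?thesis using \<open>\<eta> = (%x. 0)\<close> by simp
   next
    case False
    then obtain G where G: "G \<in> \<U>" "K \<inter> cball w r \<subseteq> G" using exG by blast
    have "(%z. mollifier r (z - w) * \<eta> z) \<in> test_functions G"
    proof (rule test_functionsI[where K="K \<inter> cball w r"])
     show "Ck k (%z. mollifier r (z - w) * \<eta> z)" for k
      using Cksh \<eta>(1) by (intro Ck_mult) (auto simp: test_functions_def)
     show "mollifier r (z - w) * \<eta> z = 0" if "z \<notin> K \<inter> cball w r" for z
     proof (cases "z \<in> K")
      case True
      then have "r <= norm (z - w)" using that by (simp add: dist_norm norm_minus_commute)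
      then show ?thesis using mollifier_outside[OF r, of "z - w"] by simp
     qed (simp add: K(3))
    qed (use K(1) G(2) in auto)
    from has_weak_gradientD[OF op[OF G(1)] w[OF G(1)] this d] show ?thesis .
   qed
  qed
  have ig: "integrable lebesgue (%z. f z *\<^sub>R \<eta>' z)" by (rule gradient_times_locally_integrable[OF lf \<eta>])
  have i0: "integrable lebesgue (%z. \<eta> z * f z)" using test_times_locally_integrable[OF lf \<eta>(1)] by simp
  have i1: "integrable lebesgue (%z. \<eta> z *\<^sub>R g z)" by (rule test_times_locally_integrable[OF lg \<eta>(1)])
  have m\<rho>: "(%z. mollifier r (z - w)) \<in> borel_measurable lebesgue" for w :: 'a
   by (rule continuous_borel_lebesgue[OF Ck_imp_continuous[OF Cksh[of 0]]])
  have m\<rho>': "(%z. \<rho>' (z - w)) \<in> borel_measurable lebesgue" for w :: 'a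
   by (intro continuous_borel_lebesgue continuous_on_compose2[OF \<rho>'(2)] continuous_intros) auto
  show "(\<integral>x. f x *\<^sub>R \<eta>' x \<partial>lebesgue) = - (\<integral>x. \<eta> x *\<^sub>R g x \<partial>lebesgue)"
  proof (rule euclidean_eqI)
   fix b :: 'a assume "b \<in> Basis"
   let ?F1 = "%z. f z * (\<eta>' z \<bullet> b)" let ?F2 = "%z. \<eta> z * f z" let ?F3 = "%z. \<eta> z * (g z \<bullet> b)"
   have F1: "integrable lebesgue ?F1" using integrable_inner_left[of b lebesgue "%z. f z *\<^sub>R \<eta>' z"] ig by simp
   have F3: "integrable lebesgue ?F3" using integrable_inner_left[of b lebesgue "%z. \<eta> z *\<^sub>R g z"] i1 by simp
   have e1: "(\<integral>z. f z *\<^sub>R \<eta>' z \<partial>lebesgue) \<bullet> b = (\<integral>z. ?F1 z \<partial>lebesgue)"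
    using integral_inner_left[of b lebesgue "%z. f z *\<^sub>R \<eta>' z"] ig by simp
   have e3: "(\<integral>z. \<eta> z *\<^sub>R g z \<partial>lebesgue) \<bullet> b = (\<integral>z. ?F3 z \<partial>lebesgue)"
    using integral_inner_left[of b lebesgue "%z. \<eta> z *\<^sub>R g z"] i1 by simp
   let ?P = "%w. \<integral>z. mollifier r (z - w) *\<^sub>R ?F1 z \<partial>lebesgue"
   let ?Q = "%w. \<integral>z. (\<rho>' (z - w) \<bullet> b) *\<^sub>R ?F2 z \<partial>lebesgue"
   let ?R = "%w. \<integral>z. mollifier r (z - w) *\<^sub>R ?F3 z \<partial>lebesgue"
   have PQR: "?P w + ?Q w = - ?R w" for w
   proof -
    have j1: "integrable lebesgue (%z. mollifier r (z - w) *\<^sub>R (f z *\<^sub>R \<eta>' z))"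
     using \<rho>B(1) by (intro bounded_mult_integrable[OF ig m\<rho>, where B=B]) auto
    have j2: "integrable lebesgue (%z. (\<eta> z * f z) *\<^sub>R \<rho>' (z - w))"
     using \<rho>B(2) by (intro bounded_mult_integrable2[OF i0 m\<rho>', where B=B]) auto
    have j3: "integrable lebesgue (%z. mollifier r (z - w) *\<^sub>R (\<eta> z *\<^sub>R g z))"
     using \<rho>B(1) by (intro bounded_mult_integrable[OF i1 m\<rho>, where B=B]) auto
    have "(\<integral>z. mollifier r (z - w) *\<^sub>R (f z *\<^sub>R \<eta>' z) \<partial>lebesgue) + (\<integral>z. (\<eta> z * f z) *\<^sub>R \<rho>' (z - w) \<partial>lebesgue)
     = (\<integral>z. mollifier r (z - w) *\<^sub>R (f z *\<^sub>R \<eta>' z) + (\<eta> z * f z) *\<^sub>R \<rho>' (z - w) \<partial>lebesgue)"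
     by (rule Bochner_Integration.integral_add[OF j1 j2, symmetric])
    also have "\<dots> = (\<integral>z. f z *\<^sub>R (mollifier r (z - w) *\<^sub>R \<eta>' z + \<eta> z *\<^sub>R \<rho>' (z - w)) \<partial>lebesgue)"
     by (intro Bochner_Integration.integral_cong refl) (simp add: scaleR_add_right mult.commute)
    also have "\<dots> = - (\<integral>z. mollifier r (z - w) *\<^sub>R (\<eta> z *\<^sub>R g z) \<partial>lebesgue)"
     unfolding loc by simp
    finally have "((\<integral>z. mollifier r (z - w) *\<^sub>R (f z *\<^sub>R \<eta>' z) \<partial>lebesgue) + (\<integral>z. (\<eta> z * f z) *\<^sub>R \<rho>' (z - w) \<partial>lebesgue)) \<bullet> b
      = (- (\<integral>z. mollifier r (z - w) *\<^sub>R (\<eta> z *\<^sub>R g z) \<partial>lebesgue)) \<bullet> b" by (simp only:)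
    moreover have "(\<integral>z. mollifier r (z - w) *\<^sub>R (f z *\<^sub>R \<eta>' z) \<partial>lebesgue) \<bullet> b = ?P w"
     using integral_inner_left[of b lebesgue, OF j1] by (simp only: inner_scaleR_left real_scaleR_def)
    moreover have "(\<integral>z. (\<eta> z * f z) *\<^sub>R \<rho>' (z - w) \<partial>lebesgue) \<bullet> b = ?Q w"
     using integral_inner_left[of b lebesgue, OF j2] by (simp only: inner_scaleR_left real_scaleR_def mult.commute)
    moreover have "(\<integral>z. mollifier r (z - w) *\<^sub>R (\<eta> z *\<^sub>R g z) \<partial>lebesgue) \<bullet> b = ?R w"
     using integral_inner_left[of b lebesgue, OF j3] by (simp only: inner_scaleR_left real_scaleR_def)
    ultimately show ?thesis by (simp only: inner_add_left inner_minus_left)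
   qed
   have c\<rho>b: "continuous_on UNIV (%z. \<rho>' z \<bullet> b)" using \<rho>'(2) by (intro continuous_intros)
   have i\<rho>b: "integrable lebesgue (%z. \<rho>' z \<bullet> b)" using i\<rho>' by (rule integrable_inner_left)
   note i\<rho> = mollifier_integrable[OF r, where 'a='a]
   have "(\<integral>z. \<rho>' z \<bullet> b \<partial>lebesgue) = 0" using integral_inner_left[of b lebesgue \<rho>'] i\<rho>' int\<rho>' by simp
   then have Q0: "(\<integral>w. ?Q w \<partial>lebesgue) = 0" using integral_shift_swap(2)[OF i0 c\<rho>b i\<rho>b] by simp
   have P1: "(\<integral>w. ?P w \<partial>lebesgue) = (\<integral>z. ?F1 z \<partial>lebesgue)"
    using integral_shift_swap(2)[OF F1 \<rho>c i\<rho>] mollifier_integral[OF r, where 'a='a] by simp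
   have R1: "(\<integral>w. ?R w \<partial>lebesgue) = (\<integral>z. ?F3 z \<partial>lebesgue)"
    using integral_shift_swap(2)[OF F3 \<rho>c i\<rho>] mollifier_integral[OF r, where 'a='a] by simp
   have "(\<integral>w. ?P w \<partial>lebesgue) + (\<integral>w. ?Q w \<partial>lebesgue) = (\<integral>w. ?P w + ?Q w \<partial>lebesgue)"
    by (rule Bochner_Integration.integral_add[OF integral_shift_swap(1)[OF F1 \<rho>c i\<rho>] integral_shift_swap(1)[OF i0 c\<rho>b i\<rho>b], symmetric])
   also have "\<dots> = - (\<integral>w. ?R w \<partial>lebesgue)"
    unfolding PQR by (rule integral_minus)
   finally show "(\<integral>x. f x *\<^sub>R \<eta>' x \<partial>lebesgue) \<bullet> b = - (\<integral>x. \<eta> x *\<^sub>R g x \<partial>lebesgue) \<bullet> b"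
    unfolding Q0 P1 R1 inner_minus_left e1 e3 by simp
  qed
 qed
qed

text \<open>
  Gradients agree almost everywhere on overlaps, so countably many of them can be assembled.
\<close>

lemma has_weak_gradient_patch:
 fixes U :: "nat => 'a::euclidean_space set"
 assumes op: "!!n. open (U n)" and w: "!!n. has_weak_gradient (U n) f (g n)"
 shows "\<exists>G. has_weak_gradient (\<Union>n. U n) f G"
proof -
 define G where "G x = g (LEAST n. x \<in> U n) x" for x
 have "has_weak_gradient (U n) f G" for n
 proof (rule has_weak_gradient_cong_AE[OF op w])
  have "AE x in lebesgue. x \<in> U n --> x \<in> U k --> g n x = g k x" for k
  proof -
   have o: "open (U n \<inter> U k)" using op by blast
   have "AE x in lebesgue_on (U n \<inter> U k). g n x = g k x"
    by (rule has_weak_gradient_unique[OF o has_weak_gradient_restrict[OF w op o] has_weak_gradient_restrict[OF w op o]]) auto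
   then have "AE x in lebesgue. x \<in> U n \<inter> U k --> g n x = g k x" using o by (simp add: AE_lebesgue_on_iff)
   then show ?thesis by (rule eventually_mono) blast
  qed
  then have "AE x in lebesgue. \<forall>k. x \<in> U n --> x \<in> U k --> g n x = g k x"
   by (subst AE_all_countable) blast
  then have "AE x in lebesgue. x \<in> U n --> g n x = G x"
  proof (rule eventually_mono)
   fix x assume *: "\<forall>k. x \<in> U n --> x \<in> U k --> g n x = g k x"
   show "x \<in> U n --> g n x = G x"
    using * LeastI[of "%k. x \<in> U k" n] unfolding G_def by blast
  qed
  then show "AE x in lebesgue_on (U n). g n x = G x" using op by (simp add: AE_lebesgue_on_iff)
 qed simp
 then have "has_weak_gradient (\<Union>(range U)) f G"
  using op by (intro has_weak_gradient_Union) auto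
 then show ?thesis by blast
qed

section \<open>The Hilbert space \<open>L\<^sup>2\<close>\<close>

definition L2_inner :: "'a measure => ('a => 'b::euclidean_space) => ('a => 'b) => real" where
 "L2_inner M f g = (\<integral>x. f x \<bullet> g x \<partial>M)"

lemma L2_spaceD:
 assumes "f \<in> L2_space M"
 shows "f \<in> borel_measurable M" "integrable M (%x. (norm (f x))\<^sup>2)"
 using assms by (simp_all add: L2_space_def)

lemma inner_le_squares: "\<bar>a \<bullet> b\<bar> <= (norm a)\<^sup>2 + (norm b)\<^sup>2"
proof -
 have "\<bar>a \<bullet> b\<bar> <= norm a * norm b" by (rule Cauchy_Schwarz_ineq2)
 also have "2 * (norm a * norm b) <= (norm a)\<^sup>2 + (norm b)\<^sup>2"
  using sum_squares_bound[of "norm a" "norm b"] by simp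
 finally show ?thesis using mult_nonneg_nonneg[OF norm_ge_zero[of a] norm_ge_zero[of b]] by linarith
qed

lemma L2_inner_integrable:
 assumes "f \<in> L2_space M" "g \<in> L2_space M"
 shows "integrable M (%x. f x \<bullet> g x)"
proof (rule Bochner_Integration.integrable_bound[of _ "%x. (norm (f x))\<^sup>2 + (norm (g x))\<^sup>2"])
 show "integrable M (%x. (norm (f x))\<^sup>2 + (norm (g x))\<^sup>2)"
  using L2_spaceD(2)[OF assms(1)] L2_spaceD(2)[OF assms(2)] by (rule Bochner_Integration.integrable_add)
 show "(%x. f x \<bullet> g x) \<in> borel_measurable M"
  using L2_spaceD(1)[OF assms(1)] L2_spaceD(1)[OF assms(2)] by (rule borel_measurable_inner)
 show "AE x in M. norm (f x \<bullet> g x) <= norm ((norm (f x))\<^sup>2 + (norm (g x))\<^sup>2)"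
  using inner_le_squares by (intro AE_I2) simp
qed

lemma L2_bounded_by:
 assumes "g \<in> L2_space M" "f \<in> borel_measurable M" "AE x in M. norm (f x) <= C * norm (g x)"
 shows "f \<in> L2_space M"
proof -
 have "integrable M (%x. (norm (f x))\<^sup>2)"
 proof (rule Bochner_Integration.integrable_bound[of _ "%x. C\<^sup>2 * (norm (g x))\<^sup>2"])
  show "integrable M (%x. C\<^sup>2 * (norm (g x))\<^sup>2)"
   by (rule integrable_mult_right[OF L2_spaceD(2)[OF assms(1)]])
  show "(%x. (norm (f x))\<^sup>2) \<in> borel_measurable M" using assms(2) by measurable
  show "AE x in M. norm ((norm (f x))\<^sup>2) <= norm (C\<^sup>2 * (norm (g x))\<^sup>2)"
   using assms(3)
  proof (rule eventually_mono)
   fix x assume "norm (f x) <= C * norm (g x)"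
   then have "(norm (f x))\<^sup>2 <= (C * norm (g x))\<^sup>2" by (intro power_mono) auto
   then show "norm ((norm (f x))\<^sup>2) <= norm (C\<^sup>2 * (norm (g x))\<^sup>2)" by (simp add: power_mult_distrib)
  qed
 qed
 with assms(2) show ?thesis by (simp add: L2_space_def)
qed

lemma L2_combine:
 assumes f: "f \<in> L2_space M" and g: "g \<in> L2_space M"
 shows "(%x. a *\<^sub>R f x + b *\<^sub>R g x) \<in> L2_space M"
proof -
 note m = L2_spaceD(1)[OF f] L2_spaceD(1)[OF g]
 have mm: "(%x. a *\<^sub>R f x + b *\<^sub>R g x) \<in> borel_measurable M" using m by measurable
 have eq: "(norm (a *\<^sub>R f x + b *\<^sub>R g x))\<^sup>2 = a\<^sup>2 * (norm (f x))\<^sup>2 + 2 * a * b * (f x \<bullet> g x) + b\<^sup>2 * (norm (g x))\<^sup>2" for x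
  unfolding power2_norm_eq_inner by (simp add: inner_add_left inner_add_right inner_commute power2_eq_square algebra_simps)
 have "integrable M (%x. (norm (a *\<^sub>R f x + b *\<^sub>R g x))\<^sup>2)"
  unfolding eq by (intro Bochner_Integration.integrable_add integrable_mult_right L2_spaceD(2) L2_inner_integrable f g)
 with mm show ?thesis by (simp add: L2_space_def)
qed

lemma L2_diff: "f \<in> L2_space M ==> g \<in> L2_space M ==> (%x. f x - g x) \<in> L2_space M"
 using L2_combine[of f M g 1 "-1"] by simp

lemma L2_add: "f \<in> L2_space M ==> g \<in> L2_space M ==> (%x. f x + g x) \<in> L2_space M"
 using L2_combine[of f M g 1 1] by simp

lemma L2_zero: "(%x. 0) \<in> L2_space M"
 by (simp add: L2_space_def)

lemma L2_inner_combine_left: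
 assumes "f \<in> L2_space M" "g \<in> L2_space M" "h \<in> L2_space M"
 shows "L2_inner M (%x. a *\<^sub>R f x + b *\<^sub>R g x) h = a * L2_inner M f h + b * L2_inner M g h"
proof -
 have "L2_inner M (%x. a *\<^sub>R f x + b *\<^sub>R g x) h = (\<integral>x. a * (f x \<bullet> h x) + b * (g x \<bullet> h x) \<partial>M)"
  unfolding L2_inner_def by (simp add: inner_add_left)
 also have "\<dots> = (\<integral>x. a * (f x \<bullet> h x) \<partial>M) + (\<integral>x. b * (g x \<bullet> h x) \<partial>M)"
  by (intro Bochner_Integration.integral_add integrable_mult_right L2_inner_integrable assms)
 finally show ?thesis unfolding L2_inner_def by simp
qed

lemma L2_inner_commute: "L2_inner M f g = L2_inner M g f"
 unfolding L2_inner_def by (simp add: inner_commute)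

lemma L2_inner_combine_right:
 assumes "f \<in> L2_space M" "g \<in> L2_space M" "h \<in> L2_space M"
 shows "L2_inner M h (%x. a *\<^sub>R f x + b *\<^sub>R g x) = a * L2_inner M h f + b * L2_inner M h g"
 using L2_inner_combine_left[OF assms] by (simp only: L2_inner_commute[of M h])

lemma L2_inner_diff_left:
 assumes "f \<in> L2_space M" "g \<in> L2_space M" "h \<in> L2_space M"
 shows "L2_inner M (%x. f x - g x) h = L2_inner M f h - L2_inner M g h"
 using L2_inner_combine_left[OF assms, of 1 "-1"] by simp

lemma L2_inner_diff_right:
 assumes "f \<in> L2_space M" "g \<in> L2_space M" "h \<in> L2_space M"
 shows "L2_inner M h (%x. f x - g x) = L2_inner M h f - L2_inner M h g"
 using L2_inner_combine_right[OF assms, of 1 "-1"] by simp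

lemma L2_norm_sq: "(L2_norm_on M f)\<^sup>2 = L2_inner M f f"
 unfolding L2_norm_on_def L2_inner_def power2_norm_eq_inner
 by (simp add: Bochner_Integration.integral_nonneg)

lemma L2_norm_nonneg: "0 <= L2_norm_on M f"
 unfolding L2_norm_on_def by (simp add: Bochner_Integration.integral_nonneg)

lemma L2_inner_self_nonneg: "0 <= L2_inner M f f"
 unfolding L2_norm_sq[symmetric] by simp

lemma square_le_if_quadratic_nonneg:
 fixes A B C :: real
 assumes "!!t. 0 <= A + 2 * t * B + t\<^sup>2 * C" "0 <= C"
 shows "B\<^sup>2 <= A * C"
proof (cases "C = 0")
 case True
 have "B = 0"
 proof (rule ccontr)
  assume "B \<noteq> 0"
  then have "2 * (- (A + 1) / (2 * B)) * B = - (A + 1)" by simp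
  then show False using assms(1)[of "- (A + 1) / (2 * B)"] True by simp
 qed
 then show ?thesis using True by simp
next
 case False
 then have C: "0 < C" using assms(2) by simp
 have "0 <= A + 2 * (- B / C) * B + (- B / C)\<^sup>2 * C" by (rule assms(1))
 also have "\<dots> = A - B\<^sup>2 / C"
  using C by (simp add: power2_eq_square field_simps)
 finally show ?thesis using C by (simp add: field_simps)
qed

lemma L2_Cauchy_Schwarz:
 assumes f: "f \<in> L2_space M" and g: "g \<in> L2_space M"
 shows "\<bar>L2_inner M f g\<bar> <= L2_norm_on M f * L2_norm_on M g"
proof -
 have "0 <= L2_inner M f f + 2 * t * L2_inner M f g + t\<^sup>2 * L2_inner M g g" for t
 proof -
  have fg: "(%x. 1 *\<^sub>R f x + t *\<^sub>R g x) \<in> L2_space M" by (rule L2_combine[OF f g])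
  have "0 <= L2_inner M (%x. 1 *\<^sub>R f x + t *\<^sub>R g x) (%x. 1 *\<^sub>R f x + t *\<^sub>R g x)"
   by (rule L2_inner_self_nonneg)
  then show ?thesis
   unfolding L2_inner_combine_left[OF f g fg] L2_inner_combine_right[OF f g f] L2_inner_combine_right[OF f g g]
   by (simp add: L2_inner_commute[of M g f] power2_eq_square algebra_simps)
 qed
 from square_le_if_quadratic_nonneg[OF this L2_inner_self_nonneg]
 have "(L2_inner M f g)\<^sup>2 <= (L2_norm_on M f * L2_norm_on M g)\<^sup>2"
  by (simp add: power_mult_distrib L2_norm_sq)
 then show ?thesis
  using L2_norm_nonneg[of M f] L2_norm_nonneg[of M g] by (simp add: abs_le_square_iff[symmetric])
qed

lemma L2_norm_add_le:
 assumes f: "f \<in> L2_space M" and g: "g \<in> L2_space M"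
 shows "L2_norm_on M (%x. f x + g x) <= L2_norm_on M f + L2_norm_on M g"
proof (rule power2_le_imp_le)
 have fg: "(%x. 1 *\<^sub>R f x + 1 *\<^sub>R g x) \<in> L2_space M" by (rule L2_combine[OF f g])
 have "L2_inner M (%x. 1 *\<^sub>R f x + 1 *\<^sub>R g x) (%x. 1 *\<^sub>R f x + 1 *\<^sub>R g x)
   = L2_inner M f f + 2 * L2_inner M f g + L2_inner M g g"
  unfolding L2_inner_combine_left[OF f g fg] L2_inner_combine_right[OF f g f] L2_inner_combine_right[OF f g g]
  by (simp add: L2_inner_commute[of M g f])
 also have "\<dots> <= (L2_norm_on M f)\<^sup>2 + 2 * (L2_norm_on M f * L2_norm_on M g) + (L2_norm_on M g)\<^sup>2"
  using L2_Cauchy_Schwarz[OF f g] by (simp add: L2_norm_sq)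
 finally show "(L2_norm_on M (%x. f x + g x))\<^sup>2 <= (L2_norm_on M f + L2_norm_on M g)\<^sup>2"
  by (simp add: L2_norm_sq power2_sum)
 show "0 <= L2_norm_on M f + L2_norm_on M g" by (simp add: L2_norm_nonneg)
qed

lemma L2_norm_diff_commute: "L2_norm_on M (%x. f x - g x) = L2_norm_on M (%x. g x - f x)"
 unfolding L2_norm_on_def by (simp add: norm_minus_commute)

lemma L2_norm_triangle:
 assumes "f \<in> L2_space M" "g \<in> L2_space M" "h \<in> L2_space M"
 shows "L2_norm_on M (%x. f x - h x) <= L2_norm_on M (%x. f x - g x) + L2_norm_on M (%x. g x - h x)"
 using L2_norm_add_le[OF L2_diff[OF assms(1,2)] L2_diff[OF assms(2,3)]] by simp

lemma L2_norm_reverse_triangle: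
 assumes "f \<in> L2_space M" "g \<in> L2_space M"
 shows "L2_norm_on M f <= L2_norm_on M g + L2_norm_on M (%x. f x - g x)"
 using L2_norm_add_le[OF assms(2) L2_diff[OF assms]] by simp

lemma L2_norm_cong_AE:
 assumes "f \<in> borel_measurable M" "g \<in> borel_measurable M" "AE x in M. f x = g x"
 shows "L2_norm_on M f = L2_norm_on M g"
proof -
 have "(\<integral>x. (norm (f x))\<^sup>2 \<partial>M) = (\<integral>x. (norm (g x))\<^sup>2 \<partial>M)"
 proof (rule integral_cong_AE)
  show "(%x. (norm (f x))\<^sup>2) \<in> borel_measurable M" "(%x. (norm (g x))\<^sup>2) \<in> borel_measurable M"
   using assms(1,2) by measurable
  show "AE x in M. (norm (f x))\<^sup>2 = (norm (g x))\<^sup>2" using assms(3) by (rule eventually_mono) simp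
 qed
 then show ?thesis unfolding L2_norm_on_def by simp
qed

lemma L2_norm_zero_iff:
 assumes "f \<in> L2_space M"
 shows "L2_norm_on M f = 0 \<longleftrightarrow> (AE x in M. f x = 0)"
 unfolding L2_norm_on_def using integral_nonneg_eq_0_iff_AE[OF L2_spaceD(2)[OF assms]] by simp

lemma (in finite_measure) L2_bounded:
 assumes "f \<in> borel_measurable M" "AE x in M. norm (f x) <= B"
 shows "f \<in> L2_space M"
proof -
 have "integrable M (%x. (norm (f x))\<^sup>2)"
 proof (rule integrable_const_bound)
  show "AE x in M. norm ((norm (f x))\<^sup>2) <= B\<^sup>2"
   using assms(2) by (rule eventually_mono) (simp add: power_mono)
  show "(%x. (norm (f x))\<^sup>2) \<in> borel_measurable M" using assms(1) by measurable
 qed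
 with assms(1) show ?thesis by (simp add: L2_space_def)
qed

lemma (in finite_measure) L2_imp_L1:
 assumes f: "f \<in> L2_space M"
 shows "integrable M f" "(\<integral>x. norm (f x) \<partial>M) <= sqrt (measure M (space M)) * L2_norm_on M f"
proof -
 have n: "(%x. norm (f x)) \<in> L2_space M"
  using L2_spaceD[OF f] by (simp add: L2_space_def)
 have one: "(%x. 1::real) \<in> L2_space M" by (rule L2_bounded[where B=1]) auto
 have "integrable M (%x. norm (f x))"
  using L2_inner_integrable[OF n one] by simp
 then show "integrable M f" using L2_spaceD(1)[OF f] by (simp add: integrable_norm_iff)
 have "\<bar>L2_inner M (%x. norm (f x)) (%x. 1)\<bar> <= L2_norm_on M (%x. norm (f x)) * L2_norm_on M (%x. 1::real)"
  by (rule L2_Cauchy_Schwarz[OF n one])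
 moreover have "L2_norm_on M (%x. norm (f x)) = L2_norm_on M f" by (simp add: L2_norm_on_def)
 moreover have "L2_norm_on M (%x. 1::real) = sqrt (measure M (space M))" by (simp add: L2_norm_on_def)
 ultimately show "(\<integral>x. norm (f x) \<partial>M) <= sqrt (measure M (space M)) * L2_norm_on M f"
  by (simp add: L2_inner_def mult.commute)
qed

text \<open>
  The core of the Riesz--Fischer theorem: a geometric rate of convergence makes the telescoping
  series of increments converge almost everywhere.
\<close>

lemma (in finite_measure) L2_complete_aux:
 fixes H :: "nat => 'a => 'b::euclidean_space"
 assumes H: "!!n. H n \<in> L2_space M"
  and fast: "!!n j. n <= j ==> L2_norm_on M (%x. H n x - H j x) <= (1/2) ^ n"
 shows "\<exists>G\<in>L2_space M. \<forall>n. L2_norm_on M (%x. H n x - G x) <= (1/2) ^ n"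
proof -
 have m[measurable]: "H n \<in> borel_measurable M" for n by (rule L2_spaceD(1)[OF H])
 define s where "s = sqrt (measure M (space M))"
 have s0: "0 <= s" by (simp add: s_def)
 have D: "(\<integral>\<^sup>+x. norm (H n x - H (Suc n) x) \<partial>M) <= ennreal (s * (1/2) ^ n)" for n
 proof -
  have "(\<integral>x. norm (H n x - H (Suc n) x) \<partial>M) <= s * L2_norm_on M (%x. H n x - H (Suc n) x)"
   unfolding s_def by (rule L2_imp_L1(2)[OF L2_diff[OF H H]])
  also have "\<dots> <= s * (1/2) ^ n" using fast[of n "Suc n"] s0 by (intro mult_left_mono) auto
  finally have "(\<integral>x. norm (H n x - H (Suc n) x) \<partial>M) <= s * (1/2) ^ n" .
  moreover have "(\<integral>\<^sup>+x. norm (H n x - H (Suc n) x) \<partial>M) = ennreal (\<integral>x. norm (H n x - H (Suc n) x) \<partial>M)"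
   by (rule nn_integral_eq_integral[OF integrable_norm[OF L2_imp_L1(1)[OF L2_diff[OF H H]]]]) simp
  ultimately show ?thesis by (simp add: ennreal_leI)
 qed
 have "(\<integral>\<^sup>+x. (\<Sum>n. ennreal (norm (H n x - H (Suc n) x))) \<partial>M) = (\<Sum>n. \<integral>\<^sup>+x. norm (H n x - H (Suc n) x) \<partial>M)"
  by (rule nn_integral_suminf) measurable
 also have "\<dots> <= (\<Sum>n. ennreal (s * (1/2) ^ n))"
  by (intro suminf_le D summableI)
 also have "\<dots> = ennreal (\<Sum>n. s * (1/2) ^ n)"
  using s0 by (intro suminf_ennreal2 summable_mult) (auto intro: summable_geometric)
 also have "\<dots> < \<infinity>" by simp
 finally have "AE x in M. (\<Sum>n. ennreal (norm (H n x - H (Suc n) x))) \<noteq> \<infinity>"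
  by (intro nn_integral_PInf_AE) auto
 then have conv: "AE x in M. (%n. H n x) \<longlonglongrightarrow> lim (%n. H n x)"
 proof (rule eventually_mono)
  fix x assume "(\<Sum>n. ennreal (norm (H n x - H (Suc n) x))) \<noteq> \<infinity>"
  then have "summable (%n. norm (H n x - H (Suc n) x))"
   using summable_suminf_not_top[of "%n. norm (H n x - H (Suc n) x)"] by simp
  then have "summable (%n. norm (H (Suc n) x - H n x))"
   by (subst norm_minus_commute)
  then have "summable (%n. H (Suc n) x - H n x)"
   by (rule summable_norm_cancel)
  then have "(%n. \<Sum>i<n. H (Suc i) x - H i x) \<longlonglongrightarrow> (\<Sum>i. H (Suc i) x - H i x)"
   by (rule summable_LIMSEQ)
  moreover have "(\<Sum>i<n. H (Suc i) x - H i x) = H n x - H 0 x" for n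
   using sum_lessThan_telescope[of "%i. H i x" n] by simp
  ultimately have "(%n. (H n x - H 0 x) + H 0 x) \<longlonglongrightarrow> (\<Sum>i. H (Suc i) x - H i x) + H 0 x"
   by (intro tendsto_add tendsto_const) simp
  then have "convergent (%n. H n x)"
   unfolding diff_add_cancel by (rule convergentI)
  then show "(%n. H n x) \<longlonglongrightarrow> lim (%n. H n x)" by (simp add: convergent_LIMSEQ_iff)
 qed
 define G where "G x = lim (%n. H n x)" for x
 have mG[measurable]: "G \<in> borel_measurable M" unfolding G_def by measurable
 have bound: "(\<integral>\<^sup>+x. ennreal ((norm (H n x - G x))\<^sup>2) \<partial>M) <= ennreal (((1/2) ^ n)\<^sup>2)" for n
 proof -
  have "(\<integral>\<^sup>+x. ennreal ((norm (H n x - G x))\<^sup>2) \<partial>M) = (\<integral>\<^sup>+x. liminf (%j. ennreal ((norm (H n x - H j x))\<^sup>2)) \<partial>M)"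
  proof (rule nn_integral_cong_AE)
   show "AE x in M. ennreal ((norm (H n x - G x))\<^sup>2) = liminf (%j. ennreal ((norm (H n x - H j x))\<^sup>2))"
    using conv
   proof (rule eventually_mono)
    fix x assume "(%n. H n x) \<longlonglongrightarrow> lim (%n. H n x)"
    then have "(%j. ennreal ((norm (H n x - H j x))\<^sup>2)) \<longlonglongrightarrow> ennreal ((norm (H n x - G x))\<^sup>2)"
     unfolding G_def by (intro tendsto_intros)
    then show "ennreal ((norm (H n x - G x))\<^sup>2) = liminf (%j. ennreal ((norm (H n x - H j x))\<^sup>2))"
     by (rule lim_imp_Liminf[OF sequentially_bot, symmetric])
   qed
  qed
  also have "\<dots> <= liminf (%j. \<integral>\<^sup>+x. ennreal ((norm (H n x - H j x))\<^sup>2) \<partial>M)"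
   by (rule nn_integral_liminf) measurable
  also have "\<dots> <= limsup (%j. \<integral>\<^sup>+x. ennreal ((norm (H n x - H j x))\<^sup>2) \<partial>M)"
   by (rule Liminf_le_Limsup) simp
  also have "\<dots> <= ennreal (((1/2) ^ n)\<^sup>2)"
  proof (rule Limsup_bounded, rule eventually_sequentiallyI[of n])
   fix j assume "n <= j"
   have "(\<integral>\<^sup>+x. ennreal ((norm (H n x - H j x))\<^sup>2) \<partial>M) = ennreal (\<integral>x. (norm (H n x - H j x))\<^sup>2 \<partial>M)"
    by (rule nn_integral_eq_integral[OF L2_spaceD(2)[OF L2_diff[OF H H]]]) simp
   also have "(\<integral>x. (norm (H n x - H j x))\<^sup>2 \<partial>M) = (L2_norm_on M (%x. H n x - H j x))\<^sup>2"
    by (simp add: L2_norm_on_def Bochner_Integration.integral_nonneg)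
   also have "ennreal \<dots> <= ennreal (((1/2) ^ n)\<^sup>2)"
    using fast[OF \<open>n <= j\<close>] L2_norm_nonneg by (intro ennreal_leI power_mono)
   finally show "(\<integral>\<^sup>+x. ennreal ((norm (H n x - H j x))\<^sup>2) \<partial>M) <= ennreal (((1/2) ^ n)\<^sup>2)" .
  qed
  finally show ?thesis .
 qed
 have dL2: "(%x. H n x - G x) \<in> L2_space M" for n
 proof -
  have "integrable M (%x. (norm (H n x - G x))\<^sup>2)"
   using bound[of n] by (intro integrableI_bounded) (auto intro: le_less_trans)
  then show ?thesis by (simp add: L2_space_def)
 qed
 have "(%x. H 0 x - (H 0 x - G x)) \<in> L2_space M" by (rule L2_diff[OF H dL2])
 then have G: "G \<in> L2_space M" by simp
 have "L2_norm_on M (%x. H n x - G x) <= (1/2) ^ n" for n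
 proof -
  have "ennreal (\<integral>x. (norm (H n x - G x))\<^sup>2 \<partial>M) <= ennreal (((1/2) ^ n)\<^sup>2)"
   using bound[of n] nn_integral_eq_integral[OF L2_spaceD(2)[OF dL2[of n]]] by simp
  then have "(\<integral>x. (norm (H n x - G x))\<^sup>2 \<partial>M) <= ((1/2) ^ n)\<^sup>2" by (simp add: ennreal_le_iff)
  then show ?thesis unfolding L2_norm_on_def by (intro real_le_lsqrt) auto
 qed
 with G show ?thesis by blast
qed

lemma (in finite_measure) L2_complete:
 fixes F :: "nat => 'a => 'b::euclidean_space"
 assumes F: "!!n. F n \<in> L2_space M"
  and cauchy: "!!e. 0 < e ==> \<exists>N. \<forall>m\<ge>N. \<forall>n\<ge>N. L2_norm_on M (%x. F m x - F n x) <= e"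
 obtains G where "G \<in> L2_space M" "(%n. L2_norm_on M (%x. F n x - G x)) \<longlonglongrightarrow> 0"
proof -
 have "\<forall>k. \<exists>N. \<forall>m\<ge>N. \<forall>n\<ge>N. L2_norm_on M (%x. F m x - F n x) <= (1/2) ^ k"
  using cauchy by simp
 then obtain N where N: "\<forall>k. \<forall>m\<ge>N k. \<forall>n\<ge>N k. L2_norm_on M (%x. F m x - F n x) <= (1/2) ^ k"
  using choice[of "%k N. \<forall>m\<ge>N. \<forall>n\<ge>N. L2_norm_on M (%x. F m x - F n x) <= (1/2) ^ k"] by blast
 define r where "r k = (\<Sum>i\<le>k. N i)" for k
 have rN: "N k <= r j" if "k <= j" for k j
  unfolding r_def using that by (intro member_le_sum) auto
 have "\<exists>G\<in>L2_space M. \<forall>n. L2_norm_on M (%x. F (r n) x - G x) <= (1/2) ^ n"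
  by (rule L2_complete_aux[OF F]) (use N rN in blast)
 then obtain G where G: "G \<in> L2_space M" "!!n. L2_norm_on M (%x. F (r n) x - G x) <= (1/2) ^ n" by blast
 have "(%n. L2_norm_on M (%x. F n x - G x)) \<longlonglongrightarrow> 0"
 proof (rule LIMSEQ_I)
  fix e :: real assume "0 < e"
  then have "\<exists>k. (1/2) ^ k < e / 2" by (intro real_arch_pow_inv) auto
  then obtain k where k: "(1/2 :: real) ^ k < e / 2" ..
  have "norm (L2_norm_on M (%x. F n x - G x) - 0) < e" if "n \<ge> N k" for n
  proof -
   have "L2_norm_on M (%x. F n x - G x) <= L2_norm_on M (%x. F n x - F (r k) x) + L2_norm_on M (%x. F (r k) x - G x)"
    by (rule L2_norm_triangle[OF F F G(1)])
   moreover have "L2_norm_on M (%x. F n x - F (r k) x) <= (1/2) ^ k" using N that rN[of k k] by blast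
   ultimately show ?thesis using G(2)[of k] k L2_norm_nonneg[of M "%x. F n x - G x"] by simp
  qed
  then show "\<exists>no. \<forall>n\<ge>no. norm (L2_norm_on M (%x. F n x - G x) - 0) < e" by blast
 qed
 with G(1) show thesis by (rule that)
qed

lemma zero_if_quadratic_nonneg:
 fixes B C :: real
 assumes "!!t. 0 <= 2 * t * B + t\<^sup>2 * C" "0 <= C"
 shows "B = 0"
proof -
 have "B\<^sup>2 <= 0 * C" by (rule square_le_if_quadratic_nonneg) (use assms in auto)
 then show ?thesis by simp
qed

text \<open>Projection onto a closed subspace, by minimising the distance.\<close>

lemma (in finite_measure) L2_projection:
 fixes W :: "('a => 'b::euclidean_space) set"
 assumes W: "W \<subseteq> L2_space M" "(%x. 0) \<in> W"
  and lin: "!!f g a b. f \<in> W ==> g \<in> W ==> (%x. a *\<^sub>R f x + b *\<^sub>R g x) \<in> W"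
  and closed: "!!F G. (!!n::nat. F n \<in> W) ==> G \<in> L2_space M ==> (%n. L2_norm_on M (%x. F n x - G x)) \<longlonglongrightarrow> 0 ==> G \<in> W"
  and f: "f \<in> L2_space M"
 shows "\<exists>v\<in>W. \<forall>w\<in>W. L2_inner M v w = L2_inner M f w"
proof -
 let ?N = "%g. L2_norm_on M (%x. f x - g x)"
 define d where "d = (INF w\<in>W. (?N w)\<^sup>2)"
 have bdd: "bdd_below ((%w. (?N w)\<^sup>2) ` W)" by (rule bdd_belowI[of _ 0]) auto
 have d_le: "d <= (?N w)\<^sup>2" if "w \<in> W" for w
  unfolding d_def by (rule cINF_lower[OF bdd that])
 have "\<exists>w\<in>W. (?N w)\<^sup>2 < d + inverse (real (Suc n))" for n
 proof -
  have "d < d + inverse (real (Suc n))" by simp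
  then show ?thesis unfolding d_def using W(2) by (subst (asm) cINF_less_iff[OF _ bdd]) auto
 qed
 then have "\<forall>n. \<exists>w. w \<in> W \<and> (?N w)\<^sup>2 < d + inverse (real (Suc n))" by blast
 then obtain v where v: "\<forall>n. v n \<in> W \<and> (?N (v n))\<^sup>2 < d + inverse (real (Suc n))"
  using choice[of "%n w. w \<in> W \<and> (?N w)\<^sup>2 < d + inverse (real (Suc n))"] by blast
 have vW: "v n \<in> W" and vd: "(?N (v n))\<^sup>2 < d + inverse (real (Suc n))" for n using v by auto
 have vL: "w \<in> L2_space M" if "w \<in> W" for w using that W(1) by blast
 have para: "(L2_norm_on M (%x. v m x - v n x))\<^sup>2 <= 2 * inverse (real (Suc m)) + 2 * inverse (real (Suc n))" for m n
 proof -
  let ?a = "%x. f x - v m x" and ?b = "%x. f x - v n x"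
  let ?c = "%x. (1/2) *\<^sub>R v m x + (1/2) *\<^sub>R v n x"
  have a: "?a \<in> L2_space M" and b: "?b \<in> L2_space M" by (rule L2_diff[OF f vL[OF vW]])+
  have "(%x. v m x - v n x) = (%x. (-1) *\<^sub>R ?a x + 1 *\<^sub>R ?b x)" by (auto simp: fun_eq_iff)
  then have 1: "(L2_norm_on M (%x. v m x - v n x))\<^sup>2 = L2_inner M ?a ?a - 2 * L2_inner M ?a ?b + L2_inner M ?b ?b"
   unfolding L2_norm_sq
   by (simp only: L2_inner_combine_left[OF a b L2_combine[OF a b]] L2_inner_combine_right[OF a b a] L2_inner_combine_right[OF a b b])
    (simp add: L2_inner_commute[of M ?b ?a])
  have "(%x. f x - ?c x) = (%x. (1/2) *\<^sub>R ?a x + (1/2) *\<^sub>R ?b x)"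
  proof
   fix x
   have "f x = (1/2) *\<^sub>R f x + (1/2) *\<^sub>R f x" by (simp flip: scaleR_add_left)
   then show "f x - ?c x = (1/2) *\<^sub>R ?a x + (1/2) *\<^sub>R ?b x" by (simp add: scaleR_diff_right)
  qed
  then have 2: "4 * (?N ?c)\<^sup>2 = L2_inner M ?a ?a + 2 * L2_inner M ?a ?b + L2_inner M ?b ?b"
   unfolding L2_norm_sq
   by (simp only: L2_inner_combine_left[OF a b L2_combine[OF a b]] L2_inner_combine_right[OF a b a] L2_inner_combine_right[OF a b b])
    (simp add: L2_inner_commute[of M ?b ?a] field_simps)
  have 3: "L2_inner M ?a ?a < d + inverse (real (Suc m))" "L2_inner M ?b ?b < d + inverse (real (Suc n))"
   using vd[of m] vd[of n] by (simp_all only: L2_norm_sq)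
  have "d <= (?N ?c)\<^sup>2" by (rule d_le[OF lin[OF vW vW]])
  then show ?thesis using 1 2 3 by linarith
 qed
 have cauchy: "\<exists>N. \<forall>m\<ge>N. \<forall>n\<ge>N. L2_norm_on M (%x. v m x - v n x) <= e" if e: "0 < e" for e
 proof -
  have "\<forall>\<^sub>F n in sequentially. inverse (real (Suc n)) < e\<^sup>2 / 4"
   using e by (intro order_tendstoD(2)[OF LIMSEQ_inverse_real_of_nat]) simp
  then obtain N where N: "!!n. n \<ge> N ==> inverse (real (Suc n)) < e\<^sup>2 / 4"
   unfolding eventually_sequentially by blast
  have "L2_norm_on M (%x. v m x - v n x) <= e" if "m \<ge> N" "n \<ge> N" for m n
  proof (rule power2_le_imp_le)
   show "(L2_norm_on M (%x. v m x - v n x))\<^sup>2 <= e\<^sup>2"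
    using para[of m n] N[OF that(1)] N[OF that(2)] by linarith
  qed (use e in simp)
  then show ?thesis by blast
 qed
 obtain G where G: "G \<in> L2_space M" "(%n. L2_norm_on M (%x. v n x - G x)) \<longlonglongrightarrow> 0"
  by (rule L2_complete[OF vL[OF vW] cauchy])
 have GW: "G \<in> W" by (rule closed[OF vW G])
 have NG: "(?N G)\<^sup>2 <= d"
 proof (rule LIMSEQ_le_const)
  have "(%n. (sqrt (d + inverse (real (Suc n))) + L2_norm_on M (%x. v n x - G x))\<^sup>2) \<longlonglongrightarrow> (sqrt (d + 0) + 0)\<^sup>2"
   by (intro tendsto_intros G(2) LIMSEQ_inverse_real_of_nat)
  moreover have "0 <= d" unfolding d_def using W(2) by (intro cINF_greatest) auto
  ultimately show "(%n. (sqrt (d + inverse (real (Suc n))) + L2_norm_on M (%x. v n x - G x))\<^sup>2) \<longlonglongrightarrow> d" by simp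
  show "\<exists>N. \<forall>n\<ge>N. (?N G)\<^sup>2 <= (sqrt (d + inverse (real (Suc n))) + L2_norm_on M (%x. v n x - G x))\<^sup>2"
  proof (intro exI allI impI power_mono)
   fix n
   have "?N (v n) <= sqrt (d + inverse (real (Suc n)))"
    using vd[of n] by (intro real_le_rsqrt) simp
   then show "?N G <= sqrt (d + inverse (real (Suc n))) + L2_norm_on M (%x. v n x - G x)"
    using L2_norm_triangle[OF f vL[OF vW[of n]] G(1)] by linarith
  qed (rule L2_norm_nonneg)
 qed
 have "L2_inner M G w = L2_inner M f w" if w: "w \<in> W" for w
 proof -
  let ?a = "%x. f x - G x"
  have a: "?a \<in> L2_space M" by (rule L2_diff[OF f G(1)])
  note wL = vL[OF w]
  have "L2_inner M ?a w = 0"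
  proof (rule zero_if_quadratic_nonneg)
   show "0 <= L2_inner M w w" by (rule L2_inner_self_nonneg)
   fix t
   have "(%x. f x - (1 *\<^sub>R G x + (- t) *\<^sub>R w x)) = (%x. 1 *\<^sub>R ?a x + t *\<^sub>R w x)" by (auto simp: fun_eq_iff)
   then have "(?N (%x. 1 *\<^sub>R G x + (- t) *\<^sub>R w x))\<^sup>2 = L2_inner M ?a ?a + 2 * t * L2_inner M ?a w + t\<^sup>2 * L2_inner M w w"
    unfolding L2_norm_sq
    by (simp only: L2_inner_combine_left[OF a wL L2_combine[OF a wL]] L2_inner_combine_right[OF a wL a] L2_inner_combine_right[OF a wL wL])
     (simp add: L2_inner_commute[of M w ?a] power2_eq_square algebra_simps)
   moreover have "d <= (?N (%x. 1 *\<^sub>R G x + (- t) *\<^sub>R w x))\<^sup>2" by (rule d_le[OF lin[OF GW w]])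
   moreover have "L2_inner M ?a ?a <= d" using NG by (simp only: L2_norm_sq)
   ultimately show "0 <= 2 * t * L2_inner M ?a w + t\<^sup>2 * L2_inner M w w" by linarith
  qed
  then show ?thesis using L2_inner_diff_left[OF f G(1) wL] by simp
 qed
 then show ?thesis using GW by blast
qed

section \<open>The Sobolev space \<open>H\<^sup>1\<close> and its Riesz map\<close>

lemma weak_gradient_has_weak_gradient:
 "has_weak_gradient S f g ==> has_weak_gradient S f (weak_gradient S f)"
 unfolding weak_gradient_def by (rule someI[where P="has_weak_gradient S f"])

lemma borel_measurable_lebesgue_on_AE:
 fixes f g :: "'a::euclidean_space => 'b::euclidean_space"
 assumes S: "S \<in> sets lebesgue" and f: "f \<in> borel_measurable (lebesgue_on S)" and eq: "AE x in lebesgue_on S. f x = g x"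
 shows "g \<in> borel_measurable (lebesgue_on S)"
proof -
 have S': "S \<inter> space lebesgue \<in> sets lebesgue" using S by simp
 have 1: "(%x. indicator S x *\<^sub>R f x) \<in> borel_measurable lebesgue"
  using f unfolding borel_measurable_restrict_space_iff[OF S'] .
 have "AE x in lebesgue. x \<in> S --> f x = g x" using eq unfolding AE_lebesgue_on_iff[OF S] .
 then have "AE x in lebesgue. indicator S x *\<^sub>R f x = indicator S x *\<^sub>R g x"
  by (rule eventually_mono) (auto simp: indicator_def)
 from borel_measurable_AE[OF 1 this] show ?thesis
  unfolding borel_measurable_restrict_space_iff[OF S'] .
qed

lemma L2_cong_AE:
 fixes f g :: "'a::euclidean_space => 'b::euclidean_space"
 assumes S: "S \<in> sets lebesgue" and f: "f \<in> L2_space (lebesgue_on S)" and eq: "AE x in lebesgue_on S. f x = g x"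
 shows "g \<in> L2_space (lebesgue_on S)"
proof (rule L2_bounded_by[OF f, where C=1])
 show "g \<in> borel_measurable (lebesgue_on S)" by (rule borel_measurable_lebesgue_on_AE[OF S L2_spaceD(1)[OF f] eq])
 show "AE x in lebesgue_on S. norm (g x) <= 1 * norm (f x)" using eq by (rule eventually_mono) simp
qed

lemma L2_Pair:
 fixes f :: "'a => 'b::euclidean_space" and g :: "'a => 'c::euclidean_space"
 assumes "f \<in> L2_space M" "g \<in> L2_space M"
 shows "(%x. (f x, g x)) \<in> L2_space M"
  "(L2_norm_on M (%x. (f x, g x)))\<^sup>2 = (L2_norm_on M f)\<^sup>2 + (L2_norm_on M g)\<^sup>2"
proof -
 have eq: "(norm (f x, g x))\<^sup>2 = (norm (f x))\<^sup>2 + (norm (g x))\<^sup>2" for x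
  by (simp add: norm_Pair)
 have "(%x. (f x, g x)) \<in> borel_measurable M"
  using L2_spaceD(1)[OF assms(1)] L2_spaceD(1)[OF assms(2)] by (rule borel_measurable_Pair)
 then show "(%x. (f x, g x)) \<in> L2_space M"
  using L2_spaceD(2)[OF assms(1)] L2_spaceD(2)[OF assms(2)] unfolding L2_space_def by (simp add: eq)
 have "(\<integral>x. (norm (f x, g x))\<^sup>2 \<partial>M) = (\<integral>x. (norm (f x))\<^sup>2 \<partial>M) + (\<integral>x. (norm (g x))\<^sup>2 \<partial>M)"
  unfolding eq by (rule Bochner_Integration.integral_add[OF L2_spaceD(2)[OF assms(1)] L2_spaceD(2)[OF assms(2)]])
 then show "(L2_norm_on M (%x. (f x, g x)))\<^sup>2 = (L2_norm_on M f)\<^sup>2 + (L2_norm_on M g)\<^sup>2"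
  unfolding L2_norm_on_def by (simp add: Bochner_Integration.integral_nonneg)
qed

lemma L2_fst_snd:
 fixes V :: "'a => 'b::euclidean_space \<times> 'c::euclidean_space"
 assumes "V \<in> L2_space M"
 shows "(%x. fst (V x)) \<in> L2_space M" "(%x. snd (V x)) \<in> L2_space M"
  "L2_norm_on M (%x. fst (V x)) <= L2_norm_on M V" "L2_norm_on M (%x. snd (V x)) <= L2_norm_on M V"
proof -
 have m: "V \<in> borel_measurable M" by (rule L2_spaceD(1)[OF assms])
 have "continuous_on UNIV (fst :: 'b \<times> 'c => 'b)" "continuous_on UNIV (snd :: 'b \<times> 'c => 'c)"
  by (intro continuous_intros)+
 then have "(fst :: 'b \<times> 'c => 'b) \<in> borel_measurable borel" "(snd :: 'b \<times> 'c => 'c) \<in> borel_measurable borel"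
  by (auto intro: borel_measurable_continuous_onI)
 then have mm: "(%x. fst (V x)) \<in> borel_measurable M" "(%x. snd (V x)) \<in> borel_measurable M"
  using m by (auto intro: measurable_compose)
 have b: "norm (fst p) <= 1 * norm p" "norm (snd p) <= 1 * norm p" for p :: "'b \<times> 'c"
  by (cases p, simp add: norm_fst_le norm_snd_le)+
 show 1: "(%x. fst (V x)) \<in> L2_space M" and 2: "(%x. snd (V x)) \<in> L2_space M"
  by (rule L2_bounded_by[OF assms mm(1), where C=1] L2_bounded_by[OF assms mm(2), where C=1], use b in auto)+
 have "(L2_norm_on M V)\<^sup>2 = (L2_norm_on M (%x. fst (V x)))\<^sup>2 + (L2_norm_on M (%x. snd (V x)))\<^sup>2"
  using L2_Pair(2)[OF 1 2] by simp
 then have "(L2_norm_on M (%x. fst (V x)))\<^sup>2 <= (L2_norm_on M V)\<^sup>2" "(L2_norm_on M (%x. snd (V x)))\<^sup>2 <= (L2_norm_on M V)\<^sup>2"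
  by auto
 then show "L2_norm_on M (%x. fst (V x)) <= L2_norm_on M V" "L2_norm_on M (%x. snd (V x)) <= L2_norm_on M V"
  by (auto intro: power2_le_imp_le L2_norm_nonneg)
qed

text \<open>
 A function in \<open>H\<^sup>1\<close> together with its weak gradient is one \<open>L\<^sup>2\<close> function with values in a product
 space; in this form \<open>H\<^sup>1\<close> is a closed subspace of \<open>L\<^sup>2\<close>.
\<close>

definition H1_graph :: "'a::euclidean_space set => ('a => real \<times> 'a) set" where
 "H1_graph S = {V \<in> L2_space (lebesgue_on S). has_weak_gradient S (%x. fst (V x)) (%x. snd (V x))}"

lemma H1_graphD:
 assumes "V \<in> H1_graph S"
 shows "V \<in> L2_space (lebesgue_on S)" "has_weak_gradient S (%x. fst (V x)) (%x. snd (V x))"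
 using assms by (simp_all add: H1_graph_def)

lemma H1_graph_PairI:
 assumes "f \<in> L2_space (lebesgue_on S)" "g \<in> L2_space (lebesgue_on S)" "has_weak_gradient S f g"
 shows "(%x. (f x, g x)) \<in> H1_graph S"
 using L2_Pair(1)[OF assms(1,2)] assms(3) by (simp add: H1_graph_def)

lemma H1_weak_gradient:
 assumes S: "open S" and f: "f \<in> H1 S"
 shows "f \<in> L2_space (lebesgue_on S)" "has_weak_gradient S f (weak_gradient S f)"
  "weak_gradient S f \<in> L2_space (lebesgue_on S)" "(%x. (f x, weak_gradient S f x)) \<in> H1_graph S"
proof -
 show 1: "f \<in> L2_space (lebesgue_on S)" using f by (simp add: H1_def)
 obtain g where g: "g \<in> L2_space (lebesgue_on S)" "has_weak_gradient S f g" using f by (auto simp: H1_def)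
 show 2: "has_weak_gradient S f (weak_gradient S f)" by (rule weak_gradient_has_weak_gradient[OF g(2)])
 show 3: "weak_gradient S f \<in> L2_space (lebesgue_on S)"
  by (rule L2_cong_AE[OF open_sets_lebesgue[OF S] g(1) has_weak_gradient_unique[OF S g(2) 2]])
 show "(%x. (f x, weak_gradient S f x)) \<in> H1_graph S" by (rule H1_graph_PairI[OF 1 3 2])
qed

lemma H1_graph_fst:
 assumes S: "open S" and V: "V \<in> H1_graph S"
 shows "(%x. fst (V x)) \<in> H1 S" "AE x in lebesgue_on S. weak_gradient S (%x. fst (V x)) x = snd (V x)"
  "H1_norm S (%x. fst (V x)) = L2_norm_on (lebesgue_on S) V"
proof -
 note L = L2_fst_snd[OF H1_graphD(1)[OF V]] and w = H1_graphD(2)[OF V]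
 show H: "(%x. fst (V x)) \<in> H1 S" using L(1,2) w unfolding H1_def by blast
 show eq: "AE x in lebesgue_on S. weak_gradient S (%x. fst (V x)) x = snd (V x)"
  by (rule has_weak_gradient_unique[OF S weak_gradient_has_weak_gradient[OF w] w])
 have "L2_norm_on (lebesgue_on S) (weak_gradient S (%x. fst (V x))) = L2_norm_on (lebesgue_on S) (%x. snd (V x))"
  by (rule L2_norm_cong_AE[OF L2_spaceD(1)[OF H1_weak_gradient(3)[OF S H]] L2_spaceD(1)[OF L(2)] eq])
 moreover have "(L2_norm_on (lebesgue_on S) (%x. fst (V x)))\<^sup>2 + (L2_norm_on (lebesgue_on S) (%x. snd (V x)))\<^sup>2
   = (L2_norm_on (lebesgue_on S) V)\<^sup>2"
  using L2_Pair(2)[OF L(1,2)] by simp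
 ultimately show "H1_norm S (%x. fst (V x)) = L2_norm_on (lebesgue_on S) V"
  unfolding H1_norm_def using L2_norm_nonneg[of "lebesgue_on S" V] by simp
qed

lemma H1_graph_combine:
 assumes S: "open S" and V: "V \<in> H1_graph S" and W: "W \<in> H1_graph S"
 shows "(%x. a *\<^sub>R V x + b *\<^sub>R W x) \<in> H1_graph S"
 using L2_combine[OF H1_graphD(1)[OF V] H1_graphD(1)[OF W], of a b]
  has_weak_gradient_combine[OF S H1_graphD(2)[OF V] H1_graphD(2)[OF W], of a b]
 by (simp add: H1_graph_def)

lemma H1_graph_closed:
 assumes S: "open S" "S \<in> lmeasurable" and F: "!!n. F n \<in> H1_graph S" and G: "G \<in> L2_space (lebesgue_on S)"
  and lim: "(%n. L2_norm_on (lebesgue_on S) (%x. F n x - G x)) \<longlonglongrightarrow> 0"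
 shows "G \<in> H1_graph S"
proof -
 let ?M = "lebesgue_on S"
 interpret finite_measure ?M by (rule finite_measure_lebesgue_on[OF S(2)])
 note FL = H1_graphD(1)[OF F]
 define c where "c = sqrt (measure ?M (space ?M))"
 have c: "0 <= c" by (simp add: c_def)
 have clim: "(%n. c * L2_norm_on ?M (%x. F n x - G x)) \<longlonglongrightarrow> 0"
  using tendsto_mult_right_zero[OF lim] by simp
 have D: "(%x. F n x - G x) \<in> L2_space ?M" for n by (rule L2_diff[OF FL G])
 have 1: "(\<integral>x. norm (fst (F n x) - fst (G x)) \<partial>?M) <= c * L2_norm_on ?M (%x. F n x - G x)" for n
 proof -
  have "(\<integral>x. norm (fst (F n x - G x)) \<partial>?M) <= c * L2_norm_on ?M (%x. fst (F n x - G x))"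
   unfolding c_def by (rule L2_imp_L1(2)[OF L2_fst_snd(1)[OF D]])
  also have "\<dots> <= c * L2_norm_on ?M (%x. F n x - G x)" by (rule mult_left_mono[OF L2_fst_snd(3)[OF D] c])
  finally show ?thesis by simp
 qed
 have 2: "(\<integral>x. norm (snd (F n x) - snd (G x)) \<partial>?M) <= c * L2_norm_on ?M (%x. F n x - G x)" for n
 proof -
  have "(\<integral>x. norm (snd (F n x - G x)) \<partial>?M) <= c * L2_norm_on ?M (%x. snd (F n x - G x))"
   unfolding c_def by (rule L2_imp_L1(2)[OF L2_fst_snd(2)[OF D]])
  also have "\<dots> <= c * L2_norm_on ?M (%x. F n x - G x)" by (rule mult_left_mono[OF L2_fst_snd(4)[OF D] c])
  finally show ?thesis by simp
 qed
 have "has_weak_gradient S (%x. fst (G x)) (%x. snd (G x))"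
 proof (rule has_weak_gradient_L1_limit[OF S(1) H1_graphD(2)[OF F]])
  show "integrable ?M (%x. fst (F n x))" "integrable ?M (%x. snd (F n x))" for n
   by (rule L2_imp_L1(1)[OF L2_fst_snd(1)[OF FL]] L2_imp_L1(1)[OF L2_fst_snd(2)[OF FL]])+
  show "integrable ?M (%x. fst (G x))" "integrable ?M (%x. snd (G x))"
   by (rule L2_imp_L1(1)[OF L2_fst_snd(1)[OF G]] L2_imp_L1(1)[OF L2_fst_snd(2)[OF G]])+
  show "(%n. \<integral>x. norm (fst (F n x) - fst (G x)) \<partial>?M) \<longlonglongrightarrow> 0"
   by (rule Lim_null_comparison[OF always_eventually[OF allI] clim]) (use 1 in simp)
  show "(%n. \<integral>x. norm (snd (F n x) - snd (G x)) \<partial>?M) \<longlonglongrightarrow> 0"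
   by (rule Lim_null_comparison[OF always_eventually[OF allI] clim]) (use 2 in simp)
 qed
 with G show ?thesis by (simp add: H1_graph_def)
qed

text \<open>
 \<open>riesz_graph S f\<close> is \<open>(\<psi>, \<nabla>\<psi>)\<close> for the weak solution of \<open>-\<Delta>\<psi> + \<psi> = f\<close> with homogeneous Neumann
 boundary condition, the representative of \<open>w \<mapsto> (f,w)\<close> with respect to the full \<open>H\<^sup>1\<close> product.
\<close>

definition riesz_graph :: "'a::euclidean_space set => ('a => real) => 'a => real \<times> 'a" where
 "riesz_graph S f = (SOME V. V \<in> H1_graph S \<and>
  (\<forall>W\<in>H1_graph S. L2_inner (lebesgue_on S) V W = L2_inner (lebesgue_on S) f (%x. fst (W x))))"

lemma riesz_graph:
 assumes S: "open S" "S \<in> lmeasurable" and f: "f \<in> L2_space (lebesgue_on S)"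
 shows "riesz_graph S f \<in> H1_graph S"
  "!!W. W \<in> H1_graph S ==> L2_inner (lebesgue_on S) (riesz_graph S f) W = L2_inner (lebesgue_on S) f (%x. fst (W x))"
proof -
 let ?M = "lebesgue_on S"
 interpret finite_measure ?M by (rule finite_measure_lebesgue_on[OF S(2)])
 let ?F = "%x. (f x, 0::'a)"
 have "\<exists>V\<in>H1_graph S. \<forall>W\<in>H1_graph S. L2_inner ?M V W = L2_inner ?M ?F W"
 proof (rule L2_projection)
  show "H1_graph S \<subseteq> L2_space ?M" by (auto simp: H1_graph_def)
  have "has_weak_gradient S (%x. 0) (%x. 0)"
  proof (rule has_weak_gradientI[OF S(1)])
   show "locally_integrable S (%x. 0::real)" "locally_integrable S (%x. 0::'a)"
    by (simp_all add: locally_integrable_def set_integrable_def)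
  qed simp
  then show "(%x. 0) \<in> H1_graph S" by (simp add: H1_graph_def L2_zero)
  show "(%x. a *\<^sub>R V x + b *\<^sub>R W x) \<in> H1_graph S" if "V \<in> H1_graph S" "W \<in> H1_graph S" for V W a b
   by (rule H1_graph_combine[OF S(1) that])
  show "G \<in> H1_graph S" if "!!n::nat. F n \<in> H1_graph S" "G \<in> L2_space ?M"
   "(%n. L2_norm_on ?M (%x. F n x - G x)) \<longlonglongrightarrow> 0" for F G
   by (rule H1_graph_closed[OF S that])
  show "?F \<in> L2_space ?M" by (rule L2_Pair(1)[OF f L2_zero])
 qed
 moreover have "L2_inner ?M ?F W = L2_inner ?M f (%x. fst (W x))" for W
  unfolding L2_inner_def by (simp add: inner_prod_def)
 ultimately have "\<exists>V. V \<in> H1_graph S \<and> (\<forall>W\<in>H1_graph S. L2_inner ?M V W = L2_inner ?M f (%x. fst (W x)))"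
  by auto
 from someI_ex[OF this] have R: "riesz_graph S f \<in> H1_graph S \<and>
   (\<forall>W\<in>H1_graph S. L2_inner ?M (riesz_graph S f) W = L2_inner ?M f (%x. fst (W x)))"
  unfolding riesz_graph_def .
 show "riesz_graph S f \<in> H1_graph S" using R by (rule conjunct1)
 show "L2_inner ?M (riesz_graph S f) W = L2_inner ?M f (%x. fst (W x))" if "W \<in> H1_graph S" for W
  using conjunct2[OF R] that by (rule bspec)
qed

lemma riesz_graph_symmetric:
 assumes S: "open S" "S \<in> lmeasurable" and f: "f \<in> L2_space (lebesgue_on S)" and g: "g \<in> L2_space (lebesgue_on S)"
 shows "L2_inner (lebesgue_on S) f (%x. fst (riesz_graph S g x)) = L2_inner (lebesgue_on S) g (%x. fst (riesz_graph S f x))"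
 using riesz_graph(2)[OF S f riesz_graph(1)[OF S g]] riesz_graph(2)[OF S g riesz_graph(1)[OF S f]]
 by (simp add: L2_inner_commute)

text \<open>
  The squared norm of \<open>w \<mapsto> (f,w)\<close> in the dual of \<open>H\<^sup>1\<close>, by the Riesz isometry.
\<close>

definition dual_energy :: "'a::euclidean_space set => ('a => real) => real" where
 "dual_energy S f = (L2_norm_on (lebesgue_on S) (riesz_graph S f))\<^sup>2"

lemma dual_energy_eq:
 assumes S: "open S" "S \<in> lmeasurable" and f: "f \<in> L2_space (lebesgue_on S)"
 shows "dual_energy S f = L2_inner (lebesgue_on S) f (%x. fst (riesz_graph S f x))"
 unfolding dual_energy_def L2_norm_sq by (rule riesz_graph(2)[OF S f riesz_graph(1)[OF S f]])

text \<open>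
  The difference \<open>V\<close> of the two graphs represents \<open>f - g\<close>, so \<open>\<parallel>V\<parallel>\<^sup>2 = (f - g, fst V) \<le> \<parallel>f - g\<parallel> \<parallel>V\<parallel>\<close>.
\<close>

lemma riesz_graph_contraction:
 assumes S: "open S" "S \<in> lmeasurable" and f: "f \<in> L2_space (lebesgue_on S)" and g: "g \<in> L2_space (lebesgue_on S)"
 shows "L2_norm_on (lebesgue_on S) (%x. riesz_graph S f x - riesz_graph S g x) <= L2_norm_on (lebesgue_on S) (%x. f x - g x)"
proof -
 let ?M = "lebesgue_on S" let ?V = "%x. riesz_graph S f x - riesz_graph S g x"
 note Rf = riesz_graph[OF S f] and Rg = riesz_graph[OF S g]
 have V: "?V \<in> H1_graph S" using H1_graph_combine[OF S(1) Rf(1) Rg(1), of 1 "-1"] by simp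
 note VL = H1_graphD(1)[OF V] and FL = L2_fst_snd(1)[OF H1_graphD(1)[OF V]]
 have "(L2_norm_on ?M ?V)\<^sup>2 = L2_inner ?M (riesz_graph S f) ?V - L2_inner ?M (riesz_graph S g) ?V"
  unfolding L2_norm_sq by (rule L2_inner_diff_left[OF H1_graphD(1)[OF Rf(1)] H1_graphD(1)[OF Rg(1)] VL])
 also have "\<dots> = L2_inner ?M f (%x. fst (?V x)) - L2_inner ?M g (%x. fst (?V x))"
  by (simp only: Rf(2)[OF V] Rg(2)[OF V])
 also have "\<dots> = L2_inner ?M (%x. f x - g x) (%x. fst (?V x))"
  by (rule L2_inner_diff_left[OF f g FL, symmetric])
 also have "\<dots> <= L2_norm_on ?M (%x. f x - g x) * L2_norm_on ?M (%x. fst (?V x))"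
  using L2_Cauchy_Schwarz[OF L2_diff[OF f g] FL] by linarith
 also have "\<dots> <= L2_norm_on ?M (%x. f x - g x) * L2_norm_on ?M ?V"
  by (rule mult_left_mono[OF L2_fst_snd(3)[OF VL] L2_norm_nonneg])
 finally have *: "L2_norm_on ?M ?V * L2_norm_on ?M ?V <= L2_norm_on ?M (%x. f x - g x) * L2_norm_on ?M ?V"
  by (simp add: power2_eq_square)
 show ?thesis
 proof (cases "L2_norm_on ?M ?V = 0")
  case True
  then show ?thesis using L2_norm_nonneg by simp
 next
  case False
  then have "0 < L2_norm_on ?M ?V" using L2_norm_nonneg[of ?M ?V] by simp
  with * show ?thesis by simp
 qed
qed

lemma riesz_graph_norm_le:
 assumes S: "open S" "S \<in> lmeasurable" and f: "f \<in> L2_space (lebesgue_on S)"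
 shows "L2_norm_on (lebesgue_on S) (riesz_graph S f) <= L2_norm_on (lebesgue_on S) f"
proof -
 let ?M = "lebesgue_on S"
 have "L2_norm_on ?M (riesz_graph S (%x. 0)) = 0"
 proof -
  have "dual_energy S (%x. 0) = 0" unfolding dual_energy_eq[OF S L2_zero] by (simp add: L2_inner_def)
  then show ?thesis by (simp add: dual_energy_def)
 qed
 moreover have "L2_norm_on ?M (riesz_graph S f) <= L2_norm_on ?M (riesz_graph S (%x. 0)) + L2_norm_on ?M (%x. riesz_graph S f x - riesz_graph S (%x. 0) x)"
  by (rule L2_norm_reverse_triangle[OF H1_graphD(1)[OF riesz_graph(1)[OF S f]] H1_graphD(1)[OF riesz_graph(1)[OF S L2_zero]]])
 ultimately show ?thesis using riesz_graph_contraction[OF S f L2_zero] by simp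
qed

text \<open>
  The form \<open>(f, R g)\<close> is symmetric, so the cross terms in \<open>(f - g, R f) + (f - g, R g)\<close> cancel. The
  increment of the energy thereby involves only the increment \<open>f - g\<close>, on which the weak time
  derivative gives information.
\<close>

lemma dual_energy_diff:
 assumes S: "open S" "S \<in> lmeasurable" and f: "f \<in> L2_space (lebesgue_on S)" and g: "g \<in> L2_space (lebesgue_on S)"
 shows "dual_energy S f - dual_energy S g =
  L2_inner (lebesgue_on S) (%x. f x - g x) (%x. fst (riesz_graph S f x)) +
  L2_inner (lebesgue_on S) (%x. f x - g x) (%x. fst (riesz_graph S g x))"
 unfolding dual_energy_eq[OF S f] dual_energy_eq[OF S g]
  L2_inner_diff_left[OF f g L2_fst_snd(1)[OF H1_graphD(1)[OF riesz_graph(1)[OF S f]]]]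
  L2_inner_diff_left[OF f g L2_fst_snd(1)[OF H1_graphD(1)[OF riesz_graph(1)[OF S g]]]]
 using riesz_graph_symmetric[OF S f g] by simp

lemma dual_energy_zero:
 assumes S: "open S" "S \<in> lmeasurable" and f: "f \<in> L2_space (lebesgue_on S)" and z: "dual_energy S f = 0"
 shows "AE x in lebesgue_on S. f x = 0"
proof -
 let ?M = "lebesgue_on S"
 interpret finite_measure ?M by (rule finite_measure_lebesgue_on[OF S(2)])
 note sl = open_sets_lebesgue[OF S(1)]
 have RL: "riesz_graph S f \<in> L2_space ?M" by (rule H1_graphD(1)[OF riesz_graph(1)[OF S f]])
 have "L2_norm_on ?M (riesz_graph S f) = 0" using z by (simp add: dual_energy_def)
 then have R0: "AE x in ?M. riesz_graph S f x = 0" using L2_norm_zero_iff[OF RL] by simp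
 show ?thesis
 proof (rule AE_zero_if_orthogonal_to_test_functions[OF S(1)])
  show "locally_integrable S f" by (rule integrable_imp_locally_integrable[OF sl L2_imp_L1(1)[OF f]])
  fix \<eta> assume \<eta>: "\<eta> \<in> test_functions S"
  obtain g where g: "!!x. GDERIV \<eta> x :> g x" by (rule test_functionsE[OF \<eta>]) blast
  obtain B where B: "!!x. \<bar>\<eta> x\<bar> <= B" "!!x. norm (g x) <= B" "\<eta> \<in> borel_measurable lebesgue" "g \<in> borel_measurable lebesgue"
   by (rule test_function_bounds[OF \<eta> g]) blast
  have W: "(%x. (\<eta> x, g x)) \<in> H1_graph S"
   using B by (intro H1_graph_PairI L2_bounded[where B=B] measurable_lebesgue_on
     has_weak_gradient_test_function(1)[OF S(1) \<eta> g]) auto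
  have "L2_inner ?M f \<eta> = L2_inner ?M (riesz_graph S f) (%x. (\<eta> x, g x))"
   using riesz_graph(2)[OF S f W] by simp
  also have "\<dots> = 0"
  proof -
   have "(\<integral>x. riesz_graph S f x \<bullet> (\<eta> x, g x) \<partial>?M) = (\<integral>x. 0 \<partial>?M)"
   proof (rule integral_cong_AE)
    show "(%x. riesz_graph S f x \<bullet> (\<eta> x, g x)) \<in> borel_measurable ?M"
     by (rule borel_measurable_inner[OF L2_spaceD(1)[OF RL] L2_spaceD(1)[OF H1_graphD(1)[OF W]]])
    show "AE x in ?M. riesz_graph S f x \<bullet> (\<eta> x, g x) = 0" using R0 by (rule eventually_mono) simp
   qed simp
   then show ?thesis by (simp add: L2_inner_def)
  qed
  finally have "(\<integral>x. \<eta> x *\<^sub>R f x \<partial>?M) = 0" by (simp add: L2_inner_def mult.commute)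
  moreover have "(\<integral>x. \<eta> x *\<^sub>R f x \<partial>?M) = (\<integral>x. \<eta> x *\<^sub>R f x \<partial>lebesgue)"
   using test_functions_zero_outside(1)[OF \<eta>] by (intro integral_lebesgue_on_support(1)[OF sl]) simp
  ultimately show "(\<integral>x. \<eta> x *\<^sub>R f x \<partial>lebesgue) = 0" by simp
 qed
qed

section \<open>Evolution in the dual of \<open>H\<^sup>1\<close>\<close>

lemma integrable_indicator_Icc:
 fixes G :: "real => real"
 assumes "integrable lebesgue G"
 shows "integrable lebesgue (%r. indicator {a..b} r * G r)"
 using integrable_mult_indicator[of "{a..b}" lebesgue G] assms by simp

lemma integral_indicator_split:
 fixes G :: "real => real"
 assumes G: "integrable lebesgue G" and ab: "a <= b" "b <= c"
 shows "(\<integral>r. indicator {a..c} r * G r \<partial>lebesgue) =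
  (\<integral>r. indicator {a..b} r * G r \<partial>lebesgue) + (\<integral>r. indicator {b..c} r * G r \<partial>lebesgue)"
proof -
 have "(\<integral>r. indicator {a..b} r * G r + indicator {b..c} r * G r \<partial>lebesgue) = (\<integral>r. indicator {a..c} r * G r \<partial>lebesgue)"
 proof (rule integral_cong_AE)
  have "AE r in lborel. r \<noteq> b" by (rule AE_lborel_singleton)
  then have "AE r in lebesgue. r \<noteq> b" by (rule AE_completion)
  then show "AE r in lebesgue. indicator {a..b} r * G r + indicator {b..c} r * G r = indicator {a..c} r * G r"
   by (rule eventually_mono) (use ab in \<open>auto simp: indicator_def\<close>)
  show "(%r. indicator {a..b} r * G r + indicator {b..c} r * G r) \<in> borel_measurable lebesgue"
   "(%r. indicator {a..c} r * G r) \<in> borel_measurable lebesgue"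
   by (intro borel_measurable_add borel_measurable_integrable integrable_indicator_Icc G)+
 qed
 then show ?thesis
  using Bochner_Integration.integral_add[OF integrable_indicator_Icc[OF G] integrable_indicator_Icc[OF G]] by simp
qed

lemma integral_indicator_small:
 fixes G :: "real => real"
 assumes G: "integrable lebesgue G" and nn: "!!r. 0 <= G r" and e: "0 < e"
 shows "\<exists>d>0. \<forall>a b. a <= x --> x <= b --> b - a < d --> (\<integral>r. indicator {a..b} r * G r \<partial>lebesgue) < e"
proof -
 define r where "r n = inverse (real (Suc n))" for n
 have r0: "0 < r n" for n by (simp add: r_def)
 have "(%n. \<integral>t. indicator {x - r n..x + r n} t * G t \<partial>lebesgue) \<longlonglongrightarrow> (\<integral>t. 0 \<partial>(lebesgue :: real measure))"
 proof (rule integral_dominated_convergence[where w=G])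
  have "AE t in lborel. t \<noteq> x" by (rule AE_lborel_singleton)
  then have "AE t in lebesgue. t \<noteq> x" by (rule AE_completion)
  then show "AE t in lebesgue. (%n. indicator {x - r n..x + r n} t * G t) \<longlonglongrightarrow> 0"
  proof (rule eventually_mono)
   fix t :: real assume "t \<noteq> x"
   then have "\<forall>\<^sub>F n in sequentially. r n < \<bar>t - x\<bar>"
    unfolding r_def by (intro order_tendstoD(2)[OF LIMSEQ_inverse_real_of_nat]) simp
   then have "\<forall>\<^sub>F n in sequentially. 0 = indicator {x - r n..x + r n} t * G t"
    by (rule eventually_mono) (auto simp: indicator_def)
   then show "(%n. indicator {x - r n..x + r n} t * G t) \<longlonglongrightarrow> 0"
    by (rule Lim_transform_eventually[OF tendsto_const])
  qed
  show "AE t in lebesgue. norm (indicator {x - r n..x + r n} t * G t) <= G t" for n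
   using nn by (intro AE_I2) (simp add: indicator_def)
  show "(%t. indicator {x - r n..x + r n} t * G t) \<in> borel_measurable lebesgue" for n
   by (intro borel_measurable_integrable integrable_indicator_Icc G)
 qed (use G in auto)
 then have "\<forall>\<^sub>F n in sequentially. (\<integral>t. indicator {x - r n..x + r n} t * G t \<partial>lebesgue) < e"
  using e by (intro order_tendstoD(2)) auto
 then have "\<exists>n. (\<integral>t. indicator {x - r n..x + r n} t * G t \<partial>lebesgue) < e"
  by (rule eventually_happens'[OF sequentially_bot])
 then obtain n where n: "(\<integral>t. indicator {x - r n..x + r n} t * G t \<partial>lebesgue) < e" ..
 have "(\<integral>t. indicator {a..b} t * G t \<partial>lebesgue) < e" if ab: "a <= x" "x <= b" "b - a < r n" for a b
 proof -
  have "(\<integral>t. indicator {a..b} t * G t \<partial>lebesgue) <= (\<integral>t. indicator {x - r n..x + r n} t * G t \<partial>lebesgue)"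
  proof (rule integral_mono)
   show "indicator {a..b} t * G t <= indicator {x - r n..x + r n} t * G t" for t
    using ab nn[of t] by (auto simp: indicator_def)
  qed (rule integrable_indicator_Icc[OF G])+
  with n show ?thesis by simp
 qed
 with r0[of n] show ?thesis by blast
qed

lemma mollifier_commute: "mollifier r (x - y) = mollifier r (y - x)"
 using mollifier_minus[of r "y - x"] by simp

lemma mollifier_point_limit:
 fixes F :: "real => real"
 assumes F: "integrable lebesgue F" and a: "isCont F a"
 shows "((%r. \<integral>x. mollifier r (x - a) * F x \<partial>lebesgue) \<longlongrightarrow> F a) (at_right 0)"
proof (rule tendstoI)
 fix e :: real assume e: "0 < e"
 have "\<forall>e>0. \<exists>d>0. \<forall>x. dist x a < d --> dist (F x) (F a) < e"
  using a unfolding continuous_at_eps_delta .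
 from this[rule_format, of "e / 2"] e obtain d
  where d: "0 < d" "!!x. dist x a < d ==> dist (F x) (F a) < e / 2" by auto
 have "dist (\<integral>x. mollifier r (x - a) * F x \<partial>lebesgue) (F a) < e" if r: "0 < r" "r < d" for r
 proof -
  have i0: "integrable lebesgue (%x. mollifier r (x - a))"
   by (rule integrable_shift[OF mollifier_integrable[OF r(1)]])
  have i1: "integrable lebesgue (%x. mollifier r (x - a) * F x)"
  proof -
   have "(%x. mollifier r (x - a) * F x) = (%x. mollifier r (a - x) *\<^sub>R F x)"
    by (simp add: mollifier_commute[of r _ a])
   then show ?thesis using mollify_integrand_integrable[OF F r(1), of a] by simp
  qed
  have i2: "integrable lebesgue (%x. mollifier r (x - a) * F a)" using i0 by simp
  have one: "(\<integral>x. mollifier r (x - a) \<partial>lebesgue) = 1"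
   using integral_shift[OF borel_measurable_integrable[OF mollifier_integrable[OF r(1), where 'a=real]], of a]
    mollifier_integral[OF r(1), where 'a=real] by simp
  have "(\<integral>x. mollifier r (x - a) * F x \<partial>lebesgue) - F a = (\<integral>x. mollifier r (x - a) * F x - mollifier r (x - a) * F a \<partial>lebesgue)"
   using Bochner_Integration.integral_diff[OF i1 i2] one by simp
  also have "\<bar>\<dots>\<bar> <= (\<integral>x. mollifier r (x - a) * (e / 2) \<partial>lebesgue)"
  proof (rule order_trans[OF integral_abs_bound])
   show "(\<integral>x. \<bar>mollifier r (x - a) * F x - mollifier r (x - a) * F a\<bar> \<partial>lebesgue) <= (\<integral>x. mollifier r (x - a) * (e / 2) \<partial>lebesgue)"
   proof (rule integral_mono)
    show "integrable lebesgue (%x. \<bar>mollifier r (x - a) * F x - mollifier r (x - a) * F a\<bar>)"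
     by (rule integrable_abs[OF Bochner_Integration.integrable_diff[OF i1 i2]])
    show "integrable lebesgue (%x. mollifier r (x - a) * (e / 2))" using i0 by simp
    fix x
    show "\<bar>mollifier r (x - a) * F x - mollifier r (x - a) * F a\<bar> <= mollifier r (x - a) * (e / 2)"
    proof (cases "r <= norm (x - a)")
     case True
     then show ?thesis using mollifier_outside[OF r(1) True] by simp
    next
     case False
     then have "\<bar>F x - F a\<bar> <= e / 2" using d(2)[of x] r(2) by (simp add: dist_real_def)
     then have "mollifier r (x - a) * \<bar>F x - F a\<bar> <= mollifier r (x - a) * (e / 2)"
      by (rule mult_left_mono[OF _ mollifier_nonneg[OF r(1)]])
     then show ?thesis
      using mollifier_nonneg[OF r(1), of "x - a"] by (simp add: abs_mult flip: right_diff_distrib)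
    qed
   qed
  qed
  also have "\<dots> = e / 2" using one by simp
  finally show ?thesis using e by (simp add: dist_real_def)
 qed
 then show "\<forall>\<^sub>F r in at_right 0. dist (\<integral>x. mollifier r (x - a) * F x \<partial>lebesgue) (F a) < e"
  unfolding eventually_at_right_field using d(1) by blast
qed

text \<open>
 The test functions are mollified indicators of \<open>[s,t]\<close>; their derivatives concentrate at the end
 points.
\<close>

lemma weak_derivative_imp_integral_interior:
 fixes f g :: "real => real"
 assumes cont: "continuous_on {0..T} f" and g: "integrable (lebesgue_on {0<..<T}) g"
  and weak: "!!\<eta>. \<eta> \<in> test_functions {0<..<T} ==>
   (\<integral>t. f t * deriv \<eta> t \<partial>lebesgue_on {0<..<T}) = - (\<integral>t. g t * \<eta> t \<partial>lebesgue_on {0<..<T})"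
  and st: "0 < s" "s < t" "t < T"
 shows "f t - f s = (\<integral>r. indicator {s..t} r * (indicator {0<..<T} r * g r) \<partial>lebesgue)"
proof -
 define u :: "real => real" where "u = indicator {s..t}"
 define G where "G r = indicator {0<..<T} r * g r" for r
 define F where "F r = indicator {0..T} r * f r" for r
 have G: "integrable lebesgue G"
  using g by (simp add: G_def[abs_def] integral_lebesgue_on_indicator(2))
 have u: "integrable lebesgue u"
  unfolding u_def using lmeasurable_cbox[of s t] by (auto simp: fmeasurable_def)
 have F: "integrable lebesgue F"
 proof -
  have "integrable lborel (%x. indicator {0..T} x *\<^sub>R f x)"
   by (rule borel_integrable_compact[OF compact_Icc cont])
  then have "integrable lborel F" by (simp add: F_def[abs_def])
  then show ?thesis using integrable_completion[of F lborel] by auto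
 qed
 have Fcont: "isCont F a" if a: "0 < a" "a < T" for a
 proof -
  have "continuous_on {0<..<T} f" by (rule continuous_on_subset[OF cont]) auto
  then have "continuous_on {0<..<T} F"
   by (rule continuous_on_eq) (auto simp: F_def)
  then show ?thesis using a by (simp add: continuous_on_eq_continuous_at)
 qed
 define \<delta> where "\<delta> = min s (T - t)"
 have \<delta>: "0 < \<delta>" using st by (simp add: \<delta>_def)
 have eqr: "(\<integral>x. mollifier r (x - s) * F x \<partial>lebesgue) - (\<integral>x. mollifier r (x - t) * F x \<partial>lebesgue)
   = - (\<integral>x. mollify r u x * G x \<partial>lebesgue)" if r: "0 < r" "r < \<delta>" for r
 proof -
  note t = mollifier_test_function[OF r(1), where 'a=real]
  obtain \<rho>' where \<rho>': "!!z::real. GDERIV (mollifier r) z :> \<rho>' z" "continuous_on UNIV \<rho>'"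
   by (rule test_functionsE[OF t]) blast
  have mu: "mollify r u = (%x. \<integral>y. mollifier r (x - y) * u y \<partial>lebesgue)"
   by (simp add: mollify_def fun_eq_iff)
  have d: "(mollify r u has_real_derivative mollifier r (x - s) - mollifier r (x - t)) (at x)" for x
  proof -
   have "(mollify r u has_real_derivative (\<integral>y. u y *\<^sub>R \<rho>' (x - y) \<partial>lebesgue)) (at x)"
    using GDERIV_convolution[OF t \<rho>'(1) u, of x] unfolding mu by simp
   also have "(\<integral>y. u y *\<^sub>R \<rho>' (x - y) \<partial>lebesgue) = (\<integral>y. indicator {s..t} y *\<^sub>R \<rho>' (x - y) \<partial>lborel)"
    unfolding u_def
   proof (rule integral_completion)
    have "continuous_on UNIV (%y. \<rho>' (x - y))"
     by (rule continuous_on_compose2[OF \<rho>'(2)]) (auto intro!: continuous_intros)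
    then have "(%y. \<rho>' (x - y)) \<in> borel_measurable borel" by (rule borel_measurable_continuous_onI)
    then show "(%y. indicator {s..t} y *\<^sub>R \<rho>' (x - y)) \<in> borel_measurable lborel" by measurable
   qed
   also have "\<dots> = - mollifier r (x - t) - (- mollifier r (x - s))"
   proof (rule integral_FTC_Icc)
    show "s <= t" using st by simp
    show "continuous_on {s..t} (%y. \<rho>' (x - y))"
     by (rule continuous_on_compose2[OF \<rho>'(2)]) (auto intro!: continuous_intros)
    fix y
    have "(mollifier r has_real_derivative \<rho>' (x - y)) (at (x - y))" using \<rho>'(1) by simp
    then have "((%y. - mollifier r (x - y)) has_real_derivative \<rho>' (x - y)) (at y)"
     by (auto intro!: derivative_eq_intros DERIV_chain2[of "mollifier r"])
    then show "((%y. - mollifier r (x - y)) has_vector_derivative \<rho>' (x - y)) (at y within {s..t})"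
     by (rule has_vector_derivative_at_within[OF has_real_derivative_iff_has_vector_derivative[THEN iffD1]])
   qed
   finally show ?thesis by simp
  qed
  have test: "mollify r u \<in> test_functions {0<..<T}"
  proof (rule test_functionsI[where K="{s - r..t + r}"])
   show "Ck k (mollify r u)" for k unfolding mu by (rule Ck_convolution[OF t u])
   show "{s - r..t + r} \<subseteq> {0<..<T}" using r by (auto simp: \<delta>_def)
   show "mollify r u x = 0" if x: "x \<notin> {s - r..t + r}" for x
   proof -
    have "mollifier r (x - y) * u y = 0" for y
    proof (cases "y \<in> {s..t}")
     case True
     then have "r <= norm (x - y)" using x by (auto simp: abs_if)
     then show ?thesis using mollifier_outside[OF r(1) \<open>r <= norm (x - y)\<close>] by simp
    qed (simp add: u_def)
    then show ?thesis unfolding mu by (simp only: integral_zero)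
   qed
  qed simp
  have der: "deriv (mollify r u) x = mollifier r (x - s) - mollifier r (x - t)" for x
   by (rule DERIV_imp_deriv[OF d])
  have sup: "mollifier r (x - s) - mollifier r (x - t) = 0" if "x \<notin> {0<..<T}" for x
   by (rule test_functions_zero_outside(2)[OF test that]) (use d[of x] in simp)
  have j: "integrable lebesgue (%x. mollifier r (x - a) * F x)" for a
  proof -
   have "(%x. mollifier r (x - a) * F x) = (%x. mollifier r (a - x) *\<^sub>R F x)"
    by (simp add: mollifier_commute[of r _ a])
   then show ?thesis using mollify_integrand_integrable[OF F r(1), of a] by simp
  qed
  have "(\<integral>x. f x * deriv (mollify r u) x \<partial>lebesgue_on {0<..<T}) = (\<integral>x. f x * (mollifier r (x - s) - mollifier r (x - t)) \<partial>lebesgue)"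
   unfolding der using sup by (intro integral_lebesgue_on_support(1)) auto
  also have "\<dots> = (\<integral>x. mollifier r (x - s) * F x - mollifier r (x - t) * F x \<partial>lebesgue)"
  proof (rule Bochner_Integration.integral_cong[OF refl])
   fix x show "f x * (mollifier r (x - s) - mollifier r (x - t)) = mollifier r (x - s) * F x - mollifier r (x - t) * F x"
   proof (cases "x \<in> {0<..<T}")
    case True then show ?thesis by (simp add: F_def algebra_simps)
   next
    case False then show ?thesis using sup[OF False] by simp
   qed
  qed
  also have "\<dots> = (\<integral>x. mollifier r (x - s) * F x \<partial>lebesgue) - (\<integral>x. mollifier r (x - t) * F x \<partial>lebesgue)"
   by (rule Bochner_Integration.integral_diff[OF j j])
  finally have 1: "(\<integral>x. f x * deriv (mollify r u) x \<partial>lebesgue_on {0<..<T}) =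
   (\<integral>x. mollifier r (x - s) * F x \<partial>lebesgue) - (\<integral>x. mollifier r (x - t) * F x \<partial>lebesgue)" .
  have "(\<integral>x. g x * mollify r u x \<partial>lebesgue_on {0<..<T}) = (\<integral>x. indicator {0<..<T} x *\<^sub>R (g x * mollify r u x) \<partial>lebesgue)"
   by (rule integral_lebesgue_on_indicator(1)) simp
  also have "\<dots> = (\<integral>x. mollify r u x * G x \<partial>lebesgue)" by (simp add: G_def ac_simps)
  finally show ?thesis using 1 weak[OF test] by simp
 qed
 define r where "r n = inverse (real (Suc n))" for n
 have r0: "0 < r n" for n by (simp add: r_def)
 have rlim: "filterlim r (at_right 0) sequentially"
  unfolding filterlim_at
 proof (rule conjI)
  show "\<forall>\<^sub>F n in sequentially. r n \<in> {0<..} \<and> r n \<noteq> 0"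
   using r0 less_irrefl by (intro always_eventually allI) (simp add: less_imp_neq[symmetric])
  show "r \<longlonglongrightarrow> 0" unfolding r_def by (rule LIMSEQ_inverse_real_of_nat)
 qed
 obtain q where q_both: "strict_mono (q :: nat => nat) \<and> (AE x in lebesgue. (%n. mollify (r (q n)) u x - u x) \<longlonglongrightarrow> 0)"
  using tendsto_L1_AE_subseq[OF Bochner_Integration.integrable_diff[OF mollify_integrable[OF u r0] u]
    filterlim_compose[OF mollify_tendsto_L1[OF u] rlim]] ..
 note q = conjunct1[OF q_both]
 have rq: "filterlim (%n. r (q n)) (at_right 0) sequentially"
  by (rule filterlim_compose[OF rlim filterlim_subseq[OF q]])
 have b: "AE x in lebesgue. \<bar>u x\<bar> <= 1" by (intro AE_I2) (simp add: u_def indicator_def)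
 have lim1: "(%n. \<integral>x. mollify (r (q n)) u x * G x \<partial>lebesgue) \<longlonglongrightarrow> (\<integral>x. u x * G x \<partial>lebesgue)"
 proof (rule integral_dominated_convergence[where w="%x. \<bar>G x\<bar>"])
  show "(%x. u x * G x) \<in> borel_measurable lebesgue"
   by (rule borel_measurable_times[OF borel_measurable_integrable[OF u] borel_measurable_integrable[OF G]])
  show "(%x. mollify (r (q n)) u x * G x) \<in> borel_measurable lebesgue" for n
   by (rule borel_measurable_times[OF borel_measurable_integrable[OF mollify_integrable[OF u r0]] borel_measurable_integrable[OF G]])
  show "integrable lebesgue (%x. \<bar>G x\<bar>)" by (rule integrable_abs[OF G])
  show "AE x in lebesgue. (%n. mollify (r (q n)) u x * G x) \<longlonglongrightarrow> u x * G x"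
   using conjunct2[OF q_both]
  proof (rule eventually_mono)
   fix x assume "(%n. mollify (r (q n)) u x - u x) \<longlonglongrightarrow> 0"
   then have "(%n. mollify (r (q n)) u x) \<longlonglongrightarrow> u x" by (rule LIM_zero_cancel)
   then show "(%n. mollify (r (q n)) u x * G x) \<longlonglongrightarrow> u x * G x" by (rule tendsto_mult[OF _ tendsto_const])
  qed
  show "AE x in lebesgue. norm (mollify (r (q n)) u x * G x) <= \<bar>G x\<bar>" for n
  proof (rule AE_I2)
   fix x
   have "\<bar>mollify (r (q n)) u x\<bar> * \<bar>G x\<bar> <= 1 * \<bar>G x\<bar>"
    by (rule mult_right_mono[OF mollify_bound[OF r0 u b]]) simp
   then show "norm (mollify (r (q n)) u x * G x) <= \<bar>G x\<bar>" by (simp add: abs_mult)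
  qed
 qed
 have lim2: "(%n. (\<integral>x. mollifier (r (q n)) (x - s) * F x \<partial>lebesgue) - (\<integral>x. mollifier (r (q n)) (x - t) * F x \<partial>lebesgue)) \<longlonglongrightarrow> F s - F t"
  using st by (intro tendsto_diff filterlim_compose[OF mollifier_point_limit[OF F Fcont] rq]) auto
 have "\<forall>\<^sub>F n in sequentially. r n < \<delta>"
  unfolding r_def by (rule order_tendstoD(2)[OF LIMSEQ_inverse_real_of_nat \<delta>])
 then have "\<forall>\<^sub>F n in sequentially. r (q n) < \<delta>" by (rule eventually_subseq[OF q])
 then have "\<forall>\<^sub>F n in sequentially. - (\<integral>x. mollify (r (q n)) u x * G x \<partial>lebesgue) =
  (\<integral>x. mollifier (r (q n)) (x - s) * F x \<partial>lebesgue) - (\<integral>x. mollifier (r (q n)) (x - t) * F x \<partial>lebesgue)"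
  by (rule eventually_mono) (rule eqr[OF r0, symmetric])
 from LIMSEQ_unique[OF Lim_transform_eventually[OF tendsto_minus[OF lim1] this] lim2]
 show ?thesis using st by (simp add: F_def u_def G_def)
qed

lemma weak_derivative_imp_integral:
 fixes f g :: "real => real"
 assumes cont: "continuous_on {0..T} f" and g: "integrable (lebesgue_on {0<..<T}) g"
  and weak: "!!\<eta>. \<eta> \<in> test_functions {0<..<T} ==>
   (\<integral>t. f t * deriv \<eta> t \<partial>lebesgue_on {0<..<T}) = - (\<integral>t. g t * \<eta> t \<partial>lebesgue_on {0<..<T})"
  and st: "0 <= s" "s <= t" "t <= T"
 shows "f t - f s = (\<integral>r. indicator {s..t} r * (indicator {0<..<T} r * g r) \<partial>lebesgue)"
proof (cases "s = t")
 case True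
 have "(\<integral>r. indicator {t..t} r * (indicator {0<..<T} r * g r) \<partial>lebesgue) = (\<integral>r. 0 \<partial>(lebesgue :: real measure))"
 proof (rule integral_cong_AE)
  have "AE r in lborel. r \<noteq> t" by (rule AE_lborel_singleton)
  then have "AE r in lebesgue. r \<noteq> t" by (rule AE_completion)
  then show "AE r in lebesgue. indicator {t..t} r * (indicator {0<..<T} r * g r) = 0"
   by (rule eventually_mono) simp
  show "(%r. indicator {t..t} r * (indicator {0<..<T} r * g r)) \<in> borel_measurable lebesgue"
   using g by (intro borel_measurable_integrable integrable_indicator_Icc) (simp add: integral_lebesgue_on_indicator(2))
 qed simp
 with True show ?thesis by simp
next
 case False
 then have st': "s < t" using st by simp
 define G where "G r = indicator {0<..<T} r * g r" for r
 have G: "integrable lebesgue G"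
  using g by (simp add: G_def[abs_def] integral_lebesgue_on_indicator(2))
 define h where "h n = (t - s) / 3 * inverse (real (Suc n))" for n
 have h: "0 < h n" "h n < (t - s) / 2" for n
 proof -
  show "0 < h n" using st' by (simp add: h_def)
  have "inverse (real (Suc n)) <= 1" by (simp add: inverse_le_1_iff)
  then have "h n <= (t - s) / 3 * 1" unfolding h_def using st' by (intro mult_left_mono) auto
  then show "h n < (t - s) / 2" using st' by simp
 qed
 have hlim: "h \<longlonglongrightarrow> 0"
  unfolding h_def using tendsto_mult_right_zero[OF LIMSEQ_inverse_real_of_nat] by simp
 have eq: "f (t - h n) - f (s + h n) = (\<integral>r. indicator {s + h n..t - h n} r * G r \<partial>lebesgue)" for n
  unfolding G_def using h[of n] st by (intro weak_derivative_imp_integral_interior[OF cont g weak]) auto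
 have l1: "(%n. f (t - h n) - f (s + h n)) \<longlonglongrightarrow> f t - f s"
 proof (rule tendsto_diff)
  have "(%n. t - h n) \<longlonglongrightarrow> t - 0" "(%n. s + h n) \<longlonglongrightarrow> s + 0" by (intro tendsto_intros hlim)+
  then have lim: "(%n. t - h n) \<longlonglongrightarrow> t" "(%n. s + h n) \<longlonglongrightarrow> s" by simp_all
  have mem: "t - h n \<in> {0..T}" "s + h n \<in> {0..T}" for n using h[of n] st st' by auto
  show "(%n. f (t - h n)) \<longlonglongrightarrow> f t"
   using mem st st' by (intro continuous_on_tendsto_compose[OF cont lim(1)]) auto
  show "(%n. f (s + h n)) \<longlonglongrightarrow> f s"
   using mem st st' by (intro continuous_on_tendsto_compose[OF cont lim(2)]) auto
 qed
 have l2: "(%n. \<integral>r. indicator {s + h n..t - h n} r * G r \<partial>lebesgue) \<longlonglongrightarrow> (\<integral>r. indicator {s..t} r * G r \<partial>lebesgue)"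
 proof (rule integral_dominated_convergence[where w="%r. \<bar>G r\<bar>"])
  have "AE r in lborel. r \<noteq> s" "AE r in lborel. r \<noteq> t" by (rule AE_lborel_singleton)+
  then have "AE r in lebesgue. r \<noteq> s" "AE r in lebesgue. r \<noteq> t" by (auto intro: AE_completion)
  then have "AE r in lebesgue. r \<noteq> s \<and> r \<noteq> t" by (rule eventually_conj)
  then show "AE r in lebesgue. (%n. indicator {s + h n..t - h n} r * G r) \<longlonglongrightarrow> indicator {s..t} r * G r"
  proof (rule eventually_mono)
   fix r assume r: "r \<noteq> s \<and> r \<noteq> t"
   show "(%n. indicator {s + h n..t - h n} r * G r) \<longlonglongrightarrow> indicator {s..t} r * G r"
   proof (cases "s < r \<and> r < t")
    case True
    then have "\<forall>\<^sub>F n in sequentially. h n < min (r - s) (t - r)"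
     by (intro order_tendstoD(2)[OF hlim]) simp
    then have "\<forall>\<^sub>F n in sequentially. indicator {s..t} r * G r = indicator {s + h n..t - h n} r * G r"
     by (rule eventually_mono) (use True in \<open>auto simp: indicator_def\<close>)
    then show ?thesis by (rule Lim_transform_eventually[OF tendsto_const])
   next
    case False
    then have "r \<notin> {s..t}" using r by auto
    moreover have "r \<notin> {s + h n..t - h n}" for n using calculation h(1)[of n] by auto
    ultimately have "(%n. indicator {s + h n..t - h n} r * G r) = (%n. 0)" "indicator {s..t} r * G r = 0"
     by (auto simp: fun_eq_iff indicator_def)
    then show ?thesis by (simp only: tendsto_const)
   qed
  qed
  show "AE r in lebesgue. norm (indicator {s + h n..t - h n} r * G r) <= \<bar>G r\<bar>" for n
   by (intro AE_I2) (simp add: indicator_def)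
  show "integrable lebesgue (%r. \<bar>G r\<bar>)" by (rule integrable_abs[OF G])
  show "(%r. indicator {s..t} r * G r) \<in> borel_measurable lebesgue"
   "(%r. indicator {s + h n..t - h n} r * G r) \<in> borel_measurable lebesgue" for n
   by (rule borel_measurable_integrable[OF integrable_indicator_Icc[OF G]])+
 qed
 show ?thesis
  using LIMSEQ_unique[OF l1[unfolded eq] l2] by (simp add: G_def)
qed

text \<open>Gronwall's lemma for an integrable coefficient, by continuation over short intervals.\<close>

lemma gronwall_zero:
 fixes y K :: "real => real"
 assumes K: "integrable lebesgue K" "!!r. 0 <= K r"
  and y: "continuous_on {0..T} y" "!!t. 0 <= y t" "y 0 = 0"
  and ineq: "!!a b. 0 <= a ==> a <= b ==> b <= T ==> y b - y a <= (\<integral>r. indicator {a..b} r * (K r * (indicator {0..T} r * y r)) \<partial>lebesgue)"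
  and t: "0 <= t" "t <= T"
 shows "y t = 0"
proof -
 have yi: "integrable lebesgue (%r. K r * (indicator {0..T} r * y r))"
 proof -
  obtain B where B: "!!r. r \<in> {0..T} ==> norm (y r) <= B"
   using compact_imp_bounded[OF compact_continuous_image[OF y(1) compact_Icc]] unfolding bounded_iff by blast
  have "\<bar>indicator {0..T} r * y r\<bar> <= \<bar>B\<bar>" for r
   using B[of r] by (cases "r \<in> {0..T}") auto
  moreover have "(%x. indicator {0..T} x * y x) \<in> borel_measurable lebesgue"
  proof -
   have "(%x. indicator {0..T} x *\<^sub>R y x) \<in> borel_measurable lborel"
    by (rule borel_measurable_integrable[OF borel_integrable_compact[OF compact_Icc y(1)]])
   then show ?thesis by (intro measurable_completion) simp
  qed
  ultimately have "integrable lebesgue (%r. (indicator {0..T} r * y r) *\<^sub>R K r)"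
   by (intro bounded_mult_integrable[OF K(1), where B="\<bar>B\<bar>"]) auto
  then show ?thesis by (simp add: mult.commute)
 qed
 define P where "P a b \<longleftrightarrow> (0 <= a --> b <= T --> (\<forall>r\<in>{0..a}. y r = 0) --> (\<forall>r\<in>{0..b}. y r = 0))" for a b
 have "P 0 T"
 proof (rule Bolzano)
  show "0 <= T" using t by simp
  show "P a c" if "P a b" "P b c" "a <= b" "b <= c" for a b c
   unfolding P_def
  proof (intro impI)
   assume h: "0 <= a" "c <= T" "\<forall>r\<in>{0..a}. y r = 0"
   have "0 <= b" "b <= T" using h that by linarith+
   then have "\<forall>r\<in>{0..b}. y r = 0" using that(1) h unfolding P_def by simp
   then show "\<forall>r\<in>{0..c}. y r = 0" using that(2) h \<open>0 <= b\<close> unfolding P_def by simp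
  qed
  fix x assume "0 <= x" "x <= T"
  obtain d where d: "0 < d" "\<forall>a b. a <= x --> x <= b --> b - a < d --> (\<integral>r. indicator {a..b} r * K r \<partial>lebesgue) < 1 / 2"
   using integral_indicator_small[OF K, of "1/2" x] by auto
  have "P a b" if ab: "a <= x" "x <= b" "b - a < d" for a b
   unfolding P_def
  proof (intro impI ballI)
   fix r assume a: "0 <= a" and b: "b <= T" and za: "\<forall>r\<in>{0..a}. y r = 0" and r: "r \<in> {0..b}"
   have "\<exists>m\<in>{a..b}. \<forall>r\<in>{a..b}. y r <= y m"
    using ab a b by (intro continuous_attains_sup continuous_on_subset[OF y(1)]) auto
   then obtain m where m: "m \<in> {a..b}" "!!r. r \<in> {a..b} ==> y r <= y m" by blast
   have "y m - y a <= (\<integral>r. indicator {a..m} r * (K r * (indicator {0..T} r * y r)) \<partial>lebesgue)"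
    using m(1) a b by (intro ineq) auto
   also have "\<dots> <= (\<integral>r. (indicator {a..b} r * K r) * y m \<partial>lebesgue)"
   proof (rule integral_mono[OF integrable_indicator_Icc[OF yi]])
    show "integrable lebesgue (%r. (indicator {a..b} r * K r) * y m)"
     by (rule integrable_mult_left[OF integrable_indicator_Icc[OF K(1)]])
    fix r
    show "indicator {a..m} r * (K r * (indicator {0..T} r * y r)) <= (indicator {a..b} r * K r) * y m"
    proof (cases "r \<in> {a..m}")
     case True
     then have "r \<in> {a..b}" "r \<in> {0..T}" using m(1) a b by auto
     then show ?thesis using True m(2)[of r] mult_left_mono[OF m(2)[of r] K(2)[of r]] by simp
    next
     case False
     then show ?thesis using K(2)[of r] y(2)[of m] by simp
    qed
   qed
   also have "\<dots> = (\<integral>r. indicator {a..b} r * K r \<partial>lebesgue) * y m" by simp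
   also have "\<dots> <= (1 / 2) * y m"
    using d(2) ab y(2)[of m] by (intro mult_right_mono) (auto intro: less_imp_le)
   finally have "y m <= 0" using za a by simp
   show "y r = 0"
   proof (cases "r <= a")
    case True
    then show ?thesis using za r by auto
   next
    case False
    then show ?thesis using m(2)[of r] r \<open>y m <= 0\<close> y(2)[of r] by auto
   qed
  qed
  with d(1) show "\<exists>d>0. \<forall>a b. a <= x \<and> x <= b \<and> b - a < d --> P a b" by blast
 qed
 moreover have "\<forall>r\<in>{0..0}. y r = 0" using y(3) by simp
 ultimately show ?thesis using t unfolding P_def by simp
qed

text \<open>
 The increment of the dual energy over a short interval is the pairing of the time derivative with
 the Riesz representatives at the two end points. On a fine partition these may be replaced by the
 representative at the running time, with an error controlled by the modulus of continuity.
\<close>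

locale dual_evolution =
 fixes S :: "'a::euclidean_space set" and T :: real and c :: "real => 'a => real"
  and W :: "real => ('a => real \<times> 'a) => real" and D K :: "real => real"
 assumes S: "open S" "S \<in> lmeasurable"
  and c: "!!t. t \<in> {0..T} ==> c t \<in> L2_space (lebesgue_on S)"
  and c_cont: "!!t. t \<in> {0..T} ==> ((%s. L2_norm_on (lebesgue_on S) (%x. c s x - c t x)) \<longlongrightarrow> 0) (at t within {0..T})"
  and D: "integrable lebesgue D"
  and K: "integrable lebesgue K" "!!r. 0 <= K r"
  and W_int: "!!V. V \<in> H1_graph S ==> integrable lebesgue (%r. W r V)"
  and incr: "!!V s t. V \<in> H1_graph S ==> 0 <= s ==> s <= t ==> t <= T ==>
   L2_inner (lebesgue_on S) (%x. c t x - c s x) (%x. fst (V x)) = (\<integral>r. indicator {s..t} r * W r V \<partial>lebesgue)"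
  and W_lip: "AE r in lebesgue. \<forall>V\<in>H1_graph S. \<forall>V'\<in>H1_graph S.
   W r V - W r V' <= D r * L2_norm_on (lebesgue_on S) (%x. V x - V' x)"
  and D_nonneg: "AE r in lebesgue. 0 <= D r"
  and W_est: "AE r in lebesgue. r \<in> {0..T} --> W r (riesz_graph S (c r)) <= K r * dual_energy S (c r)"
begin

lemma dual_energy_continuous: "continuous_on {0..T} (%t. dual_energy S (c t))"
 unfolding continuous_on_def
proof
 fix t assume t: "t \<in> {0..T}"
 let ?M = "lebesgue_on S"
 let ?N = "%s. L2_norm_on ?M (%x. c s x - c t x)"
 have bound: "\<bar>dual_energy S (c s) - dual_energy S (c t)\<bar> <= ?N s * (2 * L2_norm_on ?M (c t) + ?N s)" if s: "s \<in> {0..T}" for s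
 proof -
  note ct = c[OF t] and cs = c[OF s]
  have R: "\<bar>L2_inner ?M (%x. c s x - c t x) (%x. fst (riesz_graph S f x))\<bar> <= ?N s * L2_norm_on ?M f"
   if f: "f \<in> L2_space ?M" for f
  proof -
   note RL = H1_graphD(1)[OF riesz_graph(1)[OF S f]]
   have "\<bar>L2_inner ?M (%x. c s x - c t x) (%x. fst (riesz_graph S f x))\<bar> <= ?N s * L2_norm_on ?M (%x. fst (riesz_graph S f x))"
    by (rule L2_Cauchy_Schwarz[OF L2_diff[OF cs ct] L2_fst_snd(1)[OF RL]])
   also have "\<dots> <= ?N s * L2_norm_on ?M f"
    using L2_fst_snd(3)[OF RL] riesz_graph_norm_le[OF S f] by (intro mult_left_mono L2_norm_nonneg) simp
   finally show ?thesis .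
  qed
  have "\<bar>dual_energy S (c s) - dual_energy S (c t)\<bar> <= ?N s * L2_norm_on ?M (c s) + ?N s * L2_norm_on ?M (c t)"
   unfolding dual_energy_diff[OF S cs ct] using R[OF cs] R[OF ct] by linarith
  also have "\<dots> <= ?N s * (L2_norm_on ?M (c t) + ?N s) + ?N s * L2_norm_on ?M (c t)"
   using mult_left_mono[OF L2_norm_reverse_triangle[OF cs ct] L2_norm_nonneg[of ?M "%x. c s x - c t x"]] by linarith
  finally show ?thesis by (simp add: algebra_simps)
 qed
 have "((%s. ?N s * (2 * L2_norm_on ?M (c t) + ?N s)) \<longlongrightarrow> 0 * (2 * L2_norm_on ?M (c t) + 0)) (at t within {0..T})"
  by (intro tendsto_intros c_cont[OF t])
 then have "((%s. ?N s * (2 * L2_norm_on ?M (c t) + ?N s)) \<longlongrightarrow> 0) (at t within {0..T})" by simp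
 then have "((%s. dual_energy S (c s) - dual_energy S (c t)) \<longlongrightarrow> 0) (at t within {0..T})"
  by (rule Lim_null_comparison[rotated]) (use bound in \<open>auto simp: eventually_at_filter\<close>)
 then show "((%s. dual_energy S (c s)) \<longlongrightarrow> dual_energy S (c t)) (at t within {0..T})"
  by (rule LIM_zero_cancel)
qed

lemma weighted_energy_integrable: "integrable lebesgue (%r. K r * (indicator {0..T} r * dual_energy S (c r)))"
proof -
 obtain B where B: "!!r. r \<in> {0..T} ==> norm (dual_energy S (c r)) <= B"
  using compact_imp_bounded[OF compact_continuous_image[OF dual_energy_continuous compact_Icc]] unfolding bounded_iff by blast
 have "\<bar>indicator {0..T} r * dual_energy S (c r)\<bar> <= \<bar>B\<bar>" for r
  using B[of r] by (cases "r \<in> {0..T}") auto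
 moreover have "(%r. indicator {0..T} r * dual_energy S (c r)) \<in> borel_measurable lebesgue"
 proof -
  have "(%r. indicator {0..T} r *\<^sub>R dual_energy S (c r)) \<in> borel_measurable lborel"
   by (rule borel_measurable_integrable[OF borel_integrable_compact[OF compact_Icc dual_energy_continuous]])
  then show ?thesis by (intro measurable_completion) simp
 qed
 ultimately have "integrable lebesgue (%r. (indicator {0..T} r * dual_energy S (c r)) *\<^sub>R K r)"
  by (intro bounded_mult_integrable[OF K(1), where B="\<bar>B\<bar>"]) auto
 then show ?thesis by (simp add: mult.commute)
qed

lemma dual_energy_increment_approx:
 assumes e: "0 < e" and ab: "0 <= a" "a <= b" "b <= T"
 shows "dual_energy S (c b) - dual_energy S (c a) \<le>
  (\<integral>r. indicator {a..b} r * (2 * (K r * (indicator {0..T} r * dual_energy S (c r))) + e * D r) \<partial>lebesgue)"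
proof -
 let ?M = "lebesgue_on S"
 define G where "G r = 2 * (K r * (indicator {0..T} r * dual_energy S (c r))) + e * D r" for r
 have G: "integrable lebesgue G"
  unfolding G_def by (intro Bochner_Integration.integrable_add integrable_mult_right weighted_energy_integrable D)
 define P where "P a b \<longleftrightarrow> (0 <= a --> a <= b --> b <= T --> dual_energy S (c b) - dual_energy S (c a) <= (\<integral>r. indicator {a..b} r * G r \<partial>lebesgue))" for a b
 have "P a b"
 proof (rule Bolzano)
  show "a <= b" by (rule ab(2))
  show "P a' c'" if h: "P a' b'" "P b' c'" "a' <= b'" "b' <= c'" for a' b' c'
   unfolding P_def
  proof (intro impI)
   assume "0 <= a'" "a' <= c'" "c' <= T"
   then have "dual_energy S (c b') - dual_energy S (c a') <= (\<integral>r. indicator {a'..b'} r * G r \<partial>lebesgue)"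
    "dual_energy S (c c') - dual_energy S (c b') <= (\<integral>r. indicator {b'..c'} r * G r \<partial>lebesgue)"
    using h unfolding P_def by simp_all
   then show "dual_energy S (c c') - dual_energy S (c a') <= (\<integral>r. indicator {a'..c'} r * G r \<partial>lebesgue)"
    using integral_indicator_split[OF G h(3,4)] by linarith
  qed
  fix x assume x: "a <= x" "x <= b"
  then have x': "x \<in> {0..T}" using ab by simp
  have "\<forall>\<^sub>F s in at x within {0..T}. L2_norm_on ?M (%y. c s y - c x y) < e / 4"
   using e by (intro order_tendstoD(2)[OF c_cont[OF x']]) simp
  then obtain d where d: "0 < d" "!!s. s \<in> {0..T} ==> s \<noteq> x ==> dist s x < d ==> L2_norm_on ?M (%y. c s y - c x y) < e / 4"
   unfolding eventually_at by auto
  have near: "L2_norm_on ?M (%y. c s y - c x y) <= e / 4" if "s \<in> {0..T}" "dist s x < d" for s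
  proof (cases "s = x")
   case True
   then show ?thesis using e by (simp add: L2_norm_on_def)
  qed (use d(2) that in \<open>auto intro: less_imp_le\<close>)
  have "P a' b'" if h: "a' <= x" "x <= b'" "b' - a' < d" for a' b'
   unfolding P_def
  proof (intro impI)
   assume ab': "0 <= a'" "a' <= b'" "b' <= T"
   then have mem: "a' \<in> {0..T}" "b' \<in> {0..T}" by auto
   note ca = c[OF mem(1)] and cb = c[OF mem(2)]
   let ?Ra = "riesz_graph S (c a')" and ?Rb = "riesz_graph S (c b')"
   note Ra = riesz_graph(1)[OF S ca] and Rb = riesz_graph(1)[OF S cb]
   have "dual_energy S (c b') - dual_energy S (c a') =
    (\<integral>r. indicator {a'..b'} r * W r ?Rb \<partial>lebesgue) + (\<integral>r. indicator {a'..b'} r * W r ?Ra \<partial>lebesgue)"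
    unfolding dual_energy_diff[OF S cb ca] using incr[OF Rb ab'] incr[OF Ra ab'] by simp
   also have "\<dots> = (\<integral>r. indicator {a'..b'} r * W r ?Rb + indicator {a'..b'} r * W r ?Ra \<partial>lebesgue)"
    by (rule Bochner_Integration.integral_add[OF integrable_indicator_Icc[OF W_int[OF Rb]] integrable_indicator_Icc[OF W_int[OF Ra]], symmetric])
   also have "\<dots> <= (\<integral>r. indicator {a'..b'} r * G r \<partial>lebesgue)"
   proof (rule integral_mono_AE[OF _ integrable_indicator_Icc[OF G]])
    show "integrable lebesgue (%r. indicator {a'..b'} r * W r ?Rb + indicator {a'..b'} r * W r ?Ra)"
     by (rule Bochner_Integration.integrable_add[OF integrable_indicator_Icc[OF W_int[OF Rb]] integrable_indicator_Icc[OF W_int[OF Ra]]])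
    show "AE r in lebesgue. indicator {a'..b'} r * W r ?Rb + indicator {a'..b'} r * W r ?Ra <= indicator {a'..b'} r * G r"
     using W_lip D_nonneg W_est
    proof (eventually_elim)
     case (elim r)
     show ?case
     proof (cases "r \<in> {a'..b'}")
      case True
      then have r: "r \<in> {0..T}" using ab' by simp
      note cr = c[OF r] and Rr = riesz_graph(1)[OF S c[OF r]]
      have step: "W r (riesz_graph S (c q)) <= K r * dual_energy S (c r) + D r * (e / 2)"
       if q: "q \<in> {0..T}" "dist q x < d" for q
      proof -
       note cq = c[OF q(1)]
       have "dist r x < d" using True h by (auto simp: dist_real_def)
       then have "L2_norm_on ?M (%y. c q y - c r y) <= e / 2"
        using L2_norm_triangle[OF cq c[OF x'] cr] near[OF q] near[OF r] L2_norm_diff_commute[of ?M "c x" "c r"]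
        by simp
       then have "L2_norm_on ?M (%y. riesz_graph S (c q) y - riesz_graph S (c r) y) <= e / 2"
        using riesz_graph_contraction[OF S cq cr] by linarith
       then have "D r * L2_norm_on ?M (%y. riesz_graph S (c q) y - riesz_graph S (c r) y) <= D r * (e / 2)"
        using elim(2) by (rule mult_left_mono)
       moreover have "W r (riesz_graph S (c q)) - W r (riesz_graph S (c r)) <= D r * L2_norm_on ?M (%y. riesz_graph S (c q) y - riesz_graph S (c r) y)"
        using elim(1) riesz_graph(1)[OF S cq] Rr by blast
       moreover have "W r (riesz_graph S (c r)) <= K r * dual_energy S (c r)" using elim(3) r by blast
       ultimately show ?thesis by linarith
      qed
      have "dist a' x < d" "dist b' x < d" using h by (auto simp: dist_real_def)
      then have "W r ?Rb + W r ?Ra <= 2 * (K r * dual_energy S (c r)) + e * D r"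
       using step[OF mem(1)] step[OF mem(2)] by (simp add: mult.commute)
      then show ?thesis using True r by (simp add: G_def)
     qed simp
    qed
   qed
   finally show "dual_energy S (c b') - dual_energy S (c a') <= (\<integral>r. indicator {a'..b'} r * G r \<partial>lebesgue)" .
  qed
  with d(1) show "\<exists>d>0. \<forall>a b. a <= x \<and> x <= b \<and> b - a < d --> P a b" by blast
 qed
 then show ?thesis using ab unfolding P_def G_def by simp
qed

lemma dual_energy_increment:
 assumes ab: "0 <= a" "a <= b" "b <= T"
 shows "dual_energy S (c b) - dual_energy S (c a) \<le>
  (\<integral>r. indicator {a..b} r * ((2 * K r) * (indicator {0..T} r * dual_energy S (c r))) \<partial>lebesgue)"
proof (rule field_le_epsilon)
 fix e :: real assume e: "0 < e"
 let ?H = "%r. K r * (indicator {0..T} r * dual_energy S (c r))"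
 define A where "A = (\<integral>r. indicator {a..b} r * D r \<partial>lebesgue)"
 define e' where "e' = e / (\<bar>A\<bar> + 1)"
 have e': "0 < e'" using e by (simp add: e'_def)
 have "e' * A <= e' * (\<bar>A\<bar> + 1)" using e' by (intro mult_left_mono) auto
 also have "\<dots> = e" by (simp add: e'_def)
 finally have A: "e' * A <= e" .
 have "(\<integral>r. indicator {a..b} r * (2 * ?H r + e' * D r) \<partial>lebesgue)
   = (\<integral>r. indicator {a..b} r * ((2 * K r) * (indicator {0..T} r * dual_energy S (c r))) + e' * (indicator {a..b} r * D r) \<partial>lebesgue)"
  by (intro Bochner_Integration.integral_cong refl) (simp add: algebra_simps)
 also have "\<dots> = (\<integral>r. indicator {a..b} r * ((2 * K r) * (indicator {0..T} r * dual_energy S (c r))) \<partial>lebesgue) + (\<integral>r. e' * (indicator {a..b} r * D r) \<partial>lebesgue)"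
 proof (rule Bochner_Integration.integral_add)
  have "integrable lebesgue (%r. 2 * ?H r)" by (rule integrable_mult_right[OF weighted_energy_integrable])
  then have "integrable lebesgue (%r. (2 * K r) * (indicator {0..T} r * dual_energy S (c r)))" by (simp add: mult.assoc)
  then show "integrable lebesgue (%r. indicator {a..b} r * ((2 * K r) * (indicator {0..T} r * dual_energy S (c r))))"
   by (rule integrable_indicator_Icc)
  show "integrable lebesgue (%r. e' * (indicator {a..b} r * D r))"
   by (rule integrable_mult_right[OF integrable_indicator_Icc[OF D]])
 qed
 also have "(\<integral>r. e' * (indicator {a..b} r * D r) \<partial>lebesgue) = e' * A" by (simp add: A_def)
 finally show "dual_energy S (c b) - dual_energy S (c a) \<le>
  (\<integral>r. indicator {a..b} r * ((2 * K r) * (indicator {0..T} r * dual_energy S (c r))) \<partial>lebesgue) + e"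
  using dual_energy_increment_approx[OF e' ab] A by linarith
qed

theorem vanishes:
 assumes T: "0 <= T" and zero: "AE x in lebesgue_on S. c 0 x = 0" and t: "t \<in> {0..T}"
 shows "AE x in lebesgue_on S. c t x = 0"
proof (rule dual_energy_zero[OF S c[OF t]])
 let ?M = "lebesgue_on S"
 have c0: "c 0 \<in> L2_space ?M" using c[of 0] T by simp
 have "L2_norm_on ?M (c 0) = 0" using L2_norm_zero_iff[OF c0] zero by simp
 then have "L2_norm_on ?M (riesz_graph S (c 0)) = 0"
  using riesz_graph_norm_le[OF S c0] L2_norm_nonneg[of ?M "riesz_graph S (c 0)"] by simp
 then have y0: "dual_energy S (c 0) = 0" by (simp add: dual_energy_def)
 show "dual_energy S (c t) = 0"
 proof (rule gronwall_zero[where y="%t. dual_energy S (c t)" and K="%r. 2 * K r" and T=T])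
  show "integrable lebesgue (%r. 2 * K r)" by (rule integrable_mult_right[OF K(1)])
  show "0 <= 2 * K r" for r using K(2)[of r] by simp
  show "0 <= dual_energy S (c t)" for t by (simp add: dual_energy_def)
 qed (use dual_energy_continuous y0 dual_energy_increment t in auto)
qed

end

section \<open>The convolution kernel\<close>

lemma locally_integrable_measurable:
 fixes f :: "'a::euclidean_space => 'b::euclidean_space"
 assumes "open D" "locally_integrable D f"
 shows "(%x. indicator D x *\<^sub>R f x) \<in> borel_measurable lebesgue"
proof -
 obtain C where C: "!!n::nat. compact (C n)" "!!n. C n \<subseteq> D" "!!n. C n \<subseteq> interior (C (Suc n))" "\<Union>(range C) = D"
  using open_Union_compact_subsets[OF assms(1)] by (metis (no_types, lifting))
 have mono: "C n \<subseteq> C m" if "n <= m" for n m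
  by (rule lift_Suc_mono_le[OF _ that]) (use C(3) interior_subset in blast)
 show ?thesis
 proof (rule borel_measurable_LIMSEQ_metric)
  show "(%x. indicator (C n) x *\<^sub>R f x) \<in> borel_measurable lebesgue" for n
   by (rule borel_measurable_integrable[OF locally_integrable_D[OF assms(2) C(1,2)]])
  show "(%n. indicator (C n) x *\<^sub>R f x) \<longlonglongrightarrow> indicator D x *\<^sub>R f x" for x
  proof (cases "x \<in> D")
   case True
   then obtain N where "x \<in> C N" using C(4) by blast
   then have "\<forall>\<^sub>F n in sequentially. indicator D x *\<^sub>R f x = indicator (C n) x *\<^sub>R f x"
    using mono[of N] True by (intro eventually_sequentiallyI[of N]) (auto simp: indicator_def)
   then show ?thesis by (rule Lim_transform_eventually[OF tendsto_const])
  next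
   case False
   then have "(%n. indicator (C n) x *\<^sub>R f x) = (%n. 0)" "indicator D x *\<^sub>R f x = 0"
    using C(2) by (auto simp: indicator_def fun_eq_iff)
   then show ?thesis by (simp only: tendsto_const)
  qed
 qed
qed

definition difference_set :: "'a::euclidean_space set => 'a set" where
 "difference_set S = {x - y |x y. x \<in> S \<and> y \<in> S}"

text \<open>
  The kernel has a weak gradient on the reflected translates of \<open>S\<close> by almost all of its points.
  Countably many of them cover the difference set, and the local gradients are patched.
\<close>

lemma kernel_gradient_has_weak_gradient:
 fixes S :: "'a::euclidean_space set"
 assumes S: "open S" "S \<noteq> {}" and J: "AE x in lebesgue_on S. (%y. J (y - x)) \<in> W11 S"
 shows "open (difference_set S)" "has_weak_gradient (difference_set S) J (kernel_gradient S J)"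
proof -
 define A where "A = {x \<in> S. (%y. J (y - x)) \<in> W11 S}"
 define U where "U x = {z. x + z \<in> S}" for x
 have oU: "open (U x)" for x
 proof -
  have "open ((%z. x + z) -` S)" by (intro open_vimage S(1) continuous_intros)
  then show ?thesis by (simp add: U_def vimage_def)
 qed
 have wU: "\<exists>g. has_weak_gradient (U x) J g" if "x \<in> A" for x
 proof -
  from that obtain g where "has_weak_gradient S (%y. J (y - x)) g" by (auto simp: A_def W11_def)
  from has_weak_gradient_isometry(1)[OF _ S(1) this, of 1 x] show ?thesis by (auto simp: U_def)
 qed
 have D: "difference_set S = (\<Union>x\<in>A. U x)"
 proof
  show "difference_set S \<subseteq> (\<Union>x\<in>A. U x)"
  proof
   fix z assume "z \<in> difference_set S"
   then obtain p q where pq: "p \<in> S" "q \<in> S" "z = p - q" by (auto simp: difference_set_def)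
   have "\<exists>x\<in>A. x + z \<in> S"
   proof (rule ccontr)
    assume no: "\<not> (\<exists>x\<in>A. x + z \<in> S)"
    let ?O = "S \<inter> {x. x + z \<in> S}"
    have "open ((%x. x + z) -` S)" by (intro open_vimage S(1) continuous_intros)
    then have o: "open ?O" using S(1) by (auto simp: vimage_def)
    have "AE x in lebesgue. x \<in> S --> (%y. J (y - x)) \<in> W11 S"
     using J unfolding AE_lebesgue_on_iff[OF open_sets_lebesgue[OF S(1)]] .
    then have "AE x in lebesgue. x \<in> ?O --> x \<in> {}"
     by (rule eventually_mono) (use no in \<open>auto simp: A_def\<close>)
    from mem_closed_if_AE_lebesgue_open[OF o closed_empty this, of q] show False using pq by simp
   qed
   then show "z \<in> (\<Union>x\<in>A. U x)" by (auto simp: U_def)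
  qed
  show "(\<Union>x\<in>A. U x) \<subseteq> difference_set S"
  proof
   fix z assume "z \<in> (\<Union>x\<in>A. U x)"
   then obtain x where "x \<in> S" "x + z \<in> S" by (auto simp: A_def U_def)
   moreover have "z = (x + z) - x" by simp
   ultimately show "z \<in> difference_set S" unfolding difference_set_def by blast
  qed
 qed
 show "open (difference_set S)" unfolding D using oU by blast
 obtain F where F: "F \<subseteq> U ` A" "countable F" "\<Union>F = (\<Union>x\<in>A. U x)"
  by (rule Lindelof[of "U ` A"]) (use oU in auto)
 have "difference_set S \<noteq> {}" using S(2) by (auto simp: difference_set_def)
 then have "F \<noteq> {}" using F(3) D by auto
 then have r: "range (from_nat_into F) = F" using F(2) by (rule range_from_nat_into)
 let ?u = "from_nat_into F"
 have uF: "?u n \<in> F" for n using r by blast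
 have ex: "\<exists>g. has_weak_gradient (?u n) J g" for n
 proof -
  have "?u n \<in> U ` A" using uF[of n] F(1) by blast
  then obtain x where x: "x \<in> A" "?u n = U x" by blast
  show ?thesis unfolding x(2) by (rule wU[OF x(1)])
 qed
 have ou: "open (?u n)" for n
 proof -
  have "?u n \<in> U ` A" using uF[of n] F(1) by blast
  then obtain x where x: "x \<in> A" "?u n = U x" by blast
  show ?thesis unfolding x(2) by (rule oU)
 qed
 have "\<exists>G. has_weak_gradient (\<Union>n. ?u n) J G"
  by (rule has_weak_gradient_patch[OF ou someI_ex[OF ex]])
 moreover have "(\<Union>n. ?u n) = difference_set S" unfolding r F(3) D ..
 ultimately obtain G where "has_weak_gradient (difference_set S) J G" by auto
 then have "has_weak_gradient (difference_set S) J (weak_gradient (difference_set S) J)"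
  by (rule weak_gradient_has_weak_gradient)
 then show "has_weak_gradient (difference_set S) J (kernel_gradient S J)"
  by (simp add: kernel_gradient_def difference_set_def)
qed

text \<open>
  The kernel is even, and weak gradients are unique.
\<close>

lemma kernel_gradient_odd:
 fixes S :: "'a::euclidean_space set"
 assumes D: "open (difference_set S)" "has_weak_gradient (difference_set S) J K" and sym: "!!x. J x = J (- x)"
 shows "AE z in lebesgue. z \<in> difference_set S --> K z = - K (- z)"
proof -
 have neg: "- z \<in> difference_set S \<longleftrightarrow> z \<in> difference_set S" for z
 proof -
  have "- z \<in> difference_set S" if "z \<in> difference_set S" for z
  proof -
   obtain x y where "x \<in> S" "y \<in> S" "z = x - y" using \<open>z \<in> difference_set S\<close> by (auto simp: difference_set_def)
   then have "- z = y - x" by simp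
   then show ?thesis unfolding difference_set_def using \<open>x \<in> S\<close> \<open>y \<in> S\<close> by blast
  qed
  from this[of z] this[of "- z"] show ?thesis by auto
 qed
 have "has_weak_gradient (difference_set S) J (%z. - K (- z))"
  using has_weak_gradient_isometry(1)[OF _ D, of "-1" 0] neg sym[symmetric] by simp
 from has_weak_gradient_unique[OF D this] show ?thesis
  unfolding AE_lebesgue_on_iff[OF open_sets_lebesgue[OF D(1)]] .
qed

lemma integral_cong_AE_lebesgue:
 fixes f g :: "'a::euclidean_space => 'b::euclidean_space"
 assumes "g \<in> borel_measurable lebesgue" "AE x in lebesgue. g x = f x"
 shows "(\<integral>x. f x \<partial>lebesgue) = (\<integral>x. g x \<partial>lebesgue)"
 by (rule integral_cong_AE[OF borel_measurable_AE[OF assms] assms(1)]) (use assms(2) in \<open>auto elim!: eventually_mono\<close>)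

text \<open>
 A Borel kernel bounded in the sense of Schur's test from both sides; the sections of a Lebesgue
 measurable kernel agree almost everywhere with those of a Borel one.
\<close>

locale schur_kernel =
 fixes S :: "'a::euclidean_space set" and k :: "'a => 'b::euclidean_space" and C :: real
 assumes S: "open S" "S \<in> lmeasurable" and C: "0 < C"
  and k[measurable]: "k \<in> borel_measurable borel"
  and row: "!!x. x \<in> S ==> (\<integral>\<^sup>+y. indicator S y * ennreal (norm (k (x - y))) \<partial>lborel) <= ennreal C"
  and col: "!!y. y \<in> S ==> (\<integral>\<^sup>+x. indicator S x * ennreal (norm (k (x - y))) \<partial>lborel) <= ennreal C"
begin

lemma S_borel[measurable]: "S \<in> sets borel" using S(1) by simp

lemma bounded_integrable:
 fixes f :: "'a => real"
 assumes f[measurable]: "f \<in> borel_measurable borel" and b: "AE y in lborel. \<bar>f y\<bar> <= B * indicator S y" and B: "0 <= B" and x: "x \<in> S"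
 shows "integrable lborel (%y. f y *\<^sub>R k (x - y))" "norm (\<integral>y. f y *\<^sub>R k (x - y) \<partial>lborel) <= C * B"
proof -
 have "(\<integral>\<^sup>+y. ennreal (norm (f y *\<^sub>R k (x - y))) \<partial>lborel) <= (\<integral>\<^sup>+y. ennreal B * (indicator S y * ennreal (norm (k (x - y)))) \<partial>lborel)"
 proof (rule nn_integral_mono_AE)
  show "AE y in lborel. ennreal (norm (f y *\<^sub>R k (x - y))) <= ennreal B * (indicator S y * ennreal (norm (k (x - y))))"
   using b
  proof (rule eventually_mono)
   fix y assume *: "\<bar>f y\<bar> <= B * indicator S y"
   show "ennreal (norm (f y *\<^sub>R k (x - y))) <= ennreal B * (indicator S y * ennreal (norm (k (x - y))))"
   proof (cases "y \<in> S")
    case True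
    then have "norm (f y *\<^sub>R k (x - y)) <= B * norm (k (x - y))" using * by (simp add: mult_right_mono)
    then show ?thesis using True B by (simp add: ennreal_leI flip: ennreal_mult)
   next
    case False
    then show ?thesis using * by simp
   qed
  qed
 qed
 also have "\<dots> = ennreal B * (\<integral>\<^sup>+y. indicator S y * ennreal (norm (k (x - y))) \<partial>lborel)"
  by (rule nn_integral_cmult) measurable
 also have "\<dots> <= ennreal B * ennreal C" by (rule mult_left_mono[OF row[OF x]]) simp
 also have "\<dots> = ennreal (C * B)" using B C by (simp add: ennreal_mult mult.commute)
 finally have n: "(\<integral>\<^sup>+y. ennreal (norm (f y *\<^sub>R k (x - y))) \<partial>lborel) <= ennreal (C * B)" .
 show i: "integrable lborel (%y. f y *\<^sub>R k (x - y))"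
  using n by (intro integrableI_bounded) (auto intro: le_less_trans)
 have "ennreal (norm (\<integral>y. f y *\<^sub>R k (x - y) \<partial>lborel)) <= ennreal (C * B)"
  using integral_norm_bound_ennreal[OF i] n by (rule order_trans)
 then show "norm (\<integral>y. f y *\<^sub>R k (x - y) \<partial>lborel) <= C * B" using B C by (simp add: ennreal_le_iff)
qed

text \<open>
  Schur's test in its bilinear form.
\<close>

lemma bilinear_bound:
 fixes f :: "'a => real" and g :: "'a => real"
 assumes f[measurable]: "f \<in> borel_measurable borel" and g[measurable]: "g \<in> borel_measurable borel" and l: "0 < l"
 shows "(\<integral>\<^sup>+x. indicator S x * (\<integral>\<^sup>+y. indicator S y * ennreal (\<bar>f y\<bar> * norm (k (x - y)) * \<bar>g x\<bar>) \<partial>lborel) \<partial>lborel)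
  <= ennreal (C * l / 2) * (\<integral>\<^sup>+y. indicator S y * ennreal ((f y)\<^sup>2) \<partial>lborel)
   + ennreal (C / (2 * l)) * (\<integral>\<^sup>+x. indicator S x * ennreal ((g x)\<^sup>2) \<partial>lborel)"
proof -
 let ?I = "indicator S :: 'a => ennreal"
 have young: "?I x * (?I y * ennreal (\<bar>f y\<bar> * norm (k (x - y)) * \<bar>g x\<bar>)) \<le>
   ennreal (l / 2) * (?I y * ennreal ((f y)\<^sup>2) * (?I x * ennreal (norm (k (x - y)))))
   + ennreal (1 / (2 * l)) * (?I x * ennreal ((g x)\<^sup>2) * (?I y * ennreal (norm (k (x - y)))))" for x y
 proof -
  have "0 <= (l * \<bar>f y\<bar> - \<bar>g x\<bar>)\<^sup>2" by simp
  then have "2 * l * (\<bar>f y\<bar> * \<bar>g x\<bar>) <= l\<^sup>2 * (f y)\<^sup>2 + (g x)\<^sup>2"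
   by (simp add: power2_diff power_mult_distrib)
  then have "\<bar>f y\<bar> * \<bar>g x\<bar> <= l / 2 * (f y)\<^sup>2 + 1 / (2 * l) * (g x)\<^sup>2"
   using l by (simp add: field_simps power2_eq_square)
  then have "(\<bar>f y\<bar> * \<bar>g x\<bar>) * norm (k (x - y)) <= (l / 2 * (f y)\<^sup>2 + 1 / (2 * l) * (g x)\<^sup>2) * norm (k (x - y))"
   by (rule mult_right_mono) simp
  then have "ennreal (\<bar>f y\<bar> * norm (k (x - y)) * \<bar>g x\<bar>) <= ennreal (l / 2 * ((f y)\<^sup>2 * norm (k (x - y))) + 1 / (2 * l) * ((g x)\<^sup>2 * norm (k (x - y))))"
   by (intro ennreal_leI) (simp add: algebra_simps)
  also have "\<dots> = ennreal (l / 2) * (ennreal ((f y)\<^sup>2) * ennreal (norm (k (x - y)))) + ennreal (1 / (2 * l)) * (ennreal ((g x)\<^sup>2) * ennreal (norm (k (x - y))))"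
  proof -
   have m: "ennreal (a * (b * c)) = ennreal a * (ennreal b * ennreal c)" if "0 <= a" "0 <= b" "0 <= c" for a b c
    using that by (simp add: ennreal_mult)
   have "0 <= l / 2" "0 <= 1 / (2 * l)" using l by auto
   then show ?thesis
    by (subst ennreal_plus) (auto simp only: m zero_le_power2 norm_ge_zero mult_nonneg_nonneg intro!: mult_nonneg_nonneg)
  qed
  finally show ?thesis by (cases "x \<in> S"; cases "y \<in> S") simp_all
 qed
 have "(\<integral>\<^sup>+x. ?I x * (\<integral>\<^sup>+y. ?I y * ennreal (\<bar>f y\<bar> * norm (k (x - y)) * \<bar>g x\<bar>) \<partial>lborel) \<partial>lborel)
   = (\<integral>\<^sup>+x. (\<integral>\<^sup>+y. ?I x * (?I y * ennreal (\<bar>f y\<bar> * norm (k (x - y)) * \<bar>g x\<bar>)) \<partial>lborel) \<partial>lborel)"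
  by (intro nn_integral_cong nn_integral_cmult[symmetric]) measurable
 also have "\<dots> <= (\<integral>\<^sup>+x. (\<integral>\<^sup>+y. ennreal (l / 2) * (?I y * ennreal ((f y)\<^sup>2) * (?I x * ennreal (norm (k (x - y)))))
   + ennreal (1 / (2 * l)) * (?I x * ennreal ((g x)\<^sup>2) * (?I y * ennreal (norm (k (x - y))))) \<partial>lborel) \<partial>lborel)"
  by (intro nn_integral_mono young)
 also have "\<dots> = (\<integral>\<^sup>+x. (\<integral>\<^sup>+y. ennreal (l / 2) * (?I y * ennreal ((f y)\<^sup>2) * (?I x * ennreal (norm (k (x - y))))) \<partial>lborel) \<partial>lborel)
   + (\<integral>\<^sup>+x. (\<integral>\<^sup>+y. ennreal (1 / (2 * l)) * (?I x * ennreal ((g x)\<^sup>2) * (?I y * ennreal (norm (k (x - y))))) \<partial>lborel) \<partial>lborel)"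
 proof -
  have "(\<integral>\<^sup>+y. ennreal (l / 2) * (?I y * ennreal ((f y)\<^sup>2) * (?I x * ennreal (norm (k (x - y)))))
    + ennreal (1 / (2 * l)) * (?I x * ennreal ((g x)\<^sup>2) * (?I y * ennreal (norm (k (x - y))))) \<partial>lborel)
   = (\<integral>\<^sup>+y. ennreal (l / 2) * (?I y * ennreal ((f y)\<^sup>2) * (?I x * ennreal (norm (k (x - y))))) \<partial>lborel)
    + (\<integral>\<^sup>+y. ennreal (1 / (2 * l)) * (?I x * ennreal ((g x)\<^sup>2) * (?I y * ennreal (norm (k (x - y))))) \<partial>lborel)" for x
   by (rule nn_integral_add) measurable
  then show ?thesis by (simp only:) (rule nn_integral_add, measurable)
 qed
 also have "(\<integral>\<^sup>+x. (\<integral>\<^sup>+y. ennreal (l / 2) * (?I y * ennreal ((f y)\<^sup>2) * (?I x * ennreal (norm (k (x - y))))) \<partial>lborel) \<partial>lborel)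
   <= ennreal (C * l / 2) * (\<integral>\<^sup>+y. ?I y * ennreal ((f y)\<^sup>2) \<partial>lborel)"
 proof -
  have "(\<integral>\<^sup>+x. (\<integral>\<^sup>+y. ennreal (l / 2) * (?I y * ennreal ((f y)\<^sup>2) * (?I x * ennreal (norm (k (x - y))))) \<partial>lborel) \<partial>lborel)
   = (\<integral>\<^sup>+y. (\<integral>\<^sup>+x. ennreal (l / 2) * (?I y * ennreal ((f y)\<^sup>2) * (?I x * ennreal (norm (k (x - y))))) \<partial>lborel) \<partial>lborel)"
   by (rule lborel_pair.Fubini'[symmetric]) measurable
  also have "\<dots> = (\<integral>\<^sup>+y. (ennreal (l / 2) * (?I y * ennreal ((f y)\<^sup>2))) * (\<integral>\<^sup>+x. ?I x * ennreal (norm (k (x - y))) \<partial>lborel) \<partial>lborel)"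
   unfolding mult.assoc[symmetric, of "ennreal (l / 2)"] by (intro nn_integral_cong nn_integral_cmult) measurable
  also have "\<dots> <= (\<integral>\<^sup>+y. (ennreal (l / 2) * (?I y * ennreal ((f y)\<^sup>2))) * ennreal C \<partial>lborel)"
  proof (rule nn_integral_mono)
   fix y
   show "(ennreal (l / 2) * (?I y * ennreal ((f y)\<^sup>2))) * (\<integral>\<^sup>+x. ?I x * ennreal (norm (k (x - y))) \<partial>lborel)
    <= (ennreal (l / 2) * (?I y * ennreal ((f y)\<^sup>2))) * ennreal C"
    by (cases "y \<in> S") (auto intro!: mult_left_mono col)
  qed
  also have "\<dots> = (\<integral>\<^sup>+y. ennreal (C * l / 2) * (?I y * ennreal ((f y)\<^sup>2)) \<partial>lborel)"
  proof (intro nn_integral_cong)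
   fix y
   have "ennreal (C * l / 2) = ennreal (l / 2) * ennreal C"
    using C l by (simp add: mult.commute flip: ennreal_mult)
   then show "(ennreal (l / 2) * (?I y * ennreal ((f y)\<^sup>2))) * ennreal C = ennreal (C * l / 2) * (?I y * ennreal ((f y)\<^sup>2))"
    by (simp only: ac_simps)
  qed
  also have "\<dots> = ennreal (C * l / 2) * (\<integral>\<^sup>+y. ?I y * ennreal ((f y)\<^sup>2) \<partial>lborel)"
   by (rule nn_integral_cmult) measurable
  finally show ?thesis .
 qed
 also have "(\<integral>\<^sup>+x. (\<integral>\<^sup>+y. ennreal (1 / (2 * l)) * (?I x * ennreal ((g x)\<^sup>2) * (?I y * ennreal (norm (k (x - y))))) \<partial>lborel) \<partial>lborel)
   <= ennreal (C / (2 * l)) * (\<integral>\<^sup>+x. ?I x * ennreal ((g x)\<^sup>2) \<partial>lborel)"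
 proof -
  have "(\<integral>\<^sup>+x. (\<integral>\<^sup>+y. ennreal (1 / (2 * l)) * (?I x * ennreal ((g x)\<^sup>2) * (?I y * ennreal (norm (k (x - y))))) \<partial>lborel) \<partial>lborel)
   = (\<integral>\<^sup>+x. (ennreal (1 / (2 * l)) * (?I x * ennreal ((g x)\<^sup>2))) * (\<integral>\<^sup>+y. ?I y * ennreal (norm (k (x - y))) \<partial>lborel) \<partial>lborel)"
   unfolding mult.assoc[symmetric, of "ennreal (1 / (2 * l))"] by (intro nn_integral_cong nn_integral_cmult) measurable
  also have "\<dots> <= (\<integral>\<^sup>+x. (ennreal (1 / (2 * l)) * (?I x * ennreal ((g x)\<^sup>2))) * ennreal C \<partial>lborel)"
  proof (rule nn_integral_mono)
   fix x
   show "(ennreal (1 / (2 * l)) * (?I x * ennreal ((g x)\<^sup>2))) * (\<integral>\<^sup>+y. ?I y * ennreal (norm (k (x - y))) \<partial>lborel)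
    <= (ennreal (1 / (2 * l)) * (?I x * ennreal ((g x)\<^sup>2))) * ennreal C"
    by (cases "x \<in> S") (auto intro!: mult_left_mono row)
  qed
  also have "\<dots> = (\<integral>\<^sup>+x. ennreal (C / (2 * l)) * (?I x * ennreal ((g x)\<^sup>2)) \<partial>lborel)"
  proof (intro nn_integral_cong)
   fix x
   have "ennreal (C / (2 * l)) = ennreal (1 / (2 * l)) * ennreal C"
    using C l by (simp flip: ennreal_mult)
   then show "(ennreal (1 / (2 * l)) * (?I x * ennreal ((g x)\<^sup>2))) * ennreal C = ennreal (C / (2 * l)) * (?I x * ennreal ((g x)\<^sup>2))"
    by (simp only: ac_simps)
  qed
  also have "\<dots> = ennreal (C / (2 * l)) * (\<integral>\<^sup>+x. ?I x * ennreal ((g x)\<^sup>2) \<partial>lborel)"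
   by (rule nn_integral_cmult) measurable
  finally show ?thesis .
 qed
 finally show ?thesis by (simp add: add_mono add_left_mono add_right_mono)
qed

lemma L2_bound:
 fixes f :: "'a => real"
 assumes f[measurable]: "f \<in> borel_measurable borel" and b: "AE y in lborel. \<bar>f y\<bar> <= B * indicator S y" and B: "0 <= B"
 defines "T \<equiv> %x. \<integral>y. f y *\<^sub>R k (x - y) \<partial>lborel"
 shows "L2_norm_on (lebesgue_on S) T <= C * L2_norm_on (lebesgue_on S) f" "T \<in> borel_measurable borel"
proof -
 let ?I = "indicator S :: 'a => ennreal"
 let ?M = "lebesgue_on S"
 interpret finite_measure ?M by (rule finite_measure_lebesgue_on[OF S(2)])
 show T[measurable]: "T \<in> borel_measurable borel" unfolding T_def by measurable
 have mon: "g \<in> borel_measurable ?M" if "g \<in> borel_measurable borel" for g :: "'a => 'c::euclidean_space"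
  using that by (intro measurable_lebesgue_on measurable_completion) simp
 have TB: "norm (T x) <= C * B" if "x \<in> S" for x unfolding T_def by (rule bounded_integrable(2)[OF f b B that])
 have TL: "T \<in> L2_space ?M" using TB by (intro L2_bounded[OF mon[OF T]] AE_I2) auto
 have fL: "f \<in> L2_space ?M"
 proof (rule L2_bounded[OF mon[OF f]])
  have "AE y in lebesgue. \<bar>f y\<bar> <= B * indicator S y" using b by (rule AE_completion)
  then show "AE y in ?M. norm (f y) <= B"
   unfolding AE_lebesgue_on_iff[OF open_sets_lebesgue[OF S(1)]]
   by (rule eventually_mono) (auto simp: indicator_def split: if_splits)
 qed
 have conv: "(\<integral>\<^sup>+x. ?I x * ennreal ((norm (g x))\<^sup>2) \<partial>lborel) = ennreal ((L2_norm_on ?M g)\<^sup>2)"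
  if g: "g \<in> L2_space ?M" for g :: "'a => 'c::euclidean_space"
 proof -
  have "(\<integral>\<^sup>+x. ?I x * ennreal ((norm (g x))\<^sup>2) \<partial>lborel) = (\<integral>\<^sup>+x. ennreal ((norm (g x))\<^sup>2) * ?I x \<partial>lebesgue)"
   by (simp add: nn_integral_completion mult.commute)
  also have "\<dots> = (\<integral>\<^sup>+x. ennreal ((norm (g x))\<^sup>2) \<partial>?M)"
   using open_sets_lebesgue[OF S(1)] by (subst nn_integral_restrict_space) auto
  also have "\<dots> = ennreal (\<integral>x. (norm (g x))\<^sup>2 \<partial>?M)"
   by (rule nn_integral_eq_integral[OF L2_spaceD(2)[OF g]]) simp
  finally show ?thesis by (simp add: L2_norm_on_def Bochner_Integration.integral_nonneg)
 qed
 have pt: "?I x * ennreal ((norm (T x))\<^sup>2) <= ?I x * (\<integral>\<^sup>+y. ?I y * ennreal (\<bar>f y\<bar> * norm (k (x - y)) * \<bar>norm (T x)\<bar>) \<partial>lborel)" for x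
 proof (cases "x \<in> S")
  case True
  have "ennreal (norm (T x)) <= (\<integral>\<^sup>+y. ennreal (norm (f y *\<^sub>R k (x - y))) \<partial>lborel)"
   unfolding T_def by (rule integral_norm_bound_ennreal[OF bounded_integrable(1)[OF f b B True]])
  also have "\<dots> = (\<integral>\<^sup>+y. ?I y * ennreal (\<bar>f y\<bar> * norm (k (x - y))) \<partial>lborel)"
   using b by (intro nn_integral_cong_AE) (auto elim!: eventually_mono simp: indicator_def split: if_splits)
  finally have "ennreal (norm (T x)) * ennreal (norm (T x)) <= (\<integral>\<^sup>+y. ?I y * ennreal (\<bar>f y\<bar> * norm (k (x - y))) \<partial>lborel) * ennreal (norm (T x))"
   by (rule mult_right_mono) simp
  also have "\<dots> = (\<integral>\<^sup>+y. ?I y * ennreal (\<bar>f y\<bar> * norm (k (x - y))) * ennreal (norm (T x)) \<partial>lborel)"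
   by (rule nn_integral_multc[symmetric]) measurable
  also have "\<dots> = (\<integral>\<^sup>+y. ?I y * ennreal (\<bar>f y\<bar> * norm (k (x - y)) * \<bar>norm (T x)\<bar>) \<partial>lborel)"
   by (intro nn_integral_cong) (simp add: ennreal_mult mult.assoc)
  finally show ?thesis using True by (simp add: power2_eq_square ennreal_mult)
 qed simp
 have "ennreal ((L2_norm_on ?M T)\<^sup>2) = (\<integral>\<^sup>+x. ?I x * ennreal ((norm (T x))\<^sup>2) \<partial>lborel)" by (rule conv[OF TL, symmetric])
 also have "\<dots> <= (\<integral>\<^sup>+x. ?I x * (\<integral>\<^sup>+y. ?I y * ennreal (\<bar>f y\<bar> * norm (k (x - y)) * \<bar>norm (T x)\<bar>) \<partial>lborel) \<partial>lborel)"
  by (rule nn_integral_mono[OF pt])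
 also have "\<dots> <= ennreal (C * C / 2) * (\<integral>\<^sup>+y. ?I y * ennreal ((f y)\<^sup>2) \<partial>lborel)
   + ennreal (C / (2 * C)) * (\<integral>\<^sup>+x. ?I x * ennreal ((norm (T x))\<^sup>2) \<partial>lborel)"
  by (rule bilinear_bound[OF f _ C]) measurable
 also have "\<dots> = ennreal (C * C / 2) * ennreal ((L2_norm_on ?M f)\<^sup>2) + ennreal (1 / 2) * ennreal ((L2_norm_on ?M T)\<^sup>2)"
  using conv[OF TL] conv[OF fL] C by simp
 also have "\<dots> = ennreal (C * C / 2 * (L2_norm_on ?M f)\<^sup>2 + 1 / 2 * (L2_norm_on ?M T)\<^sup>2)"
 proof -
  have "ennreal p * ennreal q + ennreal r * ennreal s = ennreal (p * q + r * s)"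
   if "0 <= p" "0 <= q" "0 <= r" "0 <= s" for p q r s
   using that by (simp add: ennreal_plus ennreal_mult)
  from this[of "C * C / 2" "(L2_norm_on ?M f)\<^sup>2" "1 / 2" "(L2_norm_on ?M T)\<^sup>2"] show ?thesis using C by simp
 qed
 finally have "(L2_norm_on ?M T)\<^sup>2 <= C * C / 2 * (L2_norm_on ?M f)\<^sup>2 + 1 / 2 * (L2_norm_on ?M T)\<^sup>2"
  by (subst (asm) ennreal_le_iff) (use C in auto)
 then have "(L2_norm_on ?M T)\<^sup>2 <= (C * L2_norm_on ?M f)\<^sup>2"
  by (simp add: power_mult_distrib power2_eq_square[of C])
 then show "L2_norm_on ?M T <= C * L2_norm_on ?M f"
  by (rule power2_le_imp_le) (use C L2_norm_nonneg[of ?M f] in simp)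
qed

end

locale schur_convolution = schur_kernel S k C
 for S :: "'a::euclidean_space set" and k :: "'a => 'b::euclidean_space" and C :: real +
 fixes \<kappa> :: "'a => 'b"
 assumes rep: "!!x. x \<in> S ==> AE y in lebesgue. y \<in> S --> \<kappa> (x - y) = k (x - y)"
  and rep_col: "!!y. y \<in> S ==> AE x in lebesgue. x \<in> S --> \<kappa> (x - y) = k (x - y)"
begin

definition conv :: "('a => real) => 'a => 'b" where
 "conv f x = (\<integral>y. f y *\<^sub>R \<kappa> (x - y) \<partial>lebesgue_on S)"

lemma conv_borel:
 fixes f :: "'a => real"
 assumes f: "f \<in> borel_measurable (lebesgue_on S)" and b: "AE y in lebesgue_on S. \<bar>f y\<bar> <= B"
 obtains g where "g \<in> borel_measurable borel" "AE y in lborel. \<bar>g y\<bar> <= B * indicator S y"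
  "AE y in lebesgue_on S. f y = g y" "!!x. x \<in> S ==> conv f x = (\<integral>y. g y *\<^sub>R k (x - y) \<partial>lborel)"
proof -
 note sl = open_sets_lebesgue[OF S(1)]
 have "(%y. indicator S y *\<^sub>R f y) \<in> borel_measurable lebesgue"
  using f borel_measurable_restrict_space_iff[of S lebesgue f] sl by simp
 then obtain g where g[measurable]: "g \<in> borel_measurable borel" and fg: "AE y in lebesgue. indicator S y *\<^sub>R f y = g y"
  by (rule lebesgue_borel_representative)
 have b': "AE y in lebesgue. y \<in> S --> \<bar>f y\<bar> <= B" using b unfolding AE_lebesgue_on_iff[OF sl] .
 have "AE y in lebesgue. \<bar>g y\<bar> <= B * indicator S y"
  using fg b'
 proof eventually_elim
  case (elim y)
  then show ?case by (cases "y \<in> S") (auto simp: elim(1)[symmetric])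
 qed
 then have gb: "AE y in lborel. \<bar>g y\<bar> <= B * indicator S y" by (simp add: AE_completion_iff)
 have fg': "AE y in lebesgue_on S. f y = g y"
  unfolding AE_lebesgue_on_iff[OF sl] using fg by (rule eventually_mono) auto
 have "conv f x = (\<integral>y. g y *\<^sub>R k (x - y) \<partial>lborel)" if x: "x \<in> S" for x
 proof -
  have "conv f x = (\<integral>y. indicator S y *\<^sub>R (f y *\<^sub>R \<kappa> (x - y)) \<partial>lebesgue)"
   unfolding conv_def by (rule integral_lebesgue_on_indicator(1)[OF sl])
  also have "\<dots> = (\<integral>y. g y *\<^sub>R k (x - y) \<partial>lebesgue)"
  proof (rule integral_cong_AE_lebesgue)
   show "(%y. g y *\<^sub>R k (x - y)) \<in> borel_measurable lebesgue" by (intro measurable_completion) measurable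
   show "AE y in lebesgue. g y *\<^sub>R k (x - y) = indicator S y *\<^sub>R (f y *\<^sub>R \<kappa> (x - y))"
    using fg rep[OF x]
   proof eventually_elim
    case (elim y)
    then show ?case by (cases "y \<in> S") (auto simp: elim(1)[symmetric])
   qed
  qed
  also have "\<dots> = (\<integral>y. g y *\<^sub>R k (x - y) \<partial>lborel)" by (rule integral_completion) measurable
  finally show ?thesis .
 qed
 with g gb fg' show thesis by (rule that)
qed

lemma conv_bound:
 assumes f: "f \<in> borel_measurable (lebesgue_on S)" "AE y in lebesgue_on S. \<bar>f y\<bar> <= B" and B: "0 <= B" and x: "x \<in> S"
 shows "norm (conv f x) <= C * B"
proof -
 obtain g where g: "g \<in> borel_measurable borel" "AE y in lborel. \<bar>g y\<bar> <= B * indicator S y"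
  "!!x. x \<in> S ==> conv f x = (\<integral>y. g y *\<^sub>R k (x - y) \<partial>lborel)"
  using conv_borel[OF f] by blast
 show ?thesis unfolding g(3)[OF x] by (rule bounded_integrable(2)[OF g(1,2) B x])
qed

lemma conv_L2:
 assumes f: "f \<in> borel_measurable (lebesgue_on S)" "AE y in lebesgue_on S. \<bar>f y\<bar> <= B" and B: "0 <= B"
 shows "conv f \<in> borel_measurable (lebesgue_on S)" "L2_norm_on (lebesgue_on S) (conv f) <= C * L2_norm_on (lebesgue_on S) f"
proof -
 obtain g where g: "g \<in> borel_measurable borel" "AE y in lborel. \<bar>g y\<bar> <= B * indicator S y"
  "AE y in lebesgue_on S. f y = g y" "!!x. x \<in> S ==> conv f x = (\<integral>y. g y *\<^sub>R k (x - y) \<partial>lborel)"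
  using conv_borel[OF f] by blast
 let ?T = "%x. \<integral>y. g y *\<^sub>R k (x - y) \<partial>lborel"
 have mon: "h \<in> borel_measurable (lebesgue_on S)" if "h \<in> borel_measurable borel" for h :: "'a => 'd::euclidean_space"
  using that by (intro measurable_lebesgue_on measurable_completion) simp
 have T: "?T \<in> borel_measurable (lebesgue_on S)" by (rule mon[OF L2_bound(2)[OF g(1,2) B]])
 have eq: "conv f x = ?T x" if "x \<in> space (lebesgue_on S)" for x using that by (intro g(4)) simp
 show m: "conv f \<in> borel_measurable (lebesgue_on S)"
  using T by (subst measurable_cong[OF eq])
 have "L2_norm_on (lebesgue_on S) (conv f) = L2_norm_on (lebesgue_on S) ?T"
  using eq by (intro L2_norm_cong_AE m T AE_I2)
 also have "\<dots> <= C * L2_norm_on (lebesgue_on S) g" by (rule L2_bound(1)[OF g(1,2) B])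
 also have "L2_norm_on (lebesgue_on S) g = L2_norm_on (lebesgue_on S) f"
  by (rule L2_norm_cong_AE[OF mon[OF g(1)] f(1)]) (use g(3) in \<open>auto elim!: eventually_mono\<close>)
 finally show "L2_norm_on (lebesgue_on S) (conv f) <= C * L2_norm_on (lebesgue_on S) f" .
qed

lemma conv_integrable:
 assumes f: "f \<in> borel_measurable (lebesgue_on S)" "AE y in lebesgue_on S. \<bar>f y\<bar> <= B" and B: "0 <= B" and x: "x \<in> S"
 shows "integrable (lebesgue_on S) (%y. f y *\<^sub>R \<kappa> (x - y))"
proof -
 note sl = open_sets_lebesgue[OF S(1)]
 obtain g where g: "g \<in> borel_measurable borel" "AE y in lborel. \<bar>g y\<bar> <= B * indicator S y"
  "AE y in lebesgue_on S. f y = g y"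
  using conv_borel[OF f] by blast
 have i: "integrable lborel (%y. g y *\<^sub>R k (x - y))" by (rule bounded_integrable(1)[OF g(1,2) B x])
 have il: "integrable lebesgue (%y. g y *\<^sub>R k (x - y))"
  using i integrable_completion[OF borel_measurable_integrable[OF i]] by simp
 have gb: "AE y in lebesgue. \<bar>g y\<bar> <= B * indicator S y" by (rule AE_completion[OF g(2)])
 have fg: "AE y in lebesgue. y \<in> S --> f y = g y" using g(3) unfolding AE_lebesgue_on_iff[OF sl] .
 have "AE y in lebesgue. g y *\<^sub>R k (x - y) = indicator S y *\<^sub>R (f y *\<^sub>R \<kappa> (x - y))"
  using gb fg rep[OF x]
 proof (eventually_elim)
  case (elim y)
  then show ?case by (cases "y \<in> S") auto
 qed
 from integrable_cong_AE_lebesgue(1)[OF il this]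
 show ?thesis unfolding integral_lebesgue_on_indicator(2)[OF sl] .
qed

lemma conv_diff:
 assumes f: "f \<in> borel_measurable (lebesgue_on S)" "AE y in lebesgue_on S. \<bar>f y\<bar> <= B"
  and g: "g \<in> borel_measurable (lebesgue_on S)" "AE y in lebesgue_on S. \<bar>g y\<bar> <= B"
  and B: "0 <= B" and x: "x \<in> S"
 shows "conv (%y. f y - g y) x = conv f x - conv g x"
 unfolding conv_def scaleR_diff_left
 by (rule Bochner_Integration.integral_diff[OF conv_integrable[OF f B x] conv_integrable[OF g B x]])

lemma conv_one:
 assumes x: "x \<in> S"
 shows "conv (%y. 1) x = (\<integral>y. indicator S y *\<^sub>R k (x - y) \<partial>lborel)"
proof -
 note sl = open_sets_lebesgue[OF S(1)]
 have "conv (%y. 1) x = (\<integral>y. indicator S y *\<^sub>R \<kappa> (x - y) \<partial>lebesgue)"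
  unfolding conv_def scaleR_one by (rule integral_lebesgue_on_indicator(1)[OF sl])
 also have "\<dots> = (\<integral>y. indicator S y *\<^sub>R k (x - y) \<partial>lebesgue)"
 proof (rule integral_cong_AE_lebesgue)
  show "(%y. indicator S y *\<^sub>R k (x - y)) \<in> borel_measurable lebesgue" by (intro measurable_completion) measurable
  show "AE y in lebesgue. indicator S y *\<^sub>R k (x - y) = indicator S y *\<^sub>R \<kappa> (x - y)"
   using rep[OF x] by (rule eventually_mono) (auto simp: indicator_def)
 qed
 also have "\<dots> = (\<integral>y. indicator S y *\<^sub>R k (x - y) \<partial>lborel)" by (rule integral_completion) measurable
 finally show ?thesis .
qed

lemma product_integrable:
 fixes F :: "'a \<times> 'a => 'd::euclidean_space"
 assumes F: "F \<in> borel_measurable (lborel \<Otimes>\<^sub>M lborel)" and B: "0 <= B"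
  and b: "!!x y. norm (F (x, y)) <= B * (indicator S x * indicator S y * norm (k (x - y)))"
 shows "integrable (lborel \<Otimes>\<^sub>M lborel) F"
proof (rule integrableI_bounded[OF F])
 have "(\<integral>\<^sup>+p. ennreal (norm (F p)) \<partial>(lborel \<Otimes>\<^sub>M lborel)) = (\<integral>\<^sup>+x. \<integral>\<^sup>+y. ennreal (norm (F (x, y))) \<partial>lborel \<partial>lborel)"
  by (intro lborel.nn_integral_fst[symmetric] measurable_compose[OF measurable_compose[OF F borel_measurable_norm] measurable_ennreal])
 also have "\<dots> <= (\<integral>\<^sup>+x. ennreal (B * C) * indicator S x \<partial>lborel)"
 proof (rule nn_integral_mono)
  fix x
  have "(\<integral>\<^sup>+y. ennreal (norm (F (x, y))) \<partial>lborel) <= (\<integral>\<^sup>+y. (ennreal B * indicator S x) * (indicator S y * ennreal (norm (k (x - y)))) \<partial>lborel)"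
  proof (rule nn_integral_mono)
   fix y
   have "ennreal (norm (F (x, y))) <= ennreal (B * (indicator S x * indicator S y * norm (k (x - y))))"
    by (rule ennreal_leI[OF b])
   also have "\<dots> = (ennreal B * indicator S x) * (indicator S y * ennreal (norm (k (x - y))))"
    using B by (cases "x \<in> S"; cases "y \<in> S") (auto simp: ennreal_mult)
   finally show "ennreal (norm (F (x, y))) <= (ennreal B * indicator S x) * (indicator S y * ennreal (norm (k (x - y))))" .
  qed
  also have "\<dots> = (ennreal B * indicator S x) * (\<integral>\<^sup>+y. indicator S y * ennreal (norm (k (x - y))) \<partial>lborel)"
   by (rule nn_integral_cmult) measurable
  also have "\<dots> <= ennreal (B * C) * indicator S x"
  proof (cases "x \<in> S")
   case True
   then show ?thesis using mult_left_mono[OF row[OF True], of "ennreal B"] B C by (simp add: ennreal_mult)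
  qed simp
  finally show "(\<integral>\<^sup>+y. ennreal (norm (F (x, y))) \<partial>lborel) <= ennreal (B * C) * indicator S x" .
 qed
 also have "\<dots> = ennreal (B * C) * emeasure lborel S" by (subst nn_integral_cmult_indicator) (use S_borel in auto)
 also have "\<dots> < \<infinity>"
 proof -
  have "emeasure lebesgue S < \<infinity>" using S(2) by (auto simp: fmeasurable_def)
  then have "emeasure lborel S < \<infinity>" by simp
  then show ?thesis by (simp add: ennreal_mult_less_top)
 qed
 finally show "(\<integral>\<^sup>+p. ennreal (norm (F p)) \<partial>(lborel \<Otimes>\<^sub>M lborel)) < \<infinity>" .
qed

end

lemma schur_convolution_exists:
 fixes S :: "'a::euclidean_space set" and \<kappa> :: "'a => 'b::euclidean_space"
 assumes S: "open S" "S \<in> lmeasurable" and D: "open (difference_set S)"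
  and li: "locally_integrable (difference_set S) \<kappa>"
  and even: "AE z in lebesgue. z \<in> difference_set S --> norm (\<kappa> z) = norm (\<kappa> (- z))"
  and fin: "kernel_sup S \<kappa> < \<infinity>"
 obtains k C where "schur_convolution S k C \<kappa>"
proof -
 note sl = open_sets_lebesgue[OF S(1)]
 obtain k where k[measurable]: "k \<in> borel_measurable borel" and eq: "AE z in lebesgue. indicator (difference_set S) z *\<^sub>R \<kappa> z = k z"
  by (rule lebesgue_borel_representative[OF locally_integrable_measurable[OF D li]])
 define C where "C = enn2real (kernel_sup S \<kappa>) + 1"
 have C: "0 < C" "kernel_sup S \<kappa> <= ennreal C"
 proof -
  show "0 < C" by (simp add: C_def add_nonneg_pos)
  have "kernel_sup S \<kappa> = ennreal (enn2real (kernel_sup S \<kappa>))" using fin by simp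
  also have "\<dots> <= ennreal C" by (rule ennreal_leI) (simp add: C_def)
  finally show "kernel_sup S \<kappa> <= ennreal C" .
 qed
 have diff: "x - y \<in> difference_set S" if "x \<in> S" "y \<in> S" for x y
  using that unfolding difference_set_def by blast
 have sec: "AE y in lebesgue. y \<in> S --> \<kappa> (x - y) = k (x - y)" if x: "x \<in> S" for x
  using AE_reflect[OF eq, of x]
 proof (rule eventually_mono)
  fix y assume "indicator (difference_set S) (x - y) *\<^sub>R \<kappa> (x - y) = k (x - y)"
  then show "y \<in> S --> \<kappa> (x - y) = k (x - y)" using diff[OF x, of y] by auto
 qed
 have sec': "AE x in lebesgue. x \<in> S --> \<kappa> (x - y) = k (x - y)" if y: "y \<in> S" for y
  using AE_shift[OF eq, of y]
 proof (rule eventually_mono)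
  fix x assume "indicator (difference_set S) (x - y) *\<^sub>R \<kappa> (x - y) = k (x - y)"
  then show "x \<in> S --> \<kappa> (x - y) = k (x - y)" using diff[OF _ y, of x] by auto
 qed
 have row: "(\<integral>\<^sup>+y. indicator S y * ennreal (norm (k (x - y))) \<partial>lborel) <= ennreal C" if x: "x \<in> S" for x
 proof -
  have "(\<integral>\<^sup>+y. indicator S y * ennreal (norm (k (x - y))) \<partial>lborel) = (\<integral>\<^sup>+y. indicator S y * ennreal (norm (k (x - y))) \<partial>lebesgue)"
   by (rule nn_integral_completion[symmetric])
  also have "\<dots> = (\<integral>\<^sup>+y. ennreal (norm (\<kappa> (x - y))) * indicator S y \<partial>lebesgue)"
  proof (rule nn_integral_cong_AE)
   show "AE y in lebesgue. indicator S y * ennreal (norm (k (x - y))) = ennreal (norm (\<kappa> (x - y))) * indicator S y"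
    using sec[OF x] by (rule eventually_mono) (auto simp: indicator_def)
  qed
  also have "\<dots> = (\<integral>\<^sup>+y. ennreal (norm (\<kappa> (x - y))) \<partial>lebesgue_on S)"
   using sl by (subst nn_integral_restrict_space) auto
  also have "\<dots> <= kernel_sup S \<kappa>" unfolding kernel_sup_def by (rule SUP_upper[OF x])
  finally show ?thesis using C(2) by (rule order_trans)
 qed
 have ev: "AE z in lebesgue. z \<in> difference_set S --> norm (k z) = norm (k (- z))"
  using eq AE_reflect[OF eq, of 0] even
 proof eventually_elim
  case (elim z)
  show ?case
  proof
   assume z: "z \<in> difference_set S"
   then obtain x y where "x \<in> S" "y \<in> S" "- z = y - x" by (auto simp: difference_set_def)
   then have "- z \<in> difference_set S" using diff by simp
   with z elim show "norm (k z) = norm (k (- z))" by simp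
  qed
 qed
 have col: "(\<integral>\<^sup>+x. indicator S x * ennreal (norm (k (x - y))) \<partial>lborel) <= ennreal C" if y: "y \<in> S" for y
 proof -
  have "(\<integral>\<^sup>+x. indicator S x * ennreal (norm (k (x - y))) \<partial>lborel) = (\<integral>\<^sup>+x. indicator S x * ennreal (norm (k (x - y))) \<partial>lebesgue)"
   by (rule nn_integral_completion[symmetric])
  also have "\<dots> = (\<integral>\<^sup>+x. indicator S x * ennreal (norm (k (y - x))) \<partial>lebesgue)"
  proof (rule nn_integral_cong_AE)
   show "AE x in lebesgue. indicator S x * ennreal (norm (k (x - y))) = indicator S x * ennreal (norm (k (y - x)))"
    using AE_shift[OF ev, of y]
   proof (rule eventually_mono)
    fix x assume "x - y \<in> difference_set S --> norm (k (x - y)) = norm (k (- (x - y)))"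
    then show "indicator S x * ennreal (norm (k (x - y))) = indicator S x * ennreal (norm (k (y - x)))"
     using diff[OF _ y, of x] by (cases "x \<in> S") auto
   qed
  qed
  also have "\<dots> = (\<integral>\<^sup>+x. indicator S x * ennreal (norm (k (y - x))) \<partial>lborel)" by (rule nn_integral_completion)
  finally show ?thesis using row[OF y] by simp
 qed
 have "schur_convolution S k C \<kappa>"
  by unfold_locales (use S C(1) k row col sec sec' in auto)
 then show thesis by (rule that)
qed

text \<open>Fubini's theorem moves the weak gradient under the convolution with the indicator of the domain.\<close>

lemma conv_has_weak_gradient:
 fixes S :: "'a::euclidean_space set" and J :: "'a => real" and K :: "'a => 'a"
 assumes J: "schur_convolution S j C J" and K: "schur_convolution S k C' K"
  and D: "open (difference_set S)" and w: "has_weak_gradient (difference_set S) J K"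
 shows "has_weak_gradient S (schur_convolution.conv S J (%y. 1)) (schur_convolution.conv S K (%y. 1))"
proof -
 interpret J: schur_convolution S j C J by (rule J)
 interpret K: schur_convolution S k C' K by (rule K)
 note S = J.S and sl = open_sets_lebesgue[OF J.S(1)]
 have jm[measurable]: "j \<in> borel_measurable borel" and km[measurable]: "k \<in> borel_measurable borel" and Sm[measurable]: "S \<in> sets borel"
  using J.k K.k J.S_borel by auto
 interpret finite_measure "lebesgue_on S" by (rule finite_measure_lebesgue_on[OF S(2)])
 let ?I = "indicator S :: 'a => real"
 have one: "(%y. 1::real) \<in> borel_measurable (lebesgue_on S)" "AE y in lebesgue_on S. \<bar>1::real\<bar> <= 1" "(0::real) <= 1" by auto
 have indm: "?I \<in> borel_measurable borel" by measurable
 have indb: "AE y in lborel. \<bar>?I y\<bar> <= 1 * ?I y" by simp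
 show ?thesis
 proof (rule has_weak_gradientI[OF S(1)])
  have b1: "AE x in lebesgue_on S. norm (J.conv (%y. 1) x) <= C * 1"
   by (rule AE_I2) (use J.conv_bound[OF one] in auto)
  have b2: "AE x in lebesgue_on S. norm (K.conv (%y. 1) x) <= C' * 1"
   by (rule AE_I2) (use K.conv_bound[OF one] in auto)
  show "locally_integrable S (J.conv (%y. 1))"
   by (rule integrable_imp_locally_integrable[OF sl integrable_const_bound[OF b1 J.conv_L2(1)[OF one]]])
  show "locally_integrable S (K.conv (%y. 1))"
   by (rule integrable_imp_locally_integrable[OF sl integrable_const_bound[OF b2 K.conv_L2(1)[OF one]]])
  fix \<eta> \<eta>' assume \<eta>: "\<eta> \<in> test_functions S" "!!x. GDERIV \<eta> x :> \<eta>' x"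
  obtain h B where h: "!!x. GDERIV \<eta> x :> h x" "continuous_on UNIV \<eta>" "continuous_on UNIV h"
   and B: "0 < B" "!!x. \<bar>\<eta> x\<bar> <= B" "!!x. norm (h x) <= B"
   by (rule test_functionsE[OF \<eta>(1)]) blast
  have "h = \<eta>'" using h(1) \<eta>(2) gderiv_unique by blast
  note h = h[unfolded this] and B = B[unfolded this]
  have em[measurable]: "\<eta> \<in> borel_measurable borel" "\<eta>' \<in> borel_measurable borel"
   using h(2,3) by (auto intro: borel_measurable_continuous_onI)
  have out: "\<eta> x = 0" "\<eta>' x = 0" if "x \<notin> S" for x
   using test_functions_zero_outside(1)[OF \<eta>(1) that] test_functions_zero_outside(2)[OF \<eta>(1) that \<eta>(2)] by auto
  define F1 where "F1 p = (?I (snd p) * j (fst p - snd p)) *\<^sub>R \<eta>' (fst p)" for p :: "'a \<times> 'a"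
  define F2 where "F2 p = (?I (snd p) * \<eta> (fst p)) *\<^sub>R k (fst p - snd p)" for p :: "'a \<times> 'a"
  have F1: "integrable (lborel \<Otimes>\<^sub>M lborel) F1"
  proof (rule J.product_integrable)
   show "F1 \<in> borel_measurable (lborel \<Otimes>\<^sub>M lborel)" unfolding F1_def by measurable
   show "norm (F1 (x, y)) <= B * (?I x * ?I y * norm (j (x - y)))" for x y
    using out(2)[of x] mult_left_mono[OF B(3)[of x] abs_ge_zero[of "j (x - y)"]]
    by (cases "x \<in> S"; cases "y \<in> S") (simp_all add: F1_def mult.commute)
  qed (use B in simp)
  have F2: "integrable (lborel \<Otimes>\<^sub>M lborel) F2"
  proof (rule K.product_integrable)
   show "F2 \<in> borel_measurable (lborel \<Otimes>\<^sub>M lborel)" unfolding F2_def by measurable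
   show "norm (F2 (x, y)) <= B * (?I x * ?I y * norm (k (x - y)))" for x y
    using out(1)[of x] mult_right_mono[OF B(2)[of x] norm_ge_zero[of "k (x - y)"]]
    by (cases "x \<in> S"; cases "y \<in> S") (simp_all add: F2_def)
  qed (use B in simp)
  have e1: "J.conv (%y. 1) x *\<^sub>R \<eta>' x = (\<integral>y. F1 (x, y) \<partial>lborel)" for x
  proof (cases "x \<in> S")
   case True
   have "(\<integral>y. F1 (x, y) \<partial>lborel) = (\<integral>y. (?I y *\<^sub>R j (x - y)) *\<^sub>R \<eta>' x \<partial>lborel)" by (simp add: F1_def)
   also have "\<dots> = (\<integral>y. ?I y *\<^sub>R j (x - y) \<partial>lborel) *\<^sub>R \<eta>' x"
    by (rule integral_scaleR_left) (rule J.bounded_integrable(1)[OF indm indb _ True], simp)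
   finally show ?thesis using J.conv_one[OF True] by simp
  qed (simp add: out F1_def)
  have e2: "\<eta> x *\<^sub>R K.conv (%y. 1) x = (\<integral>y. F2 (x, y) \<partial>lborel)" for x
  proof (cases "x \<in> S")
   case True
   have "(\<integral>y. F2 (x, y) \<partial>lborel) = (\<integral>y. \<eta> x *\<^sub>R (?I y *\<^sub>R k (x - y)) \<partial>lborel)" by (simp add: F2_def mult.commute)
   also have "\<dots> = \<eta> x *\<^sub>R (\<integral>y. ?I y *\<^sub>R k (x - y) \<partial>lborel)" by (rule integral_scaleR_right)
   finally show ?thesis using K.conv_one[OF True] by simp
  qed (simp add: out F2_def)
  have inner: "(\<integral>x. F1 (x, y) \<partial>lborel) = - (\<integral>x. F2 (x, y) \<partial>lborel)" for y
  proof (cases "y \<in> S")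
   case True
   have sub: "S \<subseteq> {x. - y + 1 *\<^sub>R x \<in> difference_set S}"
   proof
    fix x assume "x \<in> S"
    then have "x - y \<in> difference_set S" using True unfolding difference_set_def by blast
    then show "x \<in> {x. - y + 1 *\<^sub>R x \<in> difference_set S}" by simp
   qed
   have "has_weak_gradient S (%x. J (- y + 1 *\<^sub>R x)) (%x. 1 *\<^sub>R K (- y + 1 *\<^sub>R x))"
    by (rule has_weak_gradient_restrict[OF has_weak_gradient_isometry(1)[OF _ D w] has_weak_gradient_isometry(2)[OF _ D w] S(1) sub]) simp_all
   then have wt: "has_weak_gradient S (%x. J (x - y)) (%x. K (x - y))" by simp
   have "(\<integral>x. F1 (x, y) \<partial>lborel) = (\<integral>x. j (x - y) *\<^sub>R \<eta>' x \<partial>lborel)" using True by (simp add: F1_def)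
   also have "\<dots> = (\<integral>x. j (x - y) *\<^sub>R \<eta>' x \<partial>lebesgue)" by (rule integral_completion[symmetric]) measurable
   also have "\<dots> = (\<integral>x. J (x - y) *\<^sub>R \<eta>' x \<partial>lebesgue)"
   proof (rule integral_cong_AE_lebesgue[symmetric])
    show "(%x. j (x - y) *\<^sub>R \<eta>' x) \<in> borel_measurable lebesgue" by (intro measurable_completion) measurable
    show "AE x in lebesgue. j (x - y) *\<^sub>R \<eta>' x = J (x - y) *\<^sub>R \<eta>' x"
     using J.rep_col[OF True]
    proof (rule eventually_mono)
     fix x assume "x \<in> S --> J (x - y) = j (x - y)"
     then show "j (x - y) *\<^sub>R \<eta>' x = J (x - y) *\<^sub>R \<eta>' x" by (cases "x \<in> S") (simp_all add: out)
    qed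
   qed
   also have "\<dots> = - (\<integral>x. \<eta> x *\<^sub>R K (x - y) \<partial>lebesgue)" by (rule has_weak_gradientD[OF S(1) wt \<eta>])
   also have "(\<integral>x. \<eta> x *\<^sub>R K (x - y) \<partial>lebesgue) = (\<integral>x. \<eta> x *\<^sub>R k (x - y) \<partial>lebesgue)"
   proof (rule integral_cong_AE_lebesgue)
    show "(%x. \<eta> x *\<^sub>R k (x - y)) \<in> borel_measurable lebesgue" by (intro measurable_completion) measurable
    show "AE x in lebesgue. \<eta> x *\<^sub>R k (x - y) = \<eta> x *\<^sub>R K (x - y)"
     using K.rep_col[OF True]
    proof (rule eventually_mono)
     fix x assume "x \<in> S --> K (x - y) = k (x - y)"
     then show "\<eta> x *\<^sub>R k (x - y) = \<eta> x *\<^sub>R K (x - y)" by (cases "x \<in> S") (simp_all add: out)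
    qed
   qed
   also have "\<dots> = (\<integral>x. \<eta> x *\<^sub>R k (x - y) \<partial>lborel)" by (rule integral_completion) measurable
   also have "\<dots> = (\<integral>x. F2 (x, y) \<partial>lborel)" using True by (simp add: F2_def)
   finally show ?thesis .
  qed (simp add: F1_def F2_def)
  have F1': "integrable (lborel \<Otimes>\<^sub>M lborel) (%(x, y). F1 (x, y))" and F2': "integrable (lborel \<Otimes>\<^sub>M lborel) (%(x, y). F2 (x, y))"
   using F1 F2 by simp_all
  have m1: "(%x. \<integral>y. F1 (x, y) \<partial>lborel) \<in> borel_measurable lborel"
   unfolding F1_def by measurable
  have m2: "(%x. \<integral>y. F2 (x, y) \<partial>lborel) \<in> borel_measurable lborel"
   unfolding F2_def by measurable
  have "(\<integral>x. J.conv (%y. 1) x *\<^sub>R \<eta>' x \<partial>lebesgue) = (\<integral>x. \<integral>y. F1 (x, y) \<partial>lborel \<partial>lborel)"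
   unfolding e1 by (rule integral_completion[OF m1])
  also have "\<dots> = (\<integral>y. \<integral>x. F1 (x, y) \<partial>lborel \<partial>lborel)"
   by (rule lborel_pair.Fubini_integral[OF F1', symmetric])
  also have "\<dots> = - (\<integral>y. \<integral>x. F2 (x, y) \<partial>lborel \<partial>lborel)"
   unfolding inner by (rule integral_minus)
  also have "(\<integral>y. \<integral>x. F2 (x, y) \<partial>lborel \<partial>lborel) = (\<integral>x. \<integral>y. F2 (x, y) \<partial>lborel \<partial>lborel)"
   by (rule lborel_pair.Fubini_integral[OF F2'])
  also have "\<dots> = (\<integral>x. \<eta> x *\<^sub>R K.conv (%y. 1) x \<partial>lebesgue)"
   unfolding e2 by (rule integral_completion[OF m2, symmetric])
  finally show "(\<integral>x. J.conv (%y. 1) x *\<^sub>R \<eta>' x \<partial>lebesgue) = - (\<integral>x. \<eta> x *\<^sub>R K.conv (%y. 1) x \<partial>lebesgue)" .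
 qed
qed

text \<open>
  All that the energy argument needs to know about the kernel, with one constant for all bounds. The
  bound \<open>2\<close> covers differences of two functions with values in \<open>[-1,1]\<close>.
\<close>

lemma admissible_kernel_estimates:
 fixes S :: "'a::euclidean_space set"
 assumes S: "open S" "S \<in> lmeasurable" "S \<noteq> {}" and adm: "admissible_kernel S J"
 obtains C where "0 < C"
  "kernel_mass S J \<in> borel_measurable (lebesgue_on S)" "!!x. x \<in> S ==> \<bar>kernel_mass S J x\<bar> <= C"
  "has_weak_gradient S (kernel_mass S J) (weak_gradient S (kernel_mass S J))"
  "weak_gradient S (kernel_mass S J) \<in> borel_measurable (lebesgue_on S)"
  "AE x in lebesgue_on S. norm (weak_gradient S (kernel_mass S J) x) <= C"
  "!!f. f \<in> borel_measurable (lebesgue_on S) ==> AE y in lebesgue_on S. \<bar>f y\<bar> <= 2 ==>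
   gradient_conv S J f \<in> borel_measurable (lebesgue_on S) \<and>
   L2_norm_on (lebesgue_on S) (gradient_conv S J f) <= C * L2_norm_on (lebesgue_on S) f \<and>
   (\<forall>x\<in>S. norm (gradient_conv S J f x) <= C)"
  "!!f g x. f \<in> borel_measurable (lebesgue_on S) ==> AE y in lebesgue_on S. \<bar>f y\<bar> <= 2 ==>
   g \<in> borel_measurable (lebesgue_on S) ==> AE y in lebesgue_on S. \<bar>g y\<bar> <= 2 ==> x \<in> S ==>
   gradient_conv S J (%y. f y - g y) x = gradient_conv S J f x - gradient_conv S J g x"
proof -
 note sl = open_sets_lebesgue[OF S(1)]
 have adm': "AE x in lebesgue_on S. (%y. J (y - x)) \<in> W11 S" "!!x. J x = J (- x)"
  "kernel_sup S J < \<infinity>" "kernel_sup S (kernel_gradient S J) < \<infinity>"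
  using adm by (auto simp: admissible_kernel_def)
 note D = kernel_gradient_has_weak_gradient[OF S(1,3) adm'(1)]
 let ?K = "kernel_gradient S J"
 have odd: "AE z in lebesgue. z \<in> difference_set S --> ?K z = - ?K (- z)"
  by (rule kernel_gradient_odd[OF D adm'(2)])
 obtain k C1 where k: "schur_convolution S k C1 ?K"
 proof (rule schur_convolution_exists[OF S(1,2) D(1) has_weak_gradient_locally_integrable(2)[OF D(2)] _ adm'(4)])
  show "AE z in lebesgue. z \<in> difference_set S --> norm (?K z) = norm (?K (- z))"
   using odd by (rule eventually_mono) (metis norm_minus_cancel)
 qed
 obtain j C2 where j: "schur_convolution S j C2 J"
 proof (rule schur_convolution_exists[OF S(1,2) D(1) has_weak_gradient_locally_integrable(1)[OF D(2)] _ adm'(3)])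
  show "AE z in lebesgue. z \<in> difference_set S --> norm (J z) = norm (J (- z))"
   using adm'(2) by (intro AE_I2) simp
 qed
 interpret K: schur_convolution S k C1 ?K by (rule k)
 interpret J: schur_convolution S j C2 J by (rule j)
 have Kconv: "K.conv = gradient_conv S J" by (simp add: fun_eq_iff K.conv_def gradient_conv_def)
 have Jconv: "J.conv (%y. 1) = kernel_mass S J" by (simp add: fun_eq_iff J.conv_def kernel_mass_def)
 have one: "(%y. 1::real) \<in> borel_measurable (lebesgue_on S)" "AE y in lebesgue_on S. \<bar>1::real\<bar> <= 1" "(0::real) <= 1" by auto
 have wa: "has_weak_gradient S (kernel_mass S J) (K.conv (%y. 1))"
  using conv_has_weak_gradient[OF j k D] unfolding Jconv .
 note wg = weak_gradient_has_weak_gradient[OF wa]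
 have eq: "AE x in lebesgue_on S. K.conv (%y. 1) x = weak_gradient S (kernel_mass S J) x"
  by (rule has_weak_gradient_unique[OF S(1) wa wg])
 define C where "C = max (2 * C1) C2"
 have C: "C1 * 2 <= C" "C2 <= C" "C1 <= C" using K.C by (auto simp: C_def)
 have inS: "x \<in> S" if "x \<in> space (lebesgue_on S)" for x using that by simp
 show thesis
 proof (rule that[of C])
  show "0 < C" using J.C C(2) by linarith
  show "kernel_mass S J \<in> borel_measurable (lebesgue_on S)" using J.conv_L2(1)[OF one] unfolding Jconv .
  show "\<bar>kernel_mass S J x\<bar> <= C" if "x \<in> S" for x
   using J.conv_bound[OF one that] C(2) unfolding Jconv by simp
  show "has_weak_gradient S (kernel_mass S J) (weak_gradient S (kernel_mass S J))" by (rule wg)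
  show "weak_gradient S (kernel_mass S J) \<in> borel_measurable (lebesgue_on S)"
   by (rule borel_measurable_lebesgue_on_AE[OF sl K.conv_L2(1)[OF one] eq])
  show "AE x in lebesgue_on S. norm (weak_gradient S (kernel_mass S J) x) <= C"
   using eq AE_space
  proof eventually_elim
   case (elim x)
   then show ?case using K.conv_bound[OF one inS[OF elim(2)]] C(3) by simp
  qed
  show "gradient_conv S J f \<in> borel_measurable (lebesgue_on S) \<and>
   L2_norm_on (lebesgue_on S) (gradient_conv S J f) <= C * L2_norm_on (lebesgue_on S) f \<and>
   (\<forall>x\<in>S. norm (gradient_conv S J f x) <= C)"
   if f: "f \<in> borel_measurable (lebesgue_on S)" "AE y in lebesgue_on S. \<bar>f y\<bar> <= 2" for f
  proof (intro conjI ballI)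
   have two: "(0::real) <= 2" by simp
   show "gradient_conv S J f \<in> borel_measurable (lebesgue_on S)" using K.conv_L2(1)[OF f two] unfolding Kconv .
   have "L2_norm_on (lebesgue_on S) (gradient_conv S J f) <= C1 * L2_norm_on (lebesgue_on S) f"
    using K.conv_L2(2)[OF f two] unfolding Kconv .
   also have "\<dots> <= C * L2_norm_on (lebesgue_on S) f" by (rule mult_right_mono[OF C(3) L2_norm_nonneg])
   finally show "L2_norm_on (lebesgue_on S) (gradient_conv S J f) <= C * L2_norm_on (lebesgue_on S) f" .
   show "norm (gradient_conv S J f x) <= C" if "x \<in> S" for x
    using K.conv_bound[OF f two that] C(1) unfolding Kconv by simp
  qed
  show "gradient_conv S J (%y. f y - g y) x = gradient_conv S J f x - gradient_conv S J g x"
   if "f \<in> borel_measurable (lebesgue_on S)" "AE y in lebesgue_on S. \<bar>f y\<bar> <= 2"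
    "g \<in> borel_measurable (lebesgue_on S)" "AE y in lebesgue_on S. \<bar>g y\<bar> <= 2" "x \<in> S" for f g x
   using K.conv_diff[OF that(1-4) _ that(5)] unfolding Kconv by simp
 qed
qed

section \<open>The nonlocal flux\<close>

lemma L2_norm_le:
 fixes f :: "'a => 'b::euclidean_space" and g :: "'a => 'c::euclidean_space"
 assumes g: "g \<in> L2_space M" and f: "f \<in> borel_measurable M" and b: "AE x in M. norm (f x) <= B * norm (g x)" and B: "0 <= B"
 shows "L2_norm_on M f <= B * L2_norm_on M g"
proof -
 have "(\<integral>x. (norm (f x))\<^sup>2 \<partial>M) <= (\<integral>x. B\<^sup>2 * (norm (g x))\<^sup>2 \<partial>M)"
 proof (rule integral_mono_AE)
  show "integrable M (%x. (norm (f x))\<^sup>2)" by (rule L2_spaceD(2)[OF L2_bounded_by[OF g f b]])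
  show "integrable M (%x. B\<^sup>2 * (norm (g x))\<^sup>2)" by (rule integrable_mult_right[OF L2_spaceD(2)[OF g]])
  show "AE x in M. (norm (f x))\<^sup>2 <= B\<^sup>2 * (norm (g x))\<^sup>2"
   using b by (rule eventually_mono) (metis norm_ge_zero power_mono power_mult_distrib)
 qed
 then have "sqrt (\<integral>x. (norm (f x))\<^sup>2 \<partial>M) <= sqrt (B\<^sup>2 * (\<integral>x. (norm (g x))\<^sup>2 \<partial>M))"
  by (intro real_sqrt_le_mono) simp
 then show ?thesis using B by (simp add: L2_norm_on_def real_sqrt_mult)
qed

lemma compose_continuous_measurable:
 fixes S :: "'a::euclidean_space set" and f :: "real => real"
 assumes S: "S \<in> sets lebesgue" and f: "continuous_on {-1..1} f"
  and p: "p \<in> borel_measurable (lebesgue_on S)" and b: "AE x in lebesgue_on S. \<bar>p x\<bar> <= 1"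
 shows "(%x. f (p x)) \<in> borel_measurable (lebesgue_on S)"
proof (rule borel_measurable_lebesgue_on_AE[OF S])
 have "continuous_on UNIV (%s. f (max (-1) (min 1 s)))"
  by (rule continuous_on_compose2[OF f]) (auto intro!: continuous_intros)
 then have "(%s. f (max (-1) (min 1 s))) \<in> borel_measurable borel"
  by (rule borel_measurable_continuous_onI)
 then show "(%x. f (max (-1) (min 1 (p x)))) \<in> borel_measurable (lebesgue_on S)"
  by (rule measurable_compose[OF p])
 show "AE x in lebesgue_on S. f (max (-1) (min 1 (p x))) = f (p x)"
  using b by (rule eventually_mono) (auto simp: abs_le_iff max_def min_def)
qed

text \<open>
  In the application \<open>\<beta>\<close> is the continuous extension of \<open>m F''\<close>. It is bounded even where \<open>F''\<close> is
  not, so that \<open>\<Lambda>(p)\<close> is weakly differentiable and can replace the singular chemical potential.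
\<close>

locale nonlocal_flux =
 fixes S :: "'a::euclidean_space set" and a :: "'a => real" and ga :: "'a => 'a"
  and \<beta> m \<Lambda> \<Gamma> :: "real => real" and C \<kappa> :: real
 assumes S: "open S" "S \<in> lmeasurable" and C: "0 <= C" and \<kappa>: "0 < \<kappa>"
  and a: "a \<in> borel_measurable (lebesgue_on S)" "AE x in lebesgue_on S. \<bar>a x\<bar> <= C" "has_weak_gradient S a ga"
  and ga: "ga \<in> borel_measurable (lebesgue_on S)" "AE x in lebesgue_on S. norm (ga x) <= C"
  and \<beta>: "continuous_on {-1..1} \<beta>" "!!s. s \<in> {-1..1} ==> \<bar>\<beta> s\<bar> <= C"
  and m: "continuous_on {-1..1} m" "!!s. s \<in> {-1..1} ==> \<bar>m s\<bar> <= C"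
   "!!s s'. s \<in> {-1..1} ==> s' \<in> {-1..1} ==> \<bar>m s - m s'\<bar> <= C * \<bar>s - s'\<bar>"
  and \<Lambda>: "!!s. s \<in> {-1..1} ==> (\<Lambda> has_real_derivative \<beta> s) (at s within {-1..1})" "\<Lambda> 0 = 0"
  and \<Gamma>: "!!s. s \<in> {-1..1} ==> (\<Gamma> has_real_derivative m s) (at s within {-1..1})" "\<Gamma> 0 = 0"
  and mono: "AE x in lebesgue_on S. \<forall>s\<in>{-1..1}. \<forall>s'\<in>{-1..1}.
   \<kappa> * (s - s')\<^sup>2 <= (\<Lambda> s - \<Lambda> s' + a x * (\<Gamma> s - \<Gamma> s')) * (s - s')"
begin

lemma Lambda_Lipschitz:
 assumes "s \<in> {-1..1}" "s' \<in> {-1..1}"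
 shows "\<bar>\<Lambda> s - \<Lambda> s'\<bar> <= C * \<bar>s - s'\<bar>"
 using field_differentiable_bound[OF _ \<Lambda>(1), where B=C] \<beta>(2) assms by simp

lemma Gamma_Lipschitz:
 assumes "s \<in> {-1..1}" "s' \<in> {-1..1}"
 shows "\<bar>\<Gamma> s - \<Gamma> s'\<bar> <= C * \<bar>s - s'\<bar>"
 using field_differentiable_bound[OF _ \<Gamma>(1), where B=C] m(2) assms by simp

lemma Lambda_Gamma_bound:
 assumes "s \<in> {-1..1}"
 shows "\<bar>\<Lambda> s\<bar> <= C" "\<bar>\<Gamma> s\<bar> <= C"
proof -
 have "C * \<bar>s\<bar> <= C * 1" using assms C by (intro mult_left_mono) auto
 then show "\<bar>\<Lambda> s\<bar> <= C" "\<bar>\<Gamma> s\<bar> <= C"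
  using Lambda_Lipschitz[OF assms, of 0] Gamma_Lipschitz[OF assms, of 0] \<Lambda>(2) \<Gamma>(2) by simp_all
qed

lemma continuous_Lambda_Gamma: "continuous_on {-1..1} \<Lambda>" "continuous_on {-1..1} \<Gamma>"
proof -
 show "continuous_on {-1..1} \<Lambda>" by (rule DERIV_continuous_on[OF \<Lambda>(1)])
 show "continuous_on {-1..1} \<Gamma>" by (rule DERIV_continuous_on[OF \<Gamma>(1)])
qed

definition flux :: "('a => real) => ('a => 'a) => ('a => 'a) => ('a => 'a) => 'a => 'a" where
 "flux p g q w x = (\<beta> (p x) + m (p x) * a x) *\<^sub>R g x + m (p x) *\<^sub>R (p x *\<^sub>R ga x - q x) - p x *\<^sub>R w x"

lemma sets_S: "S \<in> sets lebesgue" using S(1) by simp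

lemma finite_measure_S: "finite_measure (lebesgue_on S)"
 by (rule finite_measure_lebesgue_on[OF S(2)])

lemma flux_parts_L2:
 assumes p: "p \<in> borel_measurable (lebesgue_on S)" "AE x in lebesgue_on S. \<bar>p x\<bar> <= 1"
  and g: "g \<in> L2_space (lebesgue_on S)"
  and q: "q \<in> borel_measurable (lebesgue_on S)" "AE x in lebesgue_on S. norm (q x) <= C"
  and w: "w \<in> borel_measurable (lebesgue_on S)" "AE x in lebesgue_on S. norm (w x) <= U"
 shows "(%x. \<beta> (p x) *\<^sub>R g x) \<in> L2_space (lebesgue_on S)"
  "(%x. (m (p x) * a x) *\<^sub>R g x) \<in> L2_space (lebesgue_on S)"
  "(%x. m (p x) *\<^sub>R (p x *\<^sub>R ga x - q x)) \<in> L2_space (lebesgue_on S)"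
  "(%x. p x *\<^sub>R w x) \<in> L2_space (lebesgue_on S)"
proof -
 interpret finite_measure "lebesgue_on S" by (rule finite_measure_S)
 have mb: "(%x. \<beta> (p x)) \<in> borel_measurable (lebesgue_on S)" "(%x. m (p x)) \<in> borel_measurable (lebesgue_on S)"
  by (rule compose_continuous_measurable[OF sets_S _ p], rule \<beta> m)+
 note [measurable] = mb p(1) L2_spaceD(1)[OF g] q(1) w(1) a(1) ga(1)
 have I: "AE x in lebesgue_on S. p x \<in> {-1..1}" using p(2) by (rule eventually_mono) (auto simp: abs_le_iff)
 show "(%x. \<beta> (p x) *\<^sub>R g x) \<in> L2_space (lebesgue_on S)"
 proof (rule L2_bounded_by[OF g, where C=C])
  show "AE x in lebesgue_on S. norm (\<beta> (p x) *\<^sub>R g x) <= C * norm (g x)"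
   using I by (rule eventually_mono) (auto intro!: mult_right_mono \<beta>(2))
 qed measurable
 show "(%x. (m (p x) * a x) *\<^sub>R g x) \<in> L2_space (lebesgue_on S)"
 proof (rule L2_bounded_by[OF g, where C="C * C"])
  show "AE x in lebesgue_on S. norm ((m (p x) * a x) *\<^sub>R g x) <= C * C * norm (g x)"
   using I a(2)
  proof eventually_elim
   case (elim x)
   have "\<bar>m (p x)\<bar> * \<bar>a x\<bar> <= C * C" using m(2)[OF elim(1)] elim(2) C by (intro mult_mono) auto
   then show ?case by (simp add: abs_mult mult_right_mono)
  qed
 qed measurable
 show "(%x. m (p x) *\<^sub>R (p x *\<^sub>R ga x - q x)) \<in> L2_space (lebesgue_on S)"
 proof (rule L2_bounded[where B="C * (2 * C)"])
  show "AE x in lebesgue_on S. norm (m (p x) *\<^sub>R (p x *\<^sub>R ga x - q x)) <= C * (2 * C)"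
   using I ga(2) q(2) p(2)
  proof eventually_elim
   case (elim x)
   have "\<bar>p x\<bar> * norm (ga x) <= 1 * C" using elim by (intro mult_mono) auto
   then have "norm (p x *\<^sub>R ga x - q x) <= 2 * C"
    using norm_triangle_ineq4[of "p x *\<^sub>R ga x" "q x"] elim(3) by simp
   then have "\<bar>m (p x)\<bar> * norm (p x *\<^sub>R ga x - q x) <= C * (2 * C)"
    using m(2)[OF elim(1)] C by (intro mult_mono) auto
   then show ?case by simp
  qed
 qed measurable
 show "(%x. p x *\<^sub>R w x) \<in> L2_space (lebesgue_on S)"
 proof (rule L2_bounded[where B="U"])
  show "AE x in lebesgue_on S. norm (p x *\<^sub>R w x) <= U"
   using p(2) w(2)
  proof eventually_elim
   case (elim x)
   have "\<bar>p x\<bar> * norm (w x) <= 1 * U" using elim by (intro mult_mono) auto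
   then show ?case by simp
  qed
 qed measurable
qed

lemma flux_L2:
 assumes "p \<in> borel_measurable (lebesgue_on S)" "AE x in lebesgue_on S. \<bar>p x\<bar> <= 1"
  "g \<in> L2_space (lebesgue_on S)"
  "q \<in> borel_measurable (lebesgue_on S)" "AE x in lebesgue_on S. norm (q x) <= C"
  "w \<in> borel_measurable (lebesgue_on S)" "AE x in lebesgue_on S. norm (w x) <= U"
 shows "flux p g q w \<in> L2_space (lebesgue_on S)"
 unfolding flux_def[abs_def] scaleR_add_left
 by (intro L2_add L2_diff flux_parts_L2[OF assms])

lemma flux_pairing:
 assumes p: "p \<in> borel_measurable (lebesgue_on S)" "AE x in lebesgue_on S. \<bar>p x\<bar> <= 1"
  and g: "g \<in> L2_space (lebesgue_on S)"
  and q: "q \<in> borel_measurable (lebesgue_on S)" "AE x in lebesgue_on S. norm (q x) <= C"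
  and w: "w \<in> borel_measurable (lebesgue_on S)" "AE x in lebesgue_on S. norm (w x) <= U"
  and h: "h \<in> L2_space (lebesgue_on S)"
 shows "L2_inner (lebesgue_on S) (flux p g q w) h =
   (\<integral>x. \<beta> (p x) * (g x \<bullet> h x) \<partial>lebesgue_on S) + (\<integral>x. m (p x) * a x * (g x \<bullet> h x) \<partial>lebesgue_on S)
   + (\<integral>x. m (p x) * ((p x *\<^sub>R ga x - q x) \<bullet> h x) \<partial>lebesgue_on S) - (\<integral>x. (p x *\<^sub>R w x) \<bullet> h x \<partial>lebesgue_on S)"
proof -
 note L = flux_parts_L2[OF p g q w]
 note I = L2_inner_integrable[OF L(1) h] L2_inner_integrable[OF L(2) h] L2_inner_integrable[OF L(3) h] L2_inner_integrable[OF L(4) h]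
 have "L2_inner (lebesgue_on S) (flux p g q w) h =
  (\<integral>x. (\<beta> (p x) *\<^sub>R g x) \<bullet> h x + ((m (p x) * a x) *\<^sub>R g x) \<bullet> h x + (m (p x) *\<^sub>R (p x *\<^sub>R ga x - q x)) \<bullet> h x - (p x *\<^sub>R w x) \<bullet> h x \<partial>lebesgue_on S)"
  unfolding L2_inner_def flux_def by (intro Bochner_Integration.integral_cong refl) (simp only: inner_add_left inner_diff_left scaleR_add_left)
 also have "\<dots> = (\<integral>x. (\<beta> (p x) *\<^sub>R g x) \<bullet> h x \<partial>lebesgue_on S) + (\<integral>x. ((m (p x) * a x) *\<^sub>R g x) \<bullet> h x \<partial>lebesgue_on S)
  + (\<integral>x. (m (p x) *\<^sub>R (p x *\<^sub>R ga x - q x)) \<bullet> h x \<partial>lebesgue_on S) - (\<integral>x. (p x *\<^sub>R w x) \<bullet> h x \<partial>lebesgue_on S)"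
  by (simp only: Bochner_Integration.integral_diff Bochner_Integration.integral_add Bochner_Integration.integrable_add I)
 finally show ?thesis by (simp only: inner_scaleR_left)
qed

definition potential :: "('a => real) => 'a => real" where
 "potential p x = \<Lambda> (p x) + a x * \<Gamma> (p x)"

text \<open>
  The chain rule applies to \<open>\<Lambda>\<close> and \<open>\<Gamma>\<close>, the product rule to \<open>a \<Gamma>(p)\<close>. The first part of the gradient
  is the diffusive flux; the second contains no derivative of \<open>p\<close>.
\<close>

lemma potential_gradient:
 assumes p: "p \<in> borel_measurable (lebesgue_on S)" "AE x in lebesgue_on S. \<bar>p x\<bar> <= 1"
  and g: "g \<in> L2_space (lebesgue_on S)" "has_weak_gradient S p g"
 shows "(%x. (potential p x, (\<beta> (p x) + m (p x) * a x) *\<^sub>R g x + \<Gamma> (p x) *\<^sub>R ga x)) \<in> H1_graph S"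
proof (rule H1_graph_PairI)
 interpret finite_measure "lebesgue_on S" by (rule finite_measure_S)
 have I: "AE x in lebesgue_on S. p x \<in> {-1..1}" using p(2) by (rule eventually_mono) (auto simp: abs_le_iff)
 have [measurable]: "(%x. \<Lambda> (p x)) \<in> borel_measurable (lebesgue_on S)" "(%x. \<Gamma> (p x)) \<in> borel_measurable (lebesgue_on S)"
  "(%x. m (p x)) \<in> borel_measurable (lebesgue_on S)"
  by (rule compose_continuous_measurable[OF sets_S _ p], rule continuous_Lambda_Gamma m)+
 note [measurable] = L2_spaceD(1)[OF g(1)] a(1) ga(1)
 have zero: "(%x. 0::'a) \<in> borel_measurable (lebesgue_on S)" "AE x in lebesgue_on S. norm (0::'a) <= C"
  using C by auto
 note parts = flux_parts_L2[OF p g(1) zero zero]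
 have bL: "AE x in lebesgue_on S. \<bar>\<Lambda> (p x)\<bar> <= C" and bG: "AE x in lebesgue_on S. \<bar>\<Gamma> (p x)\<bar> <= C"
  using I by (rule eventually_mono; auto intro!: Lambda_Gamma_bound)+
 have baG: "AE x in lebesgue_on S. \<bar>a x * \<Gamma> (p x)\<bar> <= C * C"
  using bG a(2)
 proof eventually_elim
  case (elim x)
  then show ?case using C unfolding abs_mult by (intro mult_mono) auto
 qed
 show pot: "potential p \<in> L2_space (lebesgue_on S)"
  unfolding potential_def[abs_def]
 proof (rule L2_add)
  show "(%x. \<Lambda> (p x)) \<in> L2_space (lebesgue_on S)" using bL by (intro L2_bounded[where B=C]) auto
  show "(%x. a x * \<Gamma> (p x)) \<in> L2_space (lebesgue_on S)" using baG by (intro L2_bounded[where B="C * C"]) auto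
 qed
 have Gga: "(%x. \<Gamma> (p x) *\<^sub>R ga x) \<in> L2_space (lebesgue_on S)"
 proof (rule L2_bounded[where B="C * C"])
  show "AE x in lebesgue_on S. norm (\<Gamma> (p x) *\<^sub>R ga x) <= C * C"
   using bG ga(2)
  proof eventually_elim
   case (elim x)
   then have "\<bar>\<Gamma> (p x)\<bar> * norm (ga x) <= C * C" using C by (intro mult_mono) auto
   then show ?case by simp
  qed
 qed measurable
 show "(%x. (\<beta> (p x) + m (p x) * a x) *\<^sub>R g x + \<Gamma> (p x) *\<^sub>R ga x) \<in> L2_space (lebesgue_on S)"
  unfolding scaleR_add_left by (intro L2_add parts(1,2) Gga)
 note gi = L2_imp_L1(1)[OF g(1)]
 have wL: "has_weak_gradient S (%x. \<Lambda> (p x)) (%x. \<beta> (p x) *\<^sub>R g x)"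
  by (rule has_weak_gradient_compose[OF S g(2) p(1) gi p(2) \<Lambda>(1) \<beta>(1) \<Lambda>(2)])
 have wG: "has_weak_gradient S (%x. \<Gamma> (p x)) (%x. m (p x) *\<^sub>R g x)"
  by (rule has_weak_gradient_compose[OF S g(2) p(1) gi p(2) \<Gamma>(1) m(1) \<Gamma>(2)])
 have mg: "(%x. m (p x) *\<^sub>R g x) \<in> L2_space (lebesgue_on S)"
 proof (rule L2_bounded_by[OF g(1), where C=C])
  show "AE x in lebesgue_on S. norm (m (p x) *\<^sub>R g x) <= C * norm (g x)"
   using I by (rule eventually_mono) (auto intro!: mult_right_mono m(2))
 qed measurable
 have "has_weak_gradient S (%x. a x * \<Gamma> (p x)) (%x. a x *\<^sub>R (m (p x) *\<^sub>R g x) + \<Gamma> (p x) *\<^sub>R ga x)"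
 proof (rule has_weak_gradient_mult[OF S(1) a(3) wG _ _ _ _ a(2) bG])
  show "integrable (lebesgue_on S) a"
   by (rule L2_imp_L1(1)[OF L2_bounded[OF a(1)]]) (use a(2) in simp)
  show "integrable (lebesgue_on S) ga"
   by (rule L2_imp_L1(1)[OF L2_bounded[OF ga]])
  show "integrable (lebesgue_on S) (%x. \<Gamma> (p x))"
   by (rule L2_imp_L1(1)[OF L2_bounded[where B=C]]) (use bG in simp_all)
  show "integrable (lebesgue_on S) (%x. m (p x) *\<^sub>R g x)" by (rule L2_imp_L1(1)[OF mg])
 qed
 from has_weak_gradient_combine[OF S(1) wL this, where a=1 and b=1]
 show "has_weak_gradient S (potential p) (%x. (\<beta> (p x) + m (p x) * a x) *\<^sub>R g x + \<Gamma> (p x) *\<^sub>R ga x)"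
  unfolding potential_def[abs_def] by (simp add: scaleR_add_left add.assoc mult.commute)
qed

text \<open>
  Testing the defining property of \<open>V = (\<psi>,\<nabla>\<psi>)\<close> with the difference \<open>v\<close> of the potentials turns the
  principal part \<open>(\<nabla>v,\<nabla>\<psi>)\<close> of the flux into \<open>(p1 - p2, v) - (v, \<psi>)\<close>. Strong monotonicity bounds the
  first product below by \<open>\<kappa> \<parallel>p1 - p2\<parallel>\<^sup>2\<close>. All remaining terms are free of derivatives of \<open>p1\<close>, \<open>p2\<close>
  and linear in their difference, so Young's inequality absorbs them.
\<close>

lemma energy_estimate:
 assumes p1: "p1 \<in> borel_measurable (lebesgue_on S)" "AE x in lebesgue_on S. \<bar>p1 x\<bar> <= 1"
  and p2: "p2 \<in> borel_measurable (lebesgue_on S)" "AE x in lebesgue_on S. \<bar>p2 x\<bar> <= 1"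
  and g1: "g1 \<in> L2_space (lebesgue_on S)" "has_weak_gradient S p1 g1"
  and g2: "g2 \<in> L2_space (lebesgue_on S)" "has_weak_gradient S p2 g2"
  and q1: "q1 \<in> borel_measurable (lebesgue_on S)" "AE x in lebesgue_on S. norm (q1 x) <= C"
  and q2: "q2 \<in> borel_measurable (lebesgue_on S)" "AE x in lebesgue_on S. norm (q2 x) <= C"
  and q: "L2_norm_on (lebesgue_on S) (%x. q1 x - q2 x) <= C * L2_norm_on (lebesgue_on S) (%x. p1 x - p2 x)"
  and w: "w \<in> borel_measurable (lebesgue_on S)" "AE x in lebesgue_on S. norm (w x) <= U" "0 <= U"
  and V: "V \<in> H1_graph S"
   "!!W. W \<in> H1_graph S ==> L2_inner (lebesgue_on S) V W = L2_inner (lebesgue_on S) (%x. p1 x - p2 x) (%x. fst (W x))"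
 shows "- L2_inner (lebesgue_on S) (%x. flux p1 g1 q1 w x - flux p2 g2 q2 w x) (%x. snd (V x))
  <= (1 + (C + 6 * C\<^sup>2)\<^sup>2) / (2 * \<kappa>) * (1 + U\<^sup>2) * (L2_norm_on (lebesgue_on S) V)\<^sup>2"
proof -
 interpret finite_measure "lebesgue_on S" by (rule finite_measure_S)
 let ?M = "lebesgue_on S"
 define \<phi> where "\<phi> x = p1 x - p2 x" for x
 define G1 where "G1 x = (\<beta> (p1 x) + m (p1 x) * a x) *\<^sub>R g1 x + \<Gamma> (p1 x) *\<^sub>R ga x" for x
 define G2 where "G2 x = (\<beta> (p2 x) + m (p2 x) * a x) *\<^sub>R g2 x + \<Gamma> (p2 x) *\<^sub>R ga x" for x
 define v where "v x = potential p1 x - potential p2 x" for x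
 define G where "G x = G1 x - G2 x" for x
 define E1 where "E1 x = (\<Gamma> (p1 x) - \<Gamma> (p2 x)) *\<^sub>R ga x - (m (p1 x) - m (p2 x)) *\<^sub>R (p1 x *\<^sub>R ga x - q1 x)
  - (m (p2 x) * \<phi> x) *\<^sub>R ga x + \<phi> x *\<^sub>R w x" for x
 define E2 where "E2 x = m (p2 x) *\<^sub>R (q1 x - q2 x)" for x
 have I1: "AE x in ?M. p1 x \<in> {-1..1}" using p1(2) by (rule eventually_mono) (auto simp: abs_le_iff)
 have I2: "AE x in ?M. p2 x \<in> {-1..1}" using p2(2) by (rule eventually_mono) (auto simp: abs_le_iff)
 have [measurable]: "(%x. \<Gamma> (p1 x)) \<in> borel_measurable ?M" "(%x. m (p1 x)) \<in> borel_measurable ?M"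
  by (rule compose_continuous_measurable[OF sets_S _ p1], rule continuous_Lambda_Gamma m)+
 have [measurable]: "(%x. \<Gamma> (p2 x)) \<in> borel_measurable ?M" "(%x. m (p2 x)) \<in> borel_measurable ?M"
  by (rule compose_continuous_measurable[OF sets_S _ p2], rule continuous_Lambda_Gamma m)+
 note [measurable] = p1(1) p2(1) q1(1) q2(1) w(1) ga(1)
 have p1L: "p1 \<in> L2_space ?M" and p2L: "p2 \<in> L2_space ?M"
  by (rule L2_bounded[where B=1]; use p1 p2 in simp)+
 have \<phi>L: "\<phi> \<in> L2_space ?M" unfolding \<phi>_def[abs_def] by (rule L2_diff[OF p1L p2L])
 have [measurable]: "\<phi> \<in> borel_measurable ?M" by (rule L2_spaceD(1)[OF \<phi>L])
 have q1L: "q1 \<in> L2_space ?M" by (rule L2_bounded[OF q1])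
 have q2L: "q2 \<in> L2_space ?M" by (rule L2_bounded[OF q2])
 note q12L = L2_diff[OF q1L q2L]
 have H1: "(%x. (potential p1 x, G1 x)) \<in> H1_graph S"
  unfolding G1_def by (rule potential_gradient[OF p1 g1])
 have H2: "(%x. (potential p2 x, G2 x)) \<in> H1_graph S"
  unfolding G2_def by (rule potential_gradient[OF p2 g2])
 have H: "(%x. (v x, G x)) \<in> H1_graph S"
  using H1_graph_combine[OF S(1) H1 H2, of 1 "-1"] by (simp add: v_def G_def)
 note HL = L2_fst_snd(1,2)[OF H1_graphD(1)[OF H], simplified]
 note VL = L2_fst_snd[OF H1_graphD(1)[OF V(1)]]
 have E1L: "E1 \<in> L2_space ?M \<and> L2_norm_on ?M E1 <= (4 * C\<^sup>2 + U) * L2_norm_on ?M \<phi>"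
 proof -
  have mE: "E1 \<in> borel_measurable ?M" unfolding E1_def[abs_def] by measurable
  have bE: "AE x in ?M. norm (E1 x) <= (4 * C\<^sup>2 + U) * norm (\<phi> x)"
   using I1 I2 ga(2) q1(2) w(2) p1(2)
  proof eventually_elim
   case (elim x)
   have "\<bar>p1 x\<bar> * norm (ga x) <= 1 * C" using elim by (intro mult_mono) auto
   then have B: "norm (p1 x *\<^sub>R ga x - q1 x) <= 2 * C"
    using norm_triangle_ineq4[of "p1 x *\<^sub>R ga x" "q1 x"] elim by simp
   have "\<bar>\<Gamma> (p1 x) - \<Gamma> (p2 x)\<bar> * norm (ga x) <= (C * \<bar>\<phi> x\<bar>) * C"
    unfolding \<phi>_def using elim C Gamma_Lipschitz by (intro mult_mono) auto
   moreover have "\<bar>m (p1 x) - m (p2 x)\<bar> * norm (p1 x *\<^sub>R ga x - q1 x) <= (C * \<bar>\<phi> x\<bar>) * (2 * C)"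
    unfolding \<phi>_def using elim C B m(3) by (intro mult_mono) auto
   moreover have "\<bar>m (p2 x) * \<phi> x\<bar> * norm (ga x) <= (C * \<bar>\<phi> x\<bar>) * C"
    unfolding abs_mult using elim C m(2) by (intro mult_mono mult_nonneg_nonneg) auto
   moreover have "\<bar>\<phi> x\<bar> * norm (w x) <= \<bar>\<phi> x\<bar> * U" using elim by (intro mult_left_mono) auto
   moreover have "norm (E1 x) <= \<bar>\<Gamma> (p1 x) - \<Gamma> (p2 x)\<bar> * norm (ga x) + \<bar>m (p1 x) - m (p2 x)\<bar> * norm (p1 x *\<^sub>R ga x - q1 x)
     + \<bar>m (p2 x) * \<phi> x\<bar> * norm (ga x) + \<bar>\<phi> x\<bar> * norm (w x)"
    unfolding E1_def by (intro order_trans[OF norm_triangle_ineq] order_trans[OF norm_triangle_ineq4] add_mono) (simp_all only: norm_scaleR order_refl)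
   ultimately show ?case by (simp add: power2_eq_square algebra_simps)
  qed
  have "0 <= 4 * C\<^sup>2 + U" using w(3) by simp
  then show ?thesis using L2_bounded_by[OF \<phi>L mE bE] L2_norm_le[OF \<phi>L mE bE] by blast
 qed
 have E2L: "E2 \<in> L2_space ?M \<and> L2_norm_on ?M E2 <= C\<^sup>2 * L2_norm_on ?M \<phi>"
 proof -
  have mE: "E2 \<in> borel_measurable ?M" unfolding E2_def[abs_def] by measurable
  have bE: "AE x in ?M. norm (E2 x) <= C * norm (q1 x - q2 x)"
   using I2 by (rule eventually_mono) (auto simp: E2_def intro!: mult_right_mono m(2))
  have "L2_norm_on ?M E2 <= C * L2_norm_on ?M (%x. q1 x - q2 x)" by (rule L2_norm_le[OF q12L mE bE C])
  also have "\<dots> <= C * (C * L2_norm_on ?M \<phi>)" using q C unfolding \<phi>_def[abs_def] by (rule mult_left_mono)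
  finally show ?thesis using L2_bounded_by[OF q12L mE bE] by (simp add: power2_eq_square mult.assoc)
 qed
 have vN: "L2_norm_on ?M v <= (C + C\<^sup>2) * L2_norm_on ?M \<phi>"
 proof (rule L2_norm_le[OF \<phi>L L2_spaceD(1)[OF HL(1)]])
  show "AE x in ?M. norm (v x) <= (C + C\<^sup>2) * norm (\<phi> x)"
   using I1 I2 a(2)
  proof eventually_elim
   case (elim x)
   have "\<bar>a x\<bar> * \<bar>\<Gamma> (p1 x) - \<Gamma> (p2 x)\<bar> <= C * (C * \<bar>\<phi> x\<bar>)"
    unfolding \<phi>_def using elim C Gamma_Lipschitz by (intro mult_mono) auto
   moreover have "\<bar>\<Lambda> (p1 x) - \<Lambda> (p2 x)\<bar> <= C * \<bar>\<phi> x\<bar>"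
    unfolding \<phi>_def using elim by (intro Lambda_Lipschitz)
   moreover have e: "v x = (\<Lambda> (p1 x) - \<Lambda> (p2 x)) + a x * (\<Gamma> (p1 x) - \<Gamma> (p2 x))"
    by (simp add: v_def potential_def algebra_simps)
   have "\<bar>v x\<bar> <= \<bar>\<Lambda> (p1 x) - \<Lambda> (p2 x)\<bar> + \<bar>a x\<bar> * \<bar>\<Gamma> (p1 x) - \<Gamma> (p2 x)\<bar>"
    unfolding e abs_mult[symmetric] by (rule abs_triangle_ineq)
   moreover have "(C + C\<^sup>2) * norm (\<phi> x) = C * \<bar>\<phi> x\<bar> + C * (C * \<bar>\<phi> x\<bar>)"
    by (simp add: power2_eq_square algebra_simps)
   ultimately show ?case unfolding real_norm_def by linarith
  qed
  show "0 <= C + C\<^sup>2" using C by simp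
 qed
 have coercive: "\<kappa> * (L2_norm_on ?M \<phi>)\<^sup>2 <= L2_inner ?M \<phi> v"
 proof -
  have "(\<integral>x. \<kappa> * (norm (\<phi> x))\<^sup>2 \<partial>?M) <= (\<integral>x. \<phi> x \<bullet> v x \<partial>?M)"
  proof (rule integral_mono_AE)
   show "integrable ?M (%x. \<kappa> * (norm (\<phi> x))\<^sup>2)" by (rule integrable_mult_right[OF L2_spaceD(2)[OF \<phi>L]])
   show "integrable ?M (%x. \<phi> x \<bullet> v x)" by (rule L2_inner_integrable[OF \<phi>L HL(1)])
   show "AE x in ?M. \<kappa> * (norm (\<phi> x))\<^sup>2 <= \<phi> x \<bullet> v x"
    using mono I1 I2
   proof eventually_elim
    case (elim x)
    then have "\<kappa> * (p1 x - p2 x)\<^sup>2 <= (\<Lambda> (p1 x) - \<Lambda> (p2 x) + a x * (\<Gamma> (p1 x) - \<Gamma> (p2 x))) * (p1 x - p2 x)" by blast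
    then show ?case by (simp add: \<phi>_def v_def potential_def algebra_simps)
   qed
  qed
  moreover have "(\<integral>x. \<kappa> * (norm (\<phi> x))\<^sup>2 \<partial>?M) = \<kappa> * (L2_norm_on ?M \<phi>)\<^sup>2"
   unfolding L2_norm_sq L2_inner_def by (simp add: power2_eq_square)
  ultimately show ?thesis by (simp only: L2_inner_def)
 qed
 have split: "flux p1 g1 q1 w x - flux p2 g2 q2 w x = G x - (E1 x + E2 x)" for x
  by (simp add: flux_def G_def G1_def G2_def E1_def E2_def \<phi>_def algebra_simps)
 define f y where "f = L2_norm_on ?M \<phi>" and "y = L2_norm_on ?M V"
 have f0: "0 <= f" and y0: "0 <= y" unfolding f_def y_def by (rule L2_norm_nonneg)+
 have "L2_inner ?M V (%x. (v x, G x)) = L2_inner ?M \<phi> v"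
  using V(2)[OF H] by (simp add: \<phi>_def[abs_def])
 moreover have "L2_inner ?M V (%x. (v x, G x)) = L2_inner ?M (%x. fst (V x)) v + L2_inner ?M (%x. snd (V x)) G"
  unfolding L2_inner_def
  by (subst Bochner_Integration.integral_add[symmetric, OF L2_inner_integrable[OF VL(1) HL(1)] L2_inner_integrable[OF VL(2) HL(2)]])
   (simp add: inner_prod_def)
 ultimately have dual: "L2_inner ?M G (%x. snd (V x)) = L2_inner ?M \<phi> v - L2_inner ?M v (%x. fst (V x))"
  using L2_inner_commute[of ?M G "%x. snd (V x)"] L2_inner_commute[of ?M v "%x. fst (V x)"] by linarith
 have CS: "\<bar>L2_inner ?M h k\<bar> <= (B * f) * y"
  if "h \<in> L2_space ?M" "k \<in> L2_space ?M" "L2_norm_on ?M h <= B * f" "L2_norm_on ?M k <= y" for B and h k :: "'a => 'e::euclidean_space"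
 proof -
  have "L2_norm_on ?M h * L2_norm_on ?M k <= (B * f) * y"
   using that(3,4) L2_norm_nonneg[of ?M h] by (intro mult_mono L2_norm_nonneg) auto
  then show ?thesis using L2_Cauchy_Schwarz[OF that(1,2)] by linarith
 qed
 have c1: "\<bar>L2_inner ?M v (%x. fst (V x))\<bar> <= ((C + C\<^sup>2) * f) * y"
  unfolding f_def y_def by (rule CS[unfolded f_def y_def, OF HL(1) VL(1) vN VL(3)])
 have c2: "\<bar>L2_inner ?M E1 (%x. snd (V x))\<bar> <= ((4 * C\<^sup>2 + U) * f) * y"
  unfolding f_def y_def by (rule CS[unfolded f_def y_def, OF conjunct1[OF E1L] VL(2) conjunct2[OF E1L] VL(4)])
 have c3: "\<bar>L2_inner ?M E2 (%x. snd (V x))\<bar> <= (C\<^sup>2 * f) * y"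
  unfolding f_def y_def by (rule CS[unfolded f_def y_def, OF conjunct1[OF E2L] VL(2) conjunct2[OF E2L] VL(4)])
 have "L2_inner ?M (%x. flux p1 g1 q1 w x - flux p2 g2 q2 w x) (%x. snd (V x)) =
   L2_inner ?M G (%x. snd (V x)) - (L2_inner ?M E1 (%x. snd (V x)) + L2_inner ?M E2 (%x. snd (V x)))"
  unfolding split L2_inner_diff_left[OF HL(2) L2_add[OF conjunct1[OF E1L] conjunct1[OF E2L]] VL(2)]
  using L2_inner_combine_left[OF conjunct1[OF E1L] conjunct1[OF E2L] VL(2), of 1 1] by simp
 then have "- L2_inner ?M (%x. flux p1 g1 q1 w x - flux p2 g2 q2 w x) (%x. snd (V x)) \<le>
   - \<kappa> * f\<^sup>2 + ((C + C\<^sup>2) * f) * y + ((4 * C\<^sup>2 + U) * f) * y + (C\<^sup>2 * f) * y"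
  using dual coercive c1 c2 c3 unfolding f_def[symmetric] by linarith
 also have "\<dots> = - \<kappa> * f\<^sup>2 + (C + 6 * C\<^sup>2 + U) * f * y" by (simp add: algebra_simps)
 also have "\<dots> <= (C + 6 * C\<^sup>2 + U)\<^sup>2 * y\<^sup>2 / (4 * \<kappa>)"
 proof -
  have "0 <= (2 * \<kappa> * f - (C + 6 * C\<^sup>2 + U) * y)\<^sup>2" by simp
  then have "(- \<kappa> * f\<^sup>2 + (C + 6 * C\<^sup>2 + U) * f * y) * (4 * \<kappa>) <= (C + 6 * C\<^sup>2 + U)\<^sup>2 * y\<^sup>2"
   unfolding power2_diff power_mult_distrib by (simp add: power2_eq_square algebra_simps)
  then show ?thesis using \<kappa> by (simp add: pos_le_divide_eq)
 qed
 also have "\<dots> <= (2 * (1 + (C + 6 * C\<^sup>2)\<^sup>2) * (1 + U\<^sup>2)) * y\<^sup>2 / (4 * \<kappa>)"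
 proof -
  have "(c + U)\<^sup>2 <= 2 * (1 + c\<^sup>2) * (1 + U\<^sup>2)" for c
  proof -
   have "2 * (1 + c\<^sup>2) * (1 + U\<^sup>2) = (c + U)\<^sup>2 + ((c - U)\<^sup>2 + 2 + 2 * (c\<^sup>2 * U\<^sup>2))"
    by (simp add: power2_eq_square algebra_simps)
   moreover have "0 <= (c - U)\<^sup>2 + 2 + 2 * (c\<^sup>2 * U\<^sup>2)" by simp
   ultimately show ?thesis by linarith
  qed
  then show ?thesis using \<kappa> by (intro divide_right_mono mult_right_mono) auto
 qed
 also have "\<dots> = (1 + (C + 6 * C\<^sup>2)\<^sup>2) / (2 * \<kappa>) * (1 + U\<^sup>2) * y\<^sup>2" using \<kappa> by (simp add: field_simps)
 finally show ?thesis unfolding y_def .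
qed

end

section \<open>Null sets in products\<close>

lemma AE_lebesgue_product_slices:
 fixes A :: "'a::euclidean_space set" and B :: "'b::euclidean_space set"
 assumes A: "open A" and B: "open B" and P: "AE z in lebesgue_on (A \<times> B). P z"
 shows "AE t in lebesgue_on A. AE x in lebesgue_on B. P (t, x)"
proof -
 have "AE z in lebesgue. z \<in> A \<times> B --> P z"
  using P AE_lebesgue_on_iff[of "A \<times> B"] open_Times[OF A B] by simp
 then have "AE z in lborel \<Otimes>\<^sub>M lborel. z \<in> A \<times> B --> P z"
  unfolding AE_completion_iff lborel_prod .
 then have "AE t in lborel. AE x in lborel. (t, x) \<in> A \<times> B --> P (t, x)" by (rule lborel_pair.AE_pair)
 then have "AE t in lebesgue. t \<in> A --> (AE x in lebesgue. x \<in> B --> P (t, x))"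
  unfolding AE_completion_iff
 proof (rule eventually_mono)
  fix t assume h: "AE x in lborel. (t, x) \<in> A \<times> B --> P (t, x)"
  show "t \<in> A --> (AE x in lborel. x \<in> B --> P (t, x))"
  proof
   assume "t \<in> A"
   then show "AE x in lborel. x \<in> B --> P (t, x)" using h by simp
  qed
 qed
 then show ?thesis using A B by (simp add: AE_lebesgue_on_iff)
qed

text \<open>
  Slices determine null sets only among product measurable sets, so a Borel representative is used.
\<close>

lemma AE_lebesgue_product_zero:
 fixes f :: "'a::euclidean_space \<times> 'b::euclidean_space => real"
 assumes A: "open A" and B: "open B" and f: "f \<in> borel_measurable (lebesgue_on (A \<times> B))"
  and z: "AE t in lebesgue_on A. AE x in lebesgue_on B. f (t, x) = 0"
 shows "AE z in lebesgue_on (A \<times> B). f z = 0"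
proof -
 have AB: "A \<times> B \<in> sets lebesgue" using open_Times[OF A B] by simp
 define F where "F z = (if z \<in> A \<times> B then f z else 0)" for z
 have "F \<in> borel_measurable lebesgue"
  unfolding F_def using f AB by (simp add: borel_measurable_if)
 then obtain h where h: "h \<in> borel_measurable borel" "AE z in lebesgue. F z = h z"
  by (rule lebesgue_borel_representative)
 have "AE z in lborel \<Otimes>\<^sub>M lborel. F z = h z" using h(2) unfolding AE_completion_iff lborel_prod .
 then have "AE t in lborel. AE x in lborel. F (t, x) = h (t, x)" by (rule lborel_pair.AE_pair)
 moreover have "AE t in lborel. t \<in> A --> (AE x in lborel. x \<in> B --> f (t, x) = 0)"
  using z A B by (simp add: AE_lebesgue_on_iff AE_completion_iff)
 ultimately have "AE t in lborel. AE x in lborel. h (t, x) = 0"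
 proof eventually_elim
  case (elim t)
  show ?case
  proof (cases "t \<in> A")
   case True
   then have "AE x in lborel. x \<in> B --> f (t, x) = 0" using elim(2) by blast
   then show ?thesis using elim(1) by eventually_elim (auto simp: F_def split: if_splits)
  next
   case False
   show ?thesis using elim(1) by (rule eventually_mono) (use False in \<open>simp add: F_def\<close>)
  qed
 qed
 then have "AE z in lborel \<Otimes>\<^sub>M lborel. h z = 0"
 proof (rule lborel_pair.AE_pair_measure[rotated])
  have "h \<in> borel_measurable (lborel \<Otimes>\<^sub>M lborel)" using h(1) unfolding lborel_prod by simp
  then show "{z \<in> space (lborel \<Otimes>\<^sub>M lborel). h z = 0} \<in> sets (lborel \<Otimes>\<^sub>M lborel)" by measurable
 qed
 then have "AE z in lebesgue. h z = 0" unfolding AE_completion_iff lborel_prod .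
 with h(2) have "AE z in lebesgue. z \<in> A \<times> B --> f z = 0"
  by eventually_elim (auto simp: F_def split: if_splits)
 then show ?thesis unfolding AE_lebesgue_on_iff[OF AB] .
qed

section \<open>The degenerate coefficients\<close>

lemma deriv_on_has_derivative:
 assumes "f differentiable_on I" "s \<in> I"
 shows "(f has_real_derivative deriv_on I f s) (at s within I)"
proof -
 have "f differentiable (at s within I)" using assms by (simp add: differentiable_on_def)
 then show ?thesis
  unfolding deriv_on_def has_real_derivative_iff_has_vector_derivative by (simp add: vector_derivative_works)
qed

lemma deriv_on_add:
 assumes f: "!!s. s \<in> {-1<..<1} ==> f s = g s + h s" "f differentiable_on {-1<..<1}"
  and h: "h differentiable_on {-1..1}" and s: "s \<in> {-1<..<1::real}"
 shows "deriv_on {-1<..<1} f s = deriv_on {-1<..<1} g s + deriv_on {-1..1} h s"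
  "(g has_real_derivative deriv_on {-1<..<1} g s) (at s)"
proof -
 have df: "(f has_real_derivative deriv_on {-1<..<1} f s) (at s)"
  using deriv_on_has_derivative[OF f(2) s] unfolding at_within_open[OF s open_greaterThanLessThan] .
 have si: "s \<in> interior {-1..1}" "s \<in> {-1..1}" using s by (simp_all add: interior_atLeastAtMost_real)
 have dh: "(h has_real_derivative deriv_on {-1..1} h s) (at s)"
  using deriv_on_has_derivative[OF h si(2)] unfolding at_within_interior[OF si(1)] .
 have "(g has_real_derivative deriv_on {-1<..<1} f s - deriv_on {-1..1} h s) (at s)"
  using s f(1) by (intro has_field_derivative_transform_within_open[OF DERIV_diff[OF df dh], of "{-1<..<1}"]) auto
 note dg = this
 have "deriv_on {-1<..<1} g s = vector_derivative g (at s)"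
  unfolding deriv_on_def at_within_open[OF s open_greaterThanLessThan] ..
 also have "\<dots> = deriv_on {-1<..<1} f s - deriv_on {-1..1} h s"
  by (rule vector_derivative_at[OF dg[unfolded has_real_derivative_iff_has_vector_derivative]])
 finally have "deriv_on {-1<..<1} g s = deriv_on {-1<..<1} f s - deriv_on {-1..1} h s" .
 with dg show "deriv_on {-1<..<1} f s = deriv_on {-1<..<1} g s + deriv_on {-1..1} h s"
  "(g has_real_derivative deriv_on {-1<..<1} g s) (at s)" by simp_all
qed

lemma deriv2_on_add:
 assumes f: "\<forall>s\<in>{-1<..<1}. f s = g s + h s" "C2_on {-1<..<1} f" and h: "C2_on {-1..1} h"
  and s: "s \<in> {-1<..<1}"
 shows "deriv2_on {-1<..<1} f s = deriv2_on {-1<..<1} g s + deriv2_on {-1..1} h s"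
proof -
 have d: "f differentiable_on {-1<..<1}" "deriv_on {-1<..<1} f differentiable_on {-1<..<1}"
  "h differentiable_on {-1..1}" "deriv_on {-1..1} h differentiable_on {-1..1}"
  using f(2) h by (auto simp: C2_on_def C1_on_def)
 have "deriv_on {-1<..<1} f s = deriv_on {-1<..<1} g s + deriv_on {-1..1} h s" if "s \<in> {-1<..<1}" for s
  by (rule deriv_on_add(1)[OF _ d(1,3) that]) (use f(1) in blast)
 from deriv_on_add(1)[where f="deriv_on {-1<..<1} f" and g="deriv_on {-1<..<1} g" and h="deriv_on {-1..1} h", OF this d(2,4) s]
 show ?thesis by (simp add: deriv2_on_def)
qed

lemma primitive_on_interval:
 assumes "continuous_on {-1..1} (f :: real => real)"
 obtains G where "!!s. s \<in> {-1..1} ==> (G has_real_derivative f s) (at s within {-1..1})" "G 0 = 0"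
proof -
 obtain g where g: "!!s. s \<in> {-1..1} ==> (g has_vector_derivative f s) (at s within {-1..1})"
  using antiderivative_continuous[OF assms] by blast
 show thesis
 proof (rule that)
  show "((%s. g s - g 0) has_real_derivative f s) (at s within {-1..1})" if "s \<in> {-1..1}" for s
   using DERIV_diff[OF g[OF that, folded has_real_derivative_iff_has_vector_derivative] DERIV_const[of "g 0"]] by simp
 qed simp
qed

text \<open>
  The function \<open>\<Lambda> + a \<Gamma> - \<kappa> id\<close> is nondecreasing: its derivative is nonnegative in the interior, and
  it is continuous up to the end points.
\<close>

lemma strongly_monotone_potential:
 fixes \<beta> m \<Lambda> \<Gamma> :: "real => real"
 assumes \<Lambda>: "!!s. s \<in> {-1..1} ==> (\<Lambda> has_real_derivative \<beta> s) (at s within {-1..1})"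
  and \<Gamma>: "!!s. s \<in> {-1..1} ==> (\<Gamma> has_real_derivative m s) (at s within {-1..1})"
  and low: "!!s. s \<in> {-1<..<1} ==> \<kappa> <= \<beta> s + a * m s"
  and s: "s \<in> {-1..1}" "s' \<in> {-1..1}"
 shows "\<kappa> * (s - s')\<^sup>2 <= (\<Lambda> s - \<Lambda> s' + a * (\<Gamma> s - \<Gamma> s')) * (s - s')"
proof -
 define h where "h r = \<Lambda> r + a * \<Gamma> r - \<kappa> * r" for r
 have dh: "(h has_real_derivative \<beta> r + a * m r - \<kappa>) (at r within {-1..1})" if "r \<in> {-1..1}" for r
  unfolding h_def[abs_def] by (auto intro!: derivative_eq_intros \<Lambda> \<Gamma> that)
 have incr: "h x <= h y" if "x <= y" "x \<in> {-1..1}" "y \<in> {-1..1}" for x y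
 proof (rule DERIV_nonneg_imp_increasing_open[OF that(1)])
  show "\<exists>D. DERIV h r :> D \<and> D \<ge> 0" if "x < r" "r < y" for r
  proof -
   have r: "r \<in> {-1<..<1}" using that \<open>x \<in> _\<close> \<open>y \<in> _\<close> by auto
   then have ri: "r \<in> interior {-1..1}" "r \<in> {-1..1}" by (simp_all add: interior_atLeastAtMost_real)
   have "DERIV h r :> \<beta> r + a * m r - \<kappa>" using dh[OF ri(2)] unfolding at_within_interior[OF ri(1)] .
   then show ?thesis using low[OF r] by fastforce
  qed
  have "continuous_on {-1..1} h" by (rule DERIV_continuous_on[OF dh])
  then show "continuous_on {x..y} h" by (rule continuous_on_subset) (use that in auto)
 qed
 have "0 <= (h s - h s') * (s - s')"
  using incr[of s s'] incr[of s' s] s by (cases "s <= s'") (auto intro: mult_nonneg_nonneg mult_nonpos_nonpos)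
 then show ?thesis by (simp add: h_def power2_eq_square algebra_simps)
qed

lemma bounded_on_interval:
 assumes "continuous_on {-1..1} (f :: real => real)"
 shows "\<exists>B\<ge>0. \<forall>s\<in>{-1..1}. \<bar>f s\<bar> <= B"
proof -
 obtain B where "!!s. s \<in> {-1..1} ==> norm (f s) <= B"
  using compact_imp_bounded[OF compact_continuous_image[OF assms compact_Icc]] unfolding bounded_iff by blast
 then show ?thesis by (intro exI[of _ "max 0 B"]) (auto simp: le_max_iff_disj)
qed

text \<open>
  On \<open>(-1,1)\<close> the derivative of \<open>\<Lambda> + a \<Gamma>\<close> is
  \<open>m F'' + a m = (1 - \<rho>) m F1'' + m (\<rho> F1'' + F2'' + a) \<ge> (1 - \<rho>) \<alpha>0\<close>, so the degeneracy of \<open>m\<close> is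
  compensated by the singularity of \<open>F1''\<close>.
\<close>

lemma degenerate_coefficients:
 assumes m: "C1_on {-1..1} m" "\<forall>s\<in>{-1..1}. 0 <= m s"
  and F: "\<forall>s\<in>{-1<..<1}. F s = F1 s + F2 s" "C2_on {-1..1} F2" "C2_on {-1<..<1} F"
  and \<beta>: "continuous_on {-1..1} (limit_ext (%s. m s * deriv2_on {-1<..<1} F s))"
  and \<rho>: "\<rho> < 1"
  and alpha: "\<forall>s\<in>{-1..1}. \<alpha>0 <= limit_ext (%s. m s * deriv2_on {-1<..<1} F1 s) s"
 obtains \<Lambda> \<Gamma> B where "0 <= B" "continuous_on {-1..1} m"
  "!!s. s \<in> {-1..1} ==> \<bar>limit_ext (%s. m s * deriv2_on {-1<..<1} F s) s\<bar> <= B"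
  "!!s. s \<in> {-1..1} ==> \<bar>m s\<bar> <= B"
  "!!s s'. s \<in> {-1..1} ==> s' \<in> {-1..1} ==> \<bar>m s - m s'\<bar> <= B * \<bar>s - s'\<bar>"
  "!!s. s \<in> {-1..1} ==> (\<Lambda> has_real_derivative limit_ext (%s. m s * deriv2_on {-1<..<1} F s) s) (at s within {-1..1})"
  "\<Lambda> 0 = 0"
  "!!s. s \<in> {-1..1} ==> (\<Gamma> has_real_derivative m s) (at s within {-1..1})" "\<Gamma> 0 = 0"
  "!!a s s'. \<forall>s\<in>{-1<..<1}. 0 <= \<rho> * deriv2_on {-1<..<1} F1 s + deriv2_on {-1..1} F2 s + a ==>
   s \<in> {-1..1} ==> s' \<in> {-1..1} ==>
   (1 - \<rho>) * \<alpha>0 * (s - s')\<^sup>2 <= (\<Lambda> s - \<Lambda> s' + a * (\<Gamma> s - \<Gamma> s')) * (s - s')"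
proof -
 let ?\<beta> = "limit_ext (%s. m s * deriv2_on {-1<..<1} F s)"
 have dm: "m differentiable_on {-1..1}" "continuous_on {-1..1} (deriv_on {-1..1} m)"
  using m(1) by (auto simp: C1_on_def)
 have cm: "continuous_on {-1..1} m" by (rule differentiable_imp_continuous_on[OF dm(1)])
 obtain B1 where B1: "0 <= B1" "!!s. s \<in> {-1..1} ==> \<bar>?\<beta> s\<bar> <= B1" using bounded_on_interval[OF \<beta>] by blast
 obtain B2 where B2: "0 <= B2" "!!s. s \<in> {-1..1} ==> \<bar>m s\<bar> <= B2" using bounded_on_interval[OF cm] by blast
 obtain B3 where B3: "0 <= B3" "!!s. s \<in> {-1..1} ==> \<bar>deriv_on {-1..1} m s\<bar> <= B3" using bounded_on_interval[OF dm(2)] by blast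
 have lip: "\<bar>m s - m s'\<bar> <= B3 * \<bar>s - s'\<bar>" if "s \<in> {-1..1}" "s' \<in> {-1..1}" for s s'
  using field_differentiable_bound[OF _ deriv_on_has_derivative[OF dm(1)], where B=B3] B3(2) that by simp
 obtain \<Lambda> where \<Lambda>: "!!s. s \<in> {-1..1} ==> (\<Lambda> has_real_derivative ?\<beta> s) (at s within {-1..1})" "\<Lambda> 0 = 0"
  using primitive_on_interval[OF \<beta>] by blast
 obtain \<Gamma> where \<Gamma>: "!!s. s \<in> {-1..1} ==> (\<Gamma> has_real_derivative m s) (at s within {-1..1})" "\<Gamma> 0 = 0"
  using primitive_on_interval[OF cm] by blast
 show thesis
 proof (rule that[of "B1 + B2 + B3" \<Lambda> \<Gamma>])
  fix a s s' :: real
  assume a: "\<forall>s\<in>{-1<..<1}. 0 <= \<rho> * deriv2_on {-1<..<1} F1 s + deriv2_on {-1..1} F2 s + a"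
   and s: "s \<in> {-1..1}" "s' \<in> {-1..1}"
  show "(1 - \<rho>) * \<alpha>0 * (s - s')\<^sup>2 <= (\<Lambda> s - \<Lambda> s' + a * (\<Gamma> s - \<Gamma> s')) * (s - s')"
  proof (rule strongly_monotone_potential[OF \<Lambda>(1) \<Gamma>(1) _ s])
   fix r :: real assume r: "r \<in> {-1<..<1}"
   then have r': "r \<in> {-1..1}" by auto
   have "(1 - \<rho>) * \<alpha>0 <= (1 - \<rho>) * (m r * deriv2_on {-1<..<1} F1 r)"
    using bspec[OF alpha r'] r \<rho> by (intro mult_left_mono) (simp_all add: limit_ext_def)
   moreover have "0 <= m r * (\<rho> * deriv2_on {-1<..<1} F1 r + deriv2_on {-1..1} F2 r + a)"
    using bspec[OF a r] bspec[OF m(2) r'] by (rule mult_nonneg_nonneg[rotated])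
   moreover have "?\<beta> r = m r * (deriv2_on {-1<..<1} F1 r + deriv2_on {-1..1} F2 r)"
    using r deriv2_on_add[OF F(1,3,2) r] by (simp add: limit_ext_def)
   ultimately show "(1 - \<rho>) * \<alpha>0 <= ?\<beta> r + a * m r" by (simp add: algebra_simps)
  qed auto
 next
  fix s s' :: real assume s: "s \<in> {-1..1}" "s' \<in> {-1..1}"
  have "B3 * \<bar>s - s'\<bar> <= (B1 + B2 + B3) * \<bar>s - s'\<bar>" using B1(1) B2(1) by (intro mult_right_mono) auto
  then show "\<bar>m s - m s'\<bar> <= (B1 + B2 + B3) * \<bar>s - s'\<bar>" using lip[OF s] by linarith
 next
  fix s :: real assume s: "s \<in> {-1..1}"
  show "\<bar>?\<beta> s\<bar> <= B1 + B2 + B3" using B1(2)[OF s] B2(1) B3(1) by linarith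
  show "\<bar>m s\<bar> <= B1 + B2 + B3" using B2(2)[OF s] B1(1) B3(1) by linarith
 qed (use B1(1) B2(1) B3(1) cm \<Lambda> \<Gamma> in auto)
qed

section \<open>Paths in the dual space\<close>

lemma L2_norm_scaleR: "L2_norm_on M (%x. c *\<^sub>R f x) = \<bar>c\<bar> * L2_norm_on M f"
 by (simp add: L2_norm_on_def power_mult_distrib real_sqrt_mult)

lemma H1_dual_linear:
 "l \<in> H1_dual S ==> v \<in> H1 S ==> w \<in> H1 S ==> l (%x. c * v x + d * w x) = c * l v + d * l w"
 by (simp add: H1_dual_def)

lemma H1_dual_norm_upper:
 assumes l: "l \<in> H1_dual S" and w: "w \<in> H1 S" "H1_norm S w <= 1"
 shows "\<bar>l w\<bar> <= H1_dual_norm S l"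
proof -
 obtain C where C: "!!v. v \<in> H1 S ==> \<bar>l v\<bar> <= C * H1_norm S v" using l unfolding H1_dual_def by blast
 have bdd: "bdd_above ((%v. \<bar>l v\<bar>) ` {v \<in> H1 S. H1_norm S v <= 1})"
 proof (rule bdd_aboveI2)
  fix v assume v: "v \<in> {v \<in> H1 S. H1_norm S v <= 1}"
  have "0 <= H1_norm S v" by (simp add: H1_norm_def)
  then have "C * H1_norm S v <= \<bar>C\<bar> * 1" using v by (intro mult_mono) auto
  then show "\<bar>l v\<bar> <= \<bar>C\<bar>" using C[of v] v by simp
 qed
 show ?thesis unfolding H1_dual_norm_def by (rule cSUP_upper[OF _ bdd]) (use w in simp)
qed

lemma H1_dual_bound:
 assumes S: "open S" and l: "l \<in> H1_dual S" and V: "V \<in> H1_graph S"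
 shows "\<bar>l (%x. fst (V x))\<bar> <= H1_dual_norm S l * L2_norm_on (lebesgue_on S) V"
proof -
 let ?v = "%x. fst (V x)" and ?N = "L2_norm_on (lebesgue_on S) V"
 note v = H1_graph_fst(1,3)[OF S V]
 obtain C where C: "!!v. v \<in> H1 S ==> \<bar>l v\<bar> <= C * H1_norm S v" using l unfolding H1_dual_def by blast
 show ?thesis
 proof (cases "?N = 0")
  case True
  then show ?thesis using C[OF v(1)] v(2) by simp
 next
  case False
  then have N: "0 < ?N" using L2_norm_nonneg[of "lebesgue_on S" V] by simp
  define W where "W x = (1 / ?N) *\<^sub>R V x + 0 *\<^sub>R V x" for x
  have W: "W \<in> H1_graph S" unfolding W_def[abs_def] by (rule H1_graph_combine[OF S V V])
  have "L2_norm_on (lebesgue_on S) W = 1" using N by (simp add: W_def[abs_def] L2_norm_scaleR)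
  then have w: "(%x. fst (W x)) \<in> H1 S" "H1_norm S (%x. fst (W x)) = 1" using H1_graph_fst(1,3)[OF S W] by simp_all
  have "\<bar>l (%x. fst (W x))\<bar> <= H1_dual_norm S l" by (rule H1_dual_norm_upper[OF l w(1)]) (simp add: w(2))
  moreover have "l (%x. fst (W x)) = (1 / ?N) * l ?v"
  proof -
   have "l (%x. (1 / ?N) * fst (V x) + 0 * fst (V x)) = (1 / ?N) * l ?v + 0 * l ?v"
    by (rule H1_dual_linear[OF l v(1) v(1)])
   then show ?thesis by (simp add: W_def)
  qed
  ultimately show ?thesis using N by (simp add: abs_mult field_simps)
 qed
qed

lemma H1_dual_diff:
 assumes "open S" "l \<in> H1_dual S" "V \<in> H1_graph S" "W \<in> H1_graph S"
 shows "l (%x. fst (V x)) - l (%x. fst (W x)) = l (%x. fst (V x - W x))"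
proof -
 have "l (%x. 1 * fst (V x) + (-1) * fst (W x)) = 1 * l (%x. fst (V x)) + (-1) * l (%x. fst (W x))"
  by (rule H1_dual_linear[OF assms(2) H1_graph_fst(1)[OF assms(1,3)] H1_graph_fst(1)[OF assms(1,4)]])
 then show ?thesis by simp
qed

lemma H1_graph_diff:
 assumes "open S" "V \<in> H1_graph S" "W \<in> H1_graph S"
 shows "(%x. V x - W x) \<in> H1_graph S"
 using H1_graph_combine[OF assms, of 1 "-1"] by simp

lemma H1_dual_lipschitz:
 assumes "open S" "l \<in> H1_dual S" "V \<in> H1_graph S" "W \<in> H1_graph S"
 shows "\<bar>l (%x. fst (V x)) - l (%x. fst (W x))\<bar> <= H1_dual_norm S l * L2_norm_on (lebesgue_on S) (%x. V x - W x)"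
 unfolding H1_dual_diff[OF assms] by (rule H1_dual_bound[OF assms(1,2) H1_graph_diff[OF assms(1,3,4)]])

lemma H1_dual_norm_nonneg:
 assumes S: "open S" "S \<in> lmeasurable" and l: "l \<in> H1_dual S"
 shows "0 <= H1_dual_norm S l"
proof -
 let ?Z = "riesz_graph S (%x. 0)"
 have "L2_norm_on (lebesgue_on S) ?Z <= 0" using riesz_graph_norm_le[OF S L2_zero] by (simp add: L2_norm_on_def)
 then have "\<bar>l (%x. fst (?Z x))\<bar> <= H1_dual_norm S l"
  using H1_graph_fst(1,3)[OF S(1) riesz_graph(1)[OF S L2_zero]] by (intro H1_dual_norm_upper[OF l]) simp_all
 then show ?thesis by linarith
qed

lemma H1_dual_minus:
 assumes "k \<in> H1_dual S" "l \<in> H1_dual S"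
 shows "k - l \<in> H1_dual S"
proof -
 obtain C where C: "!!v. v \<in> H1 S ==> \<bar>k v\<bar> <= C * H1_norm S v" using assms(1) unfolding H1_dual_def by blast
 obtain D where D: "!!v. v \<in> H1 S ==> \<bar>l v\<bar> <= D * H1_norm S v" using assms(2) unfolding H1_dual_def by blast
 have "\<bar>(k - l) v\<bar> <= (C + D) * H1_norm S v" if "v \<in> H1 S" for v
  using C[OF that] D[OF that] abs_triangle_ineq4[of "k v" "l v"] by (simp add: distrib_right)
 moreover have "(k - l) (%x. c * v x + d * w x) = c * (k - l) v + d * (k - l) w" if "v \<in> H1 S" "w \<in> H1 S" for v w c d
 proof -
  have "k (%x. c * v x + d * w x) = c * k v + d * k w" "l (%x. c * v x + d * w x) = c * l v + d * l w"
   using assms that unfolding H1_dual_def by blast+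
  then show ?thesis by (simp add: algebra_simps)
 qed
 ultimately show ?thesis unfolding H1_dual_def by blast
qed

text \<open>
  Convergence of simple functions in the dual norm implies convergence on every fixed test function,
  which gives measurability of the evaluations.
\<close>

lemma dual_path_integrable:
 fixes S :: "'a::euclidean_space set" and T :: real
 assumes S: "open S" and l: "l \<in> bochner_L2 (lebesgue_on {0<..<T}) (H1_dual S) (H1_dual_norm S)"
 shows "AE t in lebesgue_on {0<..<T}. l t \<in> H1_dual S"
  "integrable (lebesgue_on {0<..<T}) (%t. H1_dual_norm S (l t))"
  "!!V. V \<in> H1_graph S ==> integrable (lebesgue_on {0<..<T}) (%t. l t (%x. fst (V x)))"
proof -
 let ?I = "lebesgue_on {0<..<T}"
 have I: "{0<..<T} \<in> sets lebesgue" by simp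
 interpret finite_measure ?I
  by (rule finite_measure_lebesgue_on) (rule lmeasurable_interval)
 have sm: "strongly_measurable ?I (H1_dual S) (H1_dual_norm S) l" and N2: "(%t. H1_dual_norm S (l t)) \<in> L2_space ?I"
  using l by (auto simp: bochner_L2_def)
 show mem: "AE t in ?I. l t \<in> H1_dual S" using sm by (simp add: strongly_measurable_def)
 show Ni: "integrable ?I (%t. H1_dual_norm S (l t))" by (rule L2_imp_L1(1)[OF N2])
 fix V assume V: "V \<in> H1_graph S"
 let ?v = "%x. fst (V x)"
 obtain s where s: "!!n. simple_function ?I (s n)" "!!n t. t \<in> space ?I ==> s n t \<in> H1_dual S"
  "AE t in ?I. (%n. H1_dual_norm S (s n t - l t)) \<longlonglongrightarrow> 0"
  using sm unfolding strongly_measurable_def by blast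
 have lim: "AE t in ?I. (%n. s n t ?v) \<longlonglongrightarrow> l t ?v"
  using s(3) mem AE_space
 proof eventually_elim
  case (elim t)
  have b: "\<bar>s n t ?v - l t ?v\<bar> <= H1_dual_norm S (s n t - l t) * L2_norm_on (lebesgue_on S) V" for n
   using H1_dual_bound[OF S H1_dual_minus[OF s(2)[OF elim(3), of n] elim(2)] V] by simp
  have "(%n. H1_dual_norm S (s n t - l t) * L2_norm_on (lebesgue_on S) V) \<longlonglongrightarrow> 0"
   using tendsto_mult_right[OF elim(1), of "L2_norm_on (lebesgue_on S) V"] by simp
  then have "(%n. s n t ?v - l t ?v) \<longlonglongrightarrow> 0"
   by (rule Lim_null_comparison[rotated]) (use b in simp)
  then show ?case by (rule LIM_zero_cancel)
 qed
 have "(%t. l t ?v) \<in> borel_measurable ?I"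
 proof (rule borel_measurable_lebesgue_on_AE[OF I])
  show "(%t. lim (%n. s n t ?v)) \<in> borel_measurable ?I"
  proof (rule borel_measurable_lim_metric)
   fix n
   have "simple_function ?I ((%k. k ?v) \<circ> s n)" by (rule simple_function_compose[OF s(1)])
   then show "(%t. s n t ?v) \<in> borel_measurable ?I" by (intro borel_measurable_simple_function) (simp add: comp_def)
  qed
  show "AE t in ?I. lim (%n. s n t ?v) = l t ?v" using lim by (rule eventually_mono) (rule limI)
 qed
 then show "integrable ?I (%t. l t ?v)"
 proof (rule Bochner_Integration.integrable_bound[OF integrable_mult_left[OF Ni, of "L2_norm_on (lebesgue_on S) V"]])
  show "AE t in ?I. norm (l t ?v) <= norm (H1_dual_norm S (l t) * L2_norm_on (lebesgue_on S) V)"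
   using mem by (rule eventually_mono) (use H1_dual_bound[OF S _ V] in fastforce)
 qed
qed

text \<open>
  The exceptional null set of times in the weak equation depends on the test function, while the
  energy argument at time \<open>r\<close> tests with the representative of \<open>c r\<close>. Representatives at rational
  times form a countable family, and they approximate the one at \<open>r\<close> by continuity of \<open>c\<close>.
\<close>

lemma dual_equation_extends:
 fixes S :: "'a::euclidean_space set" and T :: real
 assumes S: "open S" "S \<in> lmeasurable" and l: "l \<in> H1_dual S" and G: "G \<in> L2_space (lebesgue_on S)"
  and c: "!!t. t \<in> {0..T} ==> c t \<in> L2_space (lebesgue_on S)"
  and cont: "((%s. L2_norm_on (lebesgue_on S) (%x. c s x - c r x)) \<longlongrightarrow> 0) (at r within {0..T})"
  and r: "r \<in> {0<..<T}"
  and eq: "!!q. q \<in> \<rat> \<inter> {0..T} ==>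
   l (%x. fst (riesz_graph S (c q) x)) = - L2_inner (lebesgue_on S) G (%x. snd (riesz_graph S (c q) x))"
 shows "l (%x. fst (riesz_graph S (c r) x)) = - L2_inner (lebesgue_on S) G (%x. snd (riesz_graph S (c r) x))"
proof -
 let ?M = "lebesgue_on S"
 define X where "X q = l (%x. fst (riesz_graph S (c q) x)) + L2_inner ?M G (%x. snd (riesz_graph S (c q) x))" for q
 define B where "B = H1_dual_norm S l + L2_norm_on ?M G"
 have B: "0 <= B" unfolding B_def by (intro add_nonneg_nonneg H1_dual_norm_nonneg[OF S l] L2_norm_nonneg)
 have rT: "r \<in> {0..T}" using r by auto
 note Rr = riesz_graph(1)[OF S c[OF rT]]
 have bound: "\<bar>X q - X r\<bar> <= B * L2_norm_on ?M (%x. c q x - c r x)" if q: "q \<in> {0..T}" for q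
 proof -
  note Rq = riesz_graph(1)[OF S c[OF q]]
  let ?d = "%x. riesz_graph S (c q) x - riesz_graph S (c r) x"
  have d: "?d \<in> L2_space ?M" by (rule H1_graphD(1)[OF H1_graph_diff[OF S(1) Rq Rr]])
  have "L2_inner ?M G (%x. snd (riesz_graph S (c q) x)) - L2_inner ?M G (%x. snd (riesz_graph S (c r) x)) = L2_inner ?M G (%x. snd (?d x))"
   using L2_inner_diff_right[OF L2_fst_snd(2)[OF H1_graphD(1)[OF Rq]] L2_fst_snd(2)[OF H1_graphD(1)[OF Rr]] G] by simp
  moreover have "\<bar>L2_inner ?M G (%x. snd (?d x))\<bar> <= L2_norm_on ?M G * L2_norm_on ?M ?d"
   using L2_Cauchy_Schwarz[OF G L2_fst_snd(2)[OF d]] mult_left_mono[OF L2_fst_snd(4)[OF d] L2_norm_nonneg[of ?M G]] by linarith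
  ultimately have "\<bar>X q - X r\<bar> <= B * L2_norm_on ?M ?d"
   using H1_dual_lipschitz[OF S(1) l Rq Rr] unfolding X_def B_def by (simp add: distrib_right)
  also have "\<dots> <= B * L2_norm_on ?M (%x. c q x - c r x)"
   by (rule mult_left_mono[OF riesz_graph_contraction[OF S c[OF q] c[OF rT]] B])
  finally show ?thesis .
 qed
 have "\<bar>X r\<bar> <= e" if e: "0 < e" for e
 proof -
  have "((%s. B * L2_norm_on ?M (%x. c s x - c r x)) \<longlongrightarrow> 0) (at r within {0..T})"
   using tendsto_mult_left[OF cont, of B] by simp
  then have "\<forall>\<^sub>F s in at r within {0..T}. B * L2_norm_on ?M (%x. c s x - c r x) < e"
   using e by (rule order_tendstoD(2))
  then obtain d where d: "0 < d" "!!s. s \<in> {0..T} ==> s \<noteq> r ==> dist s r < d ==> B * L2_norm_on ?M (%x. c s x - c r x) < e"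
   unfolding eventually_at by auto
  obtain q where q: "q \<in> \<rat>" "r < q" "q < min (r + d) T"
   using Rats_dense_in_real[of r "min (r + d) T"] d(1) r by auto
  then have qT: "q \<in> {0..T}" using r by auto
  have "X q = 0" using eq[of q] q(1) qT by (simp add: X_def)
  then show ?thesis using bound[OF qT] d(2)[OF qT] q by (auto simp: dist_real_def)
 qed
 then have "\<bar>X r\<bar> <= 0 + e" if "0 < e" for e using that by simp
 then have "\<bar>X r\<bar> <= 0" by (rule field_le_epsilon)
 then show ?thesis by (simp add: X_def)
qed

lemma Linf_norm_AE:
 fixes f :: "'a => 'b::euclidean_space"
 assumes f: "f \<in> Linf_space M"
 shows "AE x in M. norm (f x) <= Linf_norm_on M f"
proof -
 obtain C where C: "f \<in> borel_measurable M" "AE x in M. norm (f x) <= C" using f unfolding Linf_space_def by blast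
 let ?e = "esssup M (%x. ereal (norm (f x)))"
 have le: "?e <= ereal C" using C by (intro esssup_I) auto
 have "AE x in M. ereal (norm (f x)) <= ?e" by (rule esssup_AE)
 then show ?thesis
 proof (rule eventually_mono)
  fix x assume x: "ereal (norm (f x)) <= ?e"
  then have "ereal (real_of_ereal ?e) = ?e"
   using le by (cases ?e) simp_all
  with x have "ereal (norm (f x)) <= ereal (real_of_ereal ?e)" by (simp only:)
  then show "norm (f x) <= Linf_norm_on M f" unfolding Linf_norm_on_def by (simp only: ereal_less_eq)
 qed
qed

section \<open>Uniqueness of weak solutions\<close>

text \<open>
  The weak equation at a fixed time; \<open>l\<close> is the value of the time derivative at \<open>\<psi>\<close>.
\<close>

definition weak_balance ::
 "'a::euclidean_space set => ('a => real) => (real => real) => (real => real) =>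
  ('a => real) => ('a => 'a) => real => ('a => real) => bool" where
 "weak_balance S J m F p w l \<psi> \<longleftrightarrow>
  l + (\<integral>x. limit_ext (%s. m s * deriv2_on {-1<..<1} F s) (p x) *
     (weak_gradient S p x \<bullet> weak_gradient S \<psi> x) \<partial>lebesgue_on S)
   + (\<integral>x. m (p x) * kernel_mass S J x * (weak_gradient S p x \<bullet> weak_gradient S \<psi> x) \<partial>lebesgue_on S)
   + (\<integral>x. m (p x) * ((p x *\<^sub>R weak_gradient S (kernel_mass S J) x - gradient_conv S J p x)
     \<bullet> weak_gradient S \<psi> x) \<partial>lebesgue_on S)
  = (\<integral>x. (p x *\<^sub>R w x) \<bullet> weak_gradient S \<psi> x \<partial>lebesgue_on S)"

text \<open>
  Paired with a fixed test function, the continuous representative \<open>c\<close> has a weak derivative in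
  \<open>L\<^sup>1\<close>, so its increments are integrals of the time derivative.
\<close>

lemma weak_solution_trajectory:
 fixes S :: "'a::euclidean_space set" and T :: real
 assumes S: "open S" "S \<in> lmeasurable" and sol: "weak_solution S J m F u \<phi>0 T \<phi>"
 obtains c \<phi>t where
  "!!t. t \<in> {0..T} ==> c t \<in> L2_space (lebesgue_on S)"
  "!!t. t \<in> {0..T} ==> ((%s. L2_norm_on (lebesgue_on S) (%x. c s x - c t x)) \<longlongrightarrow> 0) (at t within {0..T})"
  "AE x in lebesgue_on S. c 0 x = \<phi>0 x"
  "AE r in lebesgue_on {0<..<T}. \<phi> r \<in> H1 S \<and> (AE x in lebesgue_on S. \<bar>\<phi> r x\<bar> <= 1) \<and> (AE x in lebesgue_on S. \<phi> r x = c r x)"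
  "\<phi>t \<in> bochner_L2 (lebesgue_on {0<..<T}) (H1_dual S) (H1_dual_norm S)"
  "!!V s t. V \<in> H1_graph S ==> 0 <= s ==> s <= t ==> t <= T ==>
   L2_inner (lebesgue_on S) (%x. c t x - c s x) (%x. fst (V x)) =
   (\<integral>r. indicator {s..t} r * (indicator {0<..<T} r * \<phi>t r (%x. fst (V x))) \<partial>lebesgue)"
  "!!\<psi>. \<psi> \<in> H1 S ==> AE t in lebesgue_on {0<..<T}. weak_balance S J m F (\<phi> t) (u t) (\<phi>t t \<psi>) \<psi>"
proof -
 let ?M = "lebesgue_on S" and ?I = "lebesgue_on {0<..<T}"
 have I: "{0<..<T} \<in> sets lebesgue" by simp
 have mem: "AE t in ?I. \<phi> t \<in> H1 S"
  using sol by (simp add: weak_solution_def bochner_L2_def strongly_measurable_def)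
 have bound: "AE t in ?I. AE x in ?M. \<bar>\<phi> t x\<bar> <= 1"
 proof -
  have "AE z in lebesgue_on ({0<..<T} \<times> S). case z of (t, x) => \<bar>\<phi> t x\<bar> <= 1"
   using sol by (simp add: weak_solution_def)
  from AE_lebesgue_product_slices[OF open_greaterThanLessThan S(1) this] show ?thesis by simp
 qed
 obtain c where c: "!!t. t \<in> {0..T} ==> c t \<in> L2_space ?M"
  "!!t. t \<in> {0..T} ==> ((%s. L2_norm_on ?M (c s - c t)) \<longlongrightarrow> 0) (at t within {0..T})"
  "AE t in ?I. AE x in ?M. \<phi> t x = c t x" "AE x in ?M. c 0 x = \<phi>0 x"
 proof -
  have "has_initial_value S T \<phi> \<phi>0" using sol by (simp add: weak_solution_def)
  then show thesis unfolding has_initial_value_def using that by blast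
 qed
 have slices: "AE r in ?I. \<phi> r \<in> H1 S \<and> (AE x in ?M. \<bar>\<phi> r x\<bar> <= 1) \<and> (AE x in ?M. \<phi> r x = c r x)"
  using mem bound c(3) by eventually_elim blast
 have c_cont: "((%s. L2_norm_on ?M (%x. c s x - c t x)) \<longlongrightarrow> 0) (at t within {0..T})" if "t \<in> {0..T}" for t
  using c(2)[OF that] unfolding fun_diff_def .
 obtain \<phi>t where \<phi>t: "\<phi>t \<in> bochner_L2 ?I (H1_dual S) (H1_dual_norm S)" "has_weak_time_derivative S T \<phi> \<phi>t"
  "\<forall>\<psi>\<in>H1 S. AE t in ?I. weak_balance S J m F (\<phi> t) (u t) (\<phi>t t \<psi>) \<psi>"
  using sol unfolding weak_solution_def weak_balance_def by (elim conjE bexE)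
 have incr: "L2_inner ?M (%x. c t x - c s x) (%x. fst (V x)) =
   (\<integral>r. indicator {s..t} r * (indicator {0<..<T} r * \<phi>t r (%x. fst (V x))) \<partial>lebesgue)"
  if V: "V \<in> H1_graph S" and st: "0 <= s" "s <= t" "t <= T" for V s t
 proof -
  let ?\<psi> = "%x. fst (V x)"
  have \<psi>: "?\<psi> \<in> H1 S" "?\<psi> \<in> L2_space ?M"
   using H1_graph_fst(1)[OF S(1) V] L2_fst_snd(1)[OF H1_graphD(1)[OF V]] by simp_all
  define f where "f r = L2_inner ?M (c r) ?\<psi>" for r
  have f_diff: "L2_inner ?M (%x. c r x - c q x) ?\<psi> = f r - f q" if "r \<in> {0..T}" "q \<in> {0..T}" for r q
   unfolding f_def by (rule L2_inner_diff_left[OF c(1)[OF that(1)] c(1)[OF that(2)] \<psi>(2)])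
  have cf: "continuous_on {0..T} f"
   unfolding continuous_on_def
  proof
   fix q assume q: "q \<in> {0..T}"
   have b: "\<bar>f r - f q\<bar> <= L2_norm_on ?M (%x. c r x - c q x) * L2_norm_on ?M ?\<psi>" if "r \<in> {0..T}" for r
    using L2_Cauchy_Schwarz[OF L2_diff[OF c(1)[OF that] c(1)[OF q]] \<psi>(2)] unfolding f_diff[OF that q] .
   have "((%r. L2_norm_on ?M (%x. c r x - c q x) * L2_norm_on ?M ?\<psi>) \<longlongrightarrow> 0) (at q within {0..T})"
    using tendsto_mult_right[OF c_cont[OF q], of "L2_norm_on ?M ?\<psi>"] by simp
   then have "((%r. f r - f q) \<longlongrightarrow> 0) (at q within {0..T})"
    by (rule Lim_null_comparison[rotated]) (use b in \<open>auto simp: eventually_at_filter\<close>)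
   then show "(f \<longlongrightarrow> f q) (at q within {0..T})" by (rule LIM_zero_cancel)
  qed
  have f_AE: "AE r in ?I. f r = (\<integral>x. \<phi> r x * ?\<psi> x \<partial>?M)"
   using slices AE_space
  proof eventually_elim
   case (elim r)
   then have r: "r \<in> {0..T}" by simp
   have [measurable]: "c r \<in> borel_measurable ?M" "\<phi> r \<in> borel_measurable ?M" "?\<psi> \<in> borel_measurable ?M"
    using L2_spaceD(1)[OF c(1)[OF r]] L2_spaceD(1)[OF \<psi>(2)] L2_spaceD(1)[OF H1_weak_gradient(1)[OF S(1)]] elim(1) by blast+
   have "(\<integral>x. c r x * ?\<psi> x \<partial>?M) = (\<integral>x. \<phi> r x * ?\<psi> x \<partial>?M)"
   proof (rule integral_cong_AE)
    have "AE x in ?M. \<phi> r x = c r x" using elim(1) by blast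
    then show "AE x in ?M. c r x * ?\<psi> x = \<phi> r x * ?\<psi> x" by (rule eventually_mono) simp
   qed measurable
   then show ?case by (simp add: f_def L2_inner_def)
  qed
  have "f t - f s = (\<integral>r. indicator {s..t} r * (indicator {0<..<T} r * \<phi>t r ?\<psi>) \<partial>lebesgue)"
  proof (rule weak_derivative_imp_integral[OF cf dual_path_integrable(3)[OF S(1) \<phi>t(1) V] _ st])
   fix \<eta> :: "real => real" assume \<eta>: "\<eta> \<in> test_functions {0<..<T}"
   obtain \<eta>' where \<eta>': "!!x. GDERIV \<eta> x :> \<eta>' x" "continuous_on UNIV \<eta>'"
    by (rule test_functionsE[OF \<eta>]) blast
   have "deriv \<eta> x = \<eta>' x" for x
    using \<eta>'(1)[of x] by (intro DERIV_imp_deriv) (simp add: gderiv_def has_field_derivative_def mult.commute)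
   then have d\<eta>: "deriv \<eta> = \<eta>'" by blast
   have fm: "(%r. f r * deriv \<eta> r) \<in> borel_measurable ?I"
   proof (rule borel_measurable_times)
    show "f \<in> borel_measurable ?I"
     by (rule continuous_imp_measurable_on_sets_lebesgue[OF continuous_on_subset[OF cf] I]) auto
    show "deriv \<eta> \<in> borel_measurable ?I"
     unfolding d\<eta> by (rule continuous_imp_measurable_on_sets_lebesgue[OF continuous_on_subset[OF \<eta>'(2)] I]) auto
   qed
   have eq: "AE r in ?I. f r * deriv \<eta> r = (\<integral>x. \<phi> r x * ?\<psi> x \<partial>?M) * deriv \<eta> r"
    using f_AE by (rule eventually_mono) simp
   have "(\<integral>r. f r * deriv \<eta> r \<partial>?I) = (\<integral>r. (\<integral>x. \<phi> r x * ?\<psi> x \<partial>?M) * deriv \<eta> r \<partial>?I)"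
    by (rule integral_cong_AE[OF fm borel_measurable_lebesgue_on_AE[OF I fm eq] eq])
   also have "\<dots> = - (\<integral>r. \<phi>t r ?\<psi> * \<eta> r \<partial>?I)"
    by (rule \<phi>t(2)[unfolded has_weak_time_derivative_def, rule_format, OF \<eta> \<psi>(1)])
   finally show "(\<integral>r. f r * deriv \<eta> r \<partial>?I) = - (\<integral>r. \<phi>t r ?\<psi> * \<eta> r \<partial>?I)" .
  qed
  then show ?thesis using f_diff[of t s] st by simp
 qed
 show thesis by (rule that[OF c(1) c_cont c(4) slices \<phi>t(1) incr bspec[OF \<phi>t(3)]])
qed

lemma velocity_bound:
 fixes S :: "'a::euclidean_space set" and T :: real
 assumes u: "u \<in> bochner_L2 (lebesgue_on {0<..<T}) (V_div S \<inter> Linf_space (lebesgue_on S))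
   (%v. V_div_norm S v + Linf_norm_on (lebesgue_on S) v)"
 obtains N :: "real => real" where "!!r. 0 <= N r" "integrable (lebesgue_on {0<..<T}) (%r. (N r)\<^sup>2)"
  "AE r in lebesgue_on {0<..<T}. u r \<in> borel_measurable (lebesgue_on S) \<and> (AE x in lebesgue_on S. norm (u r x) <= N r)"
proof -
 let ?N = "%r. \<bar>V_div_norm S (u r) + Linf_norm_on (lebesgue_on S) (u r)\<bar>"
 have u': "AE r in lebesgue_on {0<..<T}. u r \<in> V_div S \<inter> Linf_space (lebesgue_on S)"
  "(%r. V_div_norm S (u r) + Linf_norm_on (lebesgue_on S) (u r)) \<in> L2_space (lebesgue_on {0<..<T})"
  using u by (auto simp: bochner_L2_def strongly_measurable_def)
 show thesis
 proof (rule that[of ?N])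
  show "integrable (lebesgue_on {0<..<T}) (%r. (?N r)\<^sup>2)" using L2_spaceD(2)[OF u'(2)] by simp
  show "AE r in lebesgue_on {0<..<T}. u r \<in> borel_measurable (lebesgue_on S) \<and> (AE x in lebesgue_on S. norm (u r x) <= ?N r)"
   using u'(1)
  proof eventually_elim
   case (elim r)
   then have L: "u r \<in> Linf_space (lebesgue_on S)" by blast
   have "0 <= V_div_norm S (u r)" unfolding V_div_norm_def by (simp add: sum_nonneg)
   then have "AE x in lebesgue_on S. norm (u r x) <= ?N r"
    using Linf_norm_AE[OF L] by (auto elim!: eventually_mono)
   moreover have "u r \<in> borel_measurable (lebesgue_on S)" using L by (simp add: Linf_space_def)
   ultimately show ?case by blast
  qed
 qed simp
qed

locale convective_flux = nonlocal_flux S "kernel_mass S J" "weak_gradient S (kernel_mass S J)"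
  "limit_ext (%s. m s * deriv2_on {-1<..<1} F s)" m \<Lambda> \<Gamma> C \<kappa>
 for S :: "'a::euclidean_space set" and J m F \<Lambda> \<Gamma> C \<kappa> +
 fixes u :: "real => 'a => 'a" and N :: "real => real" and T :: real
 assumes conv: "!!f. f \<in> borel_measurable (lebesgue_on S) ==> AE y in lebesgue_on S. \<bar>f y\<bar> <= 2 ==>
   gradient_conv S J f \<in> borel_measurable (lebesgue_on S) \<and>
   L2_norm_on (lebesgue_on S) (gradient_conv S J f) <= C * L2_norm_on (lebesgue_on S) f \<and>
   (\<forall>x\<in>S. norm (gradient_conv S J f x) <= C)"
  and conv_diff: "!!f g x. f \<in> borel_measurable (lebesgue_on S) ==> AE y in lebesgue_on S. \<bar>f y\<bar> <= 2 ==>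
   g \<in> borel_measurable (lebesgue_on S) ==> AE y in lebesgue_on S. \<bar>g y\<bar> <= 2 ==> x \<in> S ==>
   gradient_conv S J (%y. f y - g y) x = gradient_conv S J f x - gradient_conv S J g x"
  and N: "!!r. 0 <= N r" "integrable (lebesgue_on {0<..<T}) (%r. (N r)\<^sup>2)"
  and u: "AE r in lebesgue_on {0<..<T}. u r \<in> borel_measurable (lebesgue_on S) \<and> (AE x in lebesgue_on S. norm (u r x) <= N r)"
  and T: "0 < T"
begin

definition total_flux :: "('a => real) => ('a => 'a) => 'a => 'a" where
 "total_flux p w = flux p (weak_gradient S p) (gradient_conv S J p) w"

lemma gradient_conv_bound:
 assumes p: "p \<in> borel_measurable (lebesgue_on S)" "AE x in lebesgue_on S. \<bar>p x\<bar> <= 1"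
 shows "gradient_conv S J p \<in> borel_measurable (lebesgue_on S)" "AE x in lebesgue_on S. norm (gradient_conv S J p x) <= C"
proof -
 have "AE x in lebesgue_on S. \<bar>p x\<bar> <= 2" using p(2) by (rule eventually_mono) simp
 note cp = conv[OF p(1) this]
 show "gradient_conv S J p \<in> borel_measurable (lebesgue_on S)" using cp by blast
 show "AE x in lebesgue_on S. norm (gradient_conv S J p x) <= C" by (rule AE_I2) (use cp in simp)
qed

lemma weak_equation_flux:
 fixes R :: "real => 'a => real \<times> 'a"
 assumes slices: "AE r in lebesgue_on {0<..<T}. \<phi> r \<in> H1 S \<and> (AE x in lebesgue_on S. \<bar>\<phi> r x\<bar> <= 1) \<and> (AE x in lebesgue_on S. \<phi> r x = c r x)"
  and Q: "countable Q" "!!q. q \<in> Q ==> R q \<in> H1_graph S"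
  and weq: "!!\<psi>. \<psi> \<in> H1 S ==> AE t in lebesgue_on {0<..<T}. weak_balance S J m F (\<phi> t) (u t) (\<phi>t t \<psi>) \<psi>"
 shows "AE r in lebesgue_on {0<..<T}. total_flux (\<phi> r) (u r) \<in> L2_space (lebesgue_on S) \<and>
  (\<forall>q\<in>Q. \<phi>t r (%x. fst (R q x)) = - L2_inner (lebesgue_on S) (total_flux (\<phi> r) (u r)) (%x. snd (R q x)))"
proof -
 let ?\<psi> = "%q x. fst (R q x)"
 have "AE t in lebesgue_on {0<..<T}. \<forall>q\<in>Q. weak_balance S J m F (\<phi> t) (u t) (\<phi>t t (?\<psi> q)) (?\<psi> q)"
  unfolding AE_ball_countable[OF Q(1)]
 proof
  fix q assume "q \<in> Q"
  from weq[OF H1_graph_fst(1)[OF S(1) Q(2)[OF this]]] show "AE t in lebesgue_on {0<..<T}. weak_balance S J m F (\<phi> t) (u t) (\<phi>t t (?\<psi> q)) (?\<psi> q)" .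
 qed
 with slices u show ?thesis
 proof eventually_elim
  case (elim r)
  let ?p = "\<phi> r" and ?M = "lebesgue_on S"
  have p: "?p \<in> borel_measurable ?M" "AE x in ?M. \<bar>?p x\<bar> <= 1" and g: "weak_gradient S ?p \<in> L2_space ?M"
   using H1_weak_gradient(1,3)[OF S(1), of ?p] elim(1) L2_spaceD(1) by blast+
  have w: "u r \<in> borel_measurable ?M" "AE x in ?M. norm (u r x) <= N r" using elim(2) by blast+
  note q = gradient_conv_bound[OF p]
  have GL: "total_flux ?p (u r) \<in> L2_space ?M" unfolding total_flux_def by (rule flux_L2[OF p g q w])
  have "\<phi>t r (?\<psi> k) = - L2_inner ?M (total_flux ?p (u r)) (%x. snd (R k x))" if k: "k \<in> Q" for k
  proof -
   note Rk = Q(2)[OF k]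
   have h: "weak_gradient S (?\<psi> k) \<in> L2_space ?M" by (rule H1_weak_gradient(3)[OF S(1) H1_graph_fst(1)[OF S(1) Rk]])
   have "L2_inner ?M (total_flux ?p (u r)) (%x. snd (R k x)) = L2_inner ?M (total_flux ?p (u r)) (weak_gradient S (?\<psi> k))"
    unfolding L2_inner_def
   proof (rule integral_cong_AE)
    show "AE x in ?M. total_flux ?p (u r) x \<bullet> snd (R k x) = total_flux ?p (u r) x \<bullet> weak_gradient S (?\<psi> k) x"
     using H1_graph_fst(2)[OF S(1) Rk] by (rule eventually_mono) simp
   qed (intro borel_measurable_inner L2_spaceD(1) GL h L2_fst_snd(2)[OF H1_graphD(1)[OF Rk]])+
   moreover note flux_pairing[OF p g q w h, folded total_flux_def]
   moreover note bspec[OF elim(3) k, unfolded weak_balance_def]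
   ultimately show ?thesis by linarith
  qed
  with GL show ?case by blast
 qed
qed

end

context convective_flux
begin

lemma total_flux_energy_estimate:
 assumes p1: "p1 \<in> H1 S" "AE x in lebesgue_on S. \<bar>p1 x\<bar> <= 1"
  and p2: "p2 \<in> H1 S" "AE x in lebesgue_on S. \<bar>p2 x\<bar> <= 1"
  and w: "w \<in> borel_measurable (lebesgue_on S)" "AE x in lebesgue_on S. norm (w x) <= U" "0 <= U"
  and f: "f \<in> L2_space (lebesgue_on S)" "AE x in lebesgue_on S. f x = p1 x - p2 x"
 shows "- L2_inner (lebesgue_on S) (%x. total_flux p1 w x - total_flux p2 w x) (%x. snd (riesz_graph S f x))
  <= (1 + (C + 6 * C\<^sup>2)\<^sup>2) / (2 * \<kappa>) * (1 + U\<^sup>2) * dual_energy S f"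
proof -
 let ?M = "lebesgue_on S"
 note d1 = H1_weak_gradient[OF S(1) p1(1)] and d2 = H1_weak_gradient[OF S(1) p2(1)]
 note m1 = L2_spaceD(1)[OF d1(1)] and m2 = L2_spaceD(1)[OF d2(1)]
 note q1 = gradient_conv_bound[OF m1 p1(2)] and q2 = gradient_conv_bound[OF m2 p2(2)]
 have b1: "AE x in ?M. \<bar>p1 x\<bar> <= 2" using p1(2) by (rule eventually_mono) simp
 have b2: "AE x in ?M. \<bar>p2 x\<bar> <= 2" using p2(2) by (rule eventually_mono) simp
 have b: "AE x in ?M. \<bar>p1 x - p2 x\<bar> <= 2" using p1(2) p2(2) by eventually_elim simp
 have m12: "(%x. p1 x - p2 x) \<in> borel_measurable ?M" using m1 m2 by simp
 note c12 = conv[OF m12 b]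
 have "L2_norm_on ?M (%x. gradient_conv S J p1 x - gradient_conv S J p2 x) = L2_norm_on ?M (gradient_conv S J (%x. p1 x - p2 x))"
 proof (rule L2_norm_cong_AE)
  show "(%x. gradient_conv S J p1 x - gradient_conv S J p2 x) \<in> borel_measurable ?M" using q1(1) q2(1) by simp
  show "gradient_conv S J (%x. p1 x - p2 x) \<in> borel_measurable ?M" using c12 by blast
  show "AE x in ?M. gradient_conv S J p1 x - gradient_conv S J p2 x = gradient_conv S J (%x. p1 x - p2 x) x"
   by (rule AE_I2) (simp add: conv_diff[OF m1 b1 m2 b2])
 qed
 then have q: "L2_norm_on ?M (%x. gradient_conv S J p1 x - gradient_conv S J p2 x) <= C * L2_norm_on ?M (%x. p1 x - p2 x)"
  using c12 by simp
 have R: "L2_inner ?M (riesz_graph S f) W = L2_inner ?M (%x. p1 x - p2 x) (%x. fst (W x))" if W: "W \<in> H1_graph S" for W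
 proof -
  have Wm: "(%x. fst (W x)) \<in> borel_measurable ?M" by (rule L2_spaceD(1)[OF L2_fst_snd(1)[OF H1_graphD(1)[OF W]]])
  have "L2_inner ?M f (%x. fst (W x)) = L2_inner ?M (%x. p1 x - p2 x) (%x. fst (W x))"
   unfolding L2_inner_def
  proof (rule integral_cong_AE)
   show "AE x in ?M. f x \<bullet> fst (W x) = (p1 x - p2 x) \<bullet> fst (W x)" using f(2) by (rule eventually_mono) simp
  qed (intro borel_measurable_inner L2_spaceD(1)[OF f(1)] m12 Wm)+
  then show ?thesis using riesz_graph(2)[OF S f(1) W] by simp
 qed
 show ?thesis
  unfolding total_flux_def dual_energy_def
  by (rule energy_estimate[OF m1 p1(2) m2 p2(2) d1(3,2) d2(3,2) q1 q2 q w riesz_graph(1)[OF S f(1)] R])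
qed

text \<open>
  The difference of the continuous representatives vanishes at time \<open>0\<close>, and the static estimate
  bounds the rate of its dual energy with the coefficient \<open>K\<close>, which is integrable because the
  velocity is square integrable in time with values in \<open>L\<^sup>\<infinity>\<close>.
\<close>

theorem weak_solution_unique:
 assumes sol1: "weak_solution S J m F u \<phi>0 T \<phi>1" and sol2: "weak_solution S J m F u \<phi>0 T \<phi>2"
 shows "AE (t, x) in lebesgue_on ({0<..<T} \<times> S). \<phi>1 t x = \<phi>2 t x"
proof -
 let ?M = "lebesgue_on S" and ?I = "lebesgue_on {0<..<T}" and ?i = "%r. indicator {0<..<T} r :: real"
 have I: "{0<..<T} \<in> sets lebesgue" by simp
 obtain c1 l1 where
  c1: "!!t. t \<in> {0..T} ==> c1 t \<in> L2_space ?M"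
   "!!t. t \<in> {0..T} ==> ((%s. L2_norm_on ?M (%x. c1 s x - c1 t x)) \<longlongrightarrow> 0) (at t within {0..T})"
   "AE x in ?M. c1 0 x = \<phi>0 x" and
  s1: "AE r in ?I. \<phi>1 r \<in> H1 S \<and> (AE x in ?M. \<bar>\<phi>1 r x\<bar> <= 1) \<and> (AE x in ?M. \<phi>1 r x = c1 r x)" and
  l1: "l1 \<in> bochner_L2 ?I (H1_dual S) (H1_dual_norm S)" and
  i1: "!!V s t. V \<in> H1_graph S ==> 0 <= s ==> s <= t ==> t <= T ==>
   L2_inner ?M (%x. c1 t x - c1 s x) (%x. fst (V x)) =
   (\<integral>r. indicator {s..t} r * (?i r * l1 r (%x. fst (V x))) \<partial>lebesgue)" and
  e1: "!!Q R. countable Q ==> (!!q::real. q \<in> Q ==> R q \<in> H1_graph S) ==>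
   AE r in ?I. total_flux (\<phi>1 r) (u r) \<in> L2_space ?M \<and>
   (\<forall>q\<in>Q. l1 r (%x. fst (R q x)) = - L2_inner ?M (total_flux (\<phi>1 r) (u r)) (%x. snd (R q x)))"
  by (rule weak_solution_trajectory[OF S sol1]) (rule that; (assumption | (rule weak_equation_flux; assumption)))
 obtain c2 l2 where
  c2: "!!t. t \<in> {0..T} ==> c2 t \<in> L2_space ?M"
   "!!t. t \<in> {0..T} ==> ((%s. L2_norm_on ?M (%x. c2 s x - c2 t x)) \<longlongrightarrow> 0) (at t within {0..T})"
   "AE x in ?M. c2 0 x = \<phi>0 x" and
  s2: "AE r in ?I. \<phi>2 r \<in> H1 S \<and> (AE x in ?M. \<bar>\<phi>2 r x\<bar> <= 1) \<and> (AE x in ?M. \<phi>2 r x = c2 r x)" and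
  l2: "l2 \<in> bochner_L2 ?I (H1_dual S) (H1_dual_norm S)" and
  i2: "!!V s t. V \<in> H1_graph S ==> 0 <= s ==> s <= t ==> t <= T ==>
   L2_inner ?M (%x. c2 t x - c2 s x) (%x. fst (V x)) =
   (\<integral>r. indicator {s..t} r * (?i r * l2 r (%x. fst (V x))) \<partial>lebesgue)" and
  e2: "!!Q R. countable Q ==> (!!q::real. q \<in> Q ==> R q \<in> H1_graph S) ==>
   AE r in ?I. total_flux (\<phi>2 r) (u r) \<in> L2_space ?M \<and>
   (\<forall>q\<in>Q. l2 r (%x. fst (R q x)) = - L2_inner ?M (total_flux (\<phi>2 r) (u r)) (%x. snd (R q x)))"
  by (rule weak_solution_trajectory[OF S sol2]) (rule that; (assumption | (rule weak_equation_flux; assumption)))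
 define c where "c t x = c1 t x - c2 t x" for t x
 have cL: "c t \<in> L2_space ?M" if "t \<in> {0..T}" for t
  unfolding c_def[abs_def] by (rule L2_diff[OF c1(1)[OF that] c2(1)[OF that]])
 have c_cont: "((%s. L2_norm_on ?M (%x. c s x - c t x)) \<longlongrightarrow> 0) (at t within {0..T})" if t: "t \<in> {0..T}" for t
 proof -
  have b: "L2_norm_on ?M (%x. c s x - c t x) <= L2_norm_on ?M (%x. c1 s x - c1 t x) + L2_norm_on ?M (%x. c2 s x - c2 t x)"
   if s: "s \<in> {0..T}" for s
  proof -
   have "(%x. c s x - c t x) = (%x. (c1 s x - c1 t x) + (c2 t x - c2 s x))" by (simp add: c_def fun_eq_iff)
   then show ?thesis
    using L2_norm_add_le[OF L2_diff[OF c1(1)[OF s] c1(1)[OF t]] L2_diff[OF c2(1)[OF t] c2(1)[OF s]]]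
     L2_norm_diff_commute[of ?M "c2 t" "c2 s"] by simp
  qed
  have "((%s. L2_norm_on ?M (%x. c1 s x - c1 t x) + L2_norm_on ?M (%x. c2 s x - c2 t x)) \<longlongrightarrow> 0) (at t within {0..T})"
   using tendsto_add[OF c1(2)[OF t] c2(2)[OF t]] by simp
  then show ?thesis
   by (rule Lim_null_comparison[rotated]) (use b in \<open>auto simp: eventually_at_filter abs_of_nonneg[OF L2_norm_nonneg]\<close>)
 qed
 define W where "W r V = ?i r * (l1 r (%x. fst (V x)) - l2 r (%x. fst (V x)))" for r and V :: "'a => real \<times> 'a"
 define D where "D r = ?i r * (H1_dual_norm S (l1 r) + H1_dual_norm S (l2 r))" for r
 define K0 where "K0 = (1 + (C + 6 * C\<^sup>2)\<^sup>2) / (2 * \<kappa>)"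
 define K where "K r = ?i r * (K0 * (1 + (N r)\<^sup>2))" for r
 have K0: "0 <= K0" using \<kappa> by (simp add: K0_def)
 note j1 = dual_path_integrable[OF S(1) l1] and j2 = dual_path_integrable[OF S(1) l2]
 interpret finite_measure ?I by (rule finite_measure_lebesgue_on) (rule lmeasurable_interval)
 interpret E: dual_evolution S T c W D K
 proof
  show "integrable lebesgue D"
   using Bochner_Integration.integrable_add[OF j1(2) j2(2)] unfolding integral_lebesgue_on_indicator(2)[OF I] D_def[abs_def] by simp
  show "integrable lebesgue K"
  proof -
   have "integrable ?I (%r. K0 * (1 + (N r)\<^sup>2))"
    by (intro integrable_mult_right Bochner_Integration.integrable_add N(2)) simp
   then show ?thesis unfolding integral_lebesgue_on_indicator(2)[OF I] K_def[abs_def] by simp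
  qed
  show "0 <= K r" for r using K0 by (simp add: K_def)
  fix V assume V: "V \<in> H1_graph S"
  note k1 = j1(3)[OF V, unfolded integral_lebesgue_on_indicator(2)[OF I], unfolded real_scaleR_def]
   and k2 = j2(3)[OF V, unfolded integral_lebesgue_on_indicator(2)[OF I], unfolded real_scaleR_def]
  show "integrable lebesgue (%r. W r V)"
   using Bochner_Integration.integrable_diff[OF k1 k2] by (simp add: W_def right_diff_distrib)
  fix s t :: real assume st: "0 <= s" "s <= t" "t <= T"
  then have m: "s \<in> {0..T}" "t \<in> {0..T}" by auto
  have "L2_inner ?M (%x. c t x - c s x) (%x. fst (V x)) =
   L2_inner ?M (%x. (c1 t x - c1 s x) - (c2 t x - c2 s x)) (%x. fst (V x))"
   by (simp add: c_def algebra_simps)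
  also have "\<dots> = L2_inner ?M (%x. c1 t x - c1 s x) (%x. fst (V x)) - L2_inner ?M (%x. c2 t x - c2 s x) (%x. fst (V x))"
   by (rule L2_inner_diff_left[OF L2_diff[OF c1(1)[OF m(2)] c1(1)[OF m(1)]] L2_diff[OF c2(1)[OF m(2)] c2(1)[OF m(1)]]
    L2_fst_snd(1)[OF H1_graphD(1)[OF V]]])
  also have "\<dots> = (\<integral>r. indicator {s..t} r * (?i r * l1 r (%x. fst (V x))) - indicator {s..t} r * (?i r * l2 r (%x. fst (V x))) \<partial>lebesgue)"
   unfolding i1[OF V st] i2[OF V st]
   by (rule Bochner_Integration.integral_diff[OF integrable_indicator_Icc[OF k1] integrable_indicator_Icc[OF k2], symmetric])
  also have "\<dots> = (\<integral>r. indicator {s..t} r * W r V \<partial>lebesgue)"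
   by (intro Bochner_Integration.integral_cong refl) (simp add: W_def algebra_simps)
  finally show "L2_inner ?M (%x. c t x - c s x) (%x. fst (V x)) = (\<integral>r. indicator {s..t} r * W r V \<partial>lebesgue)" .
 next
  show "AE r in lebesgue. \<forall>V\<in>H1_graph S. \<forall>V'\<in>H1_graph S. W r V - W r V' <= D r * L2_norm_on ?M (%x. V x - V' x)"
   using j1(1)[unfolded AE_lebesgue_on_iff[OF I]] j2(1)[unfolded AE_lebesgue_on_iff[OF I]]
  proof eventually_elim
   case (elim r)
   show ?case
   proof (cases "r \<in> {0<..<T}")
    case True
    show ?thesis
    proof (intro ballI)
     fix V V' assume V: "V \<in> H1_graph S" "V' \<in> H1_graph S"
     show "W r V - W r V' <= D r * L2_norm_on ?M (%x. V x - V' x)"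
      using H1_dual_lipschitz[OF S(1) elim(1)[rule_format, OF True] V] H1_dual_lipschitz[OF S(1) elim(2)[rule_format, OF True] V] True
      by (simp add: W_def D_def distrib_right)
    qed
   qed (simp add: W_def D_def)
  qed
  show "AE r in lebesgue. 0 <= D r"
   using j1(1)[unfolded AE_lebesgue_on_iff[OF I]] j2(1)[unfolded AE_lebesgue_on_iff[OF I]]
  proof eventually_elim
   case (elim r)
   show ?case
   proof (cases "r \<in> {0<..<T}")
    case True
    then show ?thesis using H1_dual_norm_nonneg[OF S, of "l1 r"] H1_dual_norm_nonneg[OF S, of "l2 r"] elim by (simp add: D_def)
   qed (simp add: D_def)
  qed
  have cQ: "countable (\<rat> \<inter> {0..T})" by (intro countable_Int1 countable_rat)
  have RQ: "riesz_graph S (c q) \<in> H1_graph S" if "q \<in> \<rat> \<inter> {0..T}" for q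
   by (rule riesz_graph(1)[OF S cL]) (use that in blast)
  have E1: "AE r in ?I. total_flux (\<phi>1 r) (u r) \<in> L2_space ?M \<and>
   (\<forall>q\<in>\<rat> \<inter> {0..T}. l1 r (%x. fst (riesz_graph S (c q) x)) =
    - L2_inner ?M (total_flux (\<phi>1 r) (u r)) (%x. snd (riesz_graph S (c q) x)))"
   by (rule e1[OF cQ RQ])
  have E2: "AE r in ?I. total_flux (\<phi>2 r) (u r) \<in> L2_space ?M \<and>
   (\<forall>q\<in>\<rat> \<inter> {0..T}. l2 r (%x. fst (riesz_graph S (c q) x)) =
    - L2_inner ?M (total_flux (\<phi>2 r) (u r)) (%x. snd (riesz_graph S (c q) x)))"
   by (rule e2[OF cQ RQ])
  have "AE r in ?I. W r (riesz_graph S (c r)) <= K r * dual_energy S (c r)"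
   using s1 s2 j1(1) j2(1) E1 E2 u AE_space
  proof eventually_elim
   case (elim r)
   then have r: "r \<in> {0<..<T}" "r \<in> {0..T}" by auto
   let ?R = "riesz_graph S (c r)"
   let ?G1 = "total_flux (\<phi>1 r) (u r)" and ?G2 = "total_flux (\<phi>2 r) (u r)"
   have G: "?G1 \<in> L2_space ?M" "?G2 \<in> L2_space ?M" using elim(5,6) by blast+
   have x1: "l1 r (%x. fst (?R x)) = - L2_inner ?M ?G1 (%x. snd (?R x))"
    by (rule dual_equation_extends[OF S elim(3) G(1) cL c_cont[OF r(2)] r(1)]) (use elim(5) in blast)+
   have x2: "l2 r (%x. fst (?R x)) = - L2_inner ?M ?G2 (%x. snd (?R x))"
    by (rule dual_equation_extends[OF S elim(4) G(2) cL c_cont[OF r(2)] r(1)]) (use elim(6) in blast)+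
   have "W r ?R = - L2_inner ?M (%x. ?G1 x - ?G2 x) (%x. snd (?R x))"
    using L2_inner_diff_left[OF G L2_fst_snd(2)[OF H1_graphD(1)[OF riesz_graph(1)[OF S cL[OF r(2)]]]]] r(1) x1 x2
    by (simp add: W_def)
   also have "\<dots> <= (1 + (C + 6 * C\<^sup>2)\<^sup>2) / (2 * \<kappa>) * (1 + (N r)\<^sup>2) * dual_energy S (c r)"
   proof (rule total_flux_energy_estimate)
    show "AE x in ?M. c r x = \<phi>1 r x - \<phi>2 r x"
    proof -
     have "AE x in ?M. \<phi>1 r x = c1 r x" "AE x in ?M. \<phi>2 r x = c2 r x" using elim(1,2) by blast+
     then show ?thesis by eventually_elim (simp add: c_def)
    qed
    show "c r \<in> L2_space ?M" by (rule cL[OF r(2)])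
    show "0 <= N r" by (rule N(1))
   qed (use elim(1,2,7) in blast)+
   also have "\<dots> = K r * dual_energy S (c r)" using r(1) by (simp add: K_def K0_def)
   finally show ?case .
  qed
  then have "AE r in lebesgue. r \<in> {0<..<T} --> W r (riesz_graph S (c r)) <= K r * dual_energy S (c r)"
   unfolding AE_lebesgue_on_iff[OF I] .
  then show "AE r in lebesgue. r \<in> {0..T} --> W r (riesz_graph S (c r)) <= K r * dual_energy S (c r)"
  proof (rule eventually_mono)
   fix r assume h: "r \<in> {0<..<T} --> W r (riesz_graph S (c r)) <= K r * dual_energy S (c r)"
   show "r \<in> {0..T} --> W r (riesz_graph S (c r)) <= K r * dual_energy S (c r)"
    using h by (cases "r \<in> {0<..<T}") (simp_all add: W_def K_def)
  qed
 qed (use S cL c_cont in blast)+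
 have c0: "AE x in ?M. c 0 x = 0" using c1(3) c2(3) by eventually_elim (simp add: c_def)
 have "AE t in ?I. AE x in ?M. \<phi>1 t x - \<phi>2 t x = 0"
  using s1 s2 AE_space
 proof eventually_elim
  case (elim t)
  then have "t \<in> {0..T}" by simp
  from E.vanishes[OF less_imp_le[OF T] c0 this] have "AE x in ?M. c t x = 0" .
  moreover have "AE x in ?M. \<phi>1 t x = c1 t x" "AE x in ?M. \<phi>2 t x = c2 t x" using elim(1,2) by blast+
  ultimately show ?case by eventually_elim (simp add: c_def)
 qed
 moreover have "(%z. (case z of (t, x) => \<phi>1 t x) - (case z of (t, x) => \<phi>2 t x)) \<in> borel_measurable (lebesgue_on ({0<..<T} \<times> S))"
  using sol1 sol2 by (intro borel_measurable_diff) (simp_all add: weak_solution_def Linf_space_def)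
 ultimately have "AE z in lebesgue_on ({0<..<T} \<times> S). (case z of (t, x) => \<phi>1 t x) - (case z of (t, x) => \<phi>2 t x) = 0"
  by (intro AE_lebesgue_product_zero[OF open_greaterThanLessThan S(1)]) simp_all
 then show ?thesis by (rule eventually_mono) auto
qed

end

theorem proposition4:
  fixes \<Omega> :: "'a::euclidean_space set"
    and J :: "'a \<Rightarrow> real"
    and m F F1 F2 M :: "real \<Rightarrow> real"
    and u :: "real \<Rightarrow> 'a \<Rightarrow> 'a"
    and \<phi>0 :: "'a \<Rightarrow> real"
    and \<alpha>0 \<rho> T :: real
  assumes dim: "DIM('a) = 2 \<or> DIM('a) = 3"
    and domain: "open \<Omega>" "connected \<Omega>" "bounded \<Omega>" "\<Omega> \<noteq> {}" "C11_boundary \<Omega>"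
    and H2: "admissible_kernel \<Omega> J"
    and mobility: "C1_on {-1..1} m" "\<forall>s\<in>{-1..1}. 0 \<le> m s"
      "\<forall>s\<in>{-1..1}. m s = 0 \<longleftrightarrow> s = -1 \<or> s = 1"
    and F_split: "\<forall>s\<in>{-1<..<1}. F s = F1 s + F2 s" "C2_on {-1..1} F2"
    and A1: "C2_on {-1<..<1} F"
      "continuous_on {-1..1} (limit_ext (\<lambda>s. m s * deriv2_on {-1<..<1} F s))"
    and A2: "\<exists>a2 > 4 * (a_upper \<Omega> J - a_lower \<Omega> J - (INF s\<in>{-1..1}. deriv2_on {-1..1} F2 s)).
      \<exists>\<epsilon>0>0. \<forall>s\<in>{-1<..<1}. s \<le> -1 + \<epsilon>0 \<or> 1 - \<epsilon>0 \<le> s \<longrightarrow> a2 \<le> deriv2_on {-1<..<1} F1 s"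
    and A3: "\<exists>\<epsilon>0>0. mono_on {s\<in>{-1<..<1}. 1 - \<epsilon>0 \<le> s} (deriv2_on {-1<..<1} F1) \<and>
      antimono_on {s\<in>{-1<..<1}. s \<le> -1 + \<epsilon>0} (deriv2_on {-1<..<1} F1)"
    and A4: "\<exists>c0>0. AE x in lebesgue_on \<Omega>. \<forall>s\<in>{-1<..<1}.
      c0 \<le> deriv2_on {-1<..<1} F s + kernel_mass \<Omega> J x"
    and entropy: "C2_on {-1<..<1} M" "\<forall>s\<in>{-1<..<1}. m s * deriv2_on {-1<..<1} M s = 1"
      "M 0 = 0" "deriv_on {-1<..<1} M 0 = 0"
    and velocity: "\<forall>\<tau>>0. u \<in> bochner_L2 (lebesgue_on {0<..<\<tau>})
      (V_div \<Omega> \<inter> Linf_space (lebesgue_on \<Omega>))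
      (\<lambda>v. V_div_norm \<Omega> v + Linf_norm_on (lebesgue_on \<Omega>) v)"
    and initial: "\<phi>0 \<in> Linf_space (lebesgue_on \<Omega>)"
      "composition_in_L1 (lebesgue_on \<Omega>) F \<phi>0" "composition_in_L1 (lebesgue_on \<Omega>) M \<phi>0"
    and rho: "0 \<le> \<rho>" "\<rho> < 1"
      "AE x in lebesgue_on \<Omega>. \<forall>s\<in>{-1<..<1}.
        0 \<le> \<rho> * deriv2_on {-1<..<1} F1 s + deriv2_on {-1..1} F2 s + kernel_mass \<Omega> J x"
    and alpha: "0 < \<alpha>0"
      "\<forall>s\<in>{-1..1}. \<alpha>0 \<le> limit_ext (\<lambda>s. m s * deriv2_on {-1<..<1} F1 s) s"
    and T: "0 < T"
  shows "\<forall>\<phi>1 \<phi>2. weak_solution \<Omega> J m F u \<phi>0 T \<phi>1 \<and> weak_solution \<Omega> J m F u \<phi>0 T \<phi>2 \<longrightarrow>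
    (AE (t, x) in lebesgue_on ({0<..<T} \<times> \<Omega>). \<phi>1 t x = \<phi>2 t x)"
proof (intro allI impI)
 fix \<phi>1 \<phi>2 assume sol: "weak_solution \<Omega> J m F u \<phi>0 T \<phi>1 \<and> weak_solution \<Omega> J m F u \<phi>0 T \<phi>2"
 let ?M = "lebesgue_on \<Omega>" and ?a = "kernel_mass \<Omega> J" and ?\<beta> = "limit_ext (%s. m s * deriv2_on {-1<..<1} F s)"
 have S: "open \<Omega>" "\<Omega> \<in> lmeasurable" using domain by (auto intro: lmeasurable_open)
 obtain A where A: "0 < A" "?a \<in> borel_measurable ?M" "!!x. x \<in> \<Omega> ==> \<bar>?a x\<bar> <= A"
  "has_weak_gradient \<Omega> ?a (weak_gradient \<Omega> ?a)" "weak_gradient \<Omega> ?a \<in> borel_measurable ?M"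
  "AE x in ?M. norm (weak_gradient \<Omega> ?a x) <= A"
  "!!f. f \<in> borel_measurable ?M ==> AE y in ?M. \<bar>f y\<bar> <= 2 ==>
   gradient_conv \<Omega> J f \<in> borel_measurable ?M \<and> L2_norm_on ?M (gradient_conv \<Omega> J f) <= A * L2_norm_on ?M f \<and>
   (\<forall>x\<in>\<Omega>. norm (gradient_conv \<Omega> J f x) <= A)"
  "!!f g x. f \<in> borel_measurable ?M ==> AE y in ?M. \<bar>f y\<bar> <= 2 ==>
   g \<in> borel_measurable ?M ==> AE y in ?M. \<bar>g y\<bar> <= 2 ==> x \<in> \<Omega> ==>
   gradient_conv \<Omega> J (%y. f y - g y) x = gradient_conv \<Omega> J f x - gradient_conv \<Omega> J g x"
  by (rule admissible_kernel_estimates[OF S domain(4) H2]) (rule that; assumption)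
 obtain \<Lambda> \<Gamma> B where B: "0 <= B" "continuous_on {-1..1} m"
  "!!s. s \<in> {-1..1} ==> \<bar>?\<beta> s\<bar> <= B" "!!s. s \<in> {-1..1} ==> \<bar>m s\<bar> <= B"
  "!!s s'. s \<in> {-1..1} ==> s' \<in> {-1..1} ==> \<bar>m s - m s'\<bar> <= B * \<bar>s - s'\<bar>"
  "!!s. s \<in> {-1..1} ==> (\<Lambda> has_real_derivative ?\<beta> s) (at s within {-1..1})" "\<Lambda> 0 = 0"
  "!!s. s \<in> {-1..1} ==> (\<Gamma> has_real_derivative m s) (at s within {-1..1})" "\<Gamma> 0 = 0"
  "!!a s s'. \<forall>s\<in>{-1<..<1}. 0 <= \<rho> * deriv2_on {-1<..<1} F1 s + deriv2_on {-1..1} F2 s + a ==>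
   s \<in> {-1..1} ==> s' \<in> {-1..1} ==>
   (1 - \<rho>) * \<alpha>0 * (s - s')\<^sup>2 <= (\<Lambda> s - \<Lambda> s' + a * (\<Gamma> s - \<Gamma> s')) * (s - s')"
  by (rule degenerate_coefficients[OF mobility(1,2) F_split A1 rho(2) alpha(2)]) (rule that; assumption)
 obtain N :: "real => real" where N: "!!r. 0 <= N r" "integrable (lebesgue_on {0<..<T}) (%r. (N r)\<^sup>2)"
  "AE r in lebesgue_on {0<..<T}. u r \<in> borel_measurable ?M \<and> (AE x in ?M. norm (u r x) <= N r)"
  by (rule velocity_bound[OF velocity[rule_format, OF T]]) (rule that; assumption)
 interpret convective_flux \<Omega> J m F \<Lambda> \<Gamma> "A + B" "(1 - \<rho>) * \<alpha>0" u N T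
 proof
  show "0 < (1 - \<rho>) * \<alpha>0" using rho(2) alpha(1) by simp
  show "AE x in ?M. \<bar>?a x\<bar> <= A + B" using A(3) B(1) by (intro AE_I2) fastforce
  show "AE x in ?M. norm (weak_gradient \<Omega> ?a x) <= A + B" using A(6) by (rule eventually_mono) (use B(1) in simp)
  show "AE x in ?M. \<forall>s\<in>{-1..1}. \<forall>s'\<in>{-1..1}.
   (1 - \<rho>) * \<alpha>0 * (s - s')\<^sup>2 <= (\<Lambda> s - \<Lambda> s' + ?a x * (\<Gamma> s - \<Gamma> s')) * (s - s')"
   using rho(3)
  proof (rule eventually_mono)
   fix x assume h: "\<forall>s\<in>{-1<..<1}. 0 <= \<rho> * deriv2_on {-1<..<1} F1 s + deriv2_on {-1..1} F2 s + ?a x"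
   show "\<forall>s\<in>{-1..1}. \<forall>s'\<in>{-1..1}. (1 - \<rho>) * \<alpha>0 * (s - s')\<^sup>2 <= (\<Lambda> s - \<Lambda> s' + ?a x * (\<Gamma> s - \<Gamma> s')) * (s - s')"
    by (intro ballI B(10)[OF h])
  qed
  show "\<bar>m s - m s'\<bar> <= (A + B) * \<bar>s - s'\<bar>" if "s \<in> {-1..1}" "s' \<in> {-1..1}" for s s'
  proof -
   have "B * \<bar>s - s'\<bar> <= (A + B) * \<bar>s - s'\<bar>" using A(1) by (intro mult_right_mono) auto
   then show ?thesis using B(5)[OF that] by linarith
  qed
  show "\<bar>?\<beta> s\<bar> <= A + B" if "s \<in> {-1..1}" for s using B(3)[OF that] A(1) by linarith
  show "\<bar>m s\<bar> <= A + B" if "s \<in> {-1..1}" for s using B(4)[OF that] A(1) by linarith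
  show "gradient_conv \<Omega> J f \<in> borel_measurable ?M \<and> L2_norm_on ?M (gradient_conv \<Omega> J f) <= (A + B) * L2_norm_on ?M f \<and>
   (\<forall>x\<in>\<Omega>. norm (gradient_conv \<Omega> J f x) <= A + B)"
   if "f \<in> borel_measurable ?M" "AE y in ?M. \<bar>f y\<bar> <= 2" for f
  proof -
   have "A * L2_norm_on ?M f <= (A + B) * L2_norm_on ?M f" using B(1) by (intro mult_right_mono L2_norm_nonneg) simp
   then show ?thesis using A(7)[OF that] B(1) by (auto intro: order_trans)
  qed
  show "0 <= A + B" using A(1) B(1) by simp
  show "gradient_conv \<Omega> J (%y. f y - g y) x = gradient_conv \<Omega> J f x - gradient_conv \<Omega> J g x"
   if "f \<in> borel_measurable ?M" "AE y in ?M. \<bar>f y\<bar> <= 2" "g \<in> borel_measurable ?M" "AE y in ?M. \<bar>g y\<bar> <= 2" "x \<in> \<Omega>" for f g x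
   by (rule A(8)[OF that])
  show "(\<Lambda> has_real_derivative ?\<beta> s) (at s within {-1..1})" if "s \<in> {-1..1}" for s by (rule B(6)[OF that])
  show "(\<Gamma> has_real_derivative m s) (at s within {-1..1})" if "s \<in> {-1..1}" for s by (rule B(8)[OF that])
 qed (fact S A(2,4,5) A1(2) B(2,7,9) N T)+
 show "AE (t, x) in lebesgue_on ({0<..<T} \<times> \<Omega>). \<phi>1 t x = \<phi>2 t x"
  by (rule weak_solution_unique) (use sol in blast)+
qed

end
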